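(* Let $H$ be a quasi-Hopf algebra over a field $\mathbf k$, let $(M,\Lambda)$ be a left quasi-Hopf $H$-bimodule and assume that $H$ or $M$ is finite dimensional. Let $M^*:=\mathrm{Hom}_{\mathbf k}(M,\mathbf k)$ be the $H$-bimodule with $$(a\cdot\psi\cdot b)(m)=\psi\big(S^{-1}(a)\cdot m\cdot S(b)\big),\qquad a,b\in H,\ m\in M,\ \psi\in M^*,$$ and define $\rho:M^*\to M^*\otimes H$ by identifying $M^*\otimes H\cong\mathrm{Hom}_{\mathbf k}(M,H)$ and putting $$[\rho(\psi)](m):=(\mathrm{id}_H\otimes\psi)(\bar\Lambda(m))\in H,\qquad \bar\Lambda(m):=V\cdot\Lambda(m)\cdot U .$$ Then $(M^*,\rho)$ is a right quasi-Hopf $H$-bimodule.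
   Context: Quasi-Hopf algebras. $\mathbf k$ is a field, algebras are unital. A quasi-bialgebra $(H,\Delta,\epsilon,\phi)$ is a unital $\mathbf k$-algebra $H$ with unital algebra morphisms $\Delta:H\to H\otimes H$, $\epsilon:H\to\mathbf k$ and an invertible $\phi\in H\otimes H\otimes H$ such that $(\mathrm{id}\otimes\Delta)(\Delta(a))\,\phi=\phi\,(\Delta\otimes\mathrm{id})(\Delta(a))$ for all $a\in H$; $(\mathrm{id}\otimes\mathrm{id}\otimes\Delta)(\phi)(\Delta\otimes\mathrm{id}\otimes\mathrm{id})(\phi)=(\mathbf 1\otimes\phi)(\mathrm{id}\otimes\Delta\otimes\mathrm{id})(\phi)(\phi\otimes\mathbf 1)$; $(\epsilon\otimes\mathrm{id})\circ\Delta=\mathrm{id}=(\mathrm{id}\otimes\epsilon)\circ\Delta$; $(\mathrm{id}\otimes\epsilon\otimes\mathrm{id})(\phi)=\mathbf 1\otimes\mathbf 1$. Write $\Delta(a)=a_{(1)}\otimes a_{(2)}$, $\Delta^{op}(a)=a_{(2)}\otimes a_{(1)}$, $\phi=X^j\otimes Y^j\otimes Z^j$, $\phi^{-1}=\bar X^j\otimes\bar Y^j\otimes\bar Z^j$ (summation suppressed); for $x=x^1\otimes x^2\in H\otimes H$ put $x^{21}=x^2\otimes x^1$. $H$ is a quasi-Hopf algebra if there are an algebra anti-morphism $S:H\to H$ and $\alpha,\beta\in H$ with $S(a_{(1)})\alpha a_{(2)}=\epsilon(a)\alpha$, $a_{(1)}\beta S(a_{(2)})=\epsilon(a)\beta$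 for all $a$, and $X^j\beta S(Y^j)\alpha Z^j=\mathbf 1=S(\bar X^j)\alpha\bar Y^j\beta S(\bar Z^j)$. Standing conventions: $S$ is invertible and $\epsilon(\alpha)=\epsilon(\beta)=1$. Quasi-Hopf bimodules. For an $H$-bimodule $M$, $M\otimes H$ and $H\otimes M$ are $H$-bimodules via factorwise action of $\Delta(a)$ from left and right. A right quasi-Hopf $H$-bimodule is an $H$-bimodule $M$ with an $H$-bimodule map $\rho:M\to M\otimes H$ such that $(\mathrm{id}_M\otimes\epsilon)\circ\rho=\mathrm{id}_M$ and $\phi\cdot(\rho\otimes\mathrm{id})(\rho(m))=(\mathrm{id}_M\otimes\Delta)(\rho(m))\cdot\phi$ for all $m$. A left quasi-Hopf $H$-bimodule is an $H$-bimodule $M$ with an $H$-bimodule map $\Lambda:M\to H\otimes M$ such that $(\epsilon\otimes\mathrm{id}_M)\circ\Lambda=\mathrm{id}_M$ and $\phi\cdot(\Delta\otimes\mathrm{id}_M)(\Lambda(m))=(\mathrm{id}\otimes\Lambda)(\Lambda(m))\cdot\phi$ for all $m$. Special elements. $q_R:=X^i\otimes S^{-1}(\alpha Z^i)Y^i$, $p_R:=\bar X^i\otimes\bar Y^i\beta S(\bar Z^i)$. With $T^i\otimes U^i\otimes V^i\otimes W^i:=(\mathbf 1\otimes\phi^{-1})(\mathrm{id}\otimes\mathrm{id}\otimes\Delta)(\phi)$ let $\gamma:=S(U^i)\alpha V^i\otimes S(T^i)\alpha W^i$. Drinfeld's element is $f:=(S\otimes S)(\Delta^{op}(\bar X^i))\,\gamma\,\Delta(\bar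 Y^i\beta S(\bar Z^i))\in H\otimes H$; it is invertible. Put $h:=(S^{-1}\otimes S^{-1})(f^{21})$ and $$U:=f^{-1}\,(S\otimes S)(q_R^{21}),\qquad V:=(S^{-1}\otimes S^{-1})(p_R^{21})\,h .$$ $V\cdot\Lambda(m)\cdot U$ denotes the factorwise left action of $V$ and right action of $U$ on $H\otimes M$. *)

theory Defs
  imports Complex_Main "HOL-Library.Function_Algebras"
begin

text \<open>
  Vector spaces are subspaces \<open>A\<close> of a type carrying a \<^locale>\<open>vector_space\<close> structure, with scalars
  in a type \<open>'k::field\<close>.  The carrier sets are needed because the dual of a vector space on a type
  \<open>'m\<close> is only a subspace of the function space \<open>'m \<Rightarrow> 'k\<close>.

  Tensor products are unbracketed: \<open>A\<^sub>1 \<otimes> \<dots> \<otimes> A\<^sub>n\<close> is described by a list of factors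
  consisting of the set of tuples \<open>A\<^sub>1 \<times> \<dots> \<times> A\<^sub>n\<close> and the set of \<open>'k\<close>-valued functions that are
  multilinear on these tuples.  The pure tensor of a tuple is evaluation of multilinear forms at
  this tuple, and the tensor product is the set of finite sums of pure tensors.  In other words,
  \<open>A\<^sub>1 \<otimes> \<dots> \<otimes> A\<^sub>n\<close> is realised as its canonical image in the dual of the space of multilinear forms
  on \<open>A\<^sub>1 \<times> \<dots> \<times> A\<^sub>n\<close>; the canonical map is injective since the scalars form a field.  The
  universal property is lemma \<open>sweedler_sum_list\<close> below.
\<close>

subsection \<open>Tensor products of vector spaces\<close>

definition linear_form_on ::
  "'v::ab_group_add set \<Rightarrow> ('k::field \<Rightarrow> 'v \<Rightarrow> 'v) \<Rightarrow> ('v \<Rightarrow> 'k) \<Rightarrow> bool" where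
  "linear_form_on A s B \<longleftrightarrow>
     (\<forall>x\<in>A. \<forall>y\<in>A. B (x + y) = B x + B y) \<and> (\<forall>c. \<forall>x\<in>A. B (s c x) = c * B x)"

record ('x, 'k) factors =
  tuples :: "'x set"
  forms :: "('x \<Rightarrow> 'k) set"

definition single_factor ::
  "'v::ab_group_add set \<Rightarrow> ('k::field \<Rightarrow> 'v \<Rightarrow> 'v) \<Rightarrow> ('v, 'k) factors" where
  "single_factor A s = \<lparr>tuples = A, forms = {B. linear_form_on A s B}\<rparr>"

definition cons_factor ::
  "'v::ab_group_add set \<Rightarrow> ('k::field \<Rightarrow> 'v \<Rightarrow> 'v) \<Rightarrow> ('x, 'k) factors \<Rightarrow> ('v \<times> 'x, 'k) factors" where
  "cons_factor A s T = \<lparr>tuples = A \<times> tuples T,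
     forms = {B. (\<forall>y\<in>tuples T. linear_form_on A s (\<lambda>x. B (x, y))) \<and>
                 (\<forall>x\<in>A. (\<lambda>y. B (x, y)) \<in> forms T)}\<rparr>"

type_synonym ('x, 'k) tensor = "('x \<Rightarrow> 'k) \<Rightarrow> 'k"

definition pure_tensor :: "('x, 'k::field) factors \<Rightarrow> 'x \<Rightarrow> ('x, 'k) tensor" where
  "pure_tensor T x = (\<lambda>B. if B \<in> forms T then B x else 0)"

definition tensors :: "('x, 'k::field) factors \<Rightarrow> ('x, 'k) tensor set" where
  "tensors T = {(\<Sum>x\<leftarrow>xs. pure_tensor T x) | xs. set xs \<subseteq> tuples T}"

text \<open>Scalar multiplication on spaces of \<open>'k\<close>-valued functions, in particular on tensors.\<close>

definition fscale :: "'k::field \<Rightarrow> ('x \<Rightarrow> 'k) \<Rightarrow> 'x \<Rightarrow> 'k" where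
  "fscale c g = (\<lambda>x. c * g x)"

text \<open>
  Sweedler notation: if \<open>t = \<Sum>\<^sub>i x\<^sub>i\<^sup>1 \<otimes> \<dots> \<otimes> x\<^sub>i\<^sup>n\<close>, then \<open>sweedler T t F = \<Sum>\<^sub>i F (x\<^sub>i\<^sup>1, \<dots>, x\<^sub>i\<^sup>n)\<close>.
  For multilinear \<open>F\<close> this does not depend on the representation of \<open>t\<close>.
\<close>

definition sweedler ::
  "('x, 'k::field) factors \<Rightarrow> ('x, 'k) tensor \<Rightarrow> ('x \<Rightarrow> 'y::comm_monoid_add) \<Rightarrow> 'y" where
  "sweedler T t F =
     (THE y. \<exists>xs. set xs \<subseteq> tuples T \<and> t = (\<Sum>x\<leftarrow>xs. pure_tensor T x) \<and> y = (\<Sum>x\<leftarrow>xs. F x))"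

text \<open>
  \<open>factorwise T\<^sub>1 T\<^sub>2 T\<^sub>3 op x y = \<Sum>\<^sub>i\<^sub>j op x\<^sub>i y\<^sub>j\<close>: multiplication in tensor powers of an algebra and
  factorwise actions, where \<open>op\<close> is an operation on tuples built with \<open>pair_op\<close>.
\<close>

definition pair_op ::
  "('a \<Rightarrow> 'b \<Rightarrow> 'c) \<Rightarrow> ('x \<Rightarrow> 'y \<Rightarrow> 'z) \<Rightarrow> 'a \<times> 'x \<Rightarrow> 'b \<times> 'y \<Rightarrow> 'c \<times> 'z" where
  "pair_op f g = (\<lambda>(a, x) (b, y). (f a b, g x y))"

definition factorwise ::
  "('x, 'k::field) factors \<Rightarrow> ('y, 'k) factors \<Rightarrow> ('z, 'k) factors \<Rightarrow> ('x \<Rightarrow> 'y \<Rightarrow> 'z) \<Rightarrow>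
   ('x, 'k) tensor \<Rightarrow> ('y, 'k) tensor \<Rightarrow> ('z, 'k) tensor" where
  "factorwise T1 T2 T3 op x y =
     sweedler T1 x (\<lambda>a. sweedler T2 y (\<lambda>b. pure_tensor T3 (op a b)))"

lemma sum_list_fun_apply: "(\<Sum>x\<leftarrow>xs. g x) B = (\<Sum>x\<leftarrow>xs. g x B)"
  for g :: "'x \<Rightarrow> 'b \<Rightarrow> 'c::comm_monoid_add"
  by (induction xs) auto

lemma vector_space_fscale: "vector_space (fscale :: 'k::field \<Rightarrow> ('x \<Rightarrow> 'k) \<Rightarrow> _)"
  by unfold_locales (auto simp: fscale_def fun_eq_iff algebra_simps)

lemma vector_space_field_mult: "vector_space ((*) :: 'k::field \<Rightarrow> 'k \<Rightarrow> 'k)"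
  by unfold_locales (auto simp: algebra_simps)

lemma separating_functional:
  fixes s :: "'k::field \<Rightarrow> 'y::ab_group_add \<Rightarrow> 'y"
  assumes "vector_space s" "y \<noteq> 0"
  shows "\<exists>g. Vector_Spaces.linear s (*) g \<and> g y \<noteq> 0"
proof -
  interpret Y: vector_space s by fact
  interpret K: vector_space "(*) :: 'k \<Rightarrow> 'k \<Rightarrow> 'k" by (rule vector_space_field_mult)
  interpret P: vector_space_pair s "(*)" ..
  have "Y.independent {y}" using assms(2) by simp
  from P.linear_independent_extend[OF this, of "\<lambda>_. 1"]
  obtain g where "Vector_Spaces.linear s (*) g" "g y = 1" by auto
  then show ?thesis by auto
qed

text \<open>
  Universal property.  The assumption on \<open>F\<close> is multilinearity, tested against all linear
  functionals of the target space.
\<close>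

lemma sweedler_sum_list:
  fixes s :: "'k::field \<Rightarrow> 'y::ab_group_add \<Rightarrow> 'y"
  assumes s: "vector_space s"
    and F: "\<And>g. Vector_Spaces.linear s (*) g \<Longrightarrow> (\<lambda>x. g (F x)) \<in> forms T"
    and xs: "set xs \<subseteq> tuples T"
  shows "sweedler T (\<Sum>x\<leftarrow>xs. pure_tensor T x) F = (\<Sum>x\<leftarrow>xs. F x)"
  unfolding sweedler_def
proof (rule the_equality)
  show "\<exists>xs'. set xs' \<subseteq> tuples T \<and>
      (\<Sum>x\<leftarrow>xs. pure_tensor T x) = (\<Sum>x\<leftarrow>xs'. pure_tensor T x) \<and> (\<Sum>x\<leftarrow>xs. F x) = (\<Sum>x\<leftarrow>xs'. F x)"
    using xs by blast
next
  fix y assume "\<exists>xs'. set xs' \<subseteq> tuples T \<and>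
      (\<Sum>x\<leftarrow>xs. pure_tensor T x) = (\<Sum>x\<leftarrow>xs'. pure_tensor T x) \<and> y = (\<Sum>x\<leftarrow>xs'. F x)"
  then obtain ys where eq: "(\<Sum>x\<leftarrow>xs. pure_tensor T x) = (\<Sum>x\<leftarrow>ys. pure_tensor T x)"
    and y: "y = (\<Sum>x\<leftarrow>ys. F x)" by blast
  show "y = (\<Sum>x\<leftarrow>xs. F x)"
  proof (rule ccontr)
    assume "y \<noteq> (\<Sum>x\<leftarrow>xs. F x)"
    then obtain g where g: "Vector_Spaces.linear s (*) g" and ne: "g (y - (\<Sum>x\<leftarrow>xs. F x)) \<noteq> 0"
      using separating_functional[OF s, of "y - (\<Sum>x\<leftarrow>xs. F x)"] by auto
    interpret g: Vector_Spaces.linear s "(*)" g by fact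
    have gsum: "g (\<Sum>x\<leftarrow>zs. F x) = (\<Sum>x\<leftarrow>zs. pure_tensor T x) (\<lambda>x. g (F x))" for zs
      using F[OF g]
      by (induction zs) (auto simp: sum_list_fun_apply pure_tensor_def g.add)
    have "g y = g (\<Sum>x\<leftarrow>xs. F x)"
      unfolding y gsum eq ..
    with ne show False by (simp add: g.diff)
  qed
qed

subsection \<open>Quasi-bialgebras and quasi-Hopf algebras\<close>

locale tensor_powers =
  fixes scl :: "'k::field \<Rightarrow> 'h::ring_1 \<Rightarrow> 'h"
begin

abbreviation "H1 \<equiv> single_factor UNIV scl"
abbreviation "H2 \<equiv> cons_factor UNIV scl H1"
abbreviation "H3 \<equiv> cons_factor UNIV scl H2"
abbreviation "H4 \<equiv> cons_factor UNIV scl H3"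

abbreviation op2 :: "'h \<times> 'h \<Rightarrow> 'h \<times> 'h \<Rightarrow> 'h \<times> 'h"
  where "op2 \<equiv> pair_op (*) (*)"
abbreviation op3 :: "'h \<times> 'h \<times> 'h \<Rightarrow> 'h \<times> 'h \<times> 'h \<Rightarrow> 'h \<times> 'h \<times> 'h"
  where "op3 \<equiv> pair_op (*) op2"
abbreviation op4 :: "'h \<times> 'h \<times> 'h \<times> 'h \<Rightarrow> 'h \<times> 'h \<times> 'h \<times> 'h \<Rightarrow> 'h \<times> 'h \<times> 'h \<times> 'h"
  where "op4 \<equiv> pair_op (*) op3"

definition "mult2 = factorwise H2 H2 H2 op2"
definition "mult3 = factorwise H3 H3 H3 op3"
definition "mult4 = factorwise H4 H4 H4 op4"

definition "one2 = pure_tensor H2 (1, 1)"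
definition "one3 = pure_tensor H3 (1, 1, 1)"

definition is_inverse2 :: "('h \<times> 'h, 'k) tensor \<Rightarrow> ('h \<times> 'h, 'k) tensor \<Rightarrow> bool" where
  "is_inverse2 x y \<longleftrightarrow> y \<in> tensors H2 \<and> mult2 x y = one2 \<and> mult2 y x = one2"

definition is_inverse3 :: "('h \<times> 'h \<times> 'h, 'k) tensor \<Rightarrow> ('h \<times> 'h \<times> 'h, 'k) tensor \<Rightarrow> bool" where
  "is_inverse3 x y \<longleftrightarrow> y \<in> tensors H3 \<and> mult3 x y = one3 \<and> mult3 y x = one3"

definition flip :: "('h \<times> 'h, 'k) tensor \<Rightarrow> ('h \<times> 'h, 'k) tensor" where
  "flip x = sweedler H2 x (\<lambda>(a, b). pure_tensor H2 (b, a))"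

definition map2 :: "('h \<Rightarrow> 'h) \<Rightarrow> ('h \<times> 'h, 'k) tensor \<Rightarrow> ('h \<times> 'h, 'k) tensor" where
  "map2 F x = sweedler H2 x (\<lambda>(a, b). pure_tensor H2 (F a, F b))"

end

locale quasi_bialgebra_data = tensor_powers scl
  for scl :: "'k::field \<Rightarrow> 'h::ring_1 \<Rightarrow> 'h" +
  fixes \<Delta> :: "'h \<Rightarrow> ('h \<times> 'h, 'k) tensor"
    and \<epsilon> :: "'h \<Rightarrow> 'k"
    and \<phi> :: "('h \<times> 'h \<times> 'h, 'k) tensor"
begin

definition \<Delta>_id :: "('h \<times> 'h, 'k) tensor \<Rightarrow> ('h \<times> 'h \<times> 'h, 'k) tensor" where
  "\<Delta>_id t = sweedler H2 t (\<lambda>(a, b). sweedler H2 (\<Delta> a) (\<lambda>(c, d). pure_tensor H3 (c, d, b)))"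

definition id_\<Delta> :: "('h \<times> 'h, 'k) tensor \<Rightarrow> ('h \<times> 'h \<times> 'h, 'k) tensor" where
  "id_\<Delta> t = sweedler H2 t (\<lambda>(a, b). sweedler H2 (\<Delta> b) (\<lambda>(c, d). pure_tensor H3 (a, c, d)))"

definition \<Delta>_id_id :: "('h \<times> 'h \<times> 'h, 'k) tensor \<Rightarrow> ('h \<times> 'h \<times> 'h \<times> 'h, 'k) tensor" where
  "\<Delta>_id_id t = sweedler H3 t
     (\<lambda>(a, b, c). sweedler H2 (\<Delta> a) (\<lambda>(d, e). pure_tensor H4 (d, e, b, c)))"

definition id_\<Delta>_id :: "('h \<times> 'h \<times> 'h, 'k) tensor \<Rightarrow> ('h \<times> 'h \<times> 'h \<times> 'h, 'k) tensor" where
  "id_\<Delta>_id t = sweedler H3 t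
     (\<lambda>(a, b, c). sweedler H2 (\<Delta> b) (\<lambda>(d, e). pure_tensor H4 (a, d, e, c)))"

definition id_id_\<Delta> :: "('h \<times> 'h \<times> 'h, 'k) tensor \<Rightarrow> ('h \<times> 'h \<times> 'h \<times> 'h, 'k) tensor" where
  "id_id_\<Delta> t = sweedler H3 t
     (\<lambda>(a, b, c). sweedler H2 (\<Delta> c) (\<lambda>(d, e). pure_tensor H4 (a, b, d, e)))"

definition one_tensor :: "('h \<times> 'h \<times> 'h, 'k) tensor \<Rightarrow> ('h \<times> 'h \<times> 'h \<times> 'h, 'k) tensor" where
  "one_tensor t = sweedler H3 t (\<lambda>(a, b, c). pure_tensor H4 (1, a, b, c))"

definition tensor_one :: "('h \<times> 'h \<times> 'h, 'k) tensor \<Rightarrow> ('h \<times> 'h \<times> 'h \<times> 'h, 'k) tensor" where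
  "tensor_one t = sweedler H3 t (\<lambda>(a, b, c). pure_tensor H4 (a, b, c, 1))"

end

locale quasi_bialgebra = quasi_bialgebra_data scl \<Delta> \<epsilon> \<phi>
  for scl :: "'k::field \<Rightarrow> 'h::ring_1 \<Rightarrow> 'h" and \<Delta> \<epsilon> \<phi> +
  assumes vector_space_scl: "vector_space scl"
    and scl_mult_left: "scl c a * b = scl c (a * b)"
    and scl_mult_right: "a * scl c b = scl c (a * b)"
    and \<Delta>_in: "\<Delta> a \<in> tensors H2"
    and \<Delta>_linear: "Vector_Spaces.linear scl fscale \<Delta>"
    and \<Delta>_one: "\<Delta> 1 = one2"
    and \<Delta>_mult: "\<Delta> (a * b) = mult2 (\<Delta> a) (\<Delta> b)"
    and \<epsilon>_linear: "Vector_Spaces.linear scl (*) \<epsilon>"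
    and \<epsilon>_one: "\<epsilon> 1 = 1"
    and \<epsilon>_mult: "\<epsilon> (a * b) = \<epsilon> a * \<epsilon> b"
    and \<phi>_in: "\<phi> \<in> tensors H3"
    and \<phi>_invertible: "\<exists>\<psi>. is_inverse3 \<phi> \<psi>"
    and quasi_coassoc: "mult3 (id_\<Delta> (\<Delta> a)) \<phi> = mult3 \<phi> (\<Delta>_id (\<Delta> a))"
    and pentagon:
      "mult4 (id_id_\<Delta> \<phi>) (\<Delta>_id_id \<phi>) =
       mult4 (mult4 (one_tensor \<phi>) (id_\<Delta>_id \<phi>)) (tensor_one \<phi>)"
    and counit_left: "sweedler H2 (\<Delta> a) (\<lambda>(b, c). scl (\<epsilon> b) c) = a"
    and counit_right: "sweedler H2 (\<Delta> a) (\<lambda>(b, c). scl (\<epsilon> c) b) = a"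
    and counit_\<phi>: "sweedler H3 \<phi> (\<lambda>(x, y, z). pure_tensor H2 (scl (\<epsilon> y) x, z)) = one2"

context quasi_bialgebra_data
begin

definition "\<phi>_inv = (THE \<psi>. is_inverse3 \<phi> \<psi>)"

end

locale quasi_hopf_algebra = quasi_bialgebra scl \<Delta> \<epsilon> \<phi>
  for scl :: "'k::field \<Rightarrow> 'h::ring_1 \<Rightarrow> 'h" and \<Delta> \<epsilon> \<phi> +
  fixes S :: "'h \<Rightarrow> 'h" and \<alpha> \<beta> :: 'h
  assumes S_linear: "Vector_Spaces.linear scl scl S"
    and S_one: "S 1 = 1"
    and S_mult: "S (a * b) = S b * S a"
    and antipode_\<alpha>: "sweedler H2 (\<Delta> a) (\<lambda>(b, c). S b * \<alpha> * c) = scl (\<epsilon> a) \<alpha>"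
    and antipode_\<beta>: "sweedler H2 (\<Delta> a) (\<lambda>(b, c). b * \<beta> * S c) = scl (\<epsilon> a) \<beta>"
    and antipode_\<phi>: "sweedler H3 \<phi> (\<lambda>(x, y, z). x * \<beta> * S y * \<alpha> * z) = 1"
    and antipode_\<phi>_inv: "sweedler H3 \<phi>_inv (\<lambda>(x, y, z). S x * \<alpha> * y * \<beta> * S z) = 1"
    and S_bij: "bij S"
    and \<epsilon>_\<alpha>: "\<epsilon> \<alpha> = 1"
    and \<epsilon>_\<beta>: "\<epsilon> \<beta> = 1"
begin

definition q_R :: "('h \<times> 'h, 'k) tensor" where
  "q_R = sweedler H3 \<phi> (\<lambda>(x, y, z). pure_tensor H2 (x, inv S (\<alpha> * z) * y))"

definition p_R :: "('h \<times> 'h, 'k) tensor" where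
  "p_R = sweedler H3 \<phi>_inv (\<lambda>(x, y, z). pure_tensor H2 (x, y * \<beta> * S z))"

definition \<gamma> :: "('h \<times> 'h, 'k) tensor" where
  "\<gamma> = sweedler H4 (mult4 (one_tensor \<phi>_inv) (id_id_\<Delta> \<phi>))
     (\<lambda>(t, u, v, w). pure_tensor H2 (S u * \<alpha> * v, S t * \<alpha> * w))"

definition drinfeld_f :: "('h \<times> 'h, 'k) tensor" where
  "drinfeld_f = sweedler H3 \<phi>_inv
     (\<lambda>(x, y, z). mult2 (mult2 (map2 S (flip (\<Delta> x))) \<gamma>) (\<Delta> (y * \<beta> * S z)))"

definition "drinfeld_f_inv = (THE g. is_inverse2 drinfeld_f g)"

definition "drinfeld_h = map2 (inv S) (flip drinfeld_f)"

definition "U = mult2 drinfeld_f_inv (map2 S (flip q_R))"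

definition "V = mult2 (map2 (inv S) (flip p_R)) drinfeld_h"

end

subsection \<open>Quasi-Hopf bimodules\<close>

text \<open>
  The left and right actions \<open>l\<close> and \<open>r\<close> make the subspace \<open>A\<close> of the ambient vector space an
  \<open>'h\<close>-bimodule over \<open>'k\<close>.
\<close>

locale algebra_bimodule =
  fixes scl :: "'k::field \<Rightarrow> 'h::ring_1 \<Rightarrow> 'h"
    and A :: "'m::ab_group_add set"
    and sM :: "'k \<Rightarrow> 'm \<Rightarrow> 'm"
    and l :: "'h \<Rightarrow> 'm \<Rightarrow> 'm"
    and r :: "'m \<Rightarrow> 'h \<Rightarrow> 'm"
  assumes vector_space_sM: "vector_space sM"
    and subspace_A: "module.subspace sM A"
    and l_closed: "m \<in> A \<Longrightarrow> l a m \<in> A"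
    and r_closed: "m \<in> A \<Longrightarrow> r m a \<in> A"
    and l_add: "\<lbrakk>m \<in> A; n \<in> A\<rbrakk> \<Longrightarrow> l a (m + n) = l a m + l a n"
    and r_add: "\<lbrakk>m \<in> A; n \<in> A\<rbrakk> \<Longrightarrow> r (m + n) a = r m a + r n a"
    and l_scale: "m \<in> A \<Longrightarrow> l a (sM c m) = sM c (l a m)"
    and r_scale: "m \<in> A \<Longrightarrow> r (sM c m) a = sM c (r m a)"
    and add_l: "m \<in> A \<Longrightarrow> l (a + b) m = l a m + l b m"
    and add_r: "m \<in> A \<Longrightarrow> r m (a + b) = r m a + r m b"
    and scale_l: "m \<in> A \<Longrightarrow> l (scl c a) m = sM c (l a m)"
    and scale_r: "m \<in> A \<Longrightarrow> r m (scl c a) = sM c (r m a)"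
    and one_l: "m \<in> A \<Longrightarrow> l 1 m = m"
    and one_r: "m \<in> A \<Longrightarrow> r m 1 = m"
    and mult_l: "m \<in> A \<Longrightarrow> l (a * b) m = l a (l b m)"
    and mult_r: "m \<in> A \<Longrightarrow> r m (a * b) = r (r m a) b"
    and l_r_commute: "m \<in> A \<Longrightarrow> r (l a m) b = l a (r m b)"

locale right_quasi_hopf_bimodule =
  quasi_bialgebra_data scl \<Delta> \<epsilon> \<phi> + algebra_bimodule scl A sM l r
  for scl :: "'k::field \<Rightarrow> 'h::ring_1 \<Rightarrow> 'h" and \<Delta> \<epsilon> \<phi>
    and A :: "'m::ab_group_add set" and sM l r +
  fixes \<rho> :: "'m \<Rightarrow> ('m \<times> 'h, 'k) tensor"
  assumes \<rho>_in: "m \<in> A \<Longrightarrow> \<rho> m \<in> tensors (cons_factor A sM H1)"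
    and \<rho>_add: "\<lbrakk>m \<in> A; n \<in> A\<rbrakk> \<Longrightarrow> \<rho> (m + n) = \<rho> m + \<rho> n"
    and \<rho>_scale: "m \<in> A \<Longrightarrow> \<rho> (sM c m) = fscale c (\<rho> m)"
    and \<rho>_l: "m \<in> A \<Longrightarrow> \<rho> (l a m) =
      factorwise H2 (cons_factor A sM H1) (cons_factor A sM H1) (pair_op l (*)) (\<Delta> a) (\<rho> m)"
    and \<rho>_r: "m \<in> A \<Longrightarrow> \<rho> (r m a) =
      factorwise (cons_factor A sM H1) H2 (cons_factor A sM H1) (pair_op r (*)) (\<rho> m) (\<Delta> a)"
    and \<rho>_counit:
      "m \<in> A \<Longrightarrow> sweedler (cons_factor A sM H1) (\<rho> m) (\<lambda>(n, a). sM (\<epsilon> a) n) = m"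
    and \<rho>_coassoc: "m \<in> A \<Longrightarrow>
      factorwise H3 (cons_factor A sM H2) (cons_factor A sM H2) (pair_op l op2) \<phi>
        (sweedler (cons_factor A sM H1) (\<rho> m) (\<lambda>(n, a).
          sweedler (cons_factor A sM H1) (\<rho> n) (\<lambda>(n', b).
            pure_tensor (cons_factor A sM H2) (n', b, a)))) =
      factorwise (cons_factor A sM H2) H3 (cons_factor A sM H2) (pair_op r op2)
        (sweedler (cons_factor A sM H1) (\<rho> m) (\<lambda>(n, a).
          sweedler H2 (\<Delta> a) (\<lambda>(b, c). pure_tensor (cons_factor A sM H2) (n, b, c)))) \<phi>"

locale left_quasi_hopf_bimodule =
  quasi_bialgebra_data scl \<Delta> \<epsilon> \<phi> + algebra_bimodule scl A sM l r
  for scl :: "'k::field \<Rightarrow> 'h::ring_1 \<Rightarrow> 'h" and \<Delta> \<epsilon> \<phi>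
    and A :: "'m::ab_group_add set" and sM l r +
  fixes \<Lambda> :: "'m \<Rightarrow> ('h \<times> 'm, 'k) tensor"
  assumes \<Lambda>_in: "m \<in> A \<Longrightarrow> \<Lambda> m \<in> tensors (cons_factor UNIV scl (single_factor A sM))"
    and \<Lambda>_add: "\<lbrakk>m \<in> A; n \<in> A\<rbrakk> \<Longrightarrow> \<Lambda> (m + n) = \<Lambda> m + \<Lambda> n"
    and \<Lambda>_scale: "m \<in> A \<Longrightarrow> \<Lambda> (sM c m) = fscale c (\<Lambda> m)"
    and \<Lambda>_l: "m \<in> A \<Longrightarrow> \<Lambda> (l a m) =
      factorwise H2 (cons_factor UNIV scl (single_factor A sM))
        (cons_factor UNIV scl (single_factor A sM)) (pair_op (*) l) (\<Delta> a) (\<Lambda> m)"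
    and \<Lambda>_r: "m \<in> A \<Longrightarrow> \<Lambda> (r m a) =
      factorwise (cons_factor UNIV scl (single_factor A sM)) H2
        (cons_factor UNIV scl (single_factor A sM)) (pair_op (*) r) (\<Lambda> m) (\<Delta> a)"
    and \<Lambda>_counit: "m \<in> A \<Longrightarrow>
      sweedler (cons_factor UNIV scl (single_factor A sM)) (\<Lambda> m) (\<lambda>(a, n). sM (\<epsilon> a) n) = m"
    and \<Lambda>_coassoc: "m \<in> A \<Longrightarrow>
      factorwise H3 (cons_factor UNIV scl (cons_factor UNIV scl (single_factor A sM)))
        (cons_factor UNIV scl (cons_factor UNIV scl (single_factor A sM)))
        (pair_op (*) (pair_op (*) l)) \<phi>
        (sweedler (cons_factor UNIV scl (single_factor A sM)) (\<Lambda> m) (\<lambda>(a, n).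
          sweedler H2 (\<Delta> a) (\<lambda>(b, c).
            pure_tensor (cons_factor UNIV scl (cons_factor UNIV scl (single_factor A sM)))
              (b, c, n)))) =
      factorwise (cons_factor UNIV scl (cons_factor UNIV scl (single_factor A sM))) H3
        (cons_factor UNIV scl (cons_factor UNIV scl (single_factor A sM)))
        (pair_op (*) (pair_op (*) r))
        (sweedler (cons_factor UNIV scl (single_factor A sM)) (\<Lambda> m) (\<lambda>(a, n).
          sweedler (cons_factor UNIV scl (single_factor A sM)) (\<Lambda> n) (\<lambda>(b, n').
            pure_tensor (cons_factor UNIV scl (cons_factor UNIV scl (single_factor A sM)))
              (a, b, n')))) \<phi>"

subsection \<open>The dual of a left quasi-Hopf bimodule\<close>

definition finite_dimensional :: "('k::field \<Rightarrow> 'v::ab_group_add \<Rightarrow> 'v) \<Rightarrow> bool" where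
  "finite_dimensional s \<longleftrightarrow> (\<exists>Basis. finite_dimensional_vector_space s Basis)"

definition dual_space :: "('k::field \<Rightarrow> 'm::ab_group_add \<Rightarrow> 'm) \<Rightarrow> ('m \<Rightarrow> 'k) set" where
  "dual_space sM = {\<psi>. Vector_Spaces.linear sM (*) \<psi>}"

context quasi_hopf_algebra
begin

definition dual_left :: "('h \<Rightarrow> 'm \<Rightarrow> 'm) \<Rightarrow> 'h \<Rightarrow> ('m \<Rightarrow> 'k) \<Rightarrow> 'm \<Rightarrow> 'k" where
  "dual_left l a \<psi> = (\<lambda>m. \<psi> (l (inv S a) m))"

definition dual_right :: "('m \<Rightarrow> 'h \<Rightarrow> 'm) \<Rightarrow> ('m \<Rightarrow> 'k) \<Rightarrow> 'h \<Rightarrow> 'm \<Rightarrow> 'k" where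
  "dual_right r \<psi> b = (\<lambda>m. \<psi> (r m (S b)))"

definition \<Lambda>_bar ::
  "('k \<Rightarrow> 'm::ab_group_add \<Rightarrow> 'm) \<Rightarrow> ('h \<Rightarrow> 'm \<Rightarrow> 'm) \<Rightarrow> ('m \<Rightarrow> 'h \<Rightarrow> 'm) \<Rightarrow>
   ('m \<Rightarrow> ('h \<times> 'm, 'k) tensor) \<Rightarrow> 'm \<Rightarrow> ('h \<times> 'm, 'k) tensor" where
  "\<Lambda>_bar sM l r \<Lambda> m = (let HM = cons_factor UNIV scl (single_factor UNIV sM) in
     factorwise HM H2 HM (pair_op (*) r) (factorwise H2 HM HM (pair_op (*) l) V (\<Lambda> m)) U)"

text \<open>The canonical map from \<open>M\<^sup>* \<otimes> H\<close> to \<open>Hom(M, H)\<close>, sending \<open>\<chi> \<otimes> a\<close> to \<open>m \<mapsto> \<chi>(m) a\<close>.\<close>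

definition dual_tensor_to_hom ::
  "('k \<Rightarrow> 'm::ab_group_add \<Rightarrow> 'm) \<Rightarrow> (('m \<Rightarrow> 'k) \<times> 'h, 'k) tensor \<Rightarrow> 'm \<Rightarrow> 'h" where
  "dual_tensor_to_hom sM t m =
     sweedler (cons_factor (dual_space sM) fscale H1) t (\<lambda>(\<chi>, a). scl (\<chi> m) a)"

definition dual_coaction ::
  "('k \<Rightarrow> 'm::ab_group_add \<Rightarrow> 'm) \<Rightarrow> ('h \<Rightarrow> 'm \<Rightarrow> 'm) \<Rightarrow> ('m \<Rightarrow> 'h \<Rightarrow> 'm) \<Rightarrow>
   ('m \<Rightarrow> ('h \<times> 'm, 'k) tensor) \<Rightarrow> ('m \<Rightarrow> 'k) \<Rightarrow> (('m \<Rightarrow> 'k) \<times> 'h, 'k) tensor" where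
  "dual_coaction sM l r \<Lambda> \<psi> =
     (THE t. t \<in> tensors (cons_factor (dual_space sM) fscale H1) \<and>
       (\<forall>m. dual_tensor_to_hom sM t m =
         sweedler (cons_factor UNIV scl (single_factor UNIV sM)) (\<Lambda>_bar sM l r \<Lambda> m)
           (\<lambda>(a, n). scl (\<psi> n) a)))"

end

end

theory Submission
  imports Defs
begin

text \<open>
  The coaction axioms for \<open>M\<^sup>*\<close> come down to identities for \<open>U\<close> and \<open>V\<close> in tensor powers of \<open>H\<close>.
  The element \<open>U\<close> is characterised by the equivariance \<open>U(1 \<otimes> S(a)) = \<Delta>(S(a\<^sub>1)) U (a\<^sub>2 \<otimes> 1)\<close> and the
  contraction \<open>U(1 \<otimes> \<alpha>) = \<Delta>(S(X)\<alpha>)(Y \<otimes> Z)\<close>: inserting \<open>1 = S(X')\<alpha>Y'\<beta>S(Z')\<close>, where \<open>X' \<otimes> Y' \<otimes> Z'\<close> is the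
  inverse associator, into its second leg recovers \<open>U\<close> from these data.  The same argument reduces
  \<open>(id \<otimes> \<Delta>)(U)(1 \<otimes> U) = \<phi> (\<Delta> \<otimes> id)(\<Delta>(S(X))U)(Y \<otimes> Z \<otimes> 1)\<close> to the pentagon.  \<open>V\<close> satisfies
  the same two characterising identities in the opposite algebra, with \<open>\<phi>\<close>, \<open>S\<close>, \<open>\<alpha>\<close>, \<open>\<beta>\<close>
  replaced by \<open>\<phi>\<inverse>\<close>, \<open>S\<inverse>\<close>, \<open>S\<inverse>(\<beta>)\<close>, \<open>S\<inverse>(\<alpha>)\<close>, because \<open>f\<close> intertwines
  \<open>\<Delta>(S(a))\<close> with \<open>(S \<otimes> S)(\<Delta>\<^sup>o\<^sup>p(a))\<close> and has the inverse \<open>\<Delta>(S(X')) U (Y'\<beta>S(Z') \<otimes> 1)\<close>.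

  Finite dimensionality is needed only for \<open>\<rho>(\<psi>)\<close> to lie in \<open>M\<^sup>* \<otimes> H\<close>.  All
  axioms are then verified after evaluation at \<open>m \<in> M\<close>, since \<open>M\<^sup>* \<otimes> H\<^sup>\<otimes>\<^sup>n\<close> embeds into
  \<open>Hom(M, H\<^sup>\<otimes>\<^sup>n)\<close>.
\<close>

subsection \<open>Sums over lists of tuples\<close>

text \<open>Drinfeld's f repairs the failure of S to reverse coproducts, but the coproduct of a leg
  of f is hard to control, and the proof never expands one. U is rebuilt without f, as the
  contraction of p_R with the pairing \<Delta>(S(X a_1) \<alpha>)(Y a_2 \<otimes> Z b) of a and b; f
  itself is by definition the contraction of p_R with (S \<otimes> S)(\<Delta>^op(a)) \<gamma>
  \<Delta>(b). Both pairings are invariant under a \<otimes> b -> c_1 a \<otimes> c_2 b, and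
  invariance alone yields an equivariance and a contraction rule. Only afterwards is this U compared
  with the one in the statement. The subtle identity is the contraction rule for V. It needs p_R
  (\<beta> \<otimes> 1) = \<Delta>(X' \<beta>) f^{-1} (S(Z') \<otimes> S(Y')), and this rests on a
  formula for p_R in terms of U (\<open>t_eq_p\<close>). Lists are chosen representatives, so they
  are not additive in the element represented; only their sums against multilinear forms are. Hence
  every identity, including linearity, is stated with a form as free variable.\<close>

text \<open>
  An element of a tensor power is represented by a list of tuples, and an equation between
  such elements by the equality of the sums of an arbitrary multilinear form over the lists.
\<close>

definition tsum2 :: "('a \<times> 'b) list \<Rightarrow> ('a \<Rightarrow> 'b \<Rightarrow> 'k::comm_monoid_add) \<Rightarrow> 'k" where
  "tsum2 xs F = (\<Sum>(a, b)\<leftarrow>xs. F a b)"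

definition tsum3 :: "('a \<times> 'b \<times> 'c) list \<Rightarrow> ('a \<Rightarrow> 'b \<Rightarrow> 'c \<Rightarrow> 'k::comm_monoid_add) \<Rightarrow> 'k" where
  "tsum3 xs F = (\<Sum>(a, b, c)\<leftarrow>xs. F a b c)"

lemma tsum2_simps [simp]: "tsum2 [] F = 0" "tsum2 ((a, b) # xs) F = F a b + tsum2 xs F"
  by (simp_all add: tsum2_def)

lemma tsum3_simps [simp]: "tsum3 [] F = 0" "tsum3 ((a, b, c) # xs) F = F a b c + tsum3 xs F"
  by (simp_all add: tsum3_def)

lemma tsum2_zero [simp]: "tsum2 xs (\<lambda>_ _. 0) = 0"
  by (induction xs) auto

lemma tsum3_zero [simp]: "tsum3 xs (\<lambda>_ _ _. 0) = 0"
  by (induction xs) auto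

lemma tsum2_add: "tsum2 xs (\<lambda>a b. F a b + G a b) = tsum2 xs F + tsum2 xs G"
  by (induction xs) (auto simp: algebra_simps)

lemma tsum3_add: "tsum3 xs (\<lambda>a b c. F a b c + G a b c) = tsum3 xs F + tsum3 xs G"
  by (induction xs) (auto simp: algebra_simps)

lemma tsum2_mult: "tsum2 xs (\<lambda>a b. k * F a b) = k * tsum2 xs F" for k :: "'k::semiring_0"
  by (induction xs) (auto simp: algebra_simps)

lemma tsum3_mult: "tsum3 xs (\<lambda>a b c. k * F a b c) = k * tsum3 xs F" for k :: "'k::semiring_0"
  by (induction xs) (auto simp: algebra_simps)

lemma tsum2_tsum2_swap:
  "tsum2 xs (\<lambda>a b. tsum2 ys (\<lambda>c d. F a b c d)) = tsum2 ys (\<lambda>c d. tsum2 xs (\<lambda>a b. F a b c d))"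
  by (induction xs) (auto simp: tsum2_add)

lemma tsum2_tsum3_swap:
  "tsum2 xs (\<lambda>a b. tsum3 ys (\<lambda>c d e. F a b c d e)) = tsum3 ys (\<lambda>c d e. tsum2 xs (\<lambda>a b. F a b c d e))"
  by (induction xs) (auto simp: tsum3_add)

lemma tsum3_tsum3_swap:
  "tsum3 xs (\<lambda>a b c. tsum3 ys (\<lambda>d e f. F a b c d e f)) = tsum3 ys (\<lambda>d e f. tsum3 xs (\<lambda>a b c. F a b c d e f))"
  by (induction xs) (auto simp: tsum3_add)

lemma tsum3_rotate:
  "tsum3 xs (\<lambda>a b c. tsum3 ys (\<lambda>d e f. tsum3 zs (\<lambda>g h i. F a b c d e f g h i))) =
   tsum3 ys (\<lambda>d e f. tsum3 zs (\<lambda>g h i. tsum3 xs (\<lambda>a b c. F a b c d e f g h i)))"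
  by (simp only: tsum3_tsum3_swap[of xs ys] tsum3_tsum3_swap[of xs zs])

lemma tsum2_cong: "(\<And>a b. F a b = G a b) \<Longrightarrow> tsum2 xs F = tsum2 xs G"
  by (simp add: tsum2_def)

lemma tsum3_cong: "(\<And>a b c. F a b c = G a b c) \<Longrightarrow> tsum3 xs F = tsum3 xs G"
  by (simp add: tsum3_def)

definition tbind2 :: "('a \<times> 'b) list \<Rightarrow> ('a \<Rightarrow> 'b \<Rightarrow> 'c list) \<Rightarrow> 'c list" where
  "tbind2 xs f = concat (map (\<lambda>(a, b). f a b) xs)"

definition tbind3 :: "('a \<times> 'b \<times> 'c) list \<Rightarrow> ('a \<Rightarrow> 'b \<Rightarrow> 'c \<Rightarrow> 'd list) \<Rightarrow> 'd list" where
  "tbind3 xs f = concat (map (\<lambda>(a, b, c). f a b c) xs)"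

lemma tsum2_append: "tsum2 (xs @ ys) F = tsum2 xs F + tsum2 ys F"
  by (simp add: tsum2_def)

lemma tsum2_tbind2 [simp]: "tsum2 (tbind2 xs f) F = tsum2 xs (\<lambda>a b. tsum2 (f a b) F)"
  by (induction xs) (auto simp: tbind2_def tsum2_append)

lemma tsum2_tbind3 [simp]: "tsum2 (tbind3 xs f) F = tsum3 xs (\<lambda>a b c. tsum2 (f a b c) F)"
  by (induction xs) (auto simp: tbind3_def tsum2_append)

section \<open>Multilinear forms evaluated at words in an algebra\<close>

locale scalar_forms =
  fixes scl :: "'k::field \<Rightarrow> 'h::ab_group_add \<Rightarrow> 'h"
begin

definition lin :: "('h \<Rightarrow> 'k) \<Rightarrow> bool" where
  "lin f \<longleftrightarrow> (\<forall>x y. f (x + y) = f x + f y) \<and> (\<forall>c x. f (scl c x) = c * f x)"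

text \<open>Multilinearity of a form evaluated at words is checked letter by letter: a word is an
  \<open>endo\<close> in each of its letters, by introduction rules for products and antipodes, and
  a form composed with an \<open>endo\<close> is linear. In this way the side conditions of all
  later identities are settled by simplification.\<close>

definition endo :: "('h \<Rightarrow> 'h) \<Rightarrow> bool" where
  "endo g \<longleftrightarrow> (\<forall>x y. g (x + y) = g x + g y) \<and> (\<forall>c x. g (scl c x) = scl c (g x))"

definition form2 :: "('h \<Rightarrow> 'h \<Rightarrow> 'k) \<Rightarrow> bool" where
  "form2 F \<longleftrightarrow> (\<forall>b. lin (\<lambda>a. F a b)) \<and> (\<forall>a. lin (\<lambda>b. F a b))"

definition form3 :: "('h \<Rightarrow> 'h \<Rightarrow> 'h \<Rightarrow> 'k) \<Rightarrow> bool" where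
  "form3 F \<longleftrightarrow> (\<forall>b c. lin (\<lambda>a. F a b c)) \<and> (\<forall>a c. lin (\<lambda>b. F a b c)) \<and> (\<forall>a b. lin (\<lambda>c. F a b c))"

definition form4 :: "('h \<Rightarrow> 'h \<Rightarrow> 'h \<Rightarrow> 'h \<Rightarrow> 'k) \<Rightarrow> bool" where
  "form4 F \<longleftrightarrow> (\<forall>b c d. lin (\<lambda>a. F a b c d)) \<and> (\<forall>a c d. lin (\<lambda>b. F a b c d)) \<and>
     (\<forall>a b d. lin (\<lambda>c. F a b c d)) \<and> (\<forall>a b c. lin (\<lambda>d. F a b c d))"

lemmas form_defs = form2_def form3_def form4_def

lemma endo_id [simp]: "endo (\<lambda>x. x)"
  by (simp add: endo_def)

lemma lin_intros [simp]:
  "lin (\<lambda>x. 0)"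
  "lin f \<Longrightarrow> lin (\<lambda>x. c * f x)"
  "lin f \<Longrightarrow> lin (\<lambda>x. f x * c)"
  "lin f \<Longrightarrow> lin g \<Longrightarrow> lin (\<lambda>x. f x + g x)"
  by (auto simp: lin_def algebra_simps)

lemma lin_tsum2 [simp]: "(\<And>a b. lin (\<lambda>x. F x a b)) \<Longrightarrow> lin (\<lambda>x. tsum2 xs (\<lambda>a b. F x a b))"
  by (induction xs) auto

lemma lin_tsum3 [simp]: "(\<And>a b c. lin (\<lambda>x. F x a b c)) \<Longrightarrow> lin (\<lambda>x. tsum3 xs (\<lambda>a b c. F x a b c))"
  by (induction xs) auto

lemma lin_endo: "lin f \<Longrightarrow> endo g \<Longrightarrow> lin (\<lambda>x. f (g x))"
  by (auto simp: lin_def endo_def)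

lemma form2D: "form2 B \<Longrightarrow> endo g \<Longrightarrow> lin (\<lambda>x. B (g x) b)" "form2 B \<Longrightarrow> endo g \<Longrightarrow> lin (\<lambda>x. B a (g x))"
  by (auto simp: form2_def lin_def endo_def)

lemma form3D: "form3 B \<Longrightarrow> endo g \<Longrightarrow> lin (\<lambda>x. B (g x) b c)"
   "form3 B \<Longrightarrow> endo g \<Longrightarrow> lin (\<lambda>x. B a (g x) c)" "form3 B \<Longrightarrow> endo g \<Longrightarrow> lin (\<lambda>x. B a b (g x))"
  by (auto simp: form3_def lin_def endo_def)

end

text \<open>Product, unit and antipode are parameters instead of class operations because the theory
  is instantiated a second time with the reversed product and the inverse antipode. Only the
  additive group is taken from the type.\<close>

locale algebra_forms = scalar_forms scl
  for scl :: "'k::field \<Rightarrow> 'h::ab_group_add \<Rightarrow> 'h" +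
  fixes mul :: "'h \<Rightarrow> 'h \<Rightarrow> 'h" (infixl "\<cdot>" 70)
    and one :: 'h ("\<one>")
    and S :: "'h \<Rightarrow> 'h"
  assumes assoc: "(a \<cdot> b) \<cdot> c = a \<cdot> (b \<cdot> c)"
    and one_left [simp]: "\<one> \<cdot> a = a"
    and one_right [simp]: "a \<cdot> \<one> = a"
    and mul_add: "(a + b) \<cdot> c = a \<cdot> c + b \<cdot> c" "a \<cdot> (b + c) = a \<cdot> b + a \<cdot> c"
    and mul_scl: "scl k a \<cdot> b = scl k (a \<cdot> b)" "a \<cdot> scl k b = scl k (a \<cdot> b)"
    and S_add: "S (a + b) = S a + S b"
    and S_scl: "S (scl k a) = scl k (S a)"
    and S_mul: "S (a \<cdot> b) = S b \<cdot> S a"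
    and S_one [simp]: "S \<one> = \<one>"
begin

lemma endo_intros [simp]:
  "endo g \<Longrightarrow> endo (\<lambda>x. g x \<cdot> a)"
  "endo g \<Longrightarrow> endo (\<lambda>x. a \<cdot> g x)"
  "endo g \<Longrightarrow> endo (\<lambda>x. S (g x))"
  by (auto simp: endo_def mul_add mul_scl S_add S_scl)

end

text \<open>The axioms used both for H and for its opposite, in which \<open>ph\<close> and
  \<open>pi\<close> change places. The list \<open>cop a\<close> is a choice of representative, so
  linearity of the coproduct can only be expressed for its sums against bilinear forms. The list
  \<open>pi\<close> enters through \<open>antipode_pi\<close>, the expression for 1 that is inserted
  in the uniqueness arguments.\<close>

locale coproduct_sums = algebra_forms scl mul one S
  for scl :: "'k::field \<Rightarrow> 'h::ab_group_add \<Rightarrow> 'h" and mul (infixl "\<cdot>" 70) and one ("\<one>") and S +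
  fixes cop :: "'h \<Rightarrow> ('h \<times> 'h) list"
    and eps :: "'h \<Rightarrow> 'k"
    and ph pi :: "('h \<times> 'h \<times> 'h) list"
    and al be :: 'h
  assumes lin_cop: "form2 F \<Longrightarrow> lin (\<lambda>a. tsum2 (cop a) F)"
    and cop_mul: "form2 F \<Longrightarrow> tsum2 (cop (a \<cdot> b)) F =
      tsum2 (cop a) (\<lambda>a\<^sub>1 a\<^sub>2. tsum2 (cop b) (\<lambda>b\<^sub>1 b\<^sub>2. F (a\<^sub>1 \<cdot> b\<^sub>1) (a\<^sub>2 \<cdot> b\<^sub>2)))"
    and lin_eps: "lin eps"
    and eps_mul [simp]: "eps (a \<cdot> b) = eps a * eps b"
    and eps_one [simp]: "eps \<one> = 1"
    and counit_left: "lin f \<Longrightarrow> tsum2 (cop a) (\<lambda>b c. eps b * f c) = f a"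
    and counit_right: "lin f \<Longrightarrow> tsum2 (cop a) (\<lambda>b c. eps c * f b) = f a"
    and counit_ph2: "form2 F \<Longrightarrow> tsum3 ph (\<lambda>x y z. eps y * F x z) = F \<one> \<one>"
    and coassoc: "form3 F3 \<Longrightarrow>
      tsum2 (cop a) (\<lambda>a\<^sub>1 a\<^sub>2. tsum2 (cop a\<^sub>2) (\<lambda>b c. tsum3 ph (\<lambda>x y z. F3 (a\<^sub>1 \<cdot> x) (b \<cdot> y) (c \<cdot> z)))) =
      tsum3 ph (\<lambda>x y z. tsum2 (cop a) (\<lambda>a\<^sub>1 a\<^sub>2. tsum2 (cop a\<^sub>1) (\<lambda>b c. F3 (x \<cdot> b) (y \<cdot> c) (z \<cdot> a\<^sub>2))))"
    and pentagon: "form4 F4 \<Longrightarrow>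
      tsum3 ph (\<lambda>p q r. tsum3 ph (\<lambda>x y z. tsum2 (cop r) (\<lambda>r\<^sub>1 r\<^sub>2. tsum2 (cop x) (\<lambda>x\<^sub>1 x\<^sub>2.
        F4 (p \<cdot> x\<^sub>1) (q \<cdot> x\<^sub>2) (r\<^sub>1 \<cdot> y) (r\<^sub>2 \<cdot> z))))) =
      tsum3 ph (\<lambda>x y z. tsum3 ph (\<lambda>p q r. tsum3 ph (\<lambda>s t u. tsum2 (cop q) (\<lambda>q\<^sub>1 q\<^sub>2.
        F4 (p \<cdot> s) (x \<cdot> (q\<^sub>1 \<cdot> t)) (y \<cdot> (q\<^sub>2 \<cdot> u)) (z \<cdot> r)))))"
    and antipode_pi: "lin f \<Longrightarrow> tsum3 pi (\<lambda>x y z. f (S x \<cdot> (al \<cdot> (y \<cdot> (be \<cdot> S z))))) = f \<one>"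
begin

lemma lin_cop_endo [simp]: "form2 F \<Longrightarrow> endo g \<Longrightarrow> lin (\<lambda>x. tsum2 (cop (g x)) F)"
  by (rule lin_endo[OF lin_cop])

lemma lin_eps_endo [simp]: "endo g \<Longrightarrow> lin (\<lambda>x. eps (g x))"
  by (rule lin_endo[OF lin_eps])

end

subsection \<open>Elements determined by equivariance and contraction\<close>

locale partial_evaluation = coproduct_sums scl mul one S cop eps ph pi al be
  for scl :: "'k::field \<Rightarrow> 'h::ab_group_add \<Rightarrow> 'h" and mul (infixl "\<cdot>" 70) and one ("\<one>") and S
    and cop eps ph pi al be +
  fixes us :: "('h \<times> 'h) list"
  assumes U_equivariant: "form2 F \<Longrightarrow> tsum2 us (\<lambda>u v. F u (v \<cdot> S a)) =
      tsum2 (cop a) (\<lambda>a\<^sub>1 a\<^sub>2. tsum2 (cop (S a\<^sub>1)) (\<lambda>d e. tsum2 us (\<lambda>u v. F (d \<cdot> (u \<cdot> a\<^sub>2)) (e \<cdot> v))))"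
    and U_contract: "form2 F \<Longrightarrow> tsum2 us (\<lambda>u v. F u (v \<cdot> al)) =
      tsum3 ph (\<lambda>x y z. tsum2 (cop (S x \<cdot> al)) (\<lambda>d e. F (d \<cdot> y) (e \<cdot> z)))"
begin

text \<open>
  The two sides of \<open>(id \<otimes> \<Delta>)(U)(1 \<otimes> U) = \<phi> (\<Delta> \<otimes> id)(\<Delta>(S(X))U)(Y \<otimes> Z \<otimes> 1)\<close>.
\<close>

definition lhs :: "('h \<Rightarrow> 'h \<Rightarrow> 'h \<Rightarrow> 'k) \<Rightarrow> 'k" where
  "lhs B = tsum2 us (\<lambda>u v. tsum2 us (\<lambda>u' v'. tsum2 (cop v) (\<lambda>v\<^sub>1 v\<^sub>2. B u (v\<^sub>1 \<cdot> u') (v\<^sub>2 \<cdot> v'))))"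

definition rhs :: "('h \<Rightarrow> 'h \<Rightarrow> 'h \<Rightarrow> 'k) \<Rightarrow> 'k" where
  "rhs B = tsum3 ph (\<lambda>x y z. tsum3 ph (\<lambda>p q r. tsum2 (cop (S p)) (\<lambda>d e. tsum2 us (\<lambda>u v.
     tsum2 (cop (d \<cdot> u)) (\<lambda>g h. B (x \<cdot> (g \<cdot> q)) (y \<cdot> (h \<cdot> r)) (z \<cdot> (e \<cdot> v)))))))"

lemma swap_cop_us:
  "tsum2 (cop a) (\<lambda>b c. tsum2 us (F b c)) = tsum2 us (\<lambda>u v. tsum2 (cop a) (\<lambda>b c. F b c u v))"
  by (rule tsum2_tsum2_swap)

text \<open>The inner copy of U meets \<alpha> first. Contracting it leaves S(x) \<alpha> behind the
  second leg of the outer copy; equivariance moves S(x) away, so that \<alpha> now follows the outer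
  copy as well, and a second contraction eliminates U altogether. The two associators that remain
  stand as on the left side of the pentagon.\<close>

lemma lhs_contract:
  assumes B: "form3 B"
  shows "lhs (\<lambda>u v w. B u v (w \<cdot> al)) =
    tsum3 ph (\<lambda>p q r. tsum3 ph (\<lambda>x y z. tsum2 (cop r) (\<lambda>r\<^sub>1 r\<^sub>2. tsum2 (cop x) (\<lambda>x\<^sub>1 x\<^sub>2.
      tsum2 (cop (S (p \<cdot> x\<^sub>1) \<cdot> al)) (\<lambda>d e. tsum2 (cop e) (\<lambda>e\<^sub>1 e\<^sub>2. B (d \<cdot> (q \<cdot> x\<^sub>2)) (e\<^sub>1 \<cdot> (r\<^sub>1 \<cdot> y)) (e\<^sub>2 \<cdot> (r\<^sub>2 \<cdot> z))))))))"
proof -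
  note [simp] = form3D[OF B] form_defs
  have 1: "tsum2 us (\<lambda>u' v'. tsum2 (cop v) (\<lambda>v\<^sub>1 v\<^sub>2. B u (v\<^sub>1 \<cdot> u') (v\<^sub>2 \<cdot> (v' \<cdot> al)))) =
    tsum3 ph (\<lambda>x y z. tsum2 (cop (v \<cdot> S x \<cdot> al)) (\<lambda>s t. B u (s \<cdot> y) (t \<cdot> z)))" for u v
    by (subst U_contract) (simp_all add: cop_mul assoc tsum2_tsum2_swap[of "cop v"])
  have 2: "tsum2 us (\<lambda>u v. tsum2 (cop (v \<cdot> S x \<cdot> al)) (\<lambda>s t. B u (s \<cdot> y) (t \<cdot> z))) =
      tsum2 (cop x) (\<lambda>x\<^sub>1 x\<^sub>2. tsum2 (cop (S x\<^sub>1)) (\<lambda>d e.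
       tsum2 us (\<lambda>u v. tsum2 (cop ((e \<cdot> v) \<cdot> al)) (\<lambda>s t. B (d \<cdot> (u \<cdot> x\<^sub>2)) (s \<cdot> y) (t \<cdot> z)))))" for x y z
    by (rule U_equivariant) simp
  have 3: "tsum2 us (\<lambda>u v. tsum2 (cop (e \<cdot> (v \<cdot> al))) (\<lambda>s t. B (d \<cdot> (u \<cdot> c)) (s \<cdot> y) (t \<cdot> z))) =
      tsum3 ph (\<lambda>p q r. tsum2 (cop (S p \<cdot> al)) (\<lambda>d' e'. tsum2 (cop (e \<cdot> (e' \<cdot> r)))
        (\<lambda>s t. B (d \<cdot> ((d' \<cdot> q) \<cdot> c)) (s \<cdot> y) (t \<cdot> z))))" for c d e y z
    by (rule U_contract) simp
  have 4: "tsum2 (cop (S a)) (\<lambda>d e. tsum2 (cop (S p \<cdot> al)) (\<lambda>d' e'. tsum2 (cop (e \<cdot> (e' \<cdot> r)))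
        (\<lambda>s t. B (d \<cdot> ((d' \<cdot> q) \<cdot> c)) (s \<cdot> y) (t \<cdot> z)))) =
      tsum2 (cop r) (\<lambda>r\<^sub>1 r\<^sub>2.
      tsum2 (cop (S (p \<cdot> a) \<cdot> al)) (\<lambda>d e. tsum2 (cop e) (\<lambda>e\<^sub>1 e\<^sub>2. B (d \<cdot> (q \<cdot> c)) (e\<^sub>1 \<cdot> (r\<^sub>1 \<cdot> y)) (e\<^sub>2 \<cdot> (r\<^sub>2 \<cdot> z)))))"
    for a c p q r y z
    by (simp add: cop_mul S_mul assoc tsum2_tsum2_swap[of "cop r"])
  have "lhs (\<lambda>u v w. B u v (w \<cdot> al)) =
     tsum3 ph (\<lambda>x y z. tsum2 us (\<lambda>u v. tsum2 (cop (v \<cdot> S x \<cdot> al)) (\<lambda>s t. B u (s \<cdot> y) (t \<cdot> z))))"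
    unfolding lhs_def assoc 1 tsum2_tsum3_swap ..
  also have "\<dots> = tsum3 ph (\<lambda>x y z. tsum2 (cop x) (\<lambda>x\<^sub>1 x\<^sub>2. tsum2 (cop (S x\<^sub>1)) (\<lambda>d e.
       tsum3 ph (\<lambda>p q r. tsum2 (cop (S p \<cdot> al)) (\<lambda>d' e'. tsum2 (cop (e \<cdot> (e' \<cdot> r)))
        (\<lambda>s t. B (d \<cdot> ((d' \<cdot> q) \<cdot> x\<^sub>2)) (s \<cdot> y) (t \<cdot> z)))))))"
    unfolding 2 unfolding assoc 3 ..
  also have "\<dots> = tsum3 ph (\<lambda>x y z. tsum3 ph (\<lambda>p q r. tsum2 (cop x) (\<lambda>x\<^sub>1 x\<^sub>2. tsum2 (cop r) (\<lambda>r\<^sub>1 r\<^sub>2.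
      tsum2 (cop (S (p \<cdot> x\<^sub>1) \<cdot> al)) (\<lambda>d e. tsum2 (cop e) (\<lambda>e\<^sub>1 e\<^sub>2. B (d \<cdot> (q \<cdot> x\<^sub>2)) (e\<^sub>1 \<cdot> (r\<^sub>1 \<cdot> y)) (e\<^sub>2 \<cdot> (r\<^sub>2 \<cdot> z))))))))"
    unfolding tsum2_tsum3_swap 4 ..
  also have "\<dots> = tsum3 ph (\<lambda>p q r. tsum3 ph (\<lambda>x y z. tsum2 (cop r) (\<lambda>r\<^sub>1 r\<^sub>2. tsum2 (cop x) (\<lambda>x\<^sub>1 x\<^sub>2.
      tsum2 (cop (S (p \<cdot> x\<^sub>1) \<cdot> al)) (\<lambda>d e. tsum2 (cop e) (\<lambda>e\<^sub>1 e\<^sub>2. B (d \<cdot> (q \<cdot> x\<^sub>2)) (e\<^sub>1 \<cdot> (r\<^sub>1 \<cdot> y)) (e\<^sub>2 \<cdot> (r\<^sub>2 \<cdot> z))))))))"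
    by (subst tsum3_tsum3_swap, intro tsum3_cong, rule tsum2_tsum2_swap)
  finally show ?thesis .
qed

text \<open>One contraction eliminates U, but it leaves the outer associator to the left of an
  iterated coproduct of S(p' p) \<alpha>. Quasi-coassociativity carries it to the right, and then
  the three associators stand as on the right side of the pentagon, under the same iterated
  coproduct as in \<open>lhs_contract\<close>.\<close>

lemma rhs_contract:
  assumes B: "form3 B"
  shows "rhs (\<lambda>u v w. B u v (w \<cdot> al)) =
    tsum3 ph (\<lambda>x y z. tsum3 ph (\<lambda>p q r. tsum3 ph (\<lambda>s t u. tsum2 (cop q) (\<lambda>q\<^sub>1 q\<^sub>2.
      tsum2 (cop (S (p \<cdot> s) \<cdot> al)) (\<lambda>d e. tsum2 (cop e) (\<lambda>e\<^sub>1 e\<^sub>2.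
        B (d \<cdot> (x \<cdot> (q\<^sub>1 \<cdot> t))) (e\<^sub>1 \<cdot> (y \<cdot> (q\<^sub>2 \<cdot> u))) (e\<^sub>2 \<cdot> (z \<cdot> r))))))))"
proof -
  note [simp] = form3D[OF B] form_defs
  have 1: "tsum2 us (\<lambda>u v. tsum2 (cop (d \<cdot> u)) (\<lambda>g h. B (x \<cdot> (g \<cdot> q)) (y \<cdot> (h \<cdot> r)) (z \<cdot> (e \<cdot> (v \<cdot> al))))) =
     tsum3 ph (\<lambda>p' q' r'. tsum2 (cop (S p' \<cdot> al)) (\<lambda>d' e'. tsum2 (cop (d \<cdot> (d' \<cdot> q')))
       (\<lambda>g h. B (x \<cdot> (g \<cdot> q)) (y \<cdot> (h \<cdot> r)) (z \<cdot> (e \<cdot> (e' \<cdot> r'))))))" for d x q y h r z e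
    by (rule U_contract[of "\<lambda>u v. tsum2 (cop (d \<cdot> u)) (\<lambda>g h. B (x \<cdot> (g \<cdot> q)) (y \<cdot> (h \<cdot> r)) (z \<cdot> (e \<cdot> v)))" for d x q y h r z e]) simp
  have 2: "tsum2 (cop (S p)) (\<lambda>d e. tsum2 (cop (S p' \<cdot> al)) (\<lambda>d' e'. tsum2 (cop (d \<cdot> (d' \<cdot> q')))
       (\<lambda>g h. B (x \<cdot> (g \<cdot> q)) (y \<cdot> (h \<cdot> r)) (z \<cdot> (e \<cdot> (e' \<cdot> r')))))) =
     tsum2 (cop q') (\<lambda>c\<^sub>1 c\<^sub>2. tsum2 (cop (S (p' \<cdot> p) \<cdot> al)) (\<lambda>d e. tsum2 (cop d) (\<lambda>d\<^sub>1 d\<^sub>2.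
        B (x \<cdot> d\<^sub>1 \<cdot> (c\<^sub>1 \<cdot> q)) (y \<cdot> d\<^sub>2 \<cdot> (c\<^sub>2 \<cdot> r)) (z \<cdot> e \<cdot> r'))))" for p p' q q' r r' x y z
    by (simp add: cop_mul S_mul assoc tsum2_tsum2_swap[of "cop q'"])
  have 3: "tsum3 ph (\<lambda>x y z. tsum2 (cop a) (\<lambda>d e. tsum2 (cop d) (\<lambda>d\<^sub>1 d\<^sub>2.
        B (x \<cdot> d\<^sub>1 \<cdot> b) (y \<cdot> d\<^sub>2 \<cdot> c) (z \<cdot> e \<cdot> r')))) =
     tsum2 (cop a) (\<lambda>d e. tsum2 (cop e) (\<lambda>e\<^sub>1 e\<^sub>2.
         tsum3 ph (\<lambda>x y z. B (d \<cdot> x \<cdot> b) (e\<^sub>1 \<cdot> y \<cdot> c) (e\<^sub>2 \<cdot> z \<cdot> r'))))" for a b c r'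
    by (rule coassoc[symmetric]) simp
  have "rhs (\<lambda>u v w. B u v (w \<cdot> al)) = tsum3 ph (\<lambda>x y z. tsum3 ph (\<lambda>p q r. tsum3 ph (\<lambda>p' q' r'.
     tsum2 (cop q') (\<lambda>c\<^sub>1 c\<^sub>2. tsum2 (cop (S (p' \<cdot> p) \<cdot> al)) (\<lambda>d e. tsum2 (cop d) (\<lambda>d\<^sub>1 d\<^sub>2.
        B (x \<cdot> d\<^sub>1 \<cdot> (c\<^sub>1 \<cdot> q)) (y \<cdot> d\<^sub>2 \<cdot> (c\<^sub>2 \<cdot> r)) (z \<cdot> e \<cdot> r')))))))"
    unfolding rhs_def assoc[of _ _ al] 1 tsum2_tsum3_swap 2 ..
  also have "\<dots> = tsum3 ph (\<lambda>p q r. tsum3 ph (\<lambda>p' q' r'. tsum3 ph (\<lambda>x y z.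
     tsum2 (cop q') (\<lambda>c\<^sub>1 c\<^sub>2. tsum2 (cop (S (p' \<cdot> p) \<cdot> al)) (\<lambda>d e. tsum2 (cop d) (\<lambda>d\<^sub>1 d\<^sub>2.
        B (x \<cdot> d\<^sub>1 \<cdot> (c\<^sub>1 \<cdot> q)) (y \<cdot> d\<^sub>2 \<cdot> (c\<^sub>2 \<cdot> r)) (z \<cdot> e \<cdot> r')))))))"
    by (rule tsum3_rotate)
  also have "\<dots> = tsum3 ph (\<lambda>p q r. tsum3 ph (\<lambda>p' q' r'.
     tsum2 (cop q') (\<lambda>c\<^sub>1 c\<^sub>2. tsum2 (cop (S (p' \<cdot> p) \<cdot> al)) (\<lambda>d e. tsum2 (cop e) (\<lambda>e\<^sub>1 e\<^sub>2.
        tsum3 ph (\<lambda>x y z. B (d \<cdot> x \<cdot> (c\<^sub>1 \<cdot> q)) (e\<^sub>1 \<cdot> y \<cdot> (c\<^sub>2 \<cdot> r)) (e\<^sub>2 \<cdot> z \<cdot> r')))))))"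
    by (intro tsum3_cong, subst tsum2_tsum3_swap[symmetric]) (intro tsum2_cong 3)
  also have "\<dots> = tsum3 ph (\<lambda>p q r. tsum3 ph (\<lambda>p' q' r'. tsum3 ph (\<lambda>x y z.
     tsum2 (cop q') (\<lambda>c\<^sub>1 c\<^sub>2. tsum2 (cop (S (p' \<cdot> p) \<cdot> al)) (\<lambda>d e. tsum2 (cop e) (\<lambda>e\<^sub>1 e\<^sub>2.
        B (d \<cdot> (x \<cdot> (c\<^sub>1 \<cdot> q))) (e\<^sub>1 \<cdot> (y \<cdot> (c\<^sub>2 \<cdot> r))) (e\<^sub>2 \<cdot> (z \<cdot> r'))))))))"
    unfolding tsum2_tsum3_swap assoc ..
  also have "\<dots> = tsum3 ph (\<lambda>x y z. tsum3 ph (\<lambda>p' q' r'. tsum3 ph (\<lambda>p q r.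
     tsum2 (cop q') (\<lambda>c\<^sub>1 c\<^sub>2. tsum2 (cop (S (p' \<cdot> p) \<cdot> al)) (\<lambda>d e. tsum2 (cop e) (\<lambda>e\<^sub>1 e\<^sub>2.
        B (d \<cdot> (x \<cdot> (c\<^sub>1 \<cdot> q))) (e\<^sub>1 \<cdot> (y \<cdot> (c\<^sub>2 \<cdot> r))) (e\<^sub>2 \<cdot> (z \<cdot> r'))))))))"
    by (rule trans[OF tsum3_rotate tsum3_tsum3_swap])
  finally show ?thesis .
qed

text \<open>S(a) is moved through the inner copy of U and the resulting S(a_1) through the outer
  one. What matters is the shape of the result: \<open>rhs_equivariant\<close> performs the same
  outer operation on \<open>rhs\<close>, so an equality of the two sides for contracted forms
  survives multiplication by S(a).\<close>

lemma lhs_equivariant: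
  assumes B: "form3 B"
  shows "lhs (\<lambda>u v w. B u v (w \<cdot> S a)) =
    tsum2 (cop a) (\<lambda>a\<^sub>1 a\<^sub>2. tsum2 (cop a\<^sub>1) (\<lambda>b c. tsum2 (cop (S b)) (\<lambda>d e. tsum2 (cop e) (\<lambda>e\<^sub>1 e\<^sub>2.
      lhs (\<lambda>u v w. B (d \<cdot> (u \<cdot> c)) (e\<^sub>1 \<cdot> (v \<cdot> a\<^sub>2)) (e\<^sub>2 \<cdot> w))))))"
proof -
  note [simp] = form3D[OF B] form_defs
  have 1: "tsum2 us (\<lambda>u' v'. tsum2 (cop v) (\<lambda>v\<^sub>1 v\<^sub>2. B u (v\<^sub>1 \<cdot> u') (v\<^sub>2 \<cdot> (v' \<cdot> S a)))) =
     tsum2 (cop a) (\<lambda>a\<^sub>1 a\<^sub>2. tsum2 us (\<lambda>u' v'. tsum2 (cop (v \<cdot> S a\<^sub>1)) (\<lambda>s t. B u (s \<cdot> (u' \<cdot> a\<^sub>2)) (t \<cdot> v'))))" for u v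
    by (subst U_equivariant)
      (simp_all add: cop_mul assoc tsum2_tsum2_swap[of "cop v"] swap_cop_us)
  have 2: "tsum2 us (\<lambda>u v. tsum2 (cop (v \<cdot> S x)) (\<lambda>s t. B u (s \<cdot> m) (t \<cdot> n))) =
     tsum2 (cop x) (\<lambda>b c. tsum2 (cop (S b)) (\<lambda>d e. tsum2 us (\<lambda>u v. tsum2 (cop (e \<cdot> v)) (\<lambda>s t.
       B (d \<cdot> (u \<cdot> c)) (s \<cdot> m) (t \<cdot> n)))))" for x m n
    by (rule U_equivariant) simp
  have "lhs (\<lambda>u v w. B u v (w \<cdot> S a)) =
    tsum2 us (\<lambda>u v. tsum2 (cop a) (\<lambda>a\<^sub>1 a\<^sub>2. tsum2 us (\<lambda>u' v'. tsum2 (cop (v \<cdot> S a\<^sub>1)) (\<lambda>s t. B u (s \<cdot> (u' \<cdot> a\<^sub>2)) (t \<cdot> v')))))"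
    unfolding lhs_def assoc 1 ..
  also have "\<dots> = tsum2 (cop a) (\<lambda>a\<^sub>1 a\<^sub>2. tsum2 us (\<lambda>u' v'. tsum2 us (\<lambda>u v. tsum2 (cop (v \<cdot> S a\<^sub>1)) (\<lambda>s t. B u (s \<cdot> (u' \<cdot> a\<^sub>2)) (t \<cdot> v')))))"
    by (rule trans[OF tsum2_tsum2_swap]) (rule tsum2_cong, rule tsum2_tsum2_swap)
  also have "\<dots> = tsum2 (cop a) (\<lambda>a\<^sub>1 a\<^sub>2. tsum2 us (\<lambda>u' v'. tsum2 (cop a\<^sub>1) (\<lambda>b c. tsum2 (cop (S b)) (\<lambda>d e.
     tsum2 us (\<lambda>u v. tsum2 (cop (e \<cdot> v)) (\<lambda>s t. B (d \<cdot> (u \<cdot> c)) (s \<cdot> (u' \<cdot> a\<^sub>2)) (t \<cdot> v')))))))"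
    unfolding 2 ..
  also have "\<dots> = tsum2 (cop a) (\<lambda>a\<^sub>1 a\<^sub>2. tsum2 (cop a\<^sub>1) (\<lambda>b c. tsum2 (cop (S b)) (\<lambda>d e.
     tsum2 us (\<lambda>u v. tsum2 us (\<lambda>u' v'. tsum2 (cop (e \<cdot> v)) (\<lambda>s t. B (d \<cdot> (u \<cdot> c)) (s \<cdot> (u' \<cdot> a\<^sub>2)) (t \<cdot> v')))))))"
    by (rule tsum2_cong, rule trans[OF tsum2_tsum2_swap], rule tsum2_cong, rule trans[OF tsum2_tsum2_swap],
      rule tsum2_cong, rule tsum2_tsum2_swap)
  also have "\<dots> = tsum2 (cop a) (\<lambda>a\<^sub>1 a\<^sub>2. tsum2 (cop a\<^sub>1) (\<lambda>b c. tsum2 (cop (S b)) (\<lambda>d e. tsum2 (cop e) (\<lambda>e\<^sub>1 e\<^sub>2.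
      lhs (\<lambda>u v w. B (d \<cdot> (u \<cdot> c)) (e\<^sub>1 \<cdot> (v \<cdot> a\<^sub>2)) (e\<^sub>2 \<cdot> w))))))"
    by (simp add: lhs_def cop_mul assoc swap_cop_us)
  finally show ?thesis .
qed

text \<open>After one use of the equivariance of U, quasi-coassociativity is used twice: for a,
  across the inner associator, with everything else collected in the trilinear form
  \<open>F3\<close>; then for S(b), where b is a leg of a, across the outer associator, with the
  rest collected in \<open>K\<close>.\<close>

lemma rhs_equivariant:
  assumes B: "form3 B"
  shows "rhs (\<lambda>u v w. B u v (w \<cdot> S a)) =
    tsum2 (cop a) (\<lambda>a\<^sub>1 a\<^sub>2. tsum2 (cop a\<^sub>1) (\<lambda>b c. tsum2 (cop (S b)) (\<lambda>d e. tsum2 (cop e) (\<lambda>e\<^sub>1 e\<^sub>2.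
      rhs (\<lambda>u v w. B (d \<cdot> (u \<cdot> c)) (e\<^sub>1 \<cdot> (v \<cdot> a\<^sub>2)) (e\<^sub>2 \<cdot> w))))))"
proof -
  note [simp] = form3D[OF B] form_defs
  define F3 where "F3 k m n = tsum3 ph (\<lambda>x y z. tsum2 (cop (S k)) (\<lambda>d e. tsum2 us (\<lambda>u v.
      tsum2 (cop (d \<cdot> u)) (\<lambda>g h. B (x \<cdot> (g \<cdot> m)) (y \<cdot> (h \<cdot> n)) (z \<cdot> (e \<cdot> v))))))" for k m n
  have F3: "form3 F3" by (simp add: F3_def)
  have 1: "tsum2 us (\<lambda>u v. tsum2 (cop (d \<cdot> u)) (\<lambda>g h. B (x \<cdot> (g \<cdot> q)) (y \<cdot> (h \<cdot> r)) (z \<cdot> (e \<cdot> (v \<cdot> S a))))) =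
     tsum2 (cop a) (\<lambda>a\<^sub>1 a\<^sub>2. tsum2 (cop (S a\<^sub>1)) (\<lambda>d' e'. tsum2 us (\<lambda>u v.
       tsum2 (cop (d \<cdot> (d' \<cdot> (u \<cdot> a\<^sub>2)))) (\<lambda>g h. B (x \<cdot> (g \<cdot> q)) (y \<cdot> (h \<cdot> r)) (z \<cdot> (e \<cdot> (e' \<cdot> v)))))))" for d x q y h r z e
    by (rule U_equivariant[of "\<lambda>u v. tsum2 (cop (d \<cdot> u)) (\<lambda>g h. B (x \<cdot> (g \<cdot> q)) (y \<cdot> (h \<cdot> r)) (z \<cdot> (e \<cdot> v)))" for d x q y h r z e]) simp
  have 2: "tsum2 (cop (S p)) (\<lambda>d e. tsum2 (cop a) (\<lambda>a\<^sub>1 a\<^sub>2. tsum2 (cop (S a\<^sub>1)) (\<lambda>d' e'. tsum2 us (\<lambda>u v.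
       tsum2 (cop (d \<cdot> (d' \<cdot> (u \<cdot> a\<^sub>2)))) (\<lambda>g h. B (x \<cdot> (g \<cdot> q)) (y \<cdot> (h \<cdot> r)) (z \<cdot> (e \<cdot> (e' \<cdot> v)))))))) =
     tsum2 (cop a) (\<lambda>a\<^sub>1 a\<^sub>2. tsum2 (cop a\<^sub>2) (\<lambda>k m. tsum2 (cop (S (a\<^sub>1 \<cdot> p))) (\<lambda>d e. tsum2 us (\<lambda>u v.
       tsum2 (cop (d \<cdot> u)) (\<lambda>g h. B (x \<cdot> (g \<cdot> (k \<cdot> q))) (y \<cdot> (h \<cdot> (m \<cdot> r))) (z \<cdot> (e \<cdot> v)))))))" for p q r x y z
  proof (subst tsum2_tsum2_swap, rule tsum2_cong, goal_cases)
    case (1 a\<^sub>1 a\<^sub>2)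
    show ?case
      by (simp add: cop_mul S_mul assoc swap_cop_us tsum2_tsum2_swap[of "cop a\<^sub>2"])
  qed
  define K where "K p m n s t w = tsum2 (cop (S p)) (\<lambda>d e. tsum2 us (\<lambda>u v. tsum2 (cop (d \<cdot> u)) (\<lambda>g h.
      B (s \<cdot> (g \<cdot> m)) (t \<cdot> (h \<cdot> n)) (w \<cdot> (e \<cdot> v)))))" for p m n s t w
  have K: "form3 (K p m n)" for p m n by (simp add: K_def)
  have 3: "tsum2 (cop (S p)) (\<lambda>d' e'. tsum2 us (\<lambda>u v. tsum2 (cop (d \<cdot> (d' \<cdot> u))) (\<lambda>g h.
        B (x \<cdot> (g \<cdot> m)) (y \<cdot> (h \<cdot> n)) (z \<cdot> (e \<cdot> (e' \<cdot> v)))))) =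
     tsum2 (cop d) (\<lambda>d\<^sub>1 d\<^sub>2. K p m n (x \<cdot> d\<^sub>1) (y \<cdot> d\<^sub>2) (z \<cdot> e))" for p m n d e x y z
    by (simp add: K_def cop_mul assoc swap_cop_us tsum2_tsum2_swap[of "cop d"])
  have 4: "F3 (p \<cdot> b) m n = tsum2 (cop (S b)) (\<lambda>d e. tsum2 (cop e) (\<lambda>e\<^sub>1 e\<^sub>2.
     tsum3 ph (\<lambda>x y z. K p m n (d \<cdot> x) (e\<^sub>1 \<cdot> y) (e\<^sub>2 \<cdot> z))))" for p b m n
  proof -
    have "F3 (p \<cdot> b) m n = tsum3 ph (\<lambda>x y z. tsum2 (cop (S b)) (\<lambda>d e. tsum2 (cop (S p)) (\<lambda>d' e'.
      tsum2 us (\<lambda>u v. tsum2 (cop (d \<cdot> (d' \<cdot> u))) (\<lambda>g h.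
        B (x \<cdot> (g \<cdot> m)) (y \<cdot> (h \<cdot> n)) (z \<cdot> (e \<cdot> (e' \<cdot> v))))))))"
      unfolding F3_def S_mul by (subst cop_mul) (simp_all add: assoc)
    then show ?thesis unfolding 3 coassoc[OF K] .
  qed
  have "rhs (\<lambda>u v w. B u v (w \<cdot> S a)) = tsum3 ph (\<lambda>x y z. tsum3 ph (\<lambda>p q r.
     tsum2 (cop a) (\<lambda>a\<^sub>1 a\<^sub>2. tsum2 (cop a\<^sub>2) (\<lambda>k m. tsum2 (cop (S (a\<^sub>1 \<cdot> p))) (\<lambda>d e. tsum2 us (\<lambda>u v.
       tsum2 (cop (d \<cdot> u)) (\<lambda>g h. B (x \<cdot> (g \<cdot> (k \<cdot> q))) (y \<cdot> (h \<cdot> (m \<cdot> r))) (z \<cdot> (e \<cdot> v)))))))))"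
    unfolding rhs_def assoc[of _ _ "S a"] 1 2 ..
  also have "\<dots> = tsum2 (cop a) (\<lambda>a\<^sub>1 a\<^sub>2. tsum2 (cop a\<^sub>2) (\<lambda>k m. tsum3 ph (\<lambda>p q r. F3 (a\<^sub>1 \<cdot> p) (k \<cdot> q) (m \<cdot> r))))"
    by (subst tsum3_tsum3_swap) (simp add: F3_def tsum2_tsum3_swap)
  also have "\<dots> = tsum3 ph (\<lambda>p q r. tsum2 (cop a) (\<lambda>a\<^sub>1 a\<^sub>2. tsum2 (cop a\<^sub>1) (\<lambda>b c. F3 (p \<cdot> b) (q \<cdot> c) (r \<cdot> a\<^sub>2))))"
    by (rule coassoc[OF F3])
  also have "\<dots> = tsum2 (cop a) (\<lambda>a\<^sub>1 a\<^sub>2. tsum2 (cop a\<^sub>1) (\<lambda>b c. tsum2 (cop (S b)) (\<lambda>d e. tsum2 (cop e) (\<lambda>e\<^sub>1 e\<^sub>2.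
      rhs (\<lambda>u v w. B (d \<cdot> (u \<cdot> c)) (e\<^sub>1 \<cdot> (v \<cdot> a\<^sub>2)) (e\<^sub>2 \<cdot> w))))))"
    unfolding 4 rhs_def K_def tsum2_tsum3_swap assoc by (rule tsum3_tsum3_swap)
  finally show ?thesis .
qed

lemma lhs_swap_pi:
  "lhs (\<lambda>u v w. tsum3 pi (\<lambda>x y z. B u v w x y z)) = tsum3 pi (\<lambda>x y z. lhs (\<lambda>u v w. B u v w x y z))"
  by (simp only: lhs_def tsum2_tsum3_swap)

lemma rhs_swap_pi:
  "rhs (\<lambda>u v w. tsum3 pi (\<lambda>x y z. B u v w x y z)) = tsum3 pi (\<lambda>x y z. rhs (\<lambda>u v w. B u v w x y z))"
  by (simp only: rhs_def tsum2_tsum3_swap tsum3_tsum3_swap[of ph pi])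

text \<open>
  Inserting \<open>1 = S(X)\<alpha>Y\<beta>S(Z)\<close> for the legs of the inverse associator into the last factor,
  equivariance reduces both sides to their contractions with \<open>\<alpha>\<close>.
\<close>

lemma lhs_eq_rhs:
  assumes B: "form3 B"
  shows "lhs B = rhs B"
proof -
  note [simp] = form3D[OF B] form_defs
  have one: "tsum3 pi (\<lambda>x y z. B u v (w \<cdot> (S x \<cdot> (al \<cdot> (y \<cdot> (be \<cdot> S z)))))) = B u v w" for u v w
    using antipode_pi[of "\<lambda>a. B u v (w \<cdot> a)"] by simp
  have contract: "lhs (\<lambda>u v w. C u v (w \<cdot> al)) = rhs (\<lambda>u v w. C u v (w \<cdot> al))" if C: "form3 C" for C
    unfolding lhs_contract[OF C] rhs_contract[OF C]
    by (rule pentagon[of "\<lambda>a b c d. tsum2 (cop (S a \<cdot> al)) (\<lambda>s t. tsum2 (cop t) (\<lambda>t\<^sub>1 t\<^sub>2. C (s \<cdot> b) (t\<^sub>1 \<cdot> c) (t\<^sub>2 \<cdot> d)))"])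
      (simp add: form3D[OF C])
  have eq: "lhs (\<lambda>u v w. B u v (w \<cdot> (S x \<cdot> (al \<cdot> c)))) = rhs (\<lambda>u v w. B u v (w \<cdot> (S x \<cdot> (al \<cdot> c))))" for x c
  proof -
    have C: "form3 (\<lambda>u v w. B u v (w \<cdot> (al \<cdot> c)))" by simp
    have C': "form3 (\<lambda>u v w. B (d \<cdot> (u \<cdot> b)) (e \<cdot> (v \<cdot> b')) (f \<cdot> (w \<cdot> c)))" for b b' d e f by simp
    show ?thesis
      using lhs_equivariant[OF C, of x] rhs_equivariant[OF C, of x] contract[OF C']
      by (simp add: assoc)
  qed
  have "lhs B = tsum3 pi (\<lambda>x y z. lhs (\<lambda>u v w. B u v (w \<cdot> (S x \<cdot> (al \<cdot> (y \<cdot> (be \<cdot> S z)))))))"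
    unfolding lhs_swap_pi[symmetric] one ..
  also have "\<dots> = rhs B"
    unfolding eq rhs_swap_pi[symmetric] one ..
  finally show ?thesis .
qed

text \<open>With \<epsilon> on the first leg, equivariance says that the second leg v may be moved
  past S(a), and contraction says that v may be deleted in front of \<alpha>. Inserting 1 = S(x)
  \<alpha> y \<beta> S(z) behind v and applying the two rules in this order removes v. For U and for
  V this becomes part of the counit axiom of the coaction.\<close>

lemma counit_U:
  assumes f: "lin f"
  shows "tsum2 us (\<lambda>u v. eps u * f v) = f \<one>"
proof -
  note [simp] = lin_endo[OF f] form_defs
  have move: "tsum2 us (\<lambda>u v. eps u * f (v \<cdot> (S a \<cdot> c))) = tsum2 us (\<lambda>u v. eps u * f (S a \<cdot> (v \<cdot> c)))" for a c
  proof -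
    have 1: "tsum2 (cop (S b)) (\<lambda>d e. tsum2 us (\<lambda>u v. eps d * (eps u * (k * f (e \<cdot> (v \<cdot> c)))))) =
       k * tsum2 us (\<lambda>u v. eps u * f (S b \<cdot> (v \<cdot> c)))" for b k
      using counit_left[of "\<lambda>x. tsum2 us (\<lambda>u v. eps u * f (x \<cdot> (v \<cdot> c)))" "S b"]
      by (simp add: tsum2_mult mult.left_commute[of _ k])
    show ?thesis
      using U_equivariant[of "\<lambda>u v. eps u * f (v \<cdot> c)" a]
        counit_right[of "\<lambda>x. tsum2 us (\<lambda>u v. eps u * f (S x \<cdot> (v \<cdot> c)))" a]
      by (simp add: assoc mult.assoc 1)
  qed
  have contract: "tsum2 us (\<lambda>u v. eps u * f (b \<cdot> (v \<cdot> (al \<cdot> c)))) = f (b \<cdot> (al \<cdot> c))" for b c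
  proof -
    have 1: "tsum2 (cop a) (\<lambda>d e. eps d * (eps y * f (b \<cdot> (e \<cdot> (z \<cdot> c))))) = eps y * f (b \<cdot> (a \<cdot> (z \<cdot> c)))" for a y z
      using counit_left[of "\<lambda>x. eps y * f (b \<cdot> (x \<cdot> (z \<cdot> c)))" a] by simp
    show ?thesis
      using U_contract[of "\<lambda>u v. eps u * f (b \<cdot> (v \<cdot> c))"] counit_ph2[of "\<lambda>x z. f (b \<cdot> (S x \<cdot> (al \<cdot> (z \<cdot> c))))"]
      by (simp add: assoc mult.assoc 1 S_one)
  qed
  have "tsum2 us (\<lambda>u v. eps u * f v) = tsum2 us (\<lambda>u v. eps u * tsum3 pi (\<lambda>x y z. f (v \<cdot> (S x \<cdot> (al \<cdot> (y \<cdot> (be \<cdot> S z)))))))"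
    using antipode_pi[of "\<lambda>a. f (v \<cdot> a)" for v] by simp
  also have "\<dots> = tsum3 pi (\<lambda>x y z. tsum2 us (\<lambda>u v. eps u * f (v \<cdot> (S x \<cdot> (al \<cdot> (y \<cdot> (be \<cdot> S z)))))))"
    by (simp add: tsum3_mult[symmetric] tsum2_tsum3_swap)
  also have "\<dots> = f \<one>"
    unfolding move contract by (rule antipode_pi[OF f])
  finally show ?thesis .
qed

end

subsection \<open>Quasi-Hopf algebras in terms of lists\<close>

text \<open>The numbered pentagons are the pentagon solved for different groups of its factors, each
  in an order that places \<alpha> or \<beta> between the two halves of a coproduct when it is
  applied. \<open>pentagon_pi\<close> is the inverted pentagon, with its summations ordered so that
  reversing all products gives the axiom \<open>pentagon\<close> for the opposite algebra.\<close>

locale quasi_hopf_sums = coproduct_sums scl mul one S cop eps ph pi al be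
  for scl :: "'k::field \<Rightarrow> 'h::ab_group_add \<Rightarrow> 'h" and mul (infixl "\<cdot>" 70) and one ("\<one>") and S
    and cop eps ph pi al be +
  assumes cop_one: "form2 F \<Longrightarrow> tsum2 (cop \<one>) F = F \<one> \<one>"
    and ph_pi: "form3 F3 \<Longrightarrow>
      tsum3 ph (\<lambda>x y z. tsum3 pi (\<lambda>p q r. F3 (x \<cdot> p) (y \<cdot> q) (z \<cdot> r))) = F3 \<one> \<one> \<one>"
    and pi_ph: "form3 F3 \<Longrightarrow>
      tsum3 pi (\<lambda>x y z. tsum3 ph (\<lambda>p q r. F3 (x \<cdot> p) (y \<cdot> q) (z \<cdot> r))) = F3 \<one> \<one> \<one>"
    and coassoc_pi: "form3 F3 \<Longrightarrow>
      tsum3 pi (\<lambda>x y z. tsum2 (cop a) (\<lambda>a\<^sub>1 a\<^sub>2. tsum2 (cop a\<^sub>2) (\<lambda>b c. F3 (x \<cdot> a\<^sub>1) (y \<cdot> b) (z \<cdot> c)))) =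
      tsum3 pi (\<lambda>x y z. tsum2 (cop a) (\<lambda>a\<^sub>1 a\<^sub>2. tsum2 (cop a\<^sub>1) (\<lambda>b c. F3 (b \<cdot> x) (c \<cdot> y) (a\<^sub>2 \<cdot> z))))"
    and pentagon1: "form4 F4 \<Longrightarrow>
      tsum3 ph (\<lambda>x y z. tsum3 pi (\<lambda>p q r. tsum2 (cop p) (\<lambda>p\<^sub>1 p\<^sub>2.
        F4 (x \<cdot> p\<^sub>1) (y \<cdot> p\<^sub>2) (z \<cdot> q) r))) =
      tsum3 pi (\<lambda>a b c. tsum3 pi (\<lambda>d e f. tsum3 ph (\<lambda>x y z. tsum2 (cop b) (\<lambda>b\<^sub>1 b\<^sub>2. tsum2 (cop z) (\<lambda>z\<^sub>1 z\<^sub>2.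
        F4 (a \<cdot> x) (b\<^sub>1 \<cdot> (d \<cdot> y)) (b\<^sub>2 \<cdot> (e \<cdot> z\<^sub>1)) (c \<cdot> (f \<cdot> z\<^sub>2)))))))"
    and pentagon2: "form4 F4 \<Longrightarrow>
      tsum3 ph (\<lambda>x y z. tsum3 pi (\<lambda>p q r. tsum2 (cop x) (\<lambda>x\<^sub>1 x\<^sub>2.
        F4 (x\<^sub>1 \<cdot> p) (x\<^sub>2 \<cdot> q) (y \<cdot> r) z))) =
      tsum3 pi (\<lambda>a b c. tsum3 ph (\<lambda>d e f. tsum3 ph (\<lambda>x y z. tsum2 (cop c) (\<lambda>c\<^sub>1 c\<^sub>2. tsum2 (cop y) (\<lambda>y\<^sub>1 y\<^sub>2.
        F4 (a \<cdot> x) (b \<cdot> (d \<cdot> y\<^sub>1)) (c\<^sub>1 \<cdot> (e \<cdot> y\<^sub>2)) (c\<^sub>2 \<cdot> (f \<cdot> z)))))))"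
    and pentagon3: "form4 F4 \<Longrightarrow>
      tsum3 pi (\<lambda>a b c. tsum3 ph (\<lambda>d e f. tsum3 ph (\<lambda>x y z. tsum2 (cop f) (\<lambda>f\<^sub>1 f\<^sub>2. tsum2 (cop x) (\<lambda>x\<^sub>1 x\<^sub>2.
        F4 (d \<cdot> x\<^sub>1) (a \<cdot> (e \<cdot> x\<^sub>2)) (b \<cdot> (f\<^sub>1 \<cdot> y)) (c \<cdot> (f\<^sub>2 \<cdot> z))))))) =
      tsum3 ph (\<lambda>p q r. tsum3 ph (\<lambda>s t u. tsum2 (cop q) (\<lambda>q\<^sub>1 q\<^sub>2.
        F4 (p \<cdot> s) (q\<^sub>1 \<cdot> t) (q\<^sub>2 \<cdot> u) r)))"
    and pentagon4: "form4 F4 \<Longrightarrow>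
      tsum3 pi (\<lambda>x y z. tsum3 pi (\<lambda>a b c. tsum2 (cop y) (\<lambda>y\<^sub>1 y\<^sub>2.
        F4 x (y\<^sub>1 \<cdot> a) (y\<^sub>2 \<cdot> b) (z \<cdot> c)))) =
      tsum3 ph (\<lambda>x y z. tsum3 pi (\<lambda>p q r. tsum3 pi (\<lambda>d e f. tsum2 (cop p) (\<lambda>p\<^sub>1 p\<^sub>2. tsum2 (cop f) (\<lambda>f\<^sub>1 f\<^sub>2.
        F4 (x \<cdot> (p\<^sub>1 \<cdot> d)) (y \<cdot> (p\<^sub>2 \<cdot> e)) (z \<cdot> (q \<cdot> f\<^sub>1)) (r \<cdot> f\<^sub>2))))))"
    and pentagon_pi: "form4 F4 \<Longrightarrow>
      tsum3 pi (\<lambda>p q r. tsum3 pi (\<lambda>x y z. tsum2 (cop r) (\<lambda>r\<^sub>1 r\<^sub>2. tsum2 (cop x) (\<lambda>x\<^sub>1 x\<^sub>2.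
        F4 (x\<^sub>1 \<cdot> p) (x\<^sub>2 \<cdot> q) (y \<cdot> r\<^sub>1) (z \<cdot> r\<^sub>2))))) =
      tsum3 pi (\<lambda>x y z. tsum3 pi (\<lambda>p q r. tsum3 pi (\<lambda>s t u. tsum2 (cop q) (\<lambda>q\<^sub>1 q\<^sub>2.
        F4 (s \<cdot> p) (t \<cdot> (q\<^sub>1 \<cdot> x)) (u \<cdot> (q\<^sub>2 \<cdot> y)) (r \<cdot> z)))))"
    and antipode_al: "lin f \<Longrightarrow> tsum2 (cop a) (\<lambda>b c. f (S b \<cdot> (al \<cdot> c))) = eps a * f al"
    and antipode_be: "lin f \<Longrightarrow> tsum2 (cop a) (\<lambda>b c. f (b \<cdot> (be \<cdot> S c))) = eps a * f be"
    and antipode_ph: "lin f \<Longrightarrow> tsum3 ph (\<lambda>x y z. f (x \<cdot> (be \<cdot> (S y \<cdot> (al \<cdot> z))))) = f \<one>"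
    and bij_S: "bij S"
begin

text \<open>The axiom puts \<epsilon> on the middle leg of \<phi>; the outer legs follow from the
  pentagon. With \<epsilon> on its second leg the pentagon reads \<phi> = (1 \<otimes> (\<epsilon>
  \<otimes> id \<otimes> id)(\<phi>)) \<phi>, which is \<open>key\<close>, and \<phi> is cancelled
  on the right.\<close>

lemma counit_ph1:
  assumes F: "form2 F"
  shows "tsum3 ph (\<lambda>x y z. eps x * F y z) = F \<one> \<one>"
proof -
  note [simp] = form_defs
  have key: "tsum3 ph G = tsum3 ph (\<lambda>x y z. tsum3 ph (\<lambda>p q r. eps x * G p (y \<cdot> q) (z \<cdot> r)))"
    if G: "form3 G" for G
  proof -
    note [simp] = form3D[OF G]
    have 1: "tsum3 ph (\<lambda>p q r. eps q * tsum2 (cop r) (\<lambda>c d. G (p \<cdot> x) (c \<cdot> y) (d \<cdot> z))) = G x y z" for x y z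
      by (subst counit_ph2) (simp_all add: cop_one)
    have 2: "tsum3 ph (\<lambda>s t u. eps t * G (p \<cdot> s) (v \<cdot> u) r) = G p v r" for p v r
      by (subst counit_ph2) simp_all
    have 3: "tsum2 (cop x) (\<lambda>b c. eps c * G (p \<cdot> b) m n) = G (p \<cdot> x) m n" for x p m n
      by (subst counit_right) simp_all
    have 4: "tsum2 (cop q) (\<lambda>b c. eps b * G m (y \<cdot> (c \<cdot> u)) n) = G m (y \<cdot> (q \<cdot> u)) n" for q m y u n
      by (subst counit_left[of "\<lambda>c. G m (y \<cdot> (c \<cdot> u)) n"]) simp_all
    have "tsum3 ph (\<lambda>x y z. tsum3 ph (\<lambda>p q r. eps q * tsum2 (cop r) (\<lambda>c d. G (p \<cdot> x) (c \<cdot> y) (d \<cdot> z)))) =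
      tsum3 ph (\<lambda>x y z. tsum3 ph (\<lambda>p q r. tsum3 ph (\<lambda>s t u. eps x * (eps t * G (p \<cdot> s) (y \<cdot> (q \<cdot> u)) (z \<cdot> r)))))"
      using pentagon[of "\<lambda>a b c d. eps b * G a c d"]
      by (subst tsum3_tsum3_swap) (simp add: mult.assoc tsum2_mult 3 4 mult.left_commute[of "eps _" "eps _"])
    then show ?thesis
      by (simp only: 1 2 tsum3_mult assoc[symmetric])
  qed
  note [simp] = form2D[OF F]
  show ?thesis
    using ph_pi[of "\<lambda>a b c. eps a * F b c"] key[of "\<lambda>x y z. tsum3 pi (\<lambda>a b c. eps (x \<cdot> a) * F (y \<cdot> b) (z \<cdot> c))"]
      ph_pi[of "\<lambda>a b c. eps a * F (y \<cdot> b) (z \<cdot> c)" for y z]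
    by (simp add: mult.assoc tsum3_mult assoc)
qed

text \<open>With \<epsilon> on the third leg the pentagon reads \<phi> = \<phi> ((id \<otimes> id
  \<otimes> \<epsilon>)(\<phi>) \<otimes> 1), so that this time \<phi> is cancelled on the
  left.\<close>

lemma counit_ph3:
  assumes F: "form2 F"
  shows "tsum3 ph (\<lambda>x y z. eps z * F x y) = F \<one> \<one>"
proof -
  note [simp] = form_defs
  have key: "tsum3 ph G = tsum3 ph (\<lambda>s t u. tsum3 ph (\<lambda>p q r. eps u * G (p \<cdot> s) (q \<cdot> t) r))"
    if G: "form3 G" for G
  proof -
    note [simp] = form3D[OF G]
    have 1: "tsum3 ph (\<lambda>x y z. eps y * tsum2 (cop x) (\<lambda>c d. G (p \<cdot> c) (q \<cdot> d) (r \<cdot> z))) = G p q r" for p q r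
      by (subst counit_ph2) (simp_all add: cop_one)
    have 2: "tsum3 ph (\<lambda>x y z. eps y * G p (x \<cdot> v) (z \<cdot> r)) = G p v r" for p v r
      by (subst counit_ph2) simp_all
    have 4: "tsum2 (cop q) (\<lambda>b c. eps c * G m (y \<cdot> (b \<cdot> u)) n) = G m (y \<cdot> (q \<cdot> u)) n" for q m y u n
      by (subst counit_right[of "\<lambda>c. G m (y \<cdot> (c \<cdot> u)) n"]) simp_all
    have 5: "tsum2 (cop r) (\<lambda>r\<^sub>1 r\<^sub>2. eps r\<^sub>1 * tsum2 (cop x) (\<lambda>x\<^sub>1 x\<^sub>2. G (p \<cdot> x\<^sub>1) (q \<cdot> x\<^sub>2) (r\<^sub>2 \<cdot> z))) =
       tsum2 (cop x) (\<lambda>c d. G (p \<cdot> c) (q \<cdot> d) (r \<cdot> z))" for p q r x z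
      by (subst counit_left) simp_all
    have "tsum3 ph (\<lambda>p q r. tsum3 ph (\<lambda>x y z. eps y * tsum2 (cop x) (\<lambda>c d. G (p \<cdot> c) (q \<cdot> d) (r \<cdot> z)))) =
      tsum3 ph (\<lambda>x y z. tsum3 ph (\<lambda>p q r. tsum3 ph (\<lambda>s t u. eps u * (eps y * G (p \<cdot> s) (x \<cdot> (q \<cdot> t)) (z \<cdot> r)))))"
      using pentagon[of "\<lambda>a b c d. eps c * G a b d"]
      by (simp add: mult.assoc tsum2_mult 5 4 mult.left_commute[of "eps _" "eps _"])
    also have "\<dots> = tsum3 ph (\<lambda>p q r. tsum3 ph (\<lambda>s t u. tsum3 ph (\<lambda>x y z. eps u * (eps y * G (p \<cdot> s) (x \<cdot> (q \<cdot> t)) (z \<cdot> r)))))"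
      by (rule tsum3_rotate)
    also have "\<dots> = tsum3 ph (\<lambda>s t u. tsum3 ph (\<lambda>p q r. eps u * G (p \<cdot> s) (q \<cdot> t) r))"
      by (simp only: tsum3_mult 2 tsum3_tsum3_swap[of ph ph "\<lambda>p q r s t u. eps u * G (p \<cdot> s) (q \<cdot> t) r"])
    finally show ?thesis by (simp only: 1)
  qed
  note [simp] = form2D[OF F]
  have "tsum3 ph (\<lambda>x y z. tsum3 pi (\<lambda>a b c. eps (c \<cdot> z) * F (a \<cdot> x) (b \<cdot> y))) = F \<one> \<one>"
    using pi_ph[of "\<lambda>x y z. eps z * F x y"] by (subst tsum3_tsum3_swap) simp
  moreover have "tsum3 ph (\<lambda>p q r. tsum3 pi (\<lambda>a b c. eps (c \<cdot> r) * F (a \<cdot> (p \<cdot> s)) (b \<cdot> (q \<cdot> t)))) = F s t" for s t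
    using pi_ph[of "\<lambda>x y z. eps z * F (x \<cdot> s) (y \<cdot> t)"] by (subst tsum3_tsum3_swap) (simp add: assoc)
  ultimately show ?thesis
    using key[of "\<lambda>x y z. tsum3 pi (\<lambda>a b c. eps (c \<cdot> z) * F (a \<cdot> x) (b \<cdot> y))"]
    by (simp add: tsum3_mult)
qed

lemma counit_pi1:
  assumes F: "form2 F"
  shows "tsum3 pi (\<lambda>x y z. eps x * F y z) = F \<one> \<one>"
proof -
  note [simp] = form_defs form2D[OF F]
  have "tsum3 ph (\<lambda>p q r. eps p * F (y \<cdot> q) (z \<cdot> r)) = F y z" for y z
    by (subst counit_ph1) simp_all
  then show ?thesis
    using pi_ph[of "\<lambda>x y z. eps x * F y z"] by (simp add: mult.assoc tsum3_mult)
qed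

lemma counit_pi2:
  assumes F: "form2 F"
  shows "tsum3 pi (\<lambda>x y z. eps y * F x z) = F \<one> \<one>"
proof -
  note [simp] = form_defs form2D[OF F]
  have "tsum3 ph (\<lambda>p q r. eps q * F (y \<cdot> p) (z \<cdot> r)) = F y z" for y z
    by (subst counit_ph2) simp_all
  then show ?thesis
    using pi_ph[of "\<lambda>x y z. eps y * F x z"] by (simp add: mult.assoc tsum3_mult)
qed

lemma counit_pi3:
  assumes F: "form2 F"
  shows "tsum3 pi (\<lambda>x y z. eps z * F x y) = F \<one> \<one>"
proof -
  note [simp] = form_defs form2D[OF F]
  have "tsum3 ph (\<lambda>p q r. eps r * F (y \<cdot> p) (z \<cdot> q)) = F y z" for y z
    by (subst counit_ph3) simp_all
  then show ?thesis
    using pi_ph[of "\<lambda>x y z. eps z * F x y"] by (simp add: mult.assoc tsum3_mult)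
qed

text \<open>For p_R = p^1 \<otimes> p^2 this is (1 \<otimes> S^{-1}(p^2)) q_R \<Delta>(p^1) = 1
  \<otimes> 1, with S applied to the second leg. After \<open>pentagon1\<close> both \<alpha> and
  \<beta> stand between the halves of a coproduct and contract it to a counit. The counit identities
  then remove two of the three associators, and the last is the antipode axiom for the inverse
  associator.\<close>

lemma zigzag1:
  assumes F: "form2 F"
  shows "tsum3 ph (\<lambda>x y z. tsum3 pi (\<lambda>p q r. tsum2 (cop p) (\<lambda>p\<^sub>1 p\<^sub>2.
    F (x \<cdot> p\<^sub>1) (S (y \<cdot> p\<^sub>2) \<cdot> (al \<cdot> (z \<cdot> (q \<cdot> (be \<cdot> S r)))))))) = F \<one> \<one>"
proof -
  note [simp] = form_defs form2D[OF F]
  have be: "tsum2 (cop z) (\<lambda>z\<^sub>1 z\<^sub>2. F m (u \<cdot> (v \<cdot> (b\<^sub>1 \<cdot> (al \<cdot> (b\<^sub>2 \<cdot> (e \<cdot> (z\<^sub>1 \<cdot> (be \<cdot> (S z\<^sub>2 \<cdot> w)))))))))) =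
    eps z * F m (u \<cdot> (v \<cdot> (b\<^sub>1 \<cdot> (al \<cdot> (b\<^sub>2 \<cdot> (e \<cdot> (be \<cdot> w)))))))" for z m u v b\<^sub>1 b\<^sub>2 e w
    using antipode_be[of "\<lambda>h. F m (u \<cdot> (v \<cdot> (b\<^sub>1 \<cdot> (al \<cdot> (b\<^sub>2 \<cdot> (e \<cdot> (h \<cdot> w)))))))"] by (simp add: assoc)
  have al: "tsum2 (cop b) (\<lambda>b\<^sub>1 b\<^sub>2. F m (u \<cdot> (v \<cdot> (S b\<^sub>1 \<cdot> (al \<cdot> (b\<^sub>2 \<cdot> w)))))) =
    eps b * F m (u \<cdot> (v \<cdot> (al \<cdot> w)))" for b m u v w
    using antipode_al[of "\<lambda>h. F m (u \<cdot> (v \<cdot> (h \<cdot> w)))"] by (simp add: assoc)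
  have bz: "tsum2 (cop b) (\<lambda>b\<^sub>1 b\<^sub>2. eps z * F m (u \<cdot> (v \<cdot> (S b\<^sub>1 \<cdot> (al \<cdot> (b\<^sub>2 \<cdot> w)))))) =
    eps b * (eps z * F m (u \<cdot> (v \<cdot> (al \<cdot> w))))" for b z m u v w
    by (simp add: tsum2_mult al mult.left_commute)
  have ph: "tsum3 ph (\<lambda>x y z. eps z * F (a \<cdot> x) (S y \<cdot> w)) = F a w" for a w
    using counit_ph3[of "\<lambda>x y. F (a \<cdot> x) (S y \<cdot> w)"] by simp
  have pi: "tsum3 pi (\<lambda>a b c. eps b * F a (u \<cdot> (S c \<cdot> w))) = F \<one> (u \<cdot> w)" for u w
    using counit_pi2[of "\<lambda>a c. F a (u \<cdot> (S c \<cdot> w))"] by simp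
  have "tsum3 ph (\<lambda>x y z. tsum3 pi (\<lambda>p q r. tsum2 (cop p) (\<lambda>p\<^sub>1 p\<^sub>2.
    F (x \<cdot> p\<^sub>1) (S (y \<cdot> p\<^sub>2) \<cdot> (al \<cdot> (z \<cdot> (q \<cdot> (be \<cdot> S r)))))))) =
    tsum3 pi (\<lambda>a b c. tsum3 pi (\<lambda>d e f. eps b * tsum3 ph (\<lambda>x y z. eps z *
        F (a \<cdot> x) (S y \<cdot> (S d \<cdot> (al \<cdot> (e \<cdot> (be \<cdot> (S f \<cdot> S c)))))))))"
    using pentagon1[of "\<lambda>a b c d. F a (S b \<cdot> (al \<cdot> (c \<cdot> (be \<cdot> S d))))"]
    by (simp add: S_mul assoc be bz tsum3_mult)
  also have "\<dots> = tsum3 pi (\<lambda>d e f. tsum3 pi (\<lambda>a b c. eps b *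
        F a (S d \<cdot> (al \<cdot> (e \<cdot> (be \<cdot> (S f \<cdot> S c)))))))"
    unfolding ph by (rule tsum3_tsum3_swap)
  also have "\<dots> = F \<one> \<one>"
    using pi[of "S d \<cdot> (al \<cdot> (e \<cdot> (be \<cdot> S f)))" \<one> for d e f] antipode_pi[of "F \<one>"]
    by (simp add: assoc)
  finally show ?thesis .
qed

text \<open>The companion \<Delta>(q^1) p_R (1 \<otimes> S(q^2)) = 1 \<otimes> 1 for q_R = q^1
  \<otimes> q^2, from \<open>pentagon2\<close> in the same manner. Here the surviving associator is
  \<phi>, removed by the antipode axiom for \<phi>.\<close>

lemma zigzag2:
  assumes F: "form2 F"
  shows "tsum3 ph (\<lambda>x y z. tsum3 pi (\<lambda>p q r. tsum2 (cop x) (\<lambda>x\<^sub>1 x\<^sub>2.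
    F (x\<^sub>1 \<cdot> p) (x\<^sub>2 \<cdot> (q \<cdot> (be \<cdot> (S (y \<cdot> r) \<cdot> (al \<cdot> z)))))))) = F \<one> \<one>"
proof -
  note [simp] = form_defs form2D[OF F]
  have be: "tsum2 (cop y) (\<lambda>y\<^sub>1 y\<^sub>2. F m (b \<cdot> (d \<cdot> (y\<^sub>1 \<cdot> (be \<cdot> (S y\<^sub>2 \<cdot> w)))))) =
    eps y * F m (b \<cdot> (d \<cdot> (be \<cdot> w)))" for y m b d w
    using antipode_be[of "\<lambda>h. F m (b \<cdot> (d \<cdot> (h \<cdot> w)))"] by (simp add: assoc)
  have al: "tsum2 (cop c) (\<lambda>c\<^sub>1 c\<^sub>2. F m (b \<cdot> (d \<cdot> (be \<cdot> (e \<cdot> (S c\<^sub>1 \<cdot> (al \<cdot> (c\<^sub>2 \<cdot> w)))))))) =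
    eps c * F m (b \<cdot> (d \<cdot> (be \<cdot> (e \<cdot> (al \<cdot> w)))))" for c m b d e w
    using antipode_al[of "\<lambda>h. F m (b \<cdot> (d \<cdot> (be \<cdot> (e \<cdot> (h \<cdot> w)))))"] by (simp add: assoc)
  have cy: "tsum2 (cop c) (\<lambda>c\<^sub>1 c\<^sub>2. eps y * F m (b \<cdot> (d \<cdot> (be \<cdot> (e \<cdot> (S c\<^sub>1 \<cdot> (al \<cdot> (c\<^sub>2 \<cdot> w)))))))) =
    eps c * (eps y * F m (b \<cdot> (d \<cdot> (be \<cdot> (e \<cdot> (al \<cdot> w))))))" for c y m b d e w
    by (simp add: tsum2_mult al mult.left_commute)
  have ph: "tsum3 ph (\<lambda>x y z. eps y * F (a \<cdot> x) (b \<cdot> (d \<cdot> (be \<cdot> (e \<cdot> (al \<cdot> (f \<cdot> z))))))) =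
    F a (b \<cdot> (d \<cdot> (be \<cdot> (e \<cdot> (al \<cdot> f)))))" for a b d e f
    using counit_ph2[of "\<lambda>x z. F (a \<cdot> x) (b \<cdot> (d \<cdot> (be \<cdot> (e \<cdot> (al \<cdot> (f \<cdot> z))))))"] by simp
  have ph': "tsum3 ph (\<lambda>d e f. F a (b \<cdot> (d \<cdot> (be \<cdot> (S e \<cdot> (al \<cdot> f)))))) = F a b" for a b
    using antipode_ph[of "\<lambda>h. F a (b \<cdot> h)"] by simp
  have "tsum3 ph (\<lambda>x y z. tsum3 pi (\<lambda>p q r. tsum2 (cop x) (\<lambda>x\<^sub>1 x\<^sub>2.
    F (x\<^sub>1 \<cdot> p) (x\<^sub>2 \<cdot> (q \<cdot> (be \<cdot> (S (y \<cdot> r) \<cdot> (al \<cdot> z)))))))) =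
    tsum3 pi (\<lambda>a b c. tsum3 ph (\<lambda>d e f. eps c * tsum3 ph (\<lambda>x y z. eps y *
        F (a \<cdot> x) (b \<cdot> (d \<cdot> (be \<cdot> (S e \<cdot> (al \<cdot> (f \<cdot> z)))))))))"
    using pentagon2[of "\<lambda>a b c d. F a (b \<cdot> (be \<cdot> (S c \<cdot> (al \<cdot> d))))"]
    by (simp add: S_mul assoc be cy tsum3_mult)
  also have "\<dots> = tsum3 pi (\<lambda>a b c. eps c * F a b)"
    unfolding ph tsum3_mult ph' ..
  also have "\<dots> = F \<one> \<one>"
    by (rule counit_pi3[OF F])
  finally show ?thesis .
qed

text \<open>
  Universal property of \<open>p\<^sub>R\<close>: it produces morphisms out of a left dual from invariant pairings.
\<close>

lemma invariant_contract:
  assumes K: "form2 K"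
    and inv: "\<And>a b c. tsum2 (cop c) (\<lambda>c\<^sub>1 c\<^sub>2. K (c\<^sub>1 \<cdot> a) (c\<^sub>2 \<cdot> b)) = eps c * K a b"
  shows "tsum3 pi (\<lambda>x y z. K x (y \<cdot> (be \<cdot> (S z \<cdot> al)))) = K \<one> \<one>"
proof -
  note [simp] = form_defs form2D[OF K]
  \<comment> \<open>The arguments 1, 1 are expanded by the second zigzag. Invariance replaces
    \<Delta>(q^1) by \<epsilon>(q^1), and this counit reduces S(q^2) to \<alpha>.\<close>
  have "K \<one> \<one> = tsum3 ph (\<lambda>x y z. tsum3 pi (\<lambda>p q r. eps x * K p (q \<cdot> (be \<cdot> (S (y \<cdot> r) \<cdot> (al \<cdot> z))))))"
    unfolding zigzag2[OF K, symmetric] inv ..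
  also have "\<dots> = tsum3 ph (\<lambda>x y z. eps x * tsum3 pi (\<lambda>p q r. K p (q \<cdot> (be \<cdot> (S (y \<cdot> r) \<cdot> (al \<cdot> z))))))"
    unfolding tsum3_mult ..
  also have "\<dots> = tsum3 pi (\<lambda>p q r. K p (q \<cdot> (be \<cdot> (S r \<cdot> al))))"
    by (subst counit_ph1) simp_all
  finally show ?thesis ..
qed

text \<open>Quasi-coassociativity for the inverse associator: on one side the last two legs of the
  iterated coproduct of a enclose \<beta> and disappear, on the other side its first two legs are
  absorbed by the invariance of K.\<close>

lemma invariant_equivariant:
  assumes K: "form2 K"
    and inv: "\<And>a b c. tsum2 (cop c) (\<lambda>c\<^sub>1 c\<^sub>2. K (c\<^sub>1 \<cdot> a) (c\<^sub>2 \<cdot> b)) = eps c * K a b"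
  shows "tsum3 pi (\<lambda>x y z. K (x \<cdot> a) (y \<cdot> (be \<cdot> (S z \<cdot> b)))) =
    tsum3 pi (\<lambda>x y z. K x (y \<cdot> (be \<cdot> (S z \<cdot> (S a \<cdot> b)))))"
proof -
  note [simp] = form_defs form2D[OF K]
  have be: "tsum2 (cop c) (\<lambda>c\<^sub>1 c\<^sub>2. K m (y \<cdot> (c\<^sub>1 \<cdot> (be \<cdot> (S c\<^sub>2 \<cdot> w))))) = eps c * K m (y \<cdot> (be \<cdot> w))" for c m y w
    using antipode_be[of "\<lambda>h. K m (y \<cdot> (h \<cdot> w))"] by (simp add: assoc)
  have r: "tsum2 (cop a) (\<lambda>a\<^sub>1 a\<^sub>2. eps a\<^sub>2 * K (x \<cdot> a\<^sub>1) w) = K (x \<cdot> a) w" for x w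
    by (subst counit_right) simp_all
  have l: "tsum2 (cop a) (\<lambda>a\<^sub>1 a\<^sub>2. eps a\<^sub>1 * K x (y \<cdot> (be \<cdot> (S z \<cdot> (S a\<^sub>2 \<cdot> b))))) =
     K x (y \<cdot> (be \<cdot> (S z \<cdot> (S a \<cdot> b))))" for x y z
    by (subst counit_left[of "\<lambda>a. K x (y \<cdot> (be \<cdot> (S z \<cdot> (S a \<cdot> b))))"]) simp_all
  show ?thesis
    using coassoc_pi[of "\<lambda>u v w. K u (v \<cdot> (be \<cdot> (S w \<cdot> b)))" a]
    by (simp add: S_mul assoc be inv r l)
qed

subsection \<open>The elements U, f and V\<close>

text \<open>The pairing \<Delta>(S(X a_1) \<alpha>)(Y a_2 \<otimes> Z b), tested by F. At a = b = 1
  it is the element to which U (1 \<otimes> \<alpha>) has to be equal, and the legs of a are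
  inserted where they make it invariant.\<close>

definition U_pairing :: "('h \<Rightarrow> 'h \<Rightarrow> 'k) \<Rightarrow> 'h \<Rightarrow> 'h \<Rightarrow> 'k" where
  "U_pairing F a b = tsum2 (cop a) (\<lambda>a\<^sub>1 a\<^sub>2. tsum3 ph (\<lambda>x y z. tsum2 (cop (S (x \<cdot> a\<^sub>1) \<cdot> al)) (\<lambda>d e.
     F (d \<cdot> (y \<cdot> a\<^sub>2)) (e \<cdot> (z \<cdot> b)))))"

text \<open>U is introduced as the contraction of \<open>U_pairing\<close> with p_R, so that f does
  not occur. The agreement with f^{-1} (S \<otimes> S)(q_R^21) comes from \<open>h_Q\<close>, once
  \<open>hs\<close> is known to be the inverse of f.\<close>

definition us :: "('h \<times> 'h) list" where
  "us = tbind3 pi (\<lambda>p q r. tbind2 (cop p) (\<lambda>p\<^sub>1 p\<^sub>2. tbind3 ph (\<lambda>x y z. tbind2 (cop (S (x \<cdot> p\<^sub>1) \<cdot> al)) (\<lambda>d e.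
     [(d \<cdot> (y \<cdot> p\<^sub>2), e \<cdot> (z \<cdot> (q \<cdot> (be \<cdot> S r))))]))))"

lemma tsum_us: "tsum2 us F = tsum3 pi (\<lambda>p q r. U_pairing F p (q \<cdot> (be \<cdot> S r)))"
  by (simp add: us_def U_pairing_def)

lemma form2_U_pairing:
  assumes F: "form2 F"
  shows "form2 (U_pairing F)"
  using form2D[OF F] by (simp add: U_pairing_def form_defs)

text \<open>Quasi-coassociativity moves the legs of c past the associator, and there they merge into
  S(c_1) \<alpha> c_2 inside the coproduct, which the antipode axiom contracts.\<close>

lemma U_pairing_invariant:
  assumes F: "form2 F"
  shows "tsum2 (cop c) (\<lambda>c\<^sub>1 c\<^sub>2. U_pairing F (c\<^sub>1 \<cdot> a) (c\<^sub>2 \<cdot> b)) = eps c * U_pairing F a b"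
proof -
  note [simp] = form_defs form2D[OF F]
  define F3 where "F3 u v w = tsum2 (cop a) (\<lambda>a\<^sub>1 a\<^sub>2. tsum2 (cop (S (u \<cdot> a\<^sub>1) \<cdot> al)) (\<lambda>d e.
     F (d \<cdot> (v \<cdot> a\<^sub>2)) (e \<cdot> (w \<cdot> b))))" for u v w
  have F3: "form3 F3" by (simp add: F3_def)
  have 1: "U_pairing F (c\<^sub>1 \<cdot> a) (c\<^sub>2 \<cdot> b) = tsum3 ph (\<lambda>x y z. tsum2 (cop c\<^sub>1) (\<lambda>b c. F3 (x \<cdot> b) (y \<cdot> c) (z \<cdot> c\<^sub>2)))" for c\<^sub>1 c\<^sub>2
    unfolding U_pairing_def F3_def
    by (subst cop_mul) (simp_all add: assoc tsum2_tsum3_swap)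
  have 2: "tsum2 (cop c\<^sub>2) (\<lambda>b c. F3 (c\<^sub>1 \<cdot> x) (b \<cdot> y) (c \<cdot> z)) =
     tsum2 (cop a) (\<lambda>a\<^sub>1 a\<^sub>2. tsum2 (cop (S (x \<cdot> a\<^sub>1) \<cdot> (S c\<^sub>1 \<cdot> (al \<cdot> c\<^sub>2)))) (\<lambda>d e. F (d \<cdot> (y \<cdot> a\<^sub>2)) (e \<cdot> (z \<cdot> b))))" for c\<^sub>1 c\<^sub>2 x y z
    by (simp add: F3_def S_mul cop_mul assoc tsum2_tsum2_swap[of "cop c\<^sub>2"])
  have 3: "tsum2 (cop c) (\<lambda>c\<^sub>1 c\<^sub>2. tsum2 (cop (S (x \<cdot> a\<^sub>1) \<cdot> (S c\<^sub>1 \<cdot> (al \<cdot> c\<^sub>2)))) (\<lambda>d e. F (d \<cdot> (y \<cdot> a\<^sub>2)) (e \<cdot> (z \<cdot> b)))) =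
     eps c * tsum2 (cop (S (x \<cdot> a\<^sub>1) \<cdot> al)) (\<lambda>d e. F (d \<cdot> (y \<cdot> a\<^sub>2)) (e \<cdot> (z \<cdot> b)))" for x y z a\<^sub>1 a\<^sub>2
    by (subst antipode_al[of "\<lambda>h. tsum2 (cop (S (x \<cdot> a\<^sub>1) \<cdot> h)) (\<lambda>d e. F (d \<cdot> (y \<cdot> a\<^sub>2)) (e \<cdot> (z \<cdot> b)))"]) simp_all
  have "tsum2 (cop c) (\<lambda>c\<^sub>1 c\<^sub>2. U_pairing F (c\<^sub>1 \<cdot> a) (c\<^sub>2 \<cdot> b)) =
      tsum2 (cop c) (\<lambda>c\<^sub>1 c\<^sub>2. tsum2 (cop c\<^sub>2) (\<lambda>b c. tsum3 ph (\<lambda>x y z. F3 (c\<^sub>1 \<cdot> x) (b \<cdot> y) (c \<cdot> z))))"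
    unfolding 1 tsum2_tsum3_swap coassoc[OF F3, symmetric, unfolded tsum2_tsum3_swap] ..
  also have "\<dots> = tsum3 ph (\<lambda>x y z. tsum2 (cop a) (\<lambda>a\<^sub>1 a\<^sub>2. tsum2 (cop c) (\<lambda>c\<^sub>1 c\<^sub>2.
     tsum2 (cop (S (x \<cdot> a\<^sub>1) \<cdot> (S c\<^sub>1 \<cdot> (al \<cdot> c\<^sub>2)))) (\<lambda>d e. F (d \<cdot> (y \<cdot> a\<^sub>2)) (e \<cdot> (z \<cdot> b))))))"
    unfolding tsum2_tsum3_swap 2 tsum2_tsum2_swap[of "cop a" "cop c"] ..
  also have "\<dots> = eps c * U_pairing F a b"
    unfolding 3 U_pairing_def tsum3_mult tsum2_mult tsum2_tsum3_swap ..
  finally show ?thesis .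
qed

lemma U_contract:
  assumes F: "form2 F"
  shows "tsum2 us (\<lambda>u v. F u (v \<cdot> al)) =
    tsum3 ph (\<lambda>x y z. tsum2 (cop (S x \<cdot> al)) (\<lambda>d e. F (d \<cdot> y) (e \<cdot> z)))"
proof -
  note [simp] = form_defs form2D[OF F]
  have 1: "tsum2 us (\<lambda>u v. F u (v \<cdot> al)) = tsum3 pi (\<lambda>x y z. U_pairing F x (y \<cdot> (be \<cdot> (S z \<cdot> al))))"
    by (simp add: tsum_us U_pairing_def assoc)
  show ?thesis
    unfolding 1 invariant_contract[OF form2_U_pairing[OF F] U_pairing_invariant[OF F]]
    by (simp add: U_pairing_def cop_one)
qed

lemma U_equivariant:
  assumes F: "form2 F"
  shows "tsum2 us (\<lambda>u v. F u (v \<cdot> S a)) =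
    tsum2 (cop a) (\<lambda>a\<^sub>1 a\<^sub>2. tsum2 (cop (S a\<^sub>1)) (\<lambda>d e. tsum2 us (\<lambda>u v. F (d \<cdot> (u \<cdot> a\<^sub>2)) (e \<cdot> v))))"
proof -
  note [simp] = form_defs form2D[OF F]
  have 1: "tsum2 us (\<lambda>u v. F u (v \<cdot> S a)) = tsum3 pi (\<lambda>x y z. U_pairing F x (y \<cdot> (be \<cdot> (S z \<cdot> (S a \<cdot> \<one>)))))"
    by (simp add: tsum_us U_pairing_def assoc)
  have 2: "tsum2 (cop (S a\<^sub>1)) (\<lambda>d e. U_pairing (\<lambda>u v. F (d \<cdot> (u \<cdot> a\<^sub>2)) (e \<cdot> v)) p b) =
     tsum2 (cop p) (\<lambda>p\<^sub>1 p\<^sub>2. tsum3 ph (\<lambda>x y z. tsum2 (cop (S (x \<cdot> (p\<^sub>1 \<cdot> a\<^sub>1)) \<cdot> al)) (\<lambda>d e. F (d \<cdot> (y \<cdot> (p\<^sub>2 \<cdot> a\<^sub>2))) (e \<cdot> (z \<cdot> b)))))" for a\<^sub>1 a\<^sub>2 p b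
    by (simp add: U_pairing_def S_mul cop_mul assoc tsum2_tsum3_swap tsum2_tsum2_swap[of "cop (S a\<^sub>1)" "cop p"])
  have 3: "tsum2 (cop a) (\<lambda>a\<^sub>1 a\<^sub>2. tsum2 (cop p) (\<lambda>p\<^sub>1 p\<^sub>2. tsum3 ph (\<lambda>x y z. tsum2 (cop (S (x \<cdot> (p\<^sub>1 \<cdot> a\<^sub>1)) \<cdot> al)) (\<lambda>d e. F (d \<cdot> (y \<cdot> (p\<^sub>2 \<cdot> a\<^sub>2))) (e \<cdot> (z \<cdot> b)))))) =
     U_pairing F (p \<cdot> a) b" for p b
    unfolding U_pairing_def by (subst tsum2_tsum2_swap, subst cop_mul) (simp_all)
  show ?thesis
    unfolding 1 invariant_equivariant[OF form2_U_pairing[OF F] U_pairing_invariant[OF F], symmetric]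
    by (simp add: tsum_us tsum2_tsum3_swap[of _ pi] 2 3)
qed

section \<open>Drinfeld's element f and the product f U\<close>

definition gam :: "('h \<times> 'h) list" where
  "gam = tbind3 pi (\<lambda>a b c. tbind3 ph (\<lambda>x y z. tbind2 (cop z) (\<lambda>z\<^sub>1 z\<^sub>2.
     [(S (a \<cdot> y) \<cdot> (al \<cdot> (b \<cdot> z\<^sub>1)), S x \<cdot> (al \<cdot> (c \<cdot> z\<^sub>2)))])))"

lemma tsum_gam: "tsum2 gam F = tsum3 pi (\<lambda>a b c. tsum3 ph (\<lambda>x y z. tsum2 (cop z) (\<lambda>z\<^sub>1 z\<^sub>2.
     F (S (a \<cdot> y) \<cdot> (al \<cdot> (b \<cdot> z\<^sub>1))) (S x \<cdot> (al \<cdot> (c \<cdot> z\<^sub>2))))))"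
  by (simp add: gam_def)

text \<open>The identity (S \<otimes> S)(\<Delta>^op(c_1)) \<gamma> \<Delta>(c_2) = \<epsilon>(c)
  \<gamma>. As \<gamma> contains \<phi> and its inverse, quasi-coassociativity is used once for
  each. The legs of c are then nested: one pair encloses the \<alpha> in the first leg of \<gamma>
  and is contracted, and only after this does the outer pair enclose the \<alpha> in the second
  leg.\<close>

lemma gam_invariant:
  assumes F: "form2 F"
  shows "tsum2 (cop c) (\<lambda>c\<^sub>1 c\<^sub>2. tsum2 (cop c\<^sub>1) (\<lambda>k m. tsum2 (cop c\<^sub>2) (\<lambda>s t. tsum2 gam (\<lambda>u v.
    F (S m \<cdot> (u \<cdot> s)) (S k \<cdot> (v \<cdot> t)))))) = eps c * tsum2 gam F"
proof -
  note [simp] = form_defs form2D[OF F]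
  define F3 where "F3 a b c u v w = tsum2 (cop w) (\<lambda>w\<^sub>1 w\<^sub>2. F (S (a \<cdot> v) \<cdot> (al \<cdot> (b \<cdot> w\<^sub>1))) (S u \<cdot> (al \<cdot> (c \<cdot> w\<^sub>2))))" for a b c u v w
  have F3: "form3 (F3 a b c)" for a b c by (simp add: F3_def)
  have 1: "tsum2 (cop c\<^sub>1) (\<lambda>k m. tsum2 (cop c\<^sub>2) (\<lambda>s t. tsum2 gam (\<lambda>u v. F (S m \<cdot> (u \<cdot> s)) (S k \<cdot> (v \<cdot> t))))) =
    tsum3 pi (\<lambda>a b c. tsum3 ph (\<lambda>x y z. tsum2 (cop c\<^sub>1) (\<lambda>k m. F3 a b c (x \<cdot> k) (y \<cdot> m) (z \<cdot> c\<^sub>2))))" for c\<^sub>1 c\<^sub>2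
    by (simp add: tsum_gam F3_def S_mul cop_mul assoc tsum2_tsum3_swap tsum2_tsum2_swap[of "cop c\<^sub>2"])
  have al: "tsum2 (cop k) (\<lambda>k\<^sub>1 k\<^sub>2. F (S y \<cdot> (S a \<cdot> (S k\<^sub>1 \<cdot> (al \<cdot> (k\<^sub>2 \<cdot> w))))) n) = eps k * F (S y \<cdot> (S a \<cdot> (al \<cdot> w))) n" for k y a w n
    using antipode_al[of "\<lambda>h. F (S y \<cdot> (S a \<cdot> (h \<cdot> w))) n"] by (simp add: assoc)
  have al': "tsum2 (cop k) (\<lambda>k\<^sub>1 k\<^sub>2. F n (S x \<cdot> (S k\<^sub>1 \<cdot> (al \<cdot> (k\<^sub>2 \<cdot> w))))) = eps k * F n (S x \<cdot> (al \<cdot> w))" for k x w n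
    using antipode_al[of "\<lambda>h. F n (S x \<cdot> (h \<cdot> w))"] by (simp add: assoc)
  have eps: "tsum2 (cop k) (\<lambda>k\<^sub>1 k\<^sub>2. eps k\<^sub>1 * F n (u \<cdot> (al \<cdot> (k\<^sub>2 \<cdot> w)))) = F n (u \<cdot> (al \<cdot> (k \<cdot> w)))" for k n u w
    by (subst counit_left[of "\<lambda>k. F n (u \<cdot> (al \<cdot> (k \<cdot> w)))"]) simp_all
  have 2: "tsum3 pi (\<lambda>a b c. tsum2 (cop c\<^sub>2) (\<lambda>k m. F3 a b c (c\<^sub>1 \<cdot> x) (k \<cdot> y) (m \<cdot> z))) =
     tsum3 pi (\<lambda>a b c. tsum2 (cop z) (\<lambda>z\<^sub>1 z\<^sub>2. F (S (a \<cdot> y) \<cdot> (al \<cdot> (b \<cdot> z\<^sub>1))) (S x \<cdot> (S c\<^sub>1 \<cdot> (al \<cdot> (c\<^sub>2 \<cdot> (c \<cdot> z\<^sub>2)))))))" for c\<^sub>1 c\<^sub>2 x y z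
  proof -
    define G where "G u v w = tsum2 (cop z) (\<lambda>z\<^sub>1 z\<^sub>2. F (S (u \<cdot> y) \<cdot> (al \<cdot> (v \<cdot> z\<^sub>1))) (S x \<cdot> (S c\<^sub>1 \<cdot> (al \<cdot> (w \<cdot> z\<^sub>2)))))" for u v w
    have G: "form3 G" by (simp add: G_def)
    have "tsum3 pi (\<lambda>a b c. tsum2 (cop c\<^sub>2) (\<lambda>k m. F3 a b c (c\<^sub>1 \<cdot> x) (k \<cdot> y) (m \<cdot> z))) =
       tsum3 pi (\<lambda>a b c. tsum2 (cop c\<^sub>2) (\<lambda>k m. tsum2 (cop m) (\<lambda>m\<^sub>1 m\<^sub>2. G (a \<cdot> k) (b \<cdot> m\<^sub>1) (c \<cdot> m\<^sub>2))))"
      by (simp add: F3_def G_def S_mul cop_mul assoc)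
    also have "\<dots> = tsum3 pi (\<lambda>a b c. tsum2 (cop c\<^sub>2) (\<lambda>k m. tsum2 (cop k) (\<lambda>k\<^sub>1 k\<^sub>2. G (k\<^sub>1 \<cdot> a) (k\<^sub>2 \<cdot> b) (m \<cdot> c))))"
      by (rule coassoc_pi[OF G])
    also have "\<dots> = tsum3 pi (\<lambda>a b c. tsum2 (cop z) (\<lambda>z\<^sub>1 z\<^sub>2. F (S (a \<cdot> y) \<cdot> (al \<cdot> (b \<cdot> z\<^sub>1))) (S x \<cdot> (S c\<^sub>1 \<cdot> (al \<cdot> (c\<^sub>2 \<cdot> (c \<cdot> z\<^sub>2)))))))"
      by (intro tsum3_cong)
        (simp add: G_def S_mul assoc tsum2_tsum2_swap[of "cop k" "cop z" for k] al tsum2_tsum2_swap[of "cop c\<^sub>2" "cop z"]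
          eps[of c\<^sub>2 _ "S x \<cdot> S c\<^sub>1", unfolded assoc])
    finally show ?thesis .
  qed
  have "tsum2 (cop c) (\<lambda>c\<^sub>1 c\<^sub>2. tsum2 (cop c\<^sub>1) (\<lambda>k m. tsum2 (cop c\<^sub>2) (\<lambda>s t. tsum2 gam (\<lambda>u v.
    F (S m \<cdot> (u \<cdot> s)) (S k \<cdot> (v \<cdot> t)))))) =
    tsum3 pi (\<lambda>a b d. tsum2 (cop c) (\<lambda>c\<^sub>1 c\<^sub>2. tsum2 (cop c\<^sub>2) (\<lambda>k m. tsum3 ph (\<lambda>x y z. F3 a b d (c\<^sub>1 \<cdot> x) (k \<cdot> y) (m \<cdot> z)))))"
    unfolding 1 tsum2_tsum3_swap coassoc[OF F3, symmetric, unfolded tsum2_tsum3_swap] ..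
  also have "\<dots> = tsum3 ph (\<lambda>x y z. tsum2 (cop c) (\<lambda>c\<^sub>1 c\<^sub>2. tsum3 pi (\<lambda>a b d. tsum2 (cop c\<^sub>2) (\<lambda>k m. F3 a b d (c\<^sub>1 \<cdot> x) (k \<cdot> y) (m \<cdot> z)))))"
    unfolding tsum2_tsum3_swap by (rule tsum3_tsum3_swap)
  also have "\<dots> = tsum3 ph (\<lambda>x y z. tsum2 (cop c) (\<lambda>c\<^sub>1 c\<^sub>2. tsum3 pi (\<lambda>a b d. tsum2 (cop z) (\<lambda>z\<^sub>1 z\<^sub>2.
     F (S (a \<cdot> y) \<cdot> (al \<cdot> (b \<cdot> z\<^sub>1))) (S x \<cdot> (S c\<^sub>1 \<cdot> (al \<cdot> (c\<^sub>2 \<cdot> (d \<cdot> z\<^sub>2)))))))))"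
    unfolding 2 ..
  also have "\<dots> = tsum3 ph (\<lambda>x y z. tsum3 pi (\<lambda>a b d. tsum2 (cop z) (\<lambda>z\<^sub>1 z\<^sub>2.
     eps c * F (S (a \<cdot> y) \<cdot> (al \<cdot> (b \<cdot> z\<^sub>1))) (S x \<cdot> (al \<cdot> (d \<cdot> z\<^sub>2))))))"
    unfolding tsum2_tsum3_swap tsum2_tsum2_swap[of "cop c"] al' ..
  also have "\<dots> = eps c * tsum2 gam F"
    unfolding tsum_gam tsum3_mult tsum2_mult by (subst tsum3_tsum3_swap) (rule refl)
  finally show ?thesis .
qed

text \<open>Drinfeld's formula is literally this pairing contracted with p_R. Its invariance
  therefore gives f \<Delta>(\<alpha>) = \<gamma> and f \<Delta>(S(a)) = (S \<otimes>
  S)(\<Delta>^op(a)) f by the two lemmas already used for U.\<close>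

definition f_pairing :: "('h \<Rightarrow> 'h \<Rightarrow> 'k) \<Rightarrow> 'h \<Rightarrow> 'h \<Rightarrow> 'k" where
  "f_pairing F a b = tsum2 (cop a) (\<lambda>a\<^sub>1 a\<^sub>2. tsum2 gam (\<lambda>u v. tsum2 (cop b) (\<lambda>d e.
     F (S a\<^sub>2 \<cdot> (u \<cdot> d)) (S a\<^sub>1 \<cdot> (v \<cdot> e)))))"

definition fs :: "('h \<times> 'h) list" where
  "fs = tbind3 pi (\<lambda>x y z. tbind2 (cop x) (\<lambda>x\<^sub>1 x\<^sub>2. tbind2 gam (\<lambda>u v. tbind2 (cop (y \<cdot> (be \<cdot> S z))) (\<lambda>d e.
     [(S x\<^sub>2 \<cdot> (u \<cdot> d), S x\<^sub>1 \<cdot> (v \<cdot> e))]))))"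

lemma tsum_fs: "tsum2 fs F = tsum3 pi (\<lambda>p q r. f_pairing F p (q \<cdot> (be \<cdot> S r)))"
  by (simp add: fs_def f_pairing_def)

lemma form2_f_pairing:
  assumes F: "form2 F"
  shows "form2 (f_pairing F)"
  using form2D[OF F] by (simp add: f_pairing_def form_defs)

lemma f_pairing_invariant:
  assumes F: "form2 F"
  shows "tsum2 (cop c) (\<lambda>c\<^sub>1 c\<^sub>2. f_pairing F (c\<^sub>1 \<cdot> a) (c\<^sub>2 \<cdot> b)) = eps c * f_pairing F a b"
proof -
  note [simp] = form_defs form2D[OF F]
  have 1: "f_pairing F (c\<^sub>1 \<cdot> a) (c\<^sub>2 \<cdot> b) = tsum2 (cop a) (\<lambda>a\<^sub>1 a\<^sub>2. tsum2 (cop c\<^sub>1) (\<lambda>k m. tsum2 (cop c\<^sub>2) (\<lambda>s t. tsum2 gam (\<lambda>u v.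
     tsum2 (cop b) (\<lambda>d e. F (S a\<^sub>2 \<cdot> ((S m \<cdot> (u \<cdot> s)) \<cdot> d)) (S a\<^sub>1 \<cdot> ((S k \<cdot> (v \<cdot> t)) \<cdot> e)))))))" for c\<^sub>1 c\<^sub>2
    by (simp add: f_pairing_def S_mul cop_mul assoc tsum2_tsum2_swap[of "cop c\<^sub>1" "cop a"] tsum2_tsum2_swap[of "cop c\<^sub>2" gam])
  have 2: "tsum2 (cop c) (\<lambda>c\<^sub>1 c\<^sub>2. tsum2 (cop c\<^sub>1) (\<lambda>k m. tsum2 (cop c\<^sub>2) (\<lambda>s t. tsum2 gam (\<lambda>u v.
     tsum2 (cop b) (\<lambda>d e. F (S a\<^sub>2 \<cdot> ((S m \<cdot> (u \<cdot> s)) \<cdot> d)) (S a\<^sub>1 \<cdot> ((S k \<cdot> (v \<cdot> t)) \<cdot> e))))))) =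
     eps c * tsum2 gam (\<lambda>u v. tsum2 (cop b) (\<lambda>d e. F (S a\<^sub>2 \<cdot> (u \<cdot> d)) (S a\<^sub>1 \<cdot> (v \<cdot> e))))" for a\<^sub>1 a\<^sub>2
    by (rule gam_invariant[of "\<lambda>u v. tsum2 (cop b) (\<lambda>d e. F (S a\<^sub>2 \<cdot> (u \<cdot> d)) (S a\<^sub>1 \<cdot> (v \<cdot> e)))"]) simp
  show ?thesis
    unfolding 1 by (simp only: tsum2_tsum2_swap[of "cop c" "cop a"] 2) (simp add: f_pairing_def tsum2_mult)
qed

lemma f_contract:
  assumes F: "form2 F"
  shows "tsum2 fs (\<lambda>u v. tsum2 (cop al) (\<lambda>d e. F (u \<cdot> d) (v \<cdot> e))) = tsum2 gam F"
proof -
  note [simp] = form_defs form2D[OF F]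
  have 1: "tsum2 fs (\<lambda>u v. tsum2 (cop al) (\<lambda>d e. F (u \<cdot> d) (v \<cdot> e))) = tsum3 pi (\<lambda>x y z. f_pairing F x (y \<cdot> (be \<cdot> (S z \<cdot> al))))"
    by (simp add: tsum_fs f_pairing_def cop_mul assoc)
  show ?thesis
    unfolding 1 invariant_contract[OF form2_f_pairing[OF F] f_pairing_invariant[OF F]]
    by (simp add: f_pairing_def cop_one)
qed

lemma f_intertwines:
  assumes F: "form2 F"
  shows "tsum2 (cop (S a)) (\<lambda>d e. tsum2 fs (\<lambda>u v. F (u \<cdot> d) (v \<cdot> e))) =
    tsum2 (cop a) (\<lambda>a\<^sub>1 a\<^sub>2. tsum2 fs (\<lambda>u v. F (S a\<^sub>2 \<cdot> u) (S a\<^sub>1 \<cdot> v)))"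
proof -
  note [simp] = form_defs form2D[OF F]
  have 1: "tsum2 (cop (S a)) (\<lambda>d e. tsum2 fs (\<lambda>u v. F (u \<cdot> d) (v \<cdot> e))) =
     tsum3 pi (\<lambda>x y z. f_pairing F x (y \<cdot> (be \<cdot> (S z \<cdot> (S a \<cdot> \<one>)))))"
    by (subst tsum2_tsum2_swap) (simp add: tsum_fs f_pairing_def cop_mul assoc)
  have 2: "tsum2 (cop a) (\<lambda>a\<^sub>1 a\<^sub>2. f_pairing (\<lambda>u v. F (S a\<^sub>2 \<cdot> u) (S a\<^sub>1 \<cdot> v)) x w) = f_pairing F (x \<cdot> a) w" for x w
    by (simp add: f_pairing_def cop_mul S_mul assoc tsum2_tsum2_swap[of "cop a" "cop x"])
  show ?thesis
    unfolding 1 invariant_equivariant[OF form2_f_pairing[OF F] f_pairing_invariant[OF F], symmetric]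
    by (simp add: tsum_fs tsum2_tsum3_swap 2)
qed

text \<open>Evaluation at (S \<otimes> S)(q_R^21); S has cancelled the inverse antipode in the
  second leg of q_R.\<close>

definition Q_sum :: "('h \<Rightarrow> 'h \<Rightarrow> 'k) \<Rightarrow> 'k" where
  "Q_sum F = tsum3 ph (\<lambda>x y z. F (S y \<cdot> (al \<cdot> z)) (S x))"

text \<open>The left side is f times the element \<Delta>(S(x) \<alpha>)(y \<otimes> z) from the
  contraction rule of U, after f has been moved through \<Delta>(S(x)) and has turned
  \<Delta>(\<alpha>) into \<gamma>. Thus f U and (S \<otimes> S)(q_R^21) agree when followed by 1
  \<otimes> \<alpha>. In \<open>pentagon3\<close> the factors 1 \<otimes> \<phi>^{-1} and (id
  \<otimes> id \<otimes> \<Delta>)(\<phi>) come from \<gamma>.\<close>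

lemma gam_Q:
  assumes F: "form2 F"
  shows "tsum3 ph (\<lambda>x y z. tsum2 (cop x) (\<lambda>x\<^sub>1 x\<^sub>2. tsum2 gam (\<lambda>u v. F (S x\<^sub>2 \<cdot> (u \<cdot> y)) (S x\<^sub>1 \<cdot> (v \<cdot> z))))) =
    Q_sum (\<lambda>u v. F u (v \<cdot> al))"
proof -
  note [simp] = form_defs form2D[OF F]
  have 1: "tsum2 (cop x) (\<lambda>x\<^sub>1 x\<^sub>2. tsum2 gam (\<lambda>u v. F (S x\<^sub>2 \<cdot> (u \<cdot> y)) (S x\<^sub>1 \<cdot> (v \<cdot> z)))) =
    tsum3 pi (\<lambda>a b c. tsum3 ph (\<lambda>d e f. tsum2 (cop f) (\<lambda>f\<^sub>1 f\<^sub>2. tsum2 (cop x) (\<lambda>x\<^sub>1 x\<^sub>2.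
      F (S (a \<cdot> (e \<cdot> x\<^sub>2)) \<cdot> (al \<cdot> (b \<cdot> (f\<^sub>1 \<cdot> y)))) (S (d \<cdot> x\<^sub>1) \<cdot> (al \<cdot> (c \<cdot> (f\<^sub>2 \<cdot> z))))))))" for x y z
    by (simp add: tsum_gam S_mul assoc tsum2_tsum3_swap tsum2_tsum2_swap[of "cop x"])
  have al: "tsum2 (cop q) (\<lambda>q\<^sub>1 q\<^sub>2. F (S t \<cdot> (S q\<^sub>1 \<cdot> (al \<cdot> (q\<^sub>2 \<cdot> u)))) m) = eps q * F (S t \<cdot> (al \<cdot> u)) m" for q t u m
    using antipode_al[of "\<lambda>h. F (S t \<cdot> (h \<cdot> u)) m"] by (simp add: assoc)
  have ph: "tsum3 ph (\<lambda>p q r. eps q * F m (S s \<cdot> (S p \<cdot> (al \<cdot> r)))) = F m (S s \<cdot> al)" for m s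
    using counit_ph2[of "\<lambda>p r. F m (S s \<cdot> (S p \<cdot> (al \<cdot> r)))"] by simp
  have "tsum3 ph (\<lambda>x y z. tsum2 (cop x) (\<lambda>x\<^sub>1 x\<^sub>2. tsum2 gam (\<lambda>u v. F (S x\<^sub>2 \<cdot> (u \<cdot> y)) (S x\<^sub>1 \<cdot> (v \<cdot> z))))) =
    tsum3 pi (\<lambda>a b c. tsum3 ph (\<lambda>d e f. tsum3 ph (\<lambda>x y z. tsum2 (cop f) (\<lambda>f\<^sub>1 f\<^sub>2. tsum2 (cop x) (\<lambda>x\<^sub>1 x\<^sub>2.
      F (S (a \<cdot> (e \<cdot> x\<^sub>2)) \<cdot> (al \<cdot> (b \<cdot> (f\<^sub>1 \<cdot> y)))) (S (d \<cdot> x\<^sub>1) \<cdot> (al \<cdot> (c \<cdot> (f\<^sub>2 \<cdot> z)))))))))"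
    unfolding 1 by (rule tsum3_rotate)
  also have "\<dots> = tsum3 ph (\<lambda>p q r. tsum3 ph (\<lambda>s t u. eps q * F (S t \<cdot> (al \<cdot> u)) (S s \<cdot> (S p \<cdot> (al \<cdot> r)))))"
    using pentagon3[of "\<lambda>a b c d. F (S b \<cdot> (al \<cdot> c)) (S a \<cdot> (al \<cdot> d))"] by (simp add: S_mul assoc al)
  also have "\<dots> = Q_sum (\<lambda>u v. F u (v \<cdot> al))"
    by (subst tsum3_tsum3_swap) (simp add: ph Q_sum_def)
  finally show ?thesis .
qed

lemma Q_equivariant:
  assumes F: "form2 F"
  shows "Q_sum (\<lambda>u v. F u (v \<cdot> S a)) =
    tsum2 (cop a) (\<lambda>a\<^sub>1 a\<^sub>2. tsum2 (cop a\<^sub>1) (\<lambda>k m. Q_sum (\<lambda>u v. F (S m \<cdot> (u \<cdot> a\<^sub>2)) (S k \<cdot> v))))"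
proof -
  note [simp] = form_defs form2D[OF F]
  have al: "tsum2 (cop a) (\<lambda>k m. F (S y \<cdot> (S k \<cdot> (al \<cdot> (m \<cdot> z)))) n) = eps a * F (S y \<cdot> (al \<cdot> z)) n" for a y z n
    using antipode_al[of "\<lambda>h. F (S y \<cdot> (h \<cdot> z)) n"] by (simp add: assoc)
  have eps: "tsum2 (cop a) (\<lambda>k m. eps m * F u (v \<cdot> S k)) = F u (v \<cdot> S a)" for u v
    by (subst counit_right[of "\<lambda>k. F u (v \<cdot> S k)"]) simp_all
  show ?thesis
    using coassoc[of "\<lambda>u v w. F (S v \<cdot> (al \<cdot> w)) (S u)" a]
    by (simp add: Q_sum_def S_mul assoc tsum2_tsum3_swap al eps)
qed

text \<open>A uniqueness argument: both sides obey the same contraction rule, by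
  \<open>gam_Q\<close>, and the same equivariance, in which (S \<otimes> S)(\<Delta>^op) now acts
  from the left. Inserting 1 = S(x) \<alpha> y \<beta> S(z) behind the second leg, equivariance
  deals with S(x) and contraction with \<alpha>.\<close>

lemma f_U:
  assumes F: "form2 F"
  shows "tsum2 fs (\<lambda>f g. tsum2 us (\<lambda>u v. F (f \<cdot> u) (g \<cdot> v))) = Q_sum F"
proof -
  note [simp] = form_defs form2D[OF F]
  have one: "tsum3 pi (\<lambda>x y z. F m (u \<cdot> (S x \<cdot> (al \<cdot> (y \<cdot> (be \<cdot> S z)))))) = F m u" for m u
    using antipode_pi[of "\<lambda>h. F m (u \<cdot> h)"] by simp
  define W where "W F = tsum2 fs (\<lambda>f g. tsum2 us (\<lambda>u v. F (f \<cdot> u) (g \<cdot> v)))" for F :: "'h \<Rightarrow> 'h \<Rightarrow> 'k"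
  have contract: "W (\<lambda>u v. G u (v \<cdot> al)) = Q_sum (\<lambda>u v. G u (v \<cdot> al))" if G: "form2 G" for G
  proof -
    note [simp] = form2D[OF G]
    have 1: "tsum2 us (\<lambda>u v. G (f \<cdot> u) (g \<cdot> (v \<cdot> al))) = tsum3 ph (\<lambda>x y z. tsum2 (cop (S x)) (\<lambda>d e. tsum2 (cop al) (\<lambda>d' e'.
       G (f \<cdot> d \<cdot> (d' \<cdot> y)) (g \<cdot> e \<cdot> (e' \<cdot> z)))))" for f g
      by (subst U_contract[of "\<lambda>u v. G (f \<cdot> u) (g \<cdot> v)"]) (simp_all add: cop_mul assoc)
    have 2: "tsum2 (cop (S x)) (\<lambda>d e. tsum2 fs (\<lambda>f g. tsum2 (cop al) (\<lambda>d' e'. G (f \<cdot> d \<cdot> (d' \<cdot> y)) (g \<cdot> e \<cdot> (e' \<cdot> z))))) =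
       tsum2 (cop x) (\<lambda>x\<^sub>1 x\<^sub>2. tsum2 fs (\<lambda>f g. tsum2 (cop al) (\<lambda>d' e'. G (S x\<^sub>2 \<cdot> f \<cdot> (d' \<cdot> y)) (S x\<^sub>1 \<cdot> g \<cdot> (e' \<cdot> z)))))" for x y z
      by (rule f_intertwines[of "\<lambda>u v. tsum2 (cop al) (\<lambda>d' e'. G (u \<cdot> (d' \<cdot> y)) (v \<cdot> (e' \<cdot> z)))"]) simp
    have 3: "tsum2 fs (\<lambda>f g. tsum2 (cop al) (\<lambda>d' e'. G (s \<cdot> f \<cdot> (d' \<cdot> y)) (t \<cdot> g \<cdot> (e' \<cdot> z)))) = tsum2 gam (\<lambda>u v. G (s \<cdot> (u \<cdot> y)) (t \<cdot> (v \<cdot> z)))" for s t y z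
      using f_contract[of "\<lambda>u v. G (s \<cdot> (u \<cdot> y)) (t \<cdot> (v \<cdot> z))"] by (simp add: assoc)
    show ?thesis
      unfolding gam_Q[OF G, symmetric] W_def assoc[of _ _ al] 1
      unfolding tsum2_tsum3_swap tsum2_tsum2_swap[of fs "cop (S a)" for a] 2 3 ..
  qed
  have equiv: "W (\<lambda>u v. G u (v \<cdot> S a)) = tsum2 (cop a) (\<lambda>a\<^sub>1 a\<^sub>2. tsum2 (cop a\<^sub>1) (\<lambda>k m. W (\<lambda>u v. G (S m \<cdot> (u \<cdot> a\<^sub>2)) (S k \<cdot> v))))"
    if G: "form2 G" for G a
  proof -
    note [simp] = form2D[OF G]
    have 1: "tsum2 us (\<lambda>u v. G (f \<cdot> u) (g \<cdot> (v \<cdot> S a))) = tsum2 (cop a) (\<lambda>a\<^sub>1 a\<^sub>2. tsum2 (cop (S a\<^sub>1)) (\<lambda>d e. tsum2 us (\<lambda>u v.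
       G (f \<cdot> d \<cdot> (u \<cdot> a\<^sub>2)) (g \<cdot> e \<cdot> v))))" for f g
      by (subst U_equivariant[of "\<lambda>u v. G (f \<cdot> u) (g \<cdot> v)"]) (simp_all add: assoc)
    have 2: "tsum2 (cop (S x)) (\<lambda>d e. tsum2 fs (\<lambda>f g. tsum2 us (\<lambda>u v. G (f \<cdot> d \<cdot> (u \<cdot> y)) (g \<cdot> e \<cdot> v)))) =
       tsum2 (cop x) (\<lambda>x\<^sub>1 x\<^sub>2. tsum2 fs (\<lambda>f g. tsum2 us (\<lambda>u v. G (S x\<^sub>2 \<cdot> f \<cdot> (u \<cdot> y)) (S x\<^sub>1 \<cdot> g \<cdot> v))))" for x y
      by (rule f_intertwines[of "\<lambda>f g. tsum2 us (\<lambda>u v. G (f \<cdot> (u \<cdot> y)) (g \<cdot> v))"]) simp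
    show ?thesis
      unfolding W_def assoc[of _ _ "S a"] 1
      unfolding tsum2_tsum2_swap[of fs "cop a" for a] 2 unfolding assoc ..
  qed
  have eq: "W (\<lambda>u v. F u (v \<cdot> (S x \<cdot> (al \<cdot> c)))) = Q_sum (\<lambda>u v. F u (v \<cdot> (S x \<cdot> (al \<cdot> c))))" for x c
  proof -
    have C: "form2 (\<lambda>u v. F u (v \<cdot> (al \<cdot> c)))" by simp
    have C': "form2 (\<lambda>u v. F (d \<cdot> (u \<cdot> b)) (e \<cdot> (v \<cdot> c)))" for b d e by simp
    show ?thesis
      using equiv[OF C, of x] Q_equivariant[OF C, of x] contract[OF C']
      by (simp add: assoc)
  qed
  have "W F = tsum3 pi (\<lambda>x y z. W (\<lambda>u v. F u (v \<cdot> (S x \<cdot> (al \<cdot> (y \<cdot> (be \<cdot> S z)))))))"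
    unfolding W_def tsum2_tsum3_swap[symmetric] assoc[symmetric, of _ _ "S x \<cdot> y" for x y] one ..
  also have "\<dots> = Q_sum F"
    unfolding eq Q_sum_def tsum3_tsum3_swap[of pi ph] one ..
  finally show ?thesis unfolding W_def .
qed

section \<open>The inverse of f\<close>

definition hs :: "('h \<times> 'h) list" where
  "hs = tbind3 pi (\<lambda>x y z. tbind2 (cop (S x)) (\<lambda>d e. tbind2 us (\<lambda>u v.
     [(d \<cdot> (u \<cdot> (y \<cdot> (be \<cdot> S z))), e \<cdot> v)])))"

lemma tsum_hs: "tsum2 hs F = tsum3 pi (\<lambda>x y z. tsum2 (cop (S x)) (\<lambda>d e. tsum2 us (\<lambda>u v.
     F (d \<cdot> (u \<cdot> (y \<cdot> (be \<cdot> S z)))) (e \<cdot> v))))"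
  by (simp add: hs_def)

text \<open>\<open>hs\<close> stands for the inverse of f; it is not Drinfeld's h, which is built
  from f itself. Moving f through \<Delta>(S(x)) and using f U = (S \<otimes> S)(q_R^21) leaves q_R
  and p_R in the position of the first zigzag, with the two legs exchanged and S applied to one of
  them.\<close>

lemma f_h:
  assumes F: "form2 F"
  shows "tsum2 fs (\<lambda>f g. tsum2 hs (\<lambda>u v. F (f \<cdot> u) (g \<cdot> v))) = F \<one> \<one>"
proof -
  note [simp] = form_defs form2D[OF F]
  have 1: "tsum2 fs (\<lambda>f g. tsum2 (cop (S x)) (\<lambda>d e. tsum2 us (\<lambda>u v. F (f \<cdot> (d \<cdot> (u \<cdot> w))) (g \<cdot> (e \<cdot> v))))) =
    tsum2 (cop x) (\<lambda>x\<^sub>1 x\<^sub>2. Q_sum (\<lambda>u v. F (S x\<^sub>2 \<cdot> (u \<cdot> w)) (S x\<^sub>1 \<cdot> v)))" for x w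
  proof -
    have "tsum2 fs (\<lambda>f g. tsum2 (cop (S x)) (\<lambda>d e. tsum2 us (\<lambda>u v. F (f \<cdot> (d \<cdot> (u \<cdot> w))) (g \<cdot> (e \<cdot> v))))) =
      tsum2 (cop x) (\<lambda>x\<^sub>1 x\<^sub>2. tsum2 fs (\<lambda>f g. tsum2 us (\<lambda>u v. F (S x\<^sub>2 \<cdot> (f \<cdot> (u \<cdot> w))) (S x\<^sub>1 \<cdot> (g \<cdot> v)))))"
      using f_intertwines[of "\<lambda>f g. tsum2 us (\<lambda>u v. F (f \<cdot> (u \<cdot> w)) (g \<cdot> v))" x]
      by (subst tsum2_tsum2_swap) (simp add: assoc)
    also have "\<dots> = tsum2 (cop x) (\<lambda>x\<^sub>1 x\<^sub>2. Q_sum (\<lambda>u v. F (S x\<^sub>2 \<cdot> (u \<cdot> w)) (S x\<^sub>1 \<cdot> v)))"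
      by (subst f_U[symmetric]) (simp_all add: assoc)
    finally show ?thesis .
  qed
  show ?thesis
    using zigzag1[of "\<lambda>s t. F t (S s)"]
    by (simp add: tsum_hs tsum2_tsum3_swap 1 Q_sum_def S_mul assoc tsum3_tsum3_swap[of ph pi])
qed

text \<open>This cannot yet be read off from \<open>f_intertwines\<close>, because \<open>hs\<close>
  is so far only a right inverse of f. It is derived from the formula for \<open>hs\<close>:
  equivariance of U and quasi-coassociativity for the inverse associator regroup the legs of a, and
  \<beta> contracts two of them.\<close>

lemma h_intertwines:
  assumes F: "form2 F"
  shows "tsum2 (cop a) (\<lambda>a\<^sub>1 a\<^sub>2. tsum2 hs (\<lambda>u v. F (u \<cdot> S a\<^sub>2) (v \<cdot> S a\<^sub>1))) =
    tsum2 (cop (S a)) (\<lambda>d e. tsum2 hs (\<lambda>u v. F (d \<cdot> u) (e \<cdot> v)))"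
proof -
  note [simp] = form_defs form2D[OF F]
  define F3 where "F3 u' v' w' = tsum2 (cop (S u')) (\<lambda>d e. tsum2 us (\<lambda>u v. F (d \<cdot> (u \<cdot> (v' \<cdot> (be \<cdot> S w')))) (e \<cdot> v)))" for u' v' w'
  have F3: "form3 F3" by (simp add: F3_def)
  have 1: "tsum2 us (\<lambda>u v. F (d \<cdot> (u \<cdot> w)) (e \<cdot> (v \<cdot> S a))) = tsum2 (cop a) (\<lambda>a\<^sub>1 a\<^sub>2. tsum2 (cop (S a\<^sub>1)) (\<lambda>d' e'. tsum2 us (\<lambda>u v.
       F (d \<cdot> (d' \<cdot> (u \<cdot> (a\<^sub>2 \<cdot> w)))) (e \<cdot> (e' \<cdot> v)))))" for d e w a
    by (subst U_equivariant[of "\<lambda>u v. F (d \<cdot> (u \<cdot> w)) (e \<cdot> v)"]) (simp_all add: assoc)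
  have 2: "tsum2 hs (\<lambda>u v. F (u \<cdot> S a\<^sub>2) (v \<cdot> S a\<^sub>1)) = tsum3 pi (\<lambda>x y z. tsum2 (cop a\<^sub>1) (\<lambda>k m. F3 (k \<cdot> x) (m \<cdot> y) (a\<^sub>2 \<cdot> z)))" for a\<^sub>1 a\<^sub>2
    by (simp add: tsum_hs F3_def S_mul cop_mul assoc 1 tsum2_tsum2_swap[of "cop (S x)" "cop a\<^sub>1" for x])
  have be: "tsum2 (cop a) (\<lambda>k m. F (d \<cdot> (u \<cdot> (y \<cdot> (k \<cdot> (be \<cdot> (S m \<cdot> w)))))) n) = eps a * F (d \<cdot> (u \<cdot> (y \<cdot> (be \<cdot> w)))) n" for a d u y w n
    using antipode_be[of "\<lambda>h. F (d \<cdot> (u \<cdot> (y \<cdot> (h \<cdot> w)))) n"] by (simp add: assoc)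
  have 3: "tsum2 (cop a) (\<lambda>b c. F3 x (y \<cdot> b) (z \<cdot> c)) = eps a * F3 x y z" for a x y z
    by (simp add: F3_def S_mul assoc tsum2_tsum2_swap[of "cop a"] be tsum2_mult)
  have 4: "tsum2 (cop a) (\<lambda>b c. eps c * F3 (x \<cdot> b) y z) = F3 (x \<cdot> a) y z" for x y z
    using form3D[OF F3] by (subst counit_right) simp_all
  have "tsum2 (cop a) (\<lambda>a\<^sub>1 a\<^sub>2. tsum2 hs (\<lambda>u v. F (u \<cdot> S a\<^sub>2) (v \<cdot> S a\<^sub>1))) = tsum3 pi (\<lambda>x y z. F3 (x \<cdot> a) y z)"
    unfolding 2 tsum2_tsum3_swap coassoc_pi[OF F3, symmetric] 3 4 ..
  also have "\<dots> = tsum2 (cop (S a)) (\<lambda>d e. tsum2 hs (\<lambda>u v. F (d \<cdot> u) (e \<cdot> v)))"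
    by (simp add: F3_def tsum_hs S_mul cop_mul assoc tsum2_tsum3_swap)
  finally show ?thesis .
qed

text \<open>The factor S(x) in the second leg of (S \<otimes> S)(q_R^21) passes through U by
  equivariance. The factors then surrounding U form the second zigzag, with \<Delta> after S applied
  to its first leg, so only U is left.\<close>

lemma h_Q:
  assumes F: "form2 F"
  shows "tsum2 hs (\<lambda>f g. Q_sum (\<lambda>u v. F (f \<cdot> u) (g \<cdot> v))) = tsum2 us F"
proof -
  note [simp] = form_defs form2D[OF F]
  have 1: "tsum2 us (\<lambda>u v. F (d \<cdot> (u \<cdot> w)) (e \<cdot> (v \<cdot> S a))) = tsum2 (cop a) (\<lambda>a\<^sub>1 a\<^sub>2. tsum2 (cop (S a\<^sub>1)) (\<lambda>d' e'. tsum2 us (\<lambda>u v.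
       F (d \<cdot> (d' \<cdot> (u \<cdot> (a\<^sub>2 \<cdot> w)))) (e \<cdot> (e' \<cdot> v)))))" for d e w a
    by (subst U_equivariant[of "\<lambda>u v. F (d \<cdot> (u \<cdot> w)) (e \<cdot> v)"]) (simp_all add: assoc)
  have 2: "tsum2 (cop (S p)) (\<lambda>d e. tsum2 us (\<lambda>u v. F (d \<cdot> (u \<cdot> w)) (e \<cdot> (v \<cdot> S x)))) =
    tsum2 (cop x) (\<lambda>x\<^sub>1 x\<^sub>2. tsum2 (cop (S (x\<^sub>1 \<cdot> p))) (\<lambda>d e. tsum2 us (\<lambda>u v. F (d \<cdot> (u \<cdot> (x\<^sub>2 \<cdot> w))) (e \<cdot> v))))" for p w x
    by (simp add: 1 S_mul cop_mul assoc tsum2_tsum2_swap[of "cop (S p)" "cop x"])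
  have "tsum2 hs (\<lambda>f g. Q_sum (\<lambda>u v. F (f \<cdot> u) (g \<cdot> v))) =
    tsum3 ph (\<lambda>x y z. tsum3 pi (\<lambda>p q r. tsum2 (cop (S p)) (\<lambda>d e. tsum2 us (\<lambda>u v.
      F (d \<cdot> (u \<cdot> (q \<cdot> (be \<cdot> (S (y \<cdot> r) \<cdot> (al \<cdot> z)))))) (e \<cdot> (v \<cdot> S x))))))"
    by (simp add: tsum_hs Q_sum_def tsum2_tsum3_swap S_mul assoc)
  also have "\<dots> = tsum3 ph (\<lambda>x y z. tsum3 pi (\<lambda>p q r. tsum2 (cop x) (\<lambda>x\<^sub>1 x\<^sub>2. tsum2 (cop (S (x\<^sub>1 \<cdot> p))) (\<lambda>d e. tsum2 us (\<lambda>u v.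
      F (d \<cdot> (u \<cdot> (x\<^sub>2 \<cdot> (q \<cdot> (be \<cdot> (S (y \<cdot> r) \<cdot> (al \<cdot> z))))))) (e \<cdot> v))))))"
    unfolding 2 ..
  also have "\<dots> = tsum2 us F"
    by (subst zigzag2[of "\<lambda>s t. tsum2 (cop (S s)) (\<lambda>d e. tsum2 us (\<lambda>u v. F (d \<cdot> (u \<cdot> t)) (e \<cdot> v)))"])
      (simp_all add: cop_one)
  finally show ?thesis .
qed

text \<open>\<open>gam_Q\<close> solved for \<gamma>: the associator on its left side is cancelled
  by multiplying with the inverse associator on the right. This expresses \<gamma> by q_R, on which
  \<open>hs\<close> is known by \<open>h_Q\<close>.\<close>

lemma gam_eq:
  assumes F: "form2 F"
  shows "tsum2 gam F = tsum3 pi (\<lambda>a b c. tsum2 (cop a) (\<lambda>a\<^sub>1 a\<^sub>2. Q_sum (\<lambda>u v. F (S a\<^sub>2 \<cdot> (u \<cdot> b)) (S a\<^sub>1 \<cdot> (v \<cdot> (al \<cdot> c))))))"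
proof -
  note [simp] = form_defs form2D[OF F]
  define F3 where "F3 x y z = tsum2 (cop x) (\<lambda>x\<^sub>1 x\<^sub>2. tsum2 gam (\<lambda>u v. F (S x\<^sub>2 \<cdot> (u \<cdot> y)) (S x\<^sub>1 \<cdot> (v \<cdot> z))))" for x y z
  have F3: "form3 F3" by (simp add: F3_def)
  have 1: "tsum3 ph (\<lambda>x y z. F3 (x \<cdot> a) (y \<cdot> b) (z \<cdot> c)) = tsum2 (cop a) (\<lambda>a\<^sub>1 a\<^sub>2. Q_sum (\<lambda>u v. F (S a\<^sub>2 \<cdot> (u \<cdot> b)) (S a\<^sub>1 \<cdot> (v \<cdot> (al \<cdot> c)))))" for a b c
    using gam_Q[of "\<lambda>u v. F (S m \<cdot> (u \<cdot> b)) (S k \<cdot> (v \<cdot> c))" for m k]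
    by (simp add: F3_def cop_mul S_mul assoc tsum2_tsum2_swap[of "cop x" "cop a" for x] tsum2_tsum3_swap[symmetric])
  have "tsum2 gam F = F3 \<one> \<one> \<one>" by (simp add: F3_def cop_one)
  also have "\<dots> = tsum3 pi (\<lambda>a b c. tsum3 ph (\<lambda>x y z. F3 (x \<cdot> a) (y \<cdot> b) (z \<cdot> c)))"
    unfolding ph_pi[OF F3, symmetric] by (rule tsum3_tsum3_swap)
  finally show ?thesis unfolding 1 .
qed

text \<open>Combined with f \<Delta>(\<alpha>) = \<gamma> this says that f^{-1} f and 1 agree in
  front of \<Delta>(\<alpha>), where f^{-1} is the candidate \<open>hs\<close>. It is the
  contraction half of the proof that \<open>hs\<close> is a left inverse.\<close>

lemma h_gam:
  assumes F: "form2 F"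
  shows "tsum2 hs (\<lambda>f g. tsum2 gam (\<lambda>u v. F (f \<cdot> u) (g \<cdot> v))) = tsum2 (cop al) F"
proof -
  note [simp] = form_defs form2D[OF F]
  have 1: "tsum2 gam (\<lambda>u v. F (f \<cdot> u) (g \<cdot> v)) =
    tsum3 pi (\<lambda>a b c. tsum2 (cop a) (\<lambda>a\<^sub>1 a\<^sub>2. Q_sum (\<lambda>u v. F (f \<cdot> S a\<^sub>2 \<cdot> (u \<cdot> b)) (g \<cdot> S a\<^sub>1 \<cdot> (v \<cdot> (al \<cdot> c))))))" for f g
    by (subst gam_eq) (simp_all add: assoc)
  have 2: "tsum2 hs (\<lambda>f g. tsum2 (cop a) (\<lambda>a\<^sub>1 a\<^sub>2. Q_sum (\<lambda>u v. F (f \<cdot> S a\<^sub>2 \<cdot> (u \<cdot> b)) (g \<cdot> S a\<^sub>1 \<cdot> (v \<cdot> (al \<cdot> c)))))) =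
    tsum3 ph (\<lambda>x y z. tsum2 (cop (S (x \<cdot> a) \<cdot> al)) (\<lambda>d e. F (d \<cdot> (y \<cdot> b)) (e \<cdot> (z \<cdot> c))))" for a b c
  proof -
    have "tsum2 hs (\<lambda>f g. tsum2 (cop a) (\<lambda>a\<^sub>1 a\<^sub>2. Q_sum (\<lambda>u v. F (f \<cdot> S a\<^sub>2 \<cdot> (u \<cdot> b)) (g \<cdot> S a\<^sub>1 \<cdot> (v \<cdot> (al \<cdot> c)))))) =
      tsum2 (cop (S a)) (\<lambda>d e. tsum2 hs (\<lambda>f g. Q_sum (\<lambda>u v. F (d \<cdot> f \<cdot> (u \<cdot> b)) (e \<cdot> g \<cdot> (v \<cdot> (al \<cdot> c))))))"
      by (subst tsum2_tsum2_swap, rule h_intertwines[of "\<lambda>f g. Q_sum (\<lambda>u v. F (f \<cdot> (u \<cdot> b)) (g \<cdot> (v \<cdot> (al \<cdot> c))))"])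
        (simp add: Q_sum_def)
    also have "\<dots> = tsum2 (cop (S a)) (\<lambda>d e. tsum2 us (\<lambda>u v. F (d \<cdot> (u \<cdot> b)) (e \<cdot> (v \<cdot> (al \<cdot> c)))))"
      by (subst h_Q[symmetric]) (simp_all add: assoc)
    also have "\<dots> = tsum2 (cop (S a)) (\<lambda>d e. tsum3 ph (\<lambda>x y z. tsum2 (cop (S x \<cdot> al)) (\<lambda>d' e'. F (d \<cdot> (d' \<cdot> (y \<cdot> b))) (e \<cdot> (e' \<cdot> (z \<cdot> c))))))"
      using U_contract[of "\<lambda>u v. F (d \<cdot> (u \<cdot> b)) (e \<cdot> (v \<cdot> c))" for d e] by (simp add: assoc)
    also have "\<dots> = tsum3 ph (\<lambda>x y z. tsum2 (cop (S (x \<cdot> a) \<cdot> al)) (\<lambda>d e. F (d \<cdot> (y \<cdot> b)) (e \<cdot> (z \<cdot> c))))"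
      by (simp add: S_mul cop_mul assoc tsum2_tsum3_swap)
    finally show ?thesis .
  qed
  have "tsum2 hs (\<lambda>f g. tsum2 gam (\<lambda>u v. F (f \<cdot> u) (g \<cdot> v))) =
    tsum3 pi (\<lambda>a b c. tsum3 ph (\<lambda>x y z. tsum2 (cop (S (x \<cdot> a) \<cdot> al)) (\<lambda>d e. F (d \<cdot> (y \<cdot> b)) (e \<cdot> (z \<cdot> c)))))"
    unfolding 1 tsum2_tsum3_swap 2 ..
  also have "\<dots> = tsum2 (cop al) F"
    by (subst tsum3_tsum3_swap, subst ph_pi[of "\<lambda>x y z. tsum2 (cop (S x \<cdot> al)) (\<lambda>d e. F (d \<cdot> y) (e \<cdot> z))"]) simp_all
  finally show ?thesis .
qed

text \<open>In an infinite dimensional algebra a right inverse need not be a left inverse, so this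
  is proved separately. The product of \<open>hs\<close> and f commutes with \<Delta>(S(a)) by the
  two intertwining lemmas, and it disappears in front of \<Delta>(\<alpha>). Writing 1 \<otimes> 1
  as \<Delta>(S(x) \<alpha> y \<beta> S(z)) and moving the product between S(x) and \<alpha> removes
  it.\<close>

lemma h_f:
  assumes F: "form2 F"
  shows "tsum2 hs (\<lambda>f g. tsum2 fs (\<lambda>u v. F (f \<cdot> u) (g \<cdot> v))) = F \<one> \<one>"
proof -
  note [simp] = form_defs form2D[OF F]
  define W where "W G = tsum2 hs (\<lambda>f g. tsum2 fs (\<lambda>u v. G (f \<cdot> u) (g \<cdot> v)))" for G :: "'h \<Rightarrow> 'h \<Rightarrow> 'k"
  have one: "tsum3 pi (\<lambda>x y z. tsum2 (cop (S x \<cdot> (al \<cdot> (y \<cdot> (be \<cdot> S z))))) (\<lambda>d e. F (u \<cdot> d) (v \<cdot> e))) = F u v" for u v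
    using antipode_pi[of "\<lambda>h. tsum2 (cop h) (\<lambda>d e. F (u \<cdot> d) (v \<cdot> e))"] by (simp add: cop_one)
  have equiv: "tsum2 (cop (S a)) (\<lambda>d e. W (\<lambda>u v. G (u \<cdot> d) (v \<cdot> e))) = tsum2 (cop (S a)) (\<lambda>d e. W (\<lambda>u v. G (d \<cdot> u) (e \<cdot> v)))"
    if G: "form2 G" for G a
  proof -
    note [simp] = form2D[OF G]
    have 1: "tsum2 (cop (S a)) (\<lambda>d e. tsum2 fs (\<lambda>u v. G (f \<cdot> u \<cdot> d) (g \<cdot> v \<cdot> e))) =
       tsum2 (cop a) (\<lambda>a\<^sub>1 a\<^sub>2. tsum2 fs (\<lambda>u v. G (f \<cdot> S a\<^sub>2 \<cdot> u) (g \<cdot> S a\<^sub>1 \<cdot> v)))" for f g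
      using f_intertwines[of "\<lambda>u v. G (f \<cdot> u) (g \<cdot> v)" a] by (simp add: assoc)
    have 2: "tsum2 (cop a) (\<lambda>a\<^sub>1 a\<^sub>2. tsum2 hs (\<lambda>f g. tsum2 fs (\<lambda>u v. G (f \<cdot> S a\<^sub>2 \<cdot> u) (g \<cdot> S a\<^sub>1 \<cdot> v)))) =
       tsum2 (cop (S a)) (\<lambda>d e. tsum2 hs (\<lambda>f g. tsum2 fs (\<lambda>u v. G (d \<cdot> f \<cdot> u) (e \<cdot> g \<cdot> v))))"
      by (rule h_intertwines[of "\<lambda>f g. tsum2 fs (\<lambda>u v. G (f \<cdot> u) (g \<cdot> v))"]) simp
    show ?thesis
      unfolding W_def tsum2_tsum2_swap[of "cop (S a)" hs "\<lambda>d e f g. tsum2 fs (\<lambda>u v. G (f \<cdot> u \<cdot> d) (g \<cdot> v \<cdot> e))"] 1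
      unfolding tsum2_tsum2_swap[of hs "cop a"] 2 unfolding assoc ..
  qed
  have contract: "tsum2 (cop al) (\<lambda>d e. W (\<lambda>u v. G (u \<cdot> d) (v \<cdot> e))) = tsum2 (cop al) G" if G: "form2 G" for G
  proof -
    note [simp] = form2D[OF G]
    have 1: "tsum2 fs (\<lambda>u v. tsum2 (cop al) (\<lambda>d e. G (f \<cdot> u \<cdot> d) (g \<cdot> v \<cdot> e))) = tsum2 gam (\<lambda>u v. G (f \<cdot> u) (g \<cdot> v))" for f g
      using f_contract[of "\<lambda>u v. G (f \<cdot> u) (g \<cdot> v)"] by (simp add: assoc)
    show ?thesis
      unfolding W_def h_gam[OF G, symmetric] tsum2_tsum2_swap[of "cop al"] 1 ..
  qed
  have eq: "tsum2 (cop (S x \<cdot> (al \<cdot> c))) (\<lambda>d e. W (\<lambda>u v. F (u \<cdot> d) (v \<cdot> e))) = tsum2 (cop (S x \<cdot> (al \<cdot> c))) F" for x c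
  proof -
    have C: "form2 (\<lambda>u v. tsum2 (cop al) (\<lambda>d e. tsum2 (cop c) (\<lambda>d' e'. F (u \<cdot> (d \<cdot> d')) (v \<cdot> (e \<cdot> e')))))" by simp
    have C': "form2 (\<lambda>u v. tsum2 (cop c) (\<lambda>d' e'. F (f \<cdot> (u \<cdot> d')) (g \<cdot> (v \<cdot> e'))))" for f g by simp
    have swap: "W (\<lambda>u v. tsum2 (cop a) (\<lambda>d e. G u v d e)) = tsum2 (cop a) (\<lambda>d e. W (\<lambda>u v. G u v d e))" for a G
      by (simp only: W_def tsum2_tsum2_swap[of _ "cop a"])
    have "tsum2 (cop (S x \<cdot> (al \<cdot> c))) (\<lambda>d e. W (\<lambda>u v. F (u \<cdot> d) (v \<cdot> e))) =
       tsum2 (cop (S x)) (\<lambda>d e. W (\<lambda>u v. tsum2 (cop al) (\<lambda>d' e'. tsum2 (cop c) (\<lambda>d'' e''. F (u \<cdot> d \<cdot> (d' \<cdot> d'')) (v \<cdot> e \<cdot> (e' \<cdot> e''))))))"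
      by (simp add: W_def cop_mul assoc tsum2_tsum2_swap[of hs "cop al"] tsum2_tsum2_swap[of fs "cop al"]
          tsum2_tsum2_swap[of hs "cop c"] tsum2_tsum2_swap[of fs "cop c"])
    also have "\<dots> = tsum2 (cop (S x)) (\<lambda>d e. W (\<lambda>u v. tsum2 (cop al) (\<lambda>d' e'. tsum2 (cop c) (\<lambda>d'' e''. F (d \<cdot> u \<cdot> (d' \<cdot> d'')) (e \<cdot> v \<cdot> (e' \<cdot> e''))))))"
      by (rule equiv[OF C])
    also have "\<dots> = tsum2 (cop (S x)) (\<lambda>d e. tsum2 (cop al) (\<lambda>d' e'. tsum2 (cop c) (\<lambda>d'' e''. F (d \<cdot> (d' \<cdot> d'')) (e \<cdot> (e' \<cdot> e'')))))"
      unfolding contract[OF C', symmetric] swap[of al] assoc ..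
    also have "\<dots> = tsum2 (cop (S x \<cdot> (al \<cdot> c))) F"
      by (simp add: cop_mul)
    finally show ?thesis .
  qed
  have "W F = tsum3 pi (\<lambda>x y z. tsum2 (cop (S x \<cdot> (al \<cdot> (y \<cdot> (be \<cdot> S z))))) (\<lambda>d e. W (\<lambda>u v. F (u \<cdot> d) (v \<cdot> e))))"
    unfolding W_def tsum2_tsum2_swap[of "cop _"] tsum2_tsum3_swap[symmetric] one ..
  also have "\<dots> = F \<one> \<one>"
    unfolding eq using antipode_pi[of "\<lambda>h. tsum2 (cop h) F"] by (simp add: cop_one)
  finally show ?thesis unfolding W_def .
qed

section \<open>The element p_R expressed through U\<close>

definition p_sum :: "('h \<Rightarrow> 'h \<Rightarrow> 'k) \<Rightarrow> 'k" where
  "p_sum F = tsum3 pi (\<lambda>x y z. F x (y \<cdot> (be \<cdot> S z)))"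

text \<open>The element t = \<Delta>(X \<beta> S(Y)) U (Z \<otimes> 1). It is what remains in
  \<open>p_h\<close> after the pentagon and two contractions by \<beta>, and it turns out to be
  p_R.\<close>

definition t_sum :: "('h \<Rightarrow> 'h \<Rightarrow> 'k) \<Rightarrow> 'k" where
  "t_sum F = tsum3 ph (\<lambda>x y z. tsum2 (cop (x \<cdot> (be \<cdot> S y))) (\<lambda>d e. tsum2 us (\<lambda>u v.
     F (d \<cdot> (u \<cdot> z)) (e \<cdot> v))))"

text \<open>\<Delta>(a_1) t (1 \<otimes> S(a_2)) = t (a \<otimes> 1), the known rule for p_R.
  Equivariance of U takes in S(a_2); quasi-coassociativity then brings two legs of a to the two
  sides of \<beta>, and the remaining leg, by the counit, to the right of U.\<close>

lemma t_equivariant: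
  assumes F: "form2 F"
  shows "tsum2 (cop a) (\<lambda>a\<^sub>1 a\<^sub>2. tsum2 (cop a\<^sub>1) (\<lambda>k m. t_sum (\<lambda>u v. F (k \<cdot> u) (m \<cdot> (v \<cdot> S a\<^sub>2))))) =
    t_sum (\<lambda>u v. F (u \<cdot> a) v)"
proof -
  note [simp] = form_defs form2D[OF F]
  define F3 where "F3 x y z = tsum2 (cop (x \<cdot> (be \<cdot> S y))) (\<lambda>d e. tsum2 us (\<lambda>u v. F (d \<cdot> (u \<cdot> z)) (e \<cdot> v)))" for x y z
  have F3: "form3 F3" by (simp add: F3_def)
  have 1: "tsum2 us (\<lambda>u v. F (c \<cdot> (d \<cdot> (u \<cdot> w))) (c' \<cdot> (e \<cdot> (v \<cdot> S a)))) = tsum2 (cop a) (\<lambda>a\<^sub>1 a\<^sub>2. tsum2 (cop (S a\<^sub>1)) (\<lambda>d' e'. tsum2 us (\<lambda>u v.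
       F (c \<cdot> (d \<cdot> (d' \<cdot> (u \<cdot> (a\<^sub>2 \<cdot> w))))) (c' \<cdot> (e \<cdot> (e' \<cdot> v))))))" for c c' d e w a
    by (subst U_equivariant[of "\<lambda>u v. F (c \<cdot> (d \<cdot> (u \<cdot> w))) (c' \<cdot> (e \<cdot> v))"]) (simp_all add: assoc)
  have 2: "tsum2 (cop a\<^sub>1) (\<lambda>k m. t_sum (\<lambda>u v. F (k \<cdot> u) (m \<cdot> (v \<cdot> S a\<^sub>2)))) =
    tsum3 ph (\<lambda>x y z. tsum2 (cop a\<^sub>2) (\<lambda>k m. F3 (a\<^sub>1 \<cdot> x) (k \<cdot> y) (m \<cdot> z)))" for a\<^sub>1 a\<^sub>2
  proof -
    have "tsum2 (cop a\<^sub>1) (\<lambda>k m. tsum2 (cop (x \<cdot> (be \<cdot> S y))) (\<lambda>d e. tsum2 us (\<lambda>u v. F (k \<cdot> (d \<cdot> (u \<cdot> z))) (m \<cdot> (e \<cdot> (v \<cdot> S a\<^sub>2)))))) =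
      tsum2 (cop a\<^sub>2) (\<lambda>k m. F3 (a\<^sub>1 \<cdot> x) (k \<cdot> y) (m \<cdot> z))" for x y z
      unfolding 1
      by (subst tsum2_tsum2_swap[of _ "cop a\<^sub>2"], subst tsum2_tsum2_swap[of _ "cop a\<^sub>2"])
        (simp add: F3_def S_mul cop_mul assoc)
    then show ?thesis
      by (simp add: t_sum_def assoc tsum2_tsum3_swap)
  qed
  have be: "tsum2 (cop a) (\<lambda>b c. F3 (x \<cdot> b) (y \<cdot> c) w) = eps a * F3 x y w" for a x y w
    using antipode_be[of "\<lambda>h. tsum2 (cop (x \<cdot> (h \<cdot> S y))) (\<lambda>d e. tsum2 us (\<lambda>u v. F (d \<cdot> (u \<cdot> w)) (e \<cdot> v)))"]
    by (simp add: F3_def S_mul assoc)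
  have eps: "tsum2 (cop a) (\<lambda>b c. eps b * F3 x y (z \<cdot> c)) = F3 x y (z \<cdot> a)" for x y z
    using form3D[OF F3] by (subst counit_left) simp_all
  show ?thesis
    unfolding 2 using coassoc[OF F3, of a]
    by (simp add: tsum2_tsum3_swap be eps) (simp add: t_sum_def F3_def assoc)
qed

text \<open>The second zigzag with t in place of p_R. When equivariance and contraction have
  eliminated U, three associators stand as on the right side of the pentagon. On the left side
  \<beta> contracts the coproduct in one of its two associators, which is then removed by the
  counit, and the antipode axiom for \<phi> remains.\<close>

lemma t_contract:
  assumes F: "form2 F"
  shows "tsum3 ph (\<lambda>a b c. tsum2 (cop a) (\<lambda>a\<^sub>1 a\<^sub>2. t_sum (\<lambda>u v. F (a\<^sub>1 \<cdot> u) (a\<^sub>2 \<cdot> (v \<cdot> (S b \<cdot> (al \<cdot> c))))))) = F \<one> \<one>"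
proof -
  note [simp] = form_defs form2D[OF F]
  have 1: "tsum2 us (\<lambda>u v. F (d \<cdot> (u \<cdot> z)) (e \<cdot> (v \<cdot> (S b \<cdot> (al \<cdot> c))))) =
    tsum3 ph (\<lambda>p q r. tsum2 (cop b) (\<lambda>b\<^sub>1 b\<^sub>2. tsum2 (cop (S (p \<cdot> b\<^sub>1) \<cdot> al)) (\<lambda>d' e'.
      F (d \<cdot> (d' \<cdot> (q \<cdot> (b\<^sub>2 \<cdot> z)))) (e \<cdot> (e' \<cdot> (r \<cdot> c))))))" for d e z b c
  proof -
    have "tsum2 us (\<lambda>u v. F (d \<cdot> (u \<cdot> z)) (e \<cdot> (v \<cdot> (S b \<cdot> (al \<cdot> c))))) =
      tsum2 (cop b) (\<lambda>b\<^sub>1 b\<^sub>2. tsum2 (cop (S b\<^sub>1)) (\<lambda>d' e'. tsum2 us (\<lambda>u v.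
       F (d \<cdot> (d' \<cdot> (u \<cdot> (b\<^sub>2 \<cdot> z)))) (e \<cdot> (e' \<cdot> (v \<cdot> (al \<cdot> c)))))))"
      using U_equivariant[of "\<lambda>u v. F (d \<cdot> (u \<cdot> z)) (e \<cdot> (v \<cdot> (al \<cdot> c)))" b] by (simp add: assoc)
    also have "\<dots> = tsum2 (cop b) (\<lambda>b\<^sub>1 b\<^sub>2. tsum2 (cop (S b\<^sub>1)) (\<lambda>d' e'. tsum3 ph (\<lambda>p q r. tsum2 (cop (S p \<cdot> al)) (\<lambda>d'' e''.
       F (d \<cdot> (d' \<cdot> (d'' \<cdot> (q \<cdot> (b\<^sub>2 \<cdot> z))))) (e \<cdot> (e' \<cdot> (e'' \<cdot> (r \<cdot> c))))))))"
      using U_contract[of "\<lambda>u v. F (d \<cdot> (d' \<cdot> (u \<cdot> w))) (e \<cdot> (e' \<cdot> (v \<cdot> c)))" for d' e' w] by (simp add: assoc)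
    finally show ?thesis by (simp add: S_mul cop_mul assoc tsum2_tsum3_swap)
  qed
  have 2: "tsum2 (cop a) (\<lambda>a\<^sub>1 a\<^sub>2. t_sum (\<lambda>u v. F (a\<^sub>1 \<cdot> u) (a\<^sub>2 \<cdot> (v \<cdot> (S b \<cdot> (al \<cdot> c)))))) =
    tsum3 ph (\<lambda>x y z. tsum3 ph (\<lambda>p q r. tsum2 (cop b) (\<lambda>b\<^sub>1 b\<^sub>2. tsum2 (cop (a \<cdot> (x \<cdot> (be \<cdot> (S y \<cdot> (S (p \<cdot> b\<^sub>1) \<cdot> al)))))) (\<lambda>d e.
      F (d \<cdot> (q \<cdot> (b\<^sub>2 \<cdot> z))) (e \<cdot> (r \<cdot> c))))))" for a b c
  proof -
    have "tsum2 (cop a) (\<lambda>a\<^sub>1 a\<^sub>2. tsum2 (cop (x \<cdot> (be \<cdot> S y))) (\<lambda>d e. tsum2 us (\<lambda>u v. F (a\<^sub>1 \<cdot> d \<cdot> (u \<cdot> z)) (a\<^sub>2 \<cdot> e \<cdot> (v \<cdot> (S b \<cdot> (al \<cdot> c))))))) =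
       tsum3 ph (\<lambda>p q r. tsum2 (cop b) (\<lambda>b\<^sub>1 b\<^sub>2. tsum2 (cop (a \<cdot> (x \<cdot> (be \<cdot> (S y \<cdot> (S (p \<cdot> b\<^sub>1) \<cdot> al)))))) (\<lambda>d e.
      F (d \<cdot> (q \<cdot> (b\<^sub>2 \<cdot> z))) (e \<cdot> (r \<cdot> c)))))" for x y z
      unfolding 1 tsum2_tsum3_swap tsum2_tsum2_swap[of "cop (x \<cdot> (be \<cdot> S y))" "cop b"] tsum2_tsum2_swap[of "cop a" "cop b"]
      by (simp add: cop_mul assoc)
    then show ?thesis
      by (simp add: t_sum_def assoc tsum2_tsum3_swap)
  qed
  define F4 where "F4 m n s t = tsum2 (cop (m \<cdot> (be \<cdot> (S n \<cdot> al)))) (\<lambda>d e. F (d \<cdot> s) (e \<cdot> t))" for m n s t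
  have F4: "form4 F4" by (simp add: F4_def)
  have be: "tsum2 (cop a) (\<lambda>b c. F4 (x \<cdot> b) (y \<cdot> c) s t) = eps a * F4 x y s t" for a x y s t
    using antipode_be[of "\<lambda>h. tsum2 (cop (x \<cdot> (h \<cdot> (S y \<cdot> al)))) (\<lambda>d e. F (d \<cdot> s) (e \<cdot> t))"]
    by (simp add: F4_def S_mul assoc)
  have "tsum3 ph (\<lambda>a b c. tsum2 (cop a) (\<lambda>a\<^sub>1 a\<^sub>2. t_sum (\<lambda>u v. F (a\<^sub>1 \<cdot> u) (a\<^sub>2 \<cdot> (v \<cdot> (S b \<cdot> (al \<cdot> c))))))) =
    tsum3 ph (\<lambda>a b c. tsum3 ph (\<lambda>x y z. tsum3 ph (\<lambda>p q r. tsum2 (cop b) (\<lambda>b\<^sub>1 b\<^sub>2. F4 (a \<cdot> x) (p \<cdot> (b\<^sub>1 \<cdot> y)) (q \<cdot> (b\<^sub>2 \<cdot> z)) (r \<cdot> c)))))"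
    unfolding 2 by (simp add: F4_def S_mul assoc)
  also have "\<dots> = tsum3 ph (\<lambda>p q r. tsum3 ph (\<lambda>a b c. tsum3 ph (\<lambda>x y z. tsum2 (cop b) (\<lambda>b\<^sub>1 b\<^sub>2. F4 (a \<cdot> x) (p \<cdot> (b\<^sub>1 \<cdot> y)) (q \<cdot> (b\<^sub>2 \<cdot> z)) (r \<cdot> c)))))"
    by (rule trans[OF tsum3_rotate tsum3_rotate])
  also have "\<dots> = tsum3 ph (\<lambda>p q r. tsum3 ph (\<lambda>x y z. eps x * tsum2 (cop r) (\<lambda>r\<^sub>1 r\<^sub>2. F4 p q (r\<^sub>1 \<cdot> y) (r\<^sub>2 \<cdot> z))))"
    unfolding pentagon[OF F4, symmetric] be tsum2_mult ..
  also have "\<dots> = tsum3 ph (\<lambda>p q r. tsum2 (cop r) (\<lambda>s t. tsum2 (cop (p \<cdot> (be \<cdot> (S q \<cdot> al)))) (\<lambda>d e. F (d \<cdot> s) (e \<cdot> t))))"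
    by (subst counit_ph1) (simp_all add: F4_def)
  also have "\<dots> = tsum3 ph (\<lambda>p q r. tsum2 (cop (p \<cdot> (be \<cdot> (S q \<cdot> (al \<cdot> r))))) F)"
  proof -
    have "tsum2 (cop r) (\<lambda>s t. tsum2 (cop a) (\<lambda>d e. F (d \<cdot> s) (e \<cdot> t))) = tsum2 (cop (a \<cdot> r)) F" for a r
      by (subst tsum2_tsum2_swap) (simp add: cop_mul)
    then show ?thesis by (simp add: assoc)
  qed
  also have "\<dots> = F \<one> \<one>"
    using antipode_ph[of "\<lambda>h. tsum2 (cop h) F"] by (simp add: cop_one)
  finally show ?thesis .
qed

text \<open>The argument that a left and a right inverse coincide: p_R is multiplied on the left by
  \<Delta>(q^1) t (1 \<otimes> S(q^2)) = 1 \<otimes> 1, equivariance moves the first leg of p_R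
  across t, and there the first zigzag cancels p_R against q_R, leaving t.\<close>

lemma t_eq_p:
  assumes F: "form2 F"
  shows "t_sum F = p_sum F"
proof -
  note [simp] = form_defs form2D[OF F]
  have 1: "F x w = tsum3 ph (\<lambda>a b c. tsum2 (cop a) (\<lambda>a\<^sub>1 a\<^sub>2. t_sum (\<lambda>u v. F (a\<^sub>1 \<cdot> (u \<cdot> x)) (a\<^sub>2 \<cdot> (v \<cdot> (S b \<cdot> (al \<cdot> (c \<cdot> w))))))))" for x w
    using t_contract[of "\<lambda>u v. F (u \<cdot> x) (v \<cdot> w)"] by (simp add: assoc)
  have 2: "t_sum (\<lambda>u v. F (a\<^sub>1 \<cdot> (u \<cdot> x)) (a\<^sub>2 \<cdot> (v \<cdot> w))) =
    tsum2 (cop x) (\<lambda>x\<^sub>1 x\<^sub>2. tsum2 (cop x\<^sub>1) (\<lambda>k m. t_sum (\<lambda>u v. F (a\<^sub>1 \<cdot> (k \<cdot> u)) (a\<^sub>2 \<cdot> (m \<cdot> (v \<cdot> (S x\<^sub>2 \<cdot> w)))))))" for a\<^sub>1 a\<^sub>2 x w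
    using t_equivariant[of "\<lambda>u v. F (a\<^sub>1 \<cdot> u) (a\<^sub>2 \<cdot> (v \<cdot> w))" x] by (simp add: assoc)
  define G where "G s w = tsum2 (cop s) (\<lambda>k m. t_sum (\<lambda>u v. F (k \<cdot> u) (m \<cdot> (v \<cdot> w))))" for s w
  have G: "form2 G" by (simp add: G_def t_sum_def)
  have 3: "tsum2 (cop a) (\<lambda>a\<^sub>1 a\<^sub>2. t_sum (\<lambda>u v. F (a\<^sub>1 \<cdot> (u \<cdot> x)) (a\<^sub>2 \<cdot> (v \<cdot> w)))) = tsum2 (cop x) (\<lambda>x\<^sub>1 x\<^sub>2. G (a \<cdot> x\<^sub>1) (S x\<^sub>2 \<cdot> w))" for a x w
  proof -
    have f: "form2 (\<lambda>k m. t_sum (\<lambda>u v. F (k \<cdot> u) (m \<cdot> (v \<cdot> w))))" for w by (simp add: t_sum_def)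
    show ?thesis
      unfolding 2 G_def cop_mul[OF f] tsum2_tsum2_swap[of "cop a" "cop x"] assoc ..
  qed
  have "p_sum F = tsum3 pi (\<lambda>x y z. tsum3 ph (\<lambda>a b c. tsum2 (cop x) (\<lambda>x\<^sub>1 x\<^sub>2. G (a \<cdot> x\<^sub>1) (S x\<^sub>2 \<cdot> (S b \<cdot> (al \<cdot> (c \<cdot> (y \<cdot> (be \<cdot> S z)))))))))"
    unfolding p_sum_def by (subst 1) (simp only: 3)
  also have "\<dots> = G \<one> \<one>"
    using zigzag1[OF G] by (simp add: S_mul assoc tsum3_tsum3_swap[of ph pi])
  also have "\<dots> = t_sum F"
  proof -
    have f: "form2 (\<lambda>k m. t_sum (\<lambda>u v. F (k \<cdot> u) (m \<cdot> (v \<cdot> w))))" for w by (simp add: t_sum_def)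
    show ?thesis unfolding G_def cop_one[OF f] by simp
  qed
  finally show ?thesis ..
qed

text \<open>This rewrites p_R (\<beta> \<otimes> 1) with the inverse of f inside, so that the factor
  f of V can cancel it in \<open>V_contract\<close>. After \<open>pentagon4\<close>, \<beta>
  contracts two coproducts, the counit identities remove both inverse associators, and t (\<beta>
  \<otimes> 1) is left.\<close>

lemma p_h:
  assumes F: "form2 F"
  shows "tsum3 pi (\<lambda>x y z. tsum2 (cop (x \<cdot> be)) (\<lambda>d e. tsum2 hs (\<lambda>u v. F (d \<cdot> (u \<cdot> S z)) (e \<cdot> (v \<cdot> S y))))) =
    p_sum (\<lambda>u v. F (u \<cdot> be) v)"
proof -
  note [simp] = form_defs form2D[OF F]
  define F4 where "F4 m n s t = tsum2 (cop (m \<cdot> (be \<cdot> S n))) (\<lambda>d e. tsum2 us (\<lambda>u v. F (d \<cdot> (u \<cdot> (s \<cdot> (be \<cdot> S t)))) (e \<cdot> v)))" for m n s t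
  have F4: "form4 F4" by (simp add: F4_def)
  have 1: "tsum2 us (\<lambda>u v. F (d \<cdot> (u \<cdot> w)) (e \<cdot> (v \<cdot> S a))) = tsum2 (cop a) (\<lambda>a\<^sub>1 a\<^sub>2. tsum2 (cop (S a\<^sub>1)) (\<lambda>d' e'. tsum2 us (\<lambda>u v.
       F (d \<cdot> (d' \<cdot> (u \<cdot> (a\<^sub>2 \<cdot> w)))) (e \<cdot> (e' \<cdot> v)))))" for d e w a
    by (subst U_equivariant[of "\<lambda>u v. F (d \<cdot> (u \<cdot> w)) (e \<cdot> v)"]) (simp_all add: assoc)
  have 2: "tsum2 (cop (x \<cdot> be)) (\<lambda>d e. tsum2 hs (\<lambda>u v. F (d \<cdot> (u \<cdot> S z)) (e \<cdot> (v \<cdot> S y)))) =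
    tsum3 pi (\<lambda>a b c. tsum2 (cop y) (\<lambda>y\<^sub>1 y\<^sub>2. F4 x (y\<^sub>1 \<cdot> a) (y\<^sub>2 \<cdot> b) (z \<cdot> c)))" for x y z
  proof -
    have "tsum2 (cop (x \<cdot> be)) (\<lambda>d e. tsum2 (cop (S a)) (\<lambda>d' e'. tsum2 us (\<lambda>u v. F (d \<cdot> d' \<cdot> (u \<cdot> (b \<cdot> (be \<cdot> S (z \<cdot> c))))) (e \<cdot> e' \<cdot> (v \<cdot> S y))))) =
      tsum2 (cop y) (\<lambda>y\<^sub>1 y\<^sub>2. F4 x (y\<^sub>1 \<cdot> a) (y\<^sub>2 \<cdot> b) (z \<cdot> c))" for a b c
      unfolding 1 tsum2_tsum2_swap[of _ "cop y"]
      by (simp add: F4_def S_mul cop_mul assoc)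
    then show ?thesis
      by (simp add: tsum_hs S_mul assoc tsum2_tsum3_swap)
  qed
  have be3: "tsum2 (cop f) (\<lambda>f\<^sub>1 f\<^sub>2. F4 m n (z \<cdot> (q \<cdot> f\<^sub>1)) (r \<cdot> f\<^sub>2)) = eps f * F4 m n (z \<cdot> q) r" for f m n z q r
    using antipode_be[of "\<lambda>h. tsum2 (cop (m \<cdot> (be \<cdot> S n))) (\<lambda>d e. tsum2 us (\<lambda>u v. F (d \<cdot> (u \<cdot> (z \<cdot> (q \<cdot> (h \<cdot> S r))))) (e \<cdot> v)))"]
    by (simp add: F4_def tsum2_tsum2_swap[of "cop f"] S_mul assoc)
  have be4: "tsum2 (cop p) (\<lambda>b c. F4 (x \<cdot> b) (y \<cdot> c) s t) = eps p * F4 x y s t" for p x y s t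
    using antipode_be[of "\<lambda>h. tsum2 (cop (x \<cdot> (h \<cdot> S y))) (\<lambda>d e. tsum2 us (\<lambda>u v. F (d \<cdot> (u \<cdot> (s \<cdot> (be \<cdot> S t)))) (e \<cdot> v)))"]
    by (simp add: F4_def S_mul assoc)
  have pi3: "tsum3 pi (\<lambda>d e f. eps f * F4 (x \<cdot> (p \<cdot> d)) (y \<cdot> (q \<cdot> e)) s t) = F4 (x \<cdot> p) (y \<cdot> q) s t" for x p y q s t
    using counit_pi3[of "\<lambda>d e. F4 (x \<cdot> (p \<cdot> d)) (y \<cdot> (q \<cdot> e)) s t"] by (simp add: F4_def)
  have pi1: "tsum3 pi (\<lambda>p q r. eps p * F4 x y (z \<cdot> q) r) = F4 x y z \<one>" for x y z
    using counit_pi1[of "\<lambda>q r. F4 x y (z \<cdot> q) r"] by (simp add: F4_def)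
  have "tsum3 pi (\<lambda>x y z. tsum2 (cop (x \<cdot> be)) (\<lambda>d e. tsum2 hs (\<lambda>u v. F (d \<cdot> (u \<cdot> S z)) (e \<cdot> (v \<cdot> S y))))) =
     tsum3 ph (\<lambda>x y z. tsum3 pi (\<lambda>p q r. tsum2 (cop p) (\<lambda>p\<^sub>1 p\<^sub>2. tsum3 pi (\<lambda>d e f. eps f *
        F4 (x \<cdot> (p\<^sub>1 \<cdot> d)) (y \<cdot> (p\<^sub>2 \<cdot> e)) (z \<cdot> q) r))))"
    unfolding 2 pentagon4[OF F4] be3 tsum2_tsum3_swap ..
  also have "\<dots> = tsum3 ph (\<lambda>x y z. F4 x y z \<one>)"
    unfolding pi3 be4 pi1 ..
  also have "\<dots> = t_sum (\<lambda>u v. F (u \<cdot> be) v)"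
    by (simp add: F4_def t_sum_def assoc)
  also have "\<dots> = p_sum (\<lambda>u v. F (u \<cdot> be) v)"
    by (rule t_eq_p) simp
  finally show ?thesis .
qed

section \<open>The inverse antipode and the element V\<close>

abbreviation T :: "'h \<Rightarrow> 'h" where "T \<equiv> inv S"

lemma S_T [simp]: "S (T a) = a"
  using bij_S by (simp add: bij_is_surj surj_f_inv_f)

lemma T_S [simp]: "T (S a) = a"
  using bij_S by (simp add: bij_is_inj)

lemma T_eq_iff: "T a = b \<longleftrightarrow> a = S b"
  by auto

lemma T_add: "T (a + b) = T a + T b"
  by (simp add: T_eq_iff S_add)

lemma T_scl: "T (scl k a) = scl k (T a)"
  by (simp add: T_eq_iff S_scl)

lemma T_mul: "T (a \<cdot> b) = T b \<cdot> T a"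
  by (simp add: T_eq_iff S_mul)

lemma T_one [simp]: "T \<one> = \<one>"
  by (simp add: T_eq_iff)

lemma endo_T [simp]: "endo g \<Longrightarrow> endo (\<lambda>x. T (g x))"
  by (auto simp: endo_def T_add T_scl)

text \<open>Since S^{-1} reverses products, both factors of V combine to (S^{-1} \<otimes>
  S^{-1})((f p_R)^21). Statements about V thus become statements about f p_R.\<close>

definition vs :: "('h \<times> 'h) list" where
  "vs = tbind2 fs (\<lambda>f g. tbind3 pi (\<lambda>x y z. [(T (g \<cdot> (y \<cdot> (be \<cdot> S z))), T (f \<cdot> x))]))"

lemma tsum_vs: "tsum2 vs F = tsum2 fs (\<lambda>f g. p_sum (\<lambda>u v. F (T (g \<cdot> v)) (T (f \<cdot> u))))"
  by (simp add: vs_def p_sum_def)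

lemma f_cop:
  assumes F: "form2 F"
  shows "tsum2 (cop a) (\<lambda>d e. tsum2 fs (\<lambda>u v. F (u \<cdot> d) (v \<cdot> e))) =
    tsum2 (cop (T a)) (\<lambda>d e. tsum2 fs (\<lambda>u v. F (S e \<cdot> u) (S d \<cdot> v)))"
  using f_intertwines[OF F, of "T a"] by simp

text \<open>Left multiplication of the second leg of V by S^{-1}(a) is right multiplication of f p_R
  by a \<otimes> 1. There p_R (a \<otimes> 1) = \<Delta>(a_1) p_R (1 \<otimes> S(a_2)), known from t
  = p_R, and f is moved past \<Delta>(a_1).\<close>

lemma V_equivariant:
  assumes F: "form2 F"
  shows "tsum2 vs (\<lambda>u v. F u (T a \<cdot> v)) =
    tsum2 (cop a) (\<lambda>a\<^sub>1 a\<^sub>2. tsum2 (cop (T a\<^sub>1)) (\<lambda>d e. tsum2 vs (\<lambda>u v. F ((a\<^sub>2 \<cdot> u) \<cdot> d) (v \<cdot> e))))"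
proof -
  note [simp] = form_defs form2D[OF F]
  have p: "p_sum (\<lambda>u v. F (T (g \<cdot> v)) (T (f \<cdot> (u \<cdot> a)))) =
    tsum2 (cop a) (\<lambda>a\<^sub>1 a\<^sub>2. tsum2 (cop a\<^sub>1) (\<lambda>k m. p_sum (\<lambda>u v. F (a\<^sub>2 \<cdot> T (g \<cdot> m \<cdot> v)) (T (f \<cdot> k \<cdot> u)))))" for f g
    using t_equivariant[of "\<lambda>u v. F (T (g \<cdot> v)) (T (f \<cdot> u))" a]
    by (simp add: t_eq_p T_mul assoc)
  have f: "tsum2 (cop a\<^sub>1) (\<lambda>k m. tsum2 fs (\<lambda>f g. p_sum (\<lambda>u v. F (a\<^sub>2 \<cdot> T (g \<cdot> m \<cdot> v)) (T (f \<cdot> k \<cdot> u))))) =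
     tsum2 (cop (T a\<^sub>1)) (\<lambda>d e. tsum2 fs (\<lambda>f g. p_sum (\<lambda>u v. F (a\<^sub>2 \<cdot> T (S d \<cdot> g \<cdot> v)) (T (S e \<cdot> f \<cdot> u)))))" for a\<^sub>1 a\<^sub>2
    by (rule f_cop[of "\<lambda>f g. p_sum (\<lambda>u v. F (a\<^sub>2 \<cdot> T (g \<cdot> v)) (T (f \<cdot> u)))"]) (simp add: p_sum_def)
  have "tsum2 vs (\<lambda>u v. F u (T a \<cdot> v)) = tsum2 fs (\<lambda>f g. p_sum (\<lambda>u v. F (T (g \<cdot> v)) (T (f \<cdot> (u \<cdot> a)))))"
    by (simp add: tsum_vs T_mul assoc)
  also have "\<dots> = tsum2 (cop a) (\<lambda>a\<^sub>1 a\<^sub>2. tsum2 (cop (T a\<^sub>1)) (\<lambda>d e. tsum2 fs (\<lambda>f g. p_sum (\<lambda>u v. F (a\<^sub>2 \<cdot> T (S d \<cdot> g \<cdot> v)) (T (S e \<cdot> f \<cdot> u))))))"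
    unfolding p tsum2_tsum2_swap[of fs "cop a" for a] f ..
  finally show ?thesis
    by (simp add: tsum_vs T_mul assoc)
qed

text \<open>The same translation with \<beta> in place of a: \<open>p_h\<close> brings in the
  inverse of f, and f cancels it after passing \<Delta>(x \<beta>).\<close>

lemma V_contract:
  assumes F: "form2 F"
  shows "tsum2 vs (\<lambda>u v. F u (T be \<cdot> v)) =
    tsum3 pi (\<lambda>x y z. tsum2 (cop (T be \<cdot> T x)) (\<lambda>d e. F (y \<cdot> d) (z \<cdot> e)))"
proof -
  note [simp] = form_defs form2D[OF F]
  have p: "p_sum (\<lambda>u v. F (T (g \<cdot> v)) (T (f \<cdot> (u \<cdot> be)))) =
    tsum3 pi (\<lambda>x y z. tsum2 (cop (x \<cdot> be)) (\<lambda>d e. tsum2 hs (\<lambda>u v. F (T (g \<cdot> e \<cdot> (v \<cdot> S y))) (T (f \<cdot> d \<cdot> (u \<cdot> S z))))))" for f g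
    using p_h[of "\<lambda>u v. F (T (g \<cdot> v)) (T (f \<cdot> u))"] by (simp add: assoc)
  have f: "tsum2 (cop b) (\<lambda>d e. tsum2 fs (\<lambda>f g. tsum2 hs (\<lambda>u v. F (T (g \<cdot> e \<cdot> (v \<cdot> S y))) (T (f \<cdot> d \<cdot> (u \<cdot> S z)))))) =
     tsum2 (cop (T b)) (\<lambda>d e. tsum2 fs (\<lambda>f g. tsum2 hs (\<lambda>u v. F (T (S d \<cdot> g \<cdot> (v \<cdot> S y))) (T (S e \<cdot> f \<cdot> (u \<cdot> S z))))))" for b y z
    by (rule f_cop[of "\<lambda>f g. tsum2 hs (\<lambda>u v. F (T (g \<cdot> (v \<cdot> S y))) (T (f \<cdot> (u \<cdot> S z))))"]) simp
  have fh: "tsum2 fs (\<lambda>f g. tsum2 hs (\<lambda>u v. F (T (S d \<cdot> g \<cdot> (v \<cdot> S y))) (T (S e \<cdot> f \<cdot> (u \<cdot> S z))))) = F (y \<cdot> d) (z \<cdot> e)" for d e y z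
    using f_h[of "\<lambda>u v. F (T (S d \<cdot> v \<cdot> S y)) (T (S e \<cdot> u \<cdot> S z))"] by (simp add: T_mul assoc)
  have "tsum2 vs (\<lambda>u v. F u (T be \<cdot> v)) = tsum2 fs (\<lambda>f g. p_sum (\<lambda>u v. F (T (g \<cdot> v)) (T (f \<cdot> (u \<cdot> be)))))"
    by (simp add: tsum_vs T_mul assoc)
  also have "\<dots> = tsum3 pi (\<lambda>x y z. tsum2 (cop (T be \<cdot> T x)) (\<lambda>d e. F (y \<cdot> d) (z \<cdot> e)))"
    unfolding p tsum2_tsum3_swap tsum2_tsum2_swap[of fs "cop a" for a] f fh unfolding T_mul ..
  finally show ?thesis .
qed

sublocale U: partial_evaluation scl mul one S cop eps ph pi al be us
  by unfold_locales (rule U_equivariant U_contract; assumption)+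

text \<open>Reversing all products exchanges the roles of \<phi> and its inverse, since both
  quasi-coassociativity and the pentagon have to be inverted. The inserted unit becomes S^{-1}
  applied to the antipode axiom for \<phi>, and this is the origin of S^{-1}(\<beta>) and
  S^{-1}(\<alpha>) in place of \<alpha> and \<beta>.\<close>

sublocale V: partial_evaluation scl "\<lambda>a b. b \<cdot> a" one T cop eps pi ph "T be" "T al" vs
proof unfold_locales
  show "lin f \<Longrightarrow> tsum3 ph (\<lambda>x y z. f (T z \<cdot> T al \<cdot> y \<cdot> T be \<cdot> T x)) = f \<one>" for f
    using antipode_ph[of "\<lambda>a. f (T a)"] lin_endo[of f] by (simp add: T_mul assoc)
  show "form2 F \<Longrightarrow> tsum2 (cop (b \<cdot> a)) F =
      tsum2 (cop a) (\<lambda>a\<^sub>1 a\<^sub>2. tsum2 (cop b) (\<lambda>b\<^sub>1 b\<^sub>2. F (b\<^sub>1 \<cdot> a\<^sub>1) (b\<^sub>2 \<cdot> a\<^sub>2)))" for F a b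
    by (subst tsum2_tsum2_swap) (rule cop_mul)
  show "form3 F \<Longrightarrow>
      tsum2 (cop a) (\<lambda>a\<^sub>1 a\<^sub>2. tsum2 (cop a\<^sub>2) (\<lambda>b c. tsum3 pi (\<lambda>x y z. F (x \<cdot> a\<^sub>1) (y \<cdot> b) (z \<cdot> c)))) =
      tsum3 pi (\<lambda>x y z. tsum2 (cop a) (\<lambda>a\<^sub>1 a\<^sub>2. tsum2 (cop a\<^sub>1) (\<lambda>b c. F (b \<cdot> x) (c \<cdot> y) (a\<^sub>2 \<cdot> z))))" for F a
    unfolding tsum2_tsum3_swap by (rule coassoc_pi)
qed (assumption | rule mul_add mul_scl T_add T_scl T_mul T_one one_left one_right assoc[symmetric] eps_mul[THEN trans, OF mult.commute] eps_one lin_cop lin_eps counit_left counit_right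
      counit_pi2 pentagon_pi[unfolded assoc[symmetric]] V_equivariant V_contract)+

end

subsection \<open>Evaluation of tensors at multilinear forms\<close>

text \<open>Forms are functions on the ambient type that are constrained on the tuples only. Closure
  under changes off the tuples is therefore a condition of its own, and it lets a form be replaced
  by an expression that is valid on the carrier alone, as happens for the dual space.\<close>

definition good_factors :: "('x, 'k::field) factors \<Rightarrow> bool" where
  "good_factors T \<longleftrightarrow> (\<lambda>_. 0) \<in> forms T \<and>
     (\<forall>F\<in>forms T. \<forall>G\<in>forms T. (\<lambda>x. F x + G x) \<in> forms T) \<and>
     (\<forall>F G. F \<in> forms T \<longrightarrow> (\<forall>x\<in>tuples T. F x = G x) \<longrightarrow> G \<in> forms T)"

definition closed_under :: "'v::ab_group_add set \<Rightarrow> ('k::field \<Rightarrow> 'v \<Rightarrow> 'v) \<Rightarrow> bool" where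
  "closed_under A s \<longleftrightarrow> (\<forall>x\<in>A. \<forall>y\<in>A. x + y \<in> A) \<and> (\<forall>c. \<forall>x\<in>A. s c x \<in> A)"

lemma tuples_single [simp]: "tuples (single_factor A s) = A"
  by (simp add: single_factor_def)

lemma tuples_cons [simp]: "tuples (cons_factor A s T) = A \<times> tuples T"
  by (simp add: cons_factor_def)

lemma forms_single: "B \<in> forms (single_factor A s) \<longleftrightarrow> linear_form_on A s B"
  by (simp add: single_factor_def)

lemma forms_cons: "B \<in> forms (cons_factor A s T) \<longleftrightarrow>
    (\<forall>y\<in>tuples T. linear_form_on A s (\<lambda>x. B (x, y))) \<and> (\<forall>x\<in>A. (\<lambda>y. B (x, y)) \<in> forms T)"
  by (simp add: cons_factor_def)

lemma linear_form_on_cong: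
  assumes A: "closed_under A s" and F: "linear_form_on A s F" and eq: "\<And>x. x \<in> A \<Longrightarrow> F x = G x"
  shows "linear_form_on A s G"
  unfolding linear_form_on_def
proof (intro conjI ballI allI)
  fix x y assume "x \<in> A" "y \<in> A"
  moreover from this have "x + y \<in> A" using A by (simp add: closed_under_def)
  ultimately show "G (x + y) = G x + G y"
    using F eq[of x] eq[of y] eq[of "x + y"] by (simp add: linear_form_on_def)
next
  fix c x assume "x \<in> A"
  moreover from this have "s c x \<in> A" using A by (simp add: closed_under_def)
  ultimately show "G (s c x) = c * G x"
    using F eq[of x] eq[of "s c x"] by (simp add: linear_form_on_def)
qed

lemma linear_form_on_zero: "linear_form_on A s (\<lambda>_. 0)"
  by (simp add: linear_form_on_def)

lemma linear_form_on_add: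
  "linear_form_on A s F \<Longrightarrow> linear_form_on A s G \<Longrightarrow> linear_form_on A s (\<lambda>x. F x + G x)"
  by (simp add: linear_form_on_def algebra_simps)

lemma good_factorsI:
  assumes "(\<lambda>_. 0) \<in> forms T"
    and "\<And>F G. F \<in> forms T \<Longrightarrow> G \<in> forms T \<Longrightarrow> (\<lambda>x. F x + G x) \<in> forms T"
    and "\<And>F G. F \<in> forms T \<Longrightarrow> (\<And>x. x \<in> tuples T \<Longrightarrow> F x = G x) \<Longrightarrow> G \<in> forms T"
  shows "good_factors T"
  unfolding good_factors_def
  by (intro conjI ballI allI impI) (rule assms(1), erule (1) assms(2), erule assms(3), erule (1) bspec)

lemma good_factorsD:
  assumes "good_factors T"
  shows good_zero: "(\<lambda>_. 0) \<in> forms T"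
    and good_add: "F \<in> forms T \<Longrightarrow> G \<in> forms T \<Longrightarrow> (\<lambda>x. F x + G x) \<in> forms T"
    and good_cong: "F \<in> forms T \<Longrightarrow> (\<And>x. x \<in> tuples T \<Longrightarrow> F x = G x) \<Longrightarrow> G \<in> forms T"
proof -
  note good = assms[unfolded good_factors_def]
  show "(\<lambda>_. 0) \<in> forms T" by (rule good[THEN conjunct1])
  show "F \<in> forms T \<Longrightarrow> G \<in> forms T \<Longrightarrow> (\<lambda>x. F x + G x) \<in> forms T"
    by (rule good[THEN conjunct2, THEN conjunct1, rule_format])
  show "F \<in> forms T \<Longrightarrow> (\<And>x. x \<in> tuples T \<Longrightarrow> F x = G x) \<Longrightarrow> G \<in> forms T"
    by (rule good[THEN conjunct2, THEN conjunct2, rule_format])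
qed

lemma good_single:
  assumes "closed_under A s"
  shows "good_factors (single_factor A s)"
proof (rule good_factorsI)
  fix F G assume "F \<in> forms (single_factor A s)" "\<And>x. x \<in> tuples (single_factor A s) \<Longrightarrow> F x = G x"
  then show "G \<in> forms (single_factor A s)"
    unfolding forms_single tuples_single by (rule linear_form_on_cong[OF assms])
qed (simp_all add: forms_single linear_form_on_zero linear_form_on_add)

lemma good_cons:
  assumes A: "closed_under A s" and T: "good_factors T"
  shows "good_factors (cons_factor A s T)"
proof (rule good_factorsI; unfold forms_cons tuples_cons)
  fix F G
  assume F: "(\<forall>y\<in>tuples T. linear_form_on A s (\<lambda>x. F (x, y))) \<and> (\<forall>x\<in>A. (\<lambda>y. F (x, y)) \<in> forms T)"
    and G: "(\<forall>y\<in>tuples T. linear_form_on A s (\<lambda>x. G (x, y))) \<and> (\<forall>x\<in>A. (\<lambda>y. G (x, y)) \<in> forms T)"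
  show "(\<forall>y\<in>tuples T. linear_form_on A s (\<lambda>x. F (x, y) + G (x, y))) \<and>
      (\<forall>x\<in>A. (\<lambda>y. F (x, y) + G (x, y)) \<in> forms T)"
    by (intro conjI ballI linear_form_on_add good_add[OF T])
      (erule F[THEN conjunct1, THEN bspec] G[THEN conjunct1, THEN bspec]
        F[THEN conjunct2, THEN bspec] G[THEN conjunct2, THEN bspec])+
next
  fix F G
  assume F: "(\<forall>y\<in>tuples T. linear_form_on A s (\<lambda>x. F (x, y))) \<and> (\<forall>x\<in>A. (\<lambda>y. F (x, y)) \<in> forms T)"
    and eq: "\<And>x. x \<in> A \<times> tuples T \<Longrightarrow> F x = G x"
  show "(\<forall>y\<in>tuples T. linear_form_on A s (\<lambda>x. G (x, y))) \<and> (\<forall>x\<in>A. (\<lambda>y. G (x, y)) \<in> forms T)"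
  proof (intro conjI ballI)
    fix y assume y: "y \<in> tuples T"
    show "linear_form_on A s (\<lambda>x. G (x, y))"
      by (rule linear_form_on_cong[OF A F[THEN conjunct1, THEN bspec, OF y]]) (simp add: eq y)
  next
    fix x assume x: "x \<in> A"
    show "(\<lambda>y. G (x, y)) \<in> forms T"
      by (rule good_cong[OF T F[THEN conjunct2, THEN bspec, OF x]]) (simp add: eq x)
  qed
qed (intro conjI ballI linear_form_on_zero good_zero[OF T])

lemma good_sum_list:
  assumes T: "good_factors T" and "\<And>y. y \<in> set ys \<Longrightarrow> (\<lambda>x. F x y) \<in> forms T"
  shows "(\<lambda>x. \<Sum>y\<leftarrow>ys. F x y) \<in> forms T"
  using assms(2)
proof (induction ys)
  case Nil
  show ?case using good_zero[OF T] by simp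
next
  case (Cons y ys)
  have "(\<lambda>x. F x y + (\<Sum>y\<leftarrow>ys. F x y)) \<in> forms T"
    by (rule good_add[OF T]) (simp_all add: Cons)
  then show ?case by simp
qed

lemma sum_list_swap:
  "(\<Sum>x\<leftarrow>xs. \<Sum>y\<leftarrow>ys. F x y) = (\<Sum>y\<leftarrow>ys. \<Sum>x\<leftarrow>xs. F x y)"
  for F :: "'a \<Rightarrow> 'b \<Rightarrow> 'c::comm_monoid_add"
  by (induction xs) (simp_all add: sum_list_addf)

section \<open>Representing lists and the evaluation of Sweedler sums\<close>

definition tlist :: "('x, 'k::field) factors \<Rightarrow> ('x, 'k) tensor \<Rightarrow> 'x list" where
  "tlist T t = (SOME xs. set xs \<subseteq> tuples T \<and> t = (\<Sum>x\<leftarrow>xs. pure_tensor T x))"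

lemma tlist:
  assumes "t \<in> tensors T"
  shows set_tlist: "set (tlist T t) \<subseteq> tuples T" and sum_tlist: "(\<Sum>x\<leftarrow>tlist T t. pure_tensor T x) = t"
proof -
  have "\<exists>xs. set xs \<subseteq> tuples T \<and> t = (\<Sum>x\<leftarrow>xs. pure_tensor T x)"
    using assms unfolding tensors_def by blast
  from someI_ex[OF this] show "set (tlist T t) \<subseteq> tuples T" "(\<Sum>x\<leftarrow>tlist T t. pure_tensor T x) = t"
    unfolding tlist_def by auto
qed

lemma sum_pure_apply:
  "(\<Sum>x\<leftarrow>xs. pure_tensor T x) B = (if B \<in> forms T then \<Sum>x\<leftarrow>xs. B x else 0)"
  by (simp add: sum_list_fun_apply pure_tensor_def)

lemma tensor_apply:
  assumes "t \<in> tensors T" "B \<in> forms T"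
  shows "t B = (\<Sum>x\<leftarrow>tlist T t. B x)"
  using sum_pure_apply[of T "tlist T t" B] sum_tlist[OF assms(1)] assms(2) by simp

lemma tensor_outside:
  assumes "t \<in> tensors T" "B \<notin> forms T"
  shows "t B = 0"
  using sum_pure_apply[of T "tlist T t" B] sum_tlist[OF assms(1)] assms(2) by simp

text \<open>A pure tensor has the default value 0 on functions that are not forms, so tensors cannot
  differ there.\<close>

lemma tensor_eqI:
  assumes "t \<in> tensors T" "t' \<in> tensors T" "\<And>B. B \<in> forms T \<Longrightarrow> t B = t' B"
  shows "t = t'"
proof
  fix B show "t B = t' B"
    by (cases "B \<in> forms T") (simp_all add: assms tensor_outside[OF assms(1)] tensor_outside[OF assms(2)])
qed

lemma tensor_zero: "0 \<in> tensors T"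
  unfolding tensors_def by (rule CollectI, rule exI[of _ "[]"]) simp

lemma tensor_add:
  assumes "t \<in> tensors T" "t' \<in> tensors T"
  shows "t + t' \<in> tensors T"
proof -
  obtain xs ys where "set xs \<subseteq> tuples T" "t = (\<Sum>x\<leftarrow>xs. pure_tensor T x)"
      "set ys \<subseteq> tuples T" "t' = (\<Sum>x\<leftarrow>ys. pure_tensor T x)"
    using assms unfolding tensors_def by blast
  then show ?thesis unfolding tensors_def by (intro CollectI exI[of _ "xs @ ys"]) auto
qed

lemma tensor_pure: "x \<in> tuples T \<Longrightarrow> pure_tensor T x \<in> tensors T"
  unfolding tensors_def by (intro CollectI exI[of _ "[x]"]) auto

lemma tensor_sum_list: "(\<And>x. x \<in> set xs \<Longrightarrow> f x \<in> tensors T) \<Longrightarrow> (\<Sum>x\<leftarrow>xs. f x) \<in> tensors T"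
  by (induction xs) (auto simp: tensor_zero tensor_add)

text \<open>For function-valued F the independence of the representation can be tested at each point
  B, because evaluation at B is linear. Tensors are functions, so this evaluates every tensor-valued
  Sweedler sum.\<close>

lemma sweedler_fun:
  assumes t: "t \<in> tensors T" and F: "\<And>B. (\<lambda>x. F x B) \<in> forms T"
  shows "sweedler T t F = (\<lambda>B. t (\<lambda>x. F x B))"
  unfolding sweedler_def
proof (rule the_equality)
  show "\<exists>xs. set xs \<subseteq> tuples T \<and> t = (\<Sum>x\<leftarrow>xs. pure_tensor T x) \<and> (\<lambda>B. t (\<lambda>x. F x B)) = (\<Sum>x\<leftarrow>xs. F x)"
    using tlist[OF t] tensor_apply[OF t F]
    by (intro exI[of _ "tlist T t"]) (auto simp: fun_eq_iff sum_list_fun_apply)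
next
  fix y assume "\<exists>xs. set xs \<subseteq> tuples T \<and> t = (\<Sum>x\<leftarrow>xs. pure_tensor T x) \<and> y = (\<Sum>x\<leftarrow>xs. F x)"
  then show "y = (\<lambda>B. t (\<lambda>x. F x B))"
    using F by (auto simp: fun_eq_iff sum_list_fun_apply pure_tensor_def)
qed

lemma sweedler_fun_list:
  assumes t: "t \<in> tensors T" and F: "\<And>B. (\<lambda>x. F x B) \<in> forms T"
  shows "sweedler T t F = (\<Sum>x\<leftarrow>tlist T t. F x)"
  using tensor_apply[OF t F] by (simp add: sweedler_fun[OF assms] fun_eq_iff sum_list_fun_apply)

lemma sweedler_in:
  assumes t: "t \<in> tensors T" and F: "\<And>B. (\<lambda>x. F x B) \<in> forms T"
    and "\<And>x. x \<in> tuples T \<Longrightarrow> F x \<in> tensors T'"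
  shows "sweedler T t F \<in> tensors T'"
  unfolding sweedler_fun_list[OF t F]
  using assms(3) set_tlist[OF t] by (intro tensor_sum_list) auto

text \<open>The counterpart for sums with values in an abstract vector space, such as H or M: they
  are seen through their images under linear functionals.\<close>

lemma sweedler_linear:
  assumes t: "t \<in> tensors T" and s: "vector_space s" and g: "Vector_Spaces.linear s (*) g"
    and F: "\<And>g. Vector_Spaces.linear s (*) g \<Longrightarrow> (\<lambda>x. g (F x)) \<in> forms T"
  shows "g (sweedler T t F) = t (\<lambda>x. g (F x))"
proof -
  interpret g: Vector_Spaces.linear s "(*)" g by fact
  have gsum: "g (\<Sum>x\<leftarrow>xs. F x) = (\<Sum>x\<leftarrow>xs. g (F x))" for xs
    by (induction xs) (auto simp: g.add)
  have "sweedler T t F = (\<Sum>x\<leftarrow>tlist T t. F x)"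
    using sweedler_sum_list[OF s F set_tlist[OF t]] sum_tlist[OF t] by simp
  then show ?thesis
    by (simp add: gsum tensor_apply[OF t F[OF g]])
qed

lemma pure_tensor_form:
  assumes "good_factors T" "B \<in> forms T' \<Longrightarrow> (\<lambda>x. B (op x)) \<in> forms T"
  shows "(\<lambda>x. pure_tensor T' (op x) B) \<in> forms T"
  using assms by (cases "B \<in> forms T'") (simp_all add: pure_tensor_def good_zero)

lemma tensor_apply_form:
  assumes t: "t \<in> tensors T'" and T: "good_factors T"
    and a: "\<And>x. x \<in> tuples T \<Longrightarrow> G x \<in> forms T'"
    and b: "\<And>y. y \<in> tuples T' \<Longrightarrow> (\<lambda>x. G x y) \<in> forms T"
  shows "(\<lambda>x. t (G x)) \<in> forms T"
proof (rule good_cong[OF T])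
  show "(\<lambda>x. \<Sum>y\<leftarrow>tlist T' t. G x y) \<in> forms T"
    using b set_tlist[OF t] by (intro good_sum_list[OF T]) auto
qed (simp add: tensor_apply[OF t a])

lemma factorwise:
  assumes x: "x \<in> tensors T1" and y: "y \<in> tensors T2" and T1: "good_factors T1" and T2: "good_factors T2"
    and op: "\<And>a b. a \<in> tuples T1 \<Longrightarrow> b \<in> tuples T2 \<Longrightarrow> op a b \<in> tuples T3"
    and l: "\<And>B b. B \<in> forms T3 \<Longrightarrow> b \<in> tuples T2 \<Longrightarrow> (\<lambda>a. B (op a b)) \<in> forms T1"
    and r: "\<And>B a. B \<in> forms T3 \<Longrightarrow> a \<in> tuples T1 \<Longrightarrow> (\<lambda>b. B (op a b)) \<in> forms T2"
  shows factorwise_in: "factorwise T1 T2 T3 op x y \<in> tensors T3"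
    and factorwise_apply: "\<And>B. B \<in> forms T3 \<Longrightarrow> factorwise T1 T2 T3 op x y B = x (\<lambda>a. y (\<lambda>b. B (op a b)))"
proof -
  have inner_form: "(\<lambda>b. pure_tensor T3 (op a b) B) \<in> forms T2" if "a \<in> tuples T1" for a B
    by (intro pure_tensor_form[OF T2] r that)
  have inner: "sweedler T2 y (\<lambda>b. pure_tensor T3 (op a b)) B = y (\<lambda>b. pure_tensor T3 (op a b) B)"
    if "a \<in> tuples T1" for a B
    by (simp add: sweedler_fun[OF y inner_form[OF that]])
  \<comment> \<open>The evaluation \<open>inner\<close> of the inner sum holds for tuples a only;
    \<open>good_cong\<close> extends the form property to the expression as it stands.\<close>
  have outer_form: "(\<lambda>a. sweedler T2 y (\<lambda>b. pure_tensor T3 (op a b)) B) \<in> forms T1" for B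
  proof (rule good_cong[OF T1 _ inner[symmetric]])
    show "(\<lambda>a. y (\<lambda>b. pure_tensor T3 (op a b) B)) \<in> forms T1"
      by (intro tensor_apply_form[OF y T1] inner_form pure_tensor_form[OF T1] l)
  qed
  show "factorwise T1 T2 T3 op x y \<in> tensors T3"
    unfolding factorwise_def
    by (intro sweedler_in[OF x outer_form] sweedler_in[OF y inner_form] tensor_pure op)
  fix B assume B: "B \<in> forms T3"
  have B_pure: "pure_tensor T3 (op a b) B = B (op a b)" for a b
    by (simp add: pure_tensor_def B)
  have "(\<lambda>a. y (\<lambda>b. B (op a b))) \<in> forms T1"
    by (intro tensor_apply_form[OF y T1] l r B)
  then show "factorwise T1 T2 T3 op x y B = x (\<lambda>a. y (\<lambda>b. B (op a b)))"
    unfolding factorwise_def sweedler_fun[OF x outer_form] tensor_apply[OF x outer_form]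
    using set_tlist[OF x] by (subst tensor_apply[OF x]) (auto intro!: arg_cong[of _ _ sum_list] simp: inner B_pure subset_iff)
qed

section \<open>Tensor powers as algebras and algebra maps between them\<close>

locale tuple_algebra =
  fixes T :: "('x, 'k::field) factors" and op :: "'x \<Rightarrow> 'x \<Rightarrow> 'x" and e :: 'x
  assumes good: "good_factors T"
    and tuples_UNIV [simp]: "tuples T = UNIV"
    and form_left: "B \<in> forms T \<Longrightarrow> (\<lambda>a. B (op a b)) \<in> forms T"
    and form_right: "B \<in> forms T \<Longrightarrow> (\<lambda>b. B (op a b)) \<in> forms T"
    and op_assoc: "op (op a b) c = op a (op b c)"
    and op_unit [simp]: "op e a = a" "op a e = a"
begin

abbreviation times :: "('x, 'k) tensor \<Rightarrow> ('x, 'k) tensor \<Rightarrow> ('x, 'k) tensor" (infixl "\<star>" 70) where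
  "x \<star> y \<equiv> factorwise T T T op x y"

lemma times_in: "x \<in> tensors T \<Longrightarrow> y \<in> tensors T \<Longrightarrow> x \<star> y \<in> tensors T"
  by (rule factorwise_in) (auto intro: good form_left form_right)

lemma times_apply: "x \<in> tensors T \<Longrightarrow> y \<in> tensors T \<Longrightarrow> B \<in> forms T \<Longrightarrow>
    (x \<star> y) B = x (\<lambda>a. y (\<lambda>b. B (op a b)))"
  by (rule factorwise_apply) (auto intro: good form_left form_right)

lemma times_form: "y \<in> tensors T \<Longrightarrow> B \<in> forms T \<Longrightarrow> (\<lambda>a. y (\<lambda>b. B (op a b))) \<in> forms T"
  by (rule tensor_apply_form) (auto intro: good form_left form_right)

lemma times_assoc:
  assumes "x \<in> tensors T" "y \<in> tensors T" "z \<in> tensors T"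
  shows "(x \<star> y) \<star> z = x \<star> (y \<star> z)"
  by (rule tensor_eqI[of _ T])
    (simp_all add: assms times_in times_apply times_form form_left form_right op_assoc)

lemma unit_in: "pure_tensor T e \<in> tensors T"
  by (rule tensor_pure) simp

lemma times_unit:
  assumes "x \<in> tensors T"
  shows "pure_tensor T e \<star> x = x" "x \<star> pure_tensor T e = x"
proof -
  have unit: "pure_tensor T e B = B e" if "B \<in> forms T" for B
    using that by (simp add: pure_tensor_def)
  show "pure_tensor T e \<star> x = x" "x \<star> pure_tensor T e = x"
    by (rule tensor_eqI[of _ T]; simp add: assms times_in times_apply unit_in times_form unit form_left form_right)+
qed

lemma inverse_unique:
  assumes "x \<in> tensors T" "y \<in> tensors T" "z \<in> tensors T"
    and "y \<star> x = pure_tensor T e" "x \<star> z = pure_tensor T e"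
  shows "y = z"
  using times_assoc[of y x z] times_unit[of y] times_unit[of z] assms by simp

lemma move_right:
  assumes "x \<in> tensors T" "x' \<in> tensors T" "y \<in> tensors T" "x \<star> x' = pure_tensor T e" "y \<star> x = z"
  shows "y = z \<star> x'"
  using times_assoc[of y x x'] times_unit[of y] assms by auto

end

lemma linear_form_on_UNIV: "linear_form_on UNIV scl B \<longleftrightarrow> scalar_forms.lin scl B"
  by (simp add: linear_form_on_def scalar_forms.lin_def)

lemma closed_UNIV [simp]: "closed_under UNIV s"
  by (simp add: closed_under_def)

lemma tuple_algebra_cons:
  fixes scl :: "'k::field \<Rightarrow> 'h::ring_1 \<Rightarrow> 'h"
  assumes T: "tuple_algebra T op e"
    and lin: "\<And>B a. linear_form_on UNIV scl B \<Longrightarrow> linear_form_on UNIV scl (\<lambda>x. B (x * a))"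
       "\<And>B a. linear_form_on UNIV scl B \<Longrightarrow> linear_form_on UNIV scl (\<lambda>x. B (a * x))"
  shows "tuple_algebra (cons_factor UNIV scl T) (pair_op (*) op) (1, e)"
proof -
  interpret tuple_algebra T op e by fact
  show ?thesis
    by unfold_locales
      (auto simp: good_cons good pair_op_def forms_cons op_assoc mult.assoc intro: lin form_left form_right)
qed

text \<open>The extension to all tensors of a linear, multiplicative and unital map given on tuples.
  All five ways of placing \<Delta> or 1 in the pentagon are instances, so inverses are carried to
  inverses.\<close>

locale tensor_map =
  S: tuple_algebra T op e + T: tuple_algebra T' op' e'
  for T :: "('x, 'k::field) factors" and op e and T' :: "('y, 'k) factors" and op' e' +
  fixes f :: "'x \<Rightarrow> ('y, 'k) tensor"
  assumes f_form: "(\<lambda>x. f x B) \<in> forms T"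
    and f_in: "f x \<in> tensors T'"
    and f_op: "f (op a b) = factorwise T' T' T' op' (f a) (f b)"
    and f_unit: "f e = pure_tensor T' e'"
begin

lemma map_in: "x \<in> tensors T \<Longrightarrow> sweedler T x f \<in> tensors T'"
  by (rule sweedler_in) (simp_all add: f_form f_in)

lemma map_apply: "x \<in> tensors T \<Longrightarrow> sweedler T x f B = x (\<lambda>a. f a B)"
  by (simp add: sweedler_fun f_form)

lemma tensor_swap:
  assumes x: "x \<in> tensors T" and t: "t \<in> tensors T'"
    and G: "\<And>a. G a \<in> forms T'" "\<And>b. (\<lambda>a. G a b) \<in> forms T"
  shows "x (\<lambda>a. t (\<lambda>b. G a b)) = t (\<lambda>b. x (\<lambda>a. G a b))"
proof -
  have 1: "(\<lambda>a. t (\<lambda>b. G a b)) \<in> forms T"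
    by (rule tensor_apply_form[OF t S.good]) (simp_all add: G)
  have 2: "(\<lambda>b. x (\<lambda>a. G a b)) \<in> forms T'"
    by (rule tensor_apply_form[OF x T.good]) (simp_all add: G)
  show ?thesis
    unfolding tensor_apply[OF x 1] tensor_apply[OF t 2]
    unfolding tensor_apply[OF x G(2)] tensor_apply[OF t G(1)] by (rule sum_list_swap)
qed

lemma map_times:
  assumes x: "x \<in> tensors T" and y: "y \<in> tensors T"
  shows "sweedler T (S.times x y) f = T.times (sweedler T x f) (sweedler T y f)"
proof (rule tensor_eqI[of _ T'])
  fix B assume B: "B \<in> forms T'"
  \<comment> \<open>The two sides of multiplicativity are fourfold sums that differ in the order of
    the middle two.\<close>
  have 1: "f a (\<lambda>u. y (\<lambda>b. f b (\<lambda>v. B (op' u v)))) = y (\<lambda>b. f a (\<lambda>u. f b (\<lambda>v. B (op' u v))))" for a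
    by (rule tensor_swap[symmetric])
      (simp_all add: y f_in f_form T.times_form B)
  show "sweedler T (S.times x y) f B = T.times (sweedler T x f) (sweedler T y f) B"
    using x y B
    by (simp add: map_apply map_in S.times_in S.times_apply T.times_apply f_form f_op f_in 1 T.times_form)
qed (simp_all add: assms map_in S.times_in T.times_in)

lemma map_unit: "sweedler T (pure_tensor T e) f = pure_tensor T' e'"
  by (simp add: sweedler_fun[OF S.unit_in f_form]) (simp add: pure_tensor_def f_form f_unit)

end

subsection \<open>From tensors to lists\<close>

context quasi_hopf_algebra
begin

sublocale scalar_forms scl .

sublocale alg: algebra_forms scl "(*)" 1 S
proof unfold_locales
  interpret Vector_Spaces.linear scl scl S by (rule S_linear)
  show "S (a + b) = S a + S b" "S (scl k a) = scl k (S a)" for a b k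
    by (simp_all add: add scale)
qed (simp_all add: mult.assoc ring_distribs scl_mult_left scl_mult_right S_mult S_one)

lemma forms_H1: "B \<in> forms H1 \<longleftrightarrow> lin B"
  by (simp add: forms_single linear_form_on_UNIV)

lemma forms_H2: "B \<in> forms H2 \<longleftrightarrow> form2 (\<lambda>a b. B (a, b))"
  by (auto simp: forms_cons forms_H1 linear_form_on_UNIV form_defs)

lemma forms_H3: "B \<in> forms H3 \<longleftrightarrow> form3 (\<lambda>a b c. B (a, b, c))"
  by (auto simp: forms_cons[of _ _ _ H2] forms_H2 linear_form_on_UNIV form_defs)

lemma forms_H4: "B \<in> forms H4 \<longleftrightarrow> form4 (\<lambda>a b c d. B (a, b, c, d))"
  by (auto simp: forms_cons[of _ _ _ H3] forms_H3 linear_form_on_UNIV form_defs)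

lemma tuple_algebra_H1: "tuple_algebra H1 (*) 1"
  by unfold_locales (auto simp: good_single forms_H1 mult.assoc intro: lin_endo)

lemma tuple_algebra_H:
  "tuple_algebra T op e \<Longrightarrow> tuple_algebra (cons_factor UNIV scl T) (pair_op (*) op) (1, e)"
  by (rule tuple_algebra_cons)
    (simp_all add: linear_form_on_UNIV lin_def ring_distribs scl_mult_left scl_mult_right)

sublocale A2: tuple_algebra H2 op2 "(1, 1)"
  by (rule tuple_algebra_H[OF tuple_algebra_H1])

sublocale A3: tuple_algebra H3 op3 "(1, 1, 1)"
  by (rule tuple_algebra_H[OF A2.tuple_algebra_axioms])

sublocale A4: tuple_algebra H4 op4 "(1, 1, 1, 1)"
  by (rule tuple_algebra_H[OF A3.tuple_algebra_axioms])

lemma op_simps [simp]: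
  "op2 (a, b) (a', b') = (a * a', b * b')"
  "op3 (a, b, c) (a', b', c') = (a * a', b * b', c * c')"
  "op4 (a, b, c, d) (a', b', c', d') = (a * a', b * b', c * c', d * d')"
  by (simp_all add: pair_op_def)

section \<open>Representing lists for the coproduct and the associator\<close>

definition cop :: "'h \<Rightarrow> ('h \<times> 'h) list" where "cop a = tlist H2 (\<Delta> a)"
definition ph :: "('h \<times> 'h \<times> 'h) list" where "ph = tlist H3 \<phi>"
definition pi :: "('h \<times> 'h \<times> 'h) list" where "pi = tlist H3 \<phi>_inv"

lemma \<Delta>_apply: "B \<in> forms H2 \<Longrightarrow> \<Delta> a B = tsum2 (cop a) (\<lambda>b c. B (b, c))"
  by (simp add: tensor_apply[OF \<Delta>_in] tsum2_def cop_def)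

lemma \<phi>_apply: "B \<in> forms H3 \<Longrightarrow> \<phi> B = tsum3 ph (\<lambda>x y z. B (x, y, z))"
  by (simp add: tensor_apply[OF \<phi>_in] tsum3_def ph_def)

lemma \<phi>_inv: "is_inverse3 \<phi> \<phi>_inv"
proof -
  obtain \<psi> where \<psi>: "is_inverse3 \<phi> \<psi>" using \<phi>_invertible by blast
  have "\<chi> = \<psi>" if "is_inverse3 \<phi> \<chi>" for \<chi>
    using A3.inverse_unique[OF \<phi>_in, of \<chi> \<psi>] that \<psi> by (simp add: is_inverse3_def mult3_def one3_def)
  then show ?thesis unfolding \<phi>_inv_def using \<psi> by (rule theI[of "is_inverse3 \<phi>", rotated])
qed

lemma \<phi>_inv_in: "\<phi>_inv \<in> tensors H3"
  and \<phi>_\<phi>_inv: "A3.times \<phi> \<phi>_inv = pure_tensor H3 (1, 1, 1)"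
  and \<phi>_inv_\<phi>: "A3.times \<phi>_inv \<phi> = pure_tensor H3 (1, 1, 1)"
  using \<phi>_inv by (simp_all add: is_inverse3_def mult3_def one3_def)

lemma \<phi>_inv_apply: "B \<in> forms H3 \<Longrightarrow> \<phi>_inv B = tsum3 pi (\<lambda>x y z. B (x, y, z))"
  by (simp add: tensor_apply[OF \<phi>_inv_in] tsum3_def pi_def)

lemma cop_one: "form2 F \<Longrightarrow> tsum2 (cop 1) F = F 1 1"
  using \<Delta>_apply[of "\<lambda>(a, b). F a b" 1] by (simp add: forms_H2 \<Delta>_one one2_def pure_tensor_def)

lemma cop_mul:
  assumes F: "form2 F"
  shows "tsum2 (cop (a * b)) F =
      tsum2 (cop a) (\<lambda>a\<^sub>1 a\<^sub>2. tsum2 (cop b) (\<lambda>b\<^sub>1 b\<^sub>2. F (a\<^sub>1 * b\<^sub>1) (a\<^sub>2 * b\<^sub>2)))"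
proof -
  note [simp] = form_defs form2D[OF F]
  have B: "(\<lambda>(a, b). F a b) \<in> forms H2" by (simp add: forms_H2)
  have "tsum2 (cop (a * b)) F = \<Delta> (a * b) (\<lambda>(a, b). F a b)"
    using \<Delta>_apply[OF B] by simp
  also have "\<dots> = \<Delta> a (\<lambda>x. \<Delta> b (\<lambda>y. (\<lambda>(a, b). F a b) (op2 x y)))"
    unfolding \<Delta>_mult mult2_def by (rule A2.times_apply[OF \<Delta>_in \<Delta>_in B])
  finally show ?thesis
    unfolding \<Delta>_apply[OF A2.times_form[OF \<Delta>_in B]] unfolding \<Delta>_apply[OF A2.form_right[OF B]] by simp
qed

lemma lin_\<Delta>: "lin (\<lambda>a. \<Delta> a B)"
proof -
  interpret Vector_Spaces.linear scl fscale \<Delta> by (rule \<Delta>_linear)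
  show ?thesis by (simp add: lin_def add scale fscale_def)
qed

lemma lin_cop: "form2 F \<Longrightarrow> lin (\<lambda>a. tsum2 (cop a) F)"
  using lin_\<Delta>[of "\<lambda>(a, b). F a b"] by (simp add: \<Delta>_apply forms_H2)

lemma lin_cop_endo [simp]: "form2 F \<Longrightarrow> endo g \<Longrightarrow> lin (\<lambda>x. tsum2 (cop (g x)) F)"
  by (rule lin_endo[OF lin_cop])

lemma form4D:
  assumes "form4 B"
  shows "endo g \<Longrightarrow> lin (\<lambda>x. B (g x) b c d)" "endo g \<Longrightarrow> lin (\<lambda>x. B a (g x) c d)"
    "endo g \<Longrightarrow> lin (\<lambda>x. B a b (g x) d)" "endo g \<Longrightarrow> lin (\<lambda>x. B a b c (g x))"
  using assms by (auto simp: form4_def lin_def endo_def)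

lemma leg:
  assumes "good_factors T" "tuples T = UNIV" "\<And>B. B \<in> forms T \<Longrightarrow> form2 (\<lambda>d e. B (\<iota> d e))"
  shows leg_in: "sweedler H2 (\<Delta> a) (\<lambda>(d, e). pure_tensor T (\<iota> d e)) \<in> tensors T"
    and leg_apply: "\<And>B. B \<in> forms T \<Longrightarrow>
      sweedler H2 (\<Delta> a) (\<lambda>(d, e). pure_tensor T (\<iota> d e)) B = tsum2 (cop a) (\<lambda>d e. B (\<iota> d e))"
proof -
  have F: "(\<lambda>x. (\<lambda>(d, e). pure_tensor T (\<iota> d e)) x B) \<in> forms H2" for B
    using assms(3)[of B] by (cases "B \<in> forms T") (simp_all add: forms_H2 pure_tensor_def form_defs)
  show "sweedler H2 (\<Delta> a) (\<lambda>(d, e). pure_tensor T (\<iota> d e)) \<in> tensors T"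
    by (rule sweedler_in[OF \<Delta>_in F]) (auto intro!: tensor_pure simp: assms(2))
  fix B assume "B \<in> forms T"
  then show "sweedler H2 (\<Delta> a) (\<lambda>(d, e). pure_tensor T (\<iota> d e)) B = tsum2 (cop a) (\<lambda>d e. B (\<iota> d e))"
    using F[of B] by (simp add: sweedler_fun[OF \<Delta>_in F] \<Delta>_apply) (simp add: pure_tensor_def)
qed

text \<open>A common template for the three maps that apply \<Delta> to one leg of a triple:
  \<open>g\<close> selects the leg, and \<open>j\<close> puts its two halves back among the other
  legs. Multiplicativity reduces to that of \<Delta> in the selected leg.\<close>

lemma leg_map:
  assumes f: "\<And>x. f x = sweedler H2 (\<Delta> (g x)) (\<lambda>(d, e). pure_tensor H4 (j x d e))"
    and g: "\<And>x y. g (op3 x y) = g x * g y" "g (1, 1, 1) = 1"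
    and j: "\<And>x y d e d' e'. j (op3 x y) (d * d') (e * e') = op4 (j x d e) (j y d' e')"
      "j (1, 1, 1) 1 1 = (1, 1, 1, 1)"
    and form: "\<And>B x. B \<in> forms H4 \<Longrightarrow> form2 (\<lambda>d e. B (j x d e))"
      "\<And>B. B \<in> forms H4 \<Longrightarrow> (\<lambda>x. tsum2 (cop (g x)) (\<lambda>d e. B (j x d e))) \<in> forms H3"
  shows "tensor_map H3 op3 (1, 1, 1) H4 op4 (1, 1, 1, 1) f"
    and "x \<in> tensors H3 \<Longrightarrow> B \<in> forms H4 \<Longrightarrow>
      sweedler H3 x f B = x (\<lambda>a. tsum2 (cop (g a)) (\<lambda>d e. B (j a d e)))"
proof -
  have f_in: "f x \<in> tensors H4" for x
    unfolding f by (rule leg_in) (simp_all add: A4.good form)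
  have f_apply: "f x B = tsum2 (cop (g x)) (\<lambda>d e. B (j x d e))" if "B \<in> forms H4" for x B
    unfolding f by (rule leg_apply) (simp_all add: A4.good form that)
  have f_form: "(\<lambda>x. f x B) \<in> forms H3" for B
  proof (cases "B \<in> forms H4")
    case True
    then show ?thesis using form(2) by (simp add: f_apply)
  next
    case False
    then show ?thesis using good_zero[OF A3.good] by (simp add: tensor_outside[OF f_in])
  qed
  have f_op: "f (op3 x y) = A4.times (f x) (f y)" for x y
  proof (rule tensor_eqI[of _ H4])
    fix B assume B: "B \<in> forms H4"
    have 1: "f y (\<lambda>v. B (op4 u v)) = tsum2 (cop (g y)) (\<lambda>d' e'. B (op4 u (j y d' e')))" for u
      by (rule f_apply[OF A4.form_right[OF B]])
    show "f (op3 x y) B = A4.times (f x) (f y) B"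
      unfolding A4.times_apply[OF f_in f_in B] f_apply[OF B]
      unfolding f_apply[OF A4.times_form[OF f_in B]]
      unfolding 1 g by (simp only: cop_mul[OF form(1)[OF B]] j)
  qed (simp_all add: f_in A4.times_in)
  have f_unit: "f (1, 1, 1) = pure_tensor H4 (1, 1, 1, 1)"
    by (rule tensor_eqI[of _ H4]) (simp_all add: f_apply f_in A4.unit_in g j cop_one[OF form(1)], simp add: pure_tensor_def)
  show map: "tensor_map H3 op3 (1, 1, 1) H4 op4 (1, 1, 1, 1) f"
    by unfold_locales (fact f_form f_in f_op f_unit)+
  interpret tensor_map H3 op3 "(1, 1, 1)" H4 op4 "(1, 1, 1, 1)" f by (rule map)
  show "sweedler H3 x f B = x (\<lambda>a. tsum2 (cop (g a)) (\<lambda>d e. B (j a d e)))"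
    if "x \<in> tensors H3" "B \<in> forms H4"
    using that by (simp add: map_apply f_apply)
qed

lemma pure_map:
  assumes j: "\<And>x y. j (op3 x y) = op4 (j x) (j y)" "j (1, 1, 1) = (1, 1, 1, 1)"
    and form: "\<And>B. B \<in> forms H4 \<Longrightarrow> (\<lambda>x. B (j x)) \<in> forms H3"
  shows "tensor_map H3 op3 (1, 1, 1) H4 op4 (1, 1, 1, 1) (\<lambda>x. pure_tensor H4 (j x))"
    and "x \<in> tensors H3 \<Longrightarrow> B \<in> forms H4 \<Longrightarrow>
      sweedler H3 x (\<lambda>x. pure_tensor H4 (j x)) B = x (\<lambda>a. B (j a))"
proof -
  have f_op: "pure_tensor H4 (j (op3 x y)) = A4.times (pure_tensor H4 (j x)) (pure_tensor H4 (j y))" for x y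
    by (rule tensor_eqI[of _ H4])
      (simp_all add: j tensor_pure A4.times_in A4.times_apply, simp add: pure_tensor_def A4.form_left A4.form_right)
  show map: "tensor_map H3 op3 (1, 1, 1) H4 op4 (1, 1, 1, 1) (\<lambda>x. pure_tensor H4 (j x))"
    by unfold_locales (simp_all add: f_op pure_tensor_form A3.good form tensor_pure j(2))
  interpret tensor_map H3 op3 "(1, 1, 1)" H4 op4 "(1, 1, 1, 1)" "\<lambda>x. pure_tensor H4 (j x)" by (rule map)
  show "sweedler H3 x (\<lambda>x. pure_tensor H4 (j x)) B = x (\<lambda>a. B (j a))"
    if "x \<in> tensors H3" "B \<in> forms H4"
    using that by (simp add: map_apply) (simp add: pure_tensor_def)
qed

lemma \<Delta>_id_id:
  assumes "x \<in> tensors H3"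
  shows \<Delta>_id_id_in: "\<Delta>_id_id x \<in> tensors H4"
    and \<Delta>_id_id_times: "y \<in> tensors H3 \<Longrightarrow> \<Delta>_id_id (A3.times x y) = A4.times (\<Delta>_id_id x) (\<Delta>_id_id y)"
    and \<Delta>_id_id_one: "\<Delta>_id_id (pure_tensor H3 (1, 1, 1)) = pure_tensor H4 (1, 1, 1, 1)"
    and \<Delta>_id_id_apply: "\<forall>B\<in>forms H4.
      \<Delta>_id_id x B = tsum3 (tlist H3 x) (\<lambda>a b c. tsum2 (cop a) (\<lambda>d e. B (d, e, b, c)))"
proof -
  let ?f = "\<lambda>(a, b, c). sweedler H2 (\<Delta> a) (\<lambda>(d, e). pure_tensor H4 (d, e, b, c))"
  have form: "form2 (\<lambda>d e. B (d, e, b, c))" "(\<lambda>(a, b, c). tsum2 (cop a) (\<lambda>d e. B (d, e, b, c))) \<in> forms H3"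
    if "B \<in> forms H4" for B a b c
    using form4D[of "\<lambda>a b c d. B (a, b, c, d)"] that by (simp_all add: forms_H4 forms_H3 form2_def form3_def)
  note map = leg_map[of ?f "\<lambda>(a, b, c). a" "\<lambda>(a, b, c) d e. (d, e, b, c)"]
  interpret tensor_map H3 op3 "(1, 1, 1)" H4 op4 "(1, 1, 1, 1)" ?f
    by (rule map(1)) (auto simp: split_beta' dest: form)
  show "\<Delta>_id_id x \<in> tensors H4"
    "y \<in> tensors H3 \<Longrightarrow> \<Delta>_id_id (A3.times x y) = A4.times (\<Delta>_id_id x) (\<Delta>_id_id y)"
    "\<Delta>_id_id (pure_tensor H3 (1, 1, 1)) = pure_tensor H4 (1, 1, 1, 1)"
    unfolding \<Delta>_id_id_def by (rule map_in[OF assms], rule map_times[OF assms], assumption, rule map_unit)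
  show "\<forall>B\<in>forms H4. \<Delta>_id_id x B = tsum3 (tlist H3 x) (\<lambda>a b c. tsum2 (cop a) (\<lambda>d e. B (d, e, b, c)))"
  proof
    fix B assume B: "B \<in> forms H4"
    have "\<Delta>_id_id x B = x (\<lambda>(a, b, c). tsum2 (cop a) (\<lambda>d e. B (d, e, b, c)))"
      unfolding \<Delta>_id_id_def using map(2)[of x B] assms B form
      by (auto simp: split_beta')
    then show "\<Delta>_id_id x B = tsum3 (tlist H3 x) (\<lambda>a b c. tsum2 (cop a) (\<lambda>d e. B (d, e, b, c)))"
      using tensor_apply[OF assms form(2)[OF B]] by (simp add: tsum3_def)
  qed
qed

lemma id_\<Delta>_id:
  assumes "x \<in> tensors H3"
  shows id_\<Delta>_id_in: "id_\<Delta>_id x \<in> tensors H4"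
    and id_\<Delta>_id_times: "y \<in> tensors H3 \<Longrightarrow> id_\<Delta>_id (A3.times x y) = A4.times (id_\<Delta>_id x) (id_\<Delta>_id y)"
    and id_\<Delta>_id_one: "id_\<Delta>_id (pure_tensor H3 (1, 1, 1)) = pure_tensor H4 (1, 1, 1, 1)"
    and id_\<Delta>_id_apply: "\<forall>B\<in>forms H4.
      id_\<Delta>_id x B = tsum3 (tlist H3 x) (\<lambda>a b c. tsum2 (cop b) (\<lambda>d e. B (a, d, e, c)))"
proof -
  let ?f = "\<lambda>(a, b, c). sweedler H2 (\<Delta> b) (\<lambda>(d, e). pure_tensor H4 (a, d, e, c))"
  have form: "form2 (\<lambda>d e. B (a, d, e, c))" "(\<lambda>(a, b, c). tsum2 (cop b) (\<lambda>d e. B (a, d, e, c))) \<in> forms H3"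
    if "B \<in> forms H4" for B a b c
    using form4D[of "\<lambda>a b c d. B (a, b, c, d)"] that by (simp_all add: forms_H4 forms_H3 form2_def form3_def)
  note map = leg_map[of ?f "\<lambda>(a, b, c). b" "\<lambda>(a, b, c) d e. (a, d, e, c)"]
  interpret tensor_map H3 op3 "(1, 1, 1)" H4 op4 "(1, 1, 1, 1)" ?f
    by (rule map(1)) (auto simp: split_beta' dest: form)
  show "id_\<Delta>_id x \<in> tensors H4"
    "y \<in> tensors H3 \<Longrightarrow> id_\<Delta>_id (A3.times x y) = A4.times (id_\<Delta>_id x) (id_\<Delta>_id y)"
    "id_\<Delta>_id (pure_tensor H3 (1, 1, 1)) = pure_tensor H4 (1, 1, 1, 1)"
    unfolding id_\<Delta>_id_def by (rule map_in[OF assms], rule map_times[OF assms], assumption, rule map_unit)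
  show "\<forall>B\<in>forms H4. id_\<Delta>_id x B = tsum3 (tlist H3 x) (\<lambda>a b c. tsum2 (cop b) (\<lambda>d e. B (a, d, e, c)))"
  proof
    fix B assume B: "B \<in> forms H4"
    have "id_\<Delta>_id x B = x (\<lambda>(a, b, c). tsum2 (cop b) (\<lambda>d e. B (a, d, e, c)))"
      unfolding id_\<Delta>_id_def using map(2)[of x B] assms B form
      by (auto simp: split_beta')
    then show "id_\<Delta>_id x B = tsum3 (tlist H3 x) (\<lambda>a b c. tsum2 (cop b) (\<lambda>d e. B (a, d, e, c)))"
      using tensor_apply[OF assms form(2)[OF B]] by (simp add: tsum3_def)
  qed
qed

lemma id_id_\<Delta>:
  assumes "x \<in> tensors H3"
  shows id_id_\<Delta>_in: "id_id_\<Delta> x \<in> tensors H4"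
    and id_id_\<Delta>_times: "y \<in> tensors H3 \<Longrightarrow> id_id_\<Delta> (A3.times x y) = A4.times (id_id_\<Delta> x) (id_id_\<Delta> y)"
    and id_id_\<Delta>_one: "id_id_\<Delta> (pure_tensor H3 (1, 1, 1)) = pure_tensor H4 (1, 1, 1, 1)"
    and id_id_\<Delta>_apply: "\<forall>B\<in>forms H4.
      id_id_\<Delta> x B = tsum3 (tlist H3 x) (\<lambda>a b c. tsum2 (cop c) (\<lambda>d e. B (a, b, d, e)))"
proof -
  let ?f = "\<lambda>(a, b, c). sweedler H2 (\<Delta> c) (\<lambda>(d, e). pure_tensor H4 (a, b, d, e))"
  have form: "form2 (\<lambda>d e. B (a, b, d, e))" "(\<lambda>(a, b, c). tsum2 (cop c) (\<lambda>d e. B (a, b, d, e))) \<in> forms H3"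
    if "B \<in> forms H4" for B a b c
    using form4D[of "\<lambda>a b c d. B (a, b, c, d)"] that by (simp_all add: forms_H4 forms_H3 form2_def form3_def)
  note map = leg_map[of ?f "\<lambda>(a, b, c). c" "\<lambda>(a, b, c) d e. (a, b, d, e)"]
  interpret tensor_map H3 op3 "(1, 1, 1)" H4 op4 "(1, 1, 1, 1)" ?f
    by (rule map(1)) (auto simp: split_beta' dest: form)
  show "id_id_\<Delta> x \<in> tensors H4"
    "y \<in> tensors H3 \<Longrightarrow> id_id_\<Delta> (A3.times x y) = A4.times (id_id_\<Delta> x) (id_id_\<Delta> y)"
    "id_id_\<Delta> (pure_tensor H3 (1, 1, 1)) = pure_tensor H4 (1, 1, 1, 1)"
    unfolding id_id_\<Delta>_def by (rule map_in[OF assms], rule map_times[OF assms], assumption, rule map_unit)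
  show "\<forall>B\<in>forms H4. id_id_\<Delta> x B = tsum3 (tlist H3 x) (\<lambda>a b c. tsum2 (cop c) (\<lambda>d e. B (a, b, d, e)))"
  proof
    fix B assume B: "B \<in> forms H4"
    have "id_id_\<Delta> x B = x (\<lambda>(a, b, c). tsum2 (cop c) (\<lambda>d e. B (a, b, d, e)))"
      unfolding id_id_\<Delta>_def using map(2)[of x B] assms B form
      by (auto simp: split_beta')
    then show "id_id_\<Delta> x B = tsum3 (tlist H3 x) (\<lambda>a b c. tsum2 (cop c) (\<lambda>d e. B (a, b, d, e)))"
      using tensor_apply[OF assms form(2)[OF B]] by (simp add: tsum3_def)
  qed
qed

lemma one_tensor:
  assumes "x \<in> tensors H3"
  shows one_tensor_in: "one_tensor x \<in> tensors H4"
    and one_tensor_times: "y \<in> tensors H3 \<Longrightarrow> one_tensor (A3.times x y) = A4.times (one_tensor x) (one_tensor y)"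
    and one_tensor_one: "one_tensor (pure_tensor H3 (1, 1, 1)) = pure_tensor H4 (1, 1, 1, 1)"
    and one_tensor_apply: "\<forall>B\<in>forms H4. one_tensor x B = tsum3 (tlist H3 x) (\<lambda>a b c. B (1, a, b, c))"
proof -
  let ?j = "\<lambda>(a, b, c). (1, a, b, c)"
  have form: "(\<lambda>x. B (?j x)) \<in> forms H3" if "B \<in> forms H4" for B
    using that by (simp add: forms_H4 forms_H3 form_defs)
  note map = pure_map[of ?j]
  interpret tensor_map H3 op3 "(1, 1, 1)" H4 op4 "(1, 1, 1, 1)" "\<lambda>x. pure_tensor H4 (?j x)"
    by (rule map(1)) (auto dest: form)
  have eq: "one_tensor = (\<lambda>t. sweedler H3 t (\<lambda>x. pure_tensor H4 (?j x)))"
    unfolding one_tensor_def by (simp add: fun_eq_iff split_beta')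
  show "one_tensor x \<in> tensors H4"
    "y \<in> tensors H3 \<Longrightarrow> one_tensor (A3.times x y) = A4.times (one_tensor x) (one_tensor y)"
    "one_tensor (pure_tensor H3 (1, 1, 1)) = pure_tensor H4 (1, 1, 1, 1)"
    unfolding eq by (rule map_in[OF assms], rule map_times[OF assms], assumption, rule map_unit)
  show "\<forall>B\<in>forms H4. one_tensor x B = tsum3 (tlist H3 x) (\<lambda>a b c. B (1, a, b, c))"
  proof
    fix B assume B: "B \<in> forms H4"
    have "one_tensor x B = x (\<lambda>x. B (?j x))"
      unfolding eq using map(2)[of x B] assms B form by (auto simp: split_beta')
    then show "one_tensor x B = tsum3 (tlist H3 x) (\<lambda>a b c. B (1, a, b, c))"
      unfolding tensor_apply[OF assms form[OF B]] by (simp add: tsum3_def split_beta')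
  qed
qed

lemma tensor_one:
  assumes "x \<in> tensors H3"
  shows tensor_one_in: "tensor_one x \<in> tensors H4"
    and tensor_one_times: "y \<in> tensors H3 \<Longrightarrow> tensor_one (A3.times x y) = A4.times (tensor_one x) (tensor_one y)"
    and tensor_one_one: "tensor_one (pure_tensor H3 (1, 1, 1)) = pure_tensor H4 (1, 1, 1, 1)"
    and tensor_one_apply: "\<forall>B\<in>forms H4. tensor_one x B = tsum3 (tlist H3 x) (\<lambda>a b c. B (a, b, c, 1))"
proof -
  let ?j = "\<lambda>(a, b, c). (a, b, c, 1)"
  have form: "(\<lambda>x. B (?j x)) \<in> forms H3" if "B \<in> forms H4" for B
    using that by (simp add: forms_H4 forms_H3 form_defs)
  note map = pure_map[of ?j]
  interpret tensor_map H3 op3 "(1, 1, 1)" H4 op4 "(1, 1, 1, 1)" "\<lambda>x. pure_tensor H4 (?j x)"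
    by (rule map(1)) (auto dest: form)
  have eq: "tensor_one = (\<lambda>t. sweedler H3 t (\<lambda>x. pure_tensor H4 (?j x)))"
    unfolding tensor_one_def by (simp add: fun_eq_iff split_beta')
  show "tensor_one x \<in> tensors H4"
    "y \<in> tensors H3 \<Longrightarrow> tensor_one (A3.times x y) = A4.times (tensor_one x) (tensor_one y)"
    "tensor_one (pure_tensor H3 (1, 1, 1)) = pure_tensor H4 (1, 1, 1, 1)"
    unfolding eq by (rule map_in[OF assms], rule map_times[OF assms], assumption, rule map_unit)
  show "\<forall>B\<in>forms H4. tensor_one x B = tsum3 (tlist H3 x) (\<lambda>a b c. B (a, b, c, 1))"
  proof
    fix B assume B: "B \<in> forms H4"
    have "tensor_one x B = x (\<lambda>x. B (?j x))"
      unfolding eq using map(2)[of x B] assms B form by (auto simp: split_beta')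
    then show "tensor_one x B = tsum3 (tlist H3 x) (\<lambda>a b c. B (a, b, c, 1))"
      unfolding tensor_apply[OF assms form[OF B]] by (simp add: tsum3_def split_beta')
  qed
qed

section \<open>The pentagon solved for its factors\<close>

lemmas phi_in = \<phi>_in \<phi>_inv_in
lemmas legs_in = \<Delta>_id_id_in id_\<Delta>_id_in id_id_\<Delta>_in one_tensor_in tensor_one_in

lemma legs_inverse:
  assumes "x \<in> tensors H3" "y \<in> tensors H3" "A3.times x y = pure_tensor H3 (1, 1, 1)"
  shows "A4.times (\<Delta>_id_id x) (\<Delta>_id_id y) = pure_tensor H4 (1, 1, 1, 1)"
    and "A4.times (id_\<Delta>_id x) (id_\<Delta>_id y) = pure_tensor H4 (1, 1, 1, 1)"
    and "A4.times (id_id_\<Delta> x) (id_id_\<Delta> y) = pure_tensor H4 (1, 1, 1, 1)"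
    and "A4.times (one_tensor x) (one_tensor y) = pure_tensor H4 (1, 1, 1, 1)"
    and "A4.times (tensor_one x) (tensor_one y) = pure_tensor H4 (1, 1, 1, 1)"
  using assms(1,2)
  by (simp_all add: \<Delta>_id_id_times[symmetric] id_\<Delta>_id_times[symmetric] id_id_\<Delta>_times[symmetric]
      one_tensor_times[symmetric] tensor_one_times[symmetric] assms(3)
      \<Delta>_id_id_one id_\<Delta>_id_one id_id_\<Delta>_one one_tensor_one tensor_one_one)

lemmas phi_inverse = legs_inverse[OF \<phi>_in \<phi>_inv_in \<phi>_\<phi>_inv] legs_inverse[OF \<phi>_inv_in \<phi>_in \<phi>_inv_\<phi>]

lemma cancel_left:
  assumes "x \<in> tensors H4" "x' \<in> tensors H4" "y \<in> tensors H4" "A4.times x x' = pure_tensor H4 (1, 1, 1, 1)"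
  shows "A4.times x (A4.times x' y) = y"
  using assms by (simp add: A4.times_assoc[symmetric] A4.times_unit)

lemma pentagons:
  shows pentagon_times: "A4.times (id_id_\<Delta> \<phi>) (\<Delta>_id_id \<phi>) =
      A4.times (one_tensor \<phi>) (A4.times (id_\<Delta>_id \<phi>) (tensor_one \<phi>))"
    and pentagon1_times: "A4.times (tensor_one \<phi>) (\<Delta>_id_id \<phi>_inv) =
      A4.times (id_\<Delta>_id \<phi>_inv) (A4.times (one_tensor \<phi>_inv) (id_id_\<Delta> \<phi>))"
    and pentagon2_times: "A4.times (\<Delta>_id_id \<phi>) (tensor_one \<phi>_inv) =
      A4.times (id_id_\<Delta> \<phi>_inv) (A4.times (one_tensor \<phi>) (id_\<Delta>_id \<phi>))"
    and pentagon3_times: "A4.times (one_tensor \<phi>_inv) (A4.times (id_id_\<Delta> \<phi>) (\<Delta>_id_id \<phi>)) =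
      A4.times (id_\<Delta>_id \<phi>) (tensor_one \<phi>)"
    and pentagon4_times: "A4.times (id_\<Delta>_id \<phi>_inv) (one_tensor \<phi>_inv) =
      A4.times (tensor_one \<phi>) (A4.times (\<Delta>_id_id \<phi>_inv) (id_id_\<Delta> \<phi>_inv))"
    and pentagon_pi_times: "A4.times (\<Delta>_id_id \<phi>_inv) (id_id_\<Delta> \<phi>_inv) =
      A4.times (tensor_one \<phi>_inv) (A4.times (id_\<Delta>_id \<phi>_inv) (one_tensor \<phi>_inv))"
proof -
  note [simp] = legs_in phi_in A4.times_in A4.times_assoc A4.times_unit phi_inverse cancel_left
  show 0: "A4.times (id_id_\<Delta> \<phi>) (\<Delta>_id_id \<phi>) =
      A4.times (one_tensor \<phi>) (A4.times (id_\<Delta>_id \<phi>) (tensor_one \<phi>))"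
    using pentagon by (simp add: mult4_def)
  show "A4.times (tensor_one \<phi>) (\<Delta>_id_id \<phi>_inv) =
      A4.times (id_\<Delta>_id \<phi>_inv) (A4.times (one_tensor \<phi>_inv) (id_id_\<Delta> \<phi>))"
    by (rule A4.move_right[of "\<Delta>_id_id \<phi>", symmetric]) (simp_all add: 0)
  show "A4.times (\<Delta>_id_id \<phi>) (tensor_one \<phi>_inv) =
      A4.times (id_id_\<Delta> \<phi>_inv) (A4.times (one_tensor \<phi>) (id_\<Delta>_id \<phi>))"
    by (rule A4.move_right[of "tensor_one \<phi>", symmetric]) (simp_all add: 0[symmetric])
  show "A4.times (one_tensor \<phi>_inv) (A4.times (id_id_\<Delta> \<phi>) (\<Delta>_id_id \<phi>)) =
      A4.times (id_\<Delta>_id \<phi>) (tensor_one \<phi>)"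
    by (simp add: 0)
  \<comment> \<open>The reversed product of the inverses of the right side is a right inverse of the
    left side of the pentagon. The reversed product of the inverses of the left side is a left
    inverse, so the two coincide, and this is the inverted pentagon.\<close>
  have 1: "A4.times (A4.times (id_id_\<Delta> \<phi>) (\<Delta>_id_id \<phi>))
      (A4.times (tensor_one \<phi>_inv) (A4.times (id_\<Delta>_id \<phi>_inv) (one_tensor \<phi>_inv))) = pure_tensor H4 (1, 1, 1, 1)"
    unfolding 0 by simp
  show 5: "A4.times (\<Delta>_id_id \<phi>_inv) (id_id_\<Delta> \<phi>_inv) =
      A4.times (tensor_one \<phi>_inv) (A4.times (id_\<Delta>_id \<phi>_inv) (one_tensor \<phi>_inv))"
    by (rule A4.inverse_unique[OF _ _ _ _ 1]) simp_all
  show "A4.times (id_\<Delta>_id \<phi>_inv) (one_tensor \<phi>_inv) =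
      A4.times (tensor_one \<phi>) (A4.times (\<Delta>_id_id \<phi>_inv) (id_id_\<Delta> \<phi>_inv))"
    unfolding 5 by simp
qed

lemma lin_iff: "lin f \<longleftrightarrow> Vector_Spaces.linear scl (*) f"
  using vector_space_scl vector_space_field_mult
  by (auto simp: lin_def Vector_Spaces.linear_def module_hom_def module_hom_axioms_def module_iff_vector_space)

lemma sweedler_lin:
  assumes t: "t \<in> tensors T" and f: "lin f" and F: "\<And>g. lin g \<Longrightarrow> (\<lambda>x. g (F x)) \<in> forms T"
  shows "f (sweedler T t F) = t (\<lambda>x. f (F x))"
  by (rule sweedler_linear[OF t vector_space_scl]) (use f F in \<open>simp_all add: lin_iff\<close>)

lemma sweedler_\<Delta>:
  assumes f: "lin f" and F: "\<And>g. lin g \<Longrightarrow> form2 (\<lambda>b c. g (F b c))"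
  shows "f (sweedler H2 (\<Delta> a) (\<lambda>(b, c). F b c)) = tsum2 (cop a) (\<lambda>b c. f (F b c))"
  using sweedler_lin[OF \<Delta>_in f, of "\<lambda>(b, c). F b c" a] F f
  by (simp add: forms_H2 \<Delta>_apply)

lemma scl_lin: "lin f \<Longrightarrow> f (scl k a) = k * f a"
  by (simp add: lin_def)

lemma quasi_coassoc_times: "A3.times (id_\<Delta> (\<Delta> a)) \<phi> = A3.times \<phi> (\<Delta>_id (\<Delta> a))"
  using quasi_coassoc by (simp add: mult3_def)

lemma id_\<Delta>:
  shows id_\<Delta>_in: "id_\<Delta> (\<Delta> a) \<in> tensors H3"
    and id_\<Delta>_apply: "B \<in> forms H3 \<Longrightarrow>
      id_\<Delta> (\<Delta> a) B = tsum2 (cop a) (\<lambda>a\<^sub>1 a\<^sub>2. tsum2 (cop a\<^sub>2) (\<lambda>b c. B (a\<^sub>1, b, c)))"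
proof -
  have leg: "sweedler H2 (\<Delta> b) (\<lambda>(c, d). pure_tensor H3 (a, c, d)) \<in> tensors H3"
    "sweedler H2 (\<Delta> b) (\<lambda>(c, d). pure_tensor H3 (a, c, d)) B =
      (if B \<in> forms H3 then tsum2 (cop b) (\<lambda>c d. B (a, c, d)) else 0)" for a b B
    using leg[where T=H3 and \<iota>="\<lambda>c d. (a, c, d)" and a=b] tensor_outside[of _ H3 B]
    by (auto simp: A3.good forms_H3 form_defs)
  have form: "(\<lambda>x. (\<lambda>(a, b). sweedler H2 (\<Delta> b) (\<lambda>(c, d). pure_tensor H3 (a, c, d))) x B) \<in> forms H2" for B
    using form3D[of "\<lambda>a b c. B (a, b, c)"]
    by (cases "B \<in> forms H3") (simp_all add: leg forms_H2 forms_H3, simp_all add: form2_def form3_def)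
  show "id_\<Delta> (\<Delta> a) \<in> tensors H3"
    unfolding id_\<Delta>_def by (rule sweedler_in[OF \<Delta>_in form]) (auto simp: leg)
  show "id_\<Delta> (\<Delta> a) B = tsum2 (cop a) (\<lambda>a\<^sub>1 a\<^sub>2. tsum2 (cop a\<^sub>2) (\<lambda>b c. B (a\<^sub>1, b, c)))" if "B \<in> forms H3"
    unfolding id_\<Delta>_def using that form[of B] by (simp add: sweedler_fun[OF \<Delta>_in form] \<Delta>_apply leg)
qed

lemma \<Delta>_id:
  shows \<Delta>_id_in: "\<Delta>_id (\<Delta> a) \<in> tensors H3"
    and \<Delta>_id_apply: "B \<in> forms H3 \<Longrightarrow>
      \<Delta>_id (\<Delta> a) B = tsum2 (cop a) (\<lambda>a\<^sub>1 a\<^sub>2. tsum2 (cop a\<^sub>1) (\<lambda>b c. B (b, c, a\<^sub>2)))"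
proof -
  have leg: "sweedler H2 (\<Delta> a) (\<lambda>(c, d). pure_tensor H3 (c, d, b)) \<in> tensors H3"
    "sweedler H2 (\<Delta> a) (\<lambda>(c, d). pure_tensor H3 (c, d, b)) B =
      (if B \<in> forms H3 then tsum2 (cop a) (\<lambda>c d. B (c, d, b)) else 0)" for a b B
    using leg[where T=H3 and \<iota>="\<lambda>c d. (c, d, b)" and a=a] tensor_outside[of _ H3 B]
    by (auto simp: A3.good forms_H3 form_defs)
  have form: "(\<lambda>x. (\<lambda>(a, b). sweedler H2 (\<Delta> a) (\<lambda>(c, d). pure_tensor H3 (c, d, b))) x B) \<in> forms H2" for B
    using form3D[of "\<lambda>a b c. B (a, b, c)"]
    by (cases "B \<in> forms H3") (simp_all add: leg forms_H2 forms_H3, simp_all add: form2_def form3_def)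
  show "\<Delta>_id (\<Delta> a) \<in> tensors H3"
    unfolding \<Delta>_id_def by (rule sweedler_in[OF \<Delta>_in form]) (auto simp: leg)
  show "\<Delta>_id (\<Delta> a) B = tsum2 (cop a) (\<lambda>a\<^sub>1 a\<^sub>2. tsum2 (cop a\<^sub>1) (\<lambda>b c. B (b, c, a\<^sub>2)))" if "B \<in> forms H3"
    unfolding \<Delta>_id_def using that form[of B] by (simp add: sweedler_fun[OF \<Delta>_in form] \<Delta>_apply leg)
qed

lemma quasi_coassoc_inv: "A3.times \<phi>_inv (id_\<Delta> (\<Delta> a)) = A3.times (\<Delta>_id (\<Delta> a)) \<phi>_inv"
proof (rule A3.move_right[of \<phi>])
  have "A3.times (A3.times \<phi>_inv \<phi>) (\<Delta>_id (\<Delta> a)) = \<Delta>_id (\<Delta> a)"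
    by (simp add: \<phi>_inv_\<phi> A3.times_unit \<Delta>_id_in)
  then show "A3.times (A3.times \<phi>_inv (id_\<Delta> (\<Delta> a))) \<phi> = \<Delta>_id (\<Delta> a)"
    by (simp add: phi_in id_\<Delta>_in \<Delta>_id_in A3.times_assoc quasi_coassoc_times)
qed (simp_all add: phi_in id_\<Delta>_in \<Delta>_id_in A3.times_in \<phi>_\<phi>_inv)

lemma times_eval:
  assumes x: "x \<in> tensors H4" "\<forall>B\<in>forms H4. x B = X B"
    and y: "y \<in> tensors H4" "\<forall>B\<in>forms H4. y B = Y B"
    and B: "B \<in> forms H4"
  shows "A4.times x y B = X (\<lambda>u. Y (\<lambda>v. B (op4 u v)))"
  unfolding A4.times_apply[OF x(1) y(1) B] x(2)[rule_format, OF A4.times_form[OF y(1) B]]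
  unfolding y(2)[rule_format, OF A4.form_right[OF B]] ..

lemma times_eval3:
  assumes x: "x \<in> tensors H4" "\<forall>B\<in>forms H4. x B = X B"
    and y: "y \<in> tensors H4" "\<forall>B\<in>forms H4. y B = Y B"
    and z: "z \<in> tensors H4" "\<forall>B\<in>forms H4. z B = Z B"
    and B: "B \<in> forms H4"
  shows "A4.times x (A4.times y z) B = X (\<lambda>u. Y (\<lambda>v. Z (\<lambda>w. B (op4 u (op4 v w)))))"
  by (rule times_eval[OF x A4.times_in[OF y(1) z(1)] _ B]) (rule ballI, rule times_eval[OF y z])

lemma times3_eval:
  assumes x: "x \<in> tensors H3" "\<forall>B\<in>forms H3. x B = X B"
    and y: "y \<in> tensors H3" "\<forall>B\<in>forms H3. y B = Y B"
    and B: "B \<in> forms H3"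
  shows "A3.times x y B = X (\<lambda>u. Y (\<lambda>v. B (op3 u v)))"
  unfolding A3.times_apply[OF x(1) y(1) B] x(2)[rule_format, OF A3.times_form[OF y(1) B]]
  unfolding y(2)[rule_format, OF A3.form_right[OF B]] ..

lemma phi_facts: "\<phi> \<in> tensors H3" "\<forall>B\<in>forms H3. \<phi> B = tsum3 ph (\<lambda>x y z. B (x, y, z))"
  by (simp_all add: \<phi>_in \<phi>_apply)

lemma phi_inv_facts: "\<phi>_inv \<in> tensors H3" "\<forall>B\<in>forms H3. \<phi>_inv B = tsum3 pi (\<lambda>x y z. B (x, y, z))"
  by (simp_all add: \<phi>_inv_in \<phi>_inv_apply)

lemma id_\<Delta>_facts: "id_\<Delta> (\<Delta> a) \<in> tensors H3"
  "\<forall>B\<in>forms H3. id_\<Delta> (\<Delta> a) B = tsum2 (cop a) (\<lambda>a\<^sub>1 a\<^sub>2. tsum2 (cop a\<^sub>2) (\<lambda>b c. B (a\<^sub>1, b, c)))"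
  by (simp_all add: id_\<Delta>_in id_\<Delta>_apply)

lemma \<Delta>_id_facts: "\<Delta>_id (\<Delta> a) \<in> tensors H3"
  "\<forall>B\<in>forms H3. \<Delta>_id (\<Delta> a) B = tsum2 (cop a) (\<lambda>a\<^sub>1 a\<^sub>2. tsum2 (cop a\<^sub>1) (\<lambda>b c. B (b, c, a\<^sub>2)))"
  by (simp_all add: \<Delta>_id_in \<Delta>_id_apply)

lemmas D_facts = \<Delta>_id_id_in[OF \<phi>_in] \<Delta>_id_id_apply[OF \<phi>_in, folded ph_def]
lemmas D_inv_facts = \<Delta>_id_id_in[OF \<phi>_inv_in] \<Delta>_id_id_apply[OF \<phi>_inv_in, folded pi_def]
lemmas E_facts = id_\<Delta>_id_in[OF \<phi>_in] id_\<Delta>_id_apply[OF \<phi>_in, folded ph_def]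
lemmas E_inv_facts = id_\<Delta>_id_in[OF \<phi>_inv_in] id_\<Delta>_id_apply[OF \<phi>_inv_in, folded pi_def]
lemmas I_facts = id_id_\<Delta>_in[OF \<phi>_in] id_id_\<Delta>_apply[OF \<phi>_in, folded ph_def]
lemmas I_inv_facts = id_id_\<Delta>_in[OF \<phi>_inv_in] id_id_\<Delta>_apply[OF \<phi>_inv_in, folded pi_def]
lemmas L_facts = one_tensor_in[OF \<phi>_in] one_tensor_apply[OF \<phi>_in, folded ph_def]
lemmas L_inv_facts = one_tensor_in[OF \<phi>_inv_in] one_tensor_apply[OF \<phi>_inv_in, folded pi_def]
lemmas R_facts = tensor_one_in[OF \<phi>_in] tensor_one_apply[OF \<phi>_in, folded ph_def]
lemmas R_inv_facts = tensor_one_in[OF \<phi>_inv_in] tensor_one_apply[OF \<phi>_inv_in, folded pi_def]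

text \<open>Each condition is the corresponding tensor equation evaluated at the given form. A
  product of tensors becomes a nested sum in the order of the factors, and values in H are reached
  through functionals, which by linearity pass inside the Sweedler sum.\<close>

sublocale sums: quasi_hopf_sums scl "(*)" 1 S cop \<epsilon> ph pi \<alpha> \<beta>
proof unfold_locales
  have ph_form: "(\<lambda>t. g (case t of (x, y, z) \<Rightarrow> x * (\<beta> * (S y * (\<alpha> * z))))) \<in> forms H3"
    and pi_form: "(\<lambda>t. g (case t of (x, y, z) \<Rightarrow> S x * (\<alpha> * (y * (\<beta> * S z))))) \<in> forms H3"
    and al_form: "form2 (\<lambda>b c. g (S b * (\<alpha> * c)))" and be_form: "form2 (\<lambda>b c. g (b * (\<beta> * S c)))"
    if "lin g" for g
    using lin_endo[OF that] by (simp_all add: forms_H3 form3_def form2_def)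
  have prod4: "(\<lambda>(a, b, c, d). F a b c d) \<in> forms H4" if "form4 F" for F
    using that by (simp add: forms_H4)
  show "form2 F \<Longrightarrow> lin (\<lambda>a. tsum2 (cop a) F)" for F by (rule lin_cop)
  show "form2 F \<Longrightarrow> tsum2 (cop (a * b)) F =
      tsum2 (cop a) (\<lambda>a\<^sub>1 a\<^sub>2. tsum2 (cop b) (\<lambda>b\<^sub>1 b\<^sub>2. F (a\<^sub>1 * b\<^sub>1) (a\<^sub>2 * b\<^sub>2)))" for F a b
    by (rule cop_mul)
  show "lin \<epsilon>" using \<epsilon>_linear by (simp add: lin_iff)
  show "\<epsilon> (a * b) = \<epsilon> a * \<epsilon> b" "\<epsilon> 1 = 1" for a b by (rule \<epsilon>_mult \<epsilon>_one)+
  note lin_\<epsilon> = lin_endo[OF \<open>lin \<epsilon>\<close>]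
  show "lin f \<Longrightarrow> tsum2 (cop a) (\<lambda>b c. \<epsilon> b * f c) = f a" for f a
    using sweedler_\<Delta>[of f "\<lambda>b c. scl (\<epsilon> b) c" a] lin_\<epsilon>[of "\<lambda>x. x"]
    by (simp add: counit_left scl_lin form2_def lin_def algebra_simps)
  show "lin f \<Longrightarrow> tsum2 (cop a) (\<lambda>b c. \<epsilon> c * f b) = f a" for f a
    using sweedler_\<Delta>[of f "\<lambda>b c. scl (\<epsilon> c) b" a] lin_\<epsilon>[of "\<lambda>x. x"]
    by (simp add: counit_right scl_lin form2_def lin_def algebra_simps)
  show "tsum3 ph (\<lambda>x y z. \<epsilon> y * F x z) = F 1 1" if F: "form2 F" for F
  proof -
    have scl: "form2 (\<lambda>a b. B (a, b)) \<Longrightarrow> B (scl k a, b) = k * B (a, b)" for k a b B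
      by (simp add: form2_def lin_def)
    have form: "(\<lambda>x. (\<lambda>(x, y, z). pure_tensor H2 (scl (\<epsilon> y) x, z)) x B) \<in> forms H3" for B
      using lin_\<epsilon>[of "\<lambda>x. x"] form2D[of "\<lambda>a b. B (a, b)"]
      by (cases "B \<in> forms H2") (auto simp: pure_tensor_def forms_H2 forms_H3 form3_def scl)
    have "sweedler H3 \<phi> (\<lambda>(x, y, z). pure_tensor H2 (scl (\<epsilon> y) x, z)) (\<lambda>(a, b). F a b) = one2 (\<lambda>(a, b). F a b)"
      by (simp only: counit_\<phi>)
    then show ?thesis
      using form[of "\<lambda>(a, b). F a b"] F scl[of "\<lambda>(a, b). F a b"]
      by (simp add: sweedler_fun[OF \<phi>_in form] \<phi>_apply one2_def) (simp add: pure_tensor_def forms_H2)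
  qed
  have prod3: "(\<lambda>(a, b, c). F a b c) \<in> forms H3" if "form3 F" for F
    using that by (simp add: forms_H3)
  show "tsum2 (cop a) (\<lambda>a\<^sub>1 a\<^sub>2. tsum2 (cop a\<^sub>2) (\<lambda>b c. tsum3 ph (\<lambda>x y z. F3 (a\<^sub>1 * x) (b * y) (c * z)))) =
      tsum3 ph (\<lambda>x y z. tsum2 (cop a) (\<lambda>a\<^sub>1 a\<^sub>2. tsum2 (cop a\<^sub>1) (\<lambda>b c. F3 (x * b) (y * c) (z * a\<^sub>2))))"
    if F: "form3 F3" for F3 a
    using fun_cong[OF quasi_coassoc_times[of a], of "\<lambda>(a, b, c). F3 a b c"]
    unfolding times3_eval[OF id_\<Delta>_facts phi_facts prod3[OF F]] times3_eval[OF phi_facts \<Delta>_id_facts prod3[OF F]] by simp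
  show "tsum3 ph (\<lambda>p q r. tsum3 ph (\<lambda>x y z. tsum2 (cop r) (\<lambda>r\<^sub>1 r\<^sub>2. tsum2 (cop x) (\<lambda>x\<^sub>1 x\<^sub>2.
        F4 (p * x\<^sub>1) (q * x\<^sub>2) (r\<^sub>1 * y) (r\<^sub>2 * z))))) =
      tsum3 ph (\<lambda>x y z. tsum3 ph (\<lambda>p q r. tsum3 ph (\<lambda>s t u. tsum2 (cop q) (\<lambda>q\<^sub>1 q\<^sub>2.
        F4 (p * s) (x * (q\<^sub>1 * t)) (y * (q\<^sub>2 * u)) (z * r)))))"
    if F: "form4 F4" for F4
    using pentagon_times[THEN fun_cong, of "\<lambda>(a, b, c, d). F4 a b c d"]
    unfolding times_eval[OF I_facts D_facts prod4[OF F]] times_eval3[OF L_facts E_facts R_facts prod4[OF F]] by (simp add: tsum2_tsum3_swap)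
  show "lin f \<Longrightarrow> tsum3 pi (\<lambda>x y z. f (S x * (\<alpha> * (y * (\<beta> * S z))))) = f 1" for f
    using sweedler_lin[OF \<phi>_inv_in, of f "\<lambda>(x, y, z). S x * \<alpha> * y * \<beta> * S z"] pi_form
    by (simp add: antipode_\<phi>_inv[unfolded mult.assoc] \<phi>_inv_apply mult.assoc)
  show "form2 F \<Longrightarrow> tsum2 (cop 1) F = F 1 1" for F by (rule cop_one)
  show "tsum3 ph (\<lambda>x y z. tsum3 pi (\<lambda>p q r. F3 (x * p) (y * q) (z * r))) = F3 1 1 1"
    if F: "form3 F3" for F3
    using \<phi>_\<phi>_inv[THEN fun_cong, of "\<lambda>(a, b, c). F3 a b c"]
    unfolding times3_eval[OF phi_facts phi_inv_facts prod3[OF F]] by (simp add: pure_tensor_def prod3[OF F])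
  show "tsum3 pi (\<lambda>x y z. tsum3 ph (\<lambda>p q r. F3 (x * p) (y * q) (z * r))) = F3 1 1 1"
    if F: "form3 F3" for F3
    using \<phi>_inv_\<phi>[THEN fun_cong, of "\<lambda>(a, b, c). F3 a b c"]
    unfolding times3_eval[OF phi_inv_facts phi_facts prod3[OF F]] by (simp add: pure_tensor_def prod3[OF F])
  show "tsum3 pi (\<lambda>x y z. tsum2 (cop a) (\<lambda>a\<^sub>1 a\<^sub>2. tsum2 (cop a\<^sub>2) (\<lambda>b c. F3 (x * a\<^sub>1) (y * b) (z * c)))) =
      tsum3 pi (\<lambda>x y z. tsum2 (cop a) (\<lambda>a\<^sub>1 a\<^sub>2. tsum2 (cop a\<^sub>1) (\<lambda>b c. F3 (b * x) (c * y) (a\<^sub>2 * z))))"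
    if F: "form3 F3" for F3 a
    using fun_cong[OF quasi_coassoc_inv[of a], of "\<lambda>(a, b, c). F3 a b c"]
    unfolding times3_eval[OF phi_inv_facts id_\<Delta>_facts prod3[OF F]] times3_eval[OF \<Delta>_id_facts phi_inv_facts prod3[OF F]] by (simp add: tsum2_tsum3_swap)
  show "tsum3 ph (\<lambda>x y z. tsum3 pi (\<lambda>p q r. tsum2 (cop p) (\<lambda>p\<^sub>1 p\<^sub>2.
        F4 (x * p\<^sub>1) (y * p\<^sub>2) (z * q) r))) =
      tsum3 pi (\<lambda>a b c. tsum3 pi (\<lambda>d e f. tsum3 ph (\<lambda>x y z. tsum2 (cop b) (\<lambda>b\<^sub>1 b\<^sub>2. tsum2 (cop z) (\<lambda>z\<^sub>1 z\<^sub>2.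
        F4 (a * x) (b\<^sub>1 * (d * y)) (b\<^sub>2 * (e * z\<^sub>1)) (c * (f * z\<^sub>2)))))))"
    if F: "form4 F4" for F4
    using pentagon1_times[THEN fun_cong, of "\<lambda>(a, b, c, d). F4 a b c d"]
    unfolding times_eval[OF R_facts D_inv_facts prod4[OF F]] times_eval3[OF E_inv_facts L_inv_facts I_facts prod4[OF F]] by (simp add: tsum2_tsum3_swap)
  show "tsum3 ph (\<lambda>x y z. tsum3 pi (\<lambda>p q r. tsum2 (cop x) (\<lambda>x\<^sub>1 x\<^sub>2.
        F4 (x\<^sub>1 * p) (x\<^sub>2 * q) (y * r) z))) =
      tsum3 pi (\<lambda>a b c. tsum3 ph (\<lambda>d e f. tsum3 ph (\<lambda>x y z. tsum2 (cop c) (\<lambda>c\<^sub>1 c\<^sub>2. tsum2 (cop y) (\<lambda>y\<^sub>1 y\<^sub>2.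
        F4 (a * x) (b * (d * y\<^sub>1)) (c\<^sub>1 * (e * y\<^sub>2)) (c\<^sub>2 * (f * z)))))))"
    if F: "form4 F4" for F4
    using pentagon2_times[THEN fun_cong, of "\<lambda>(a, b, c, d). F4 a b c d"]
    unfolding times_eval[OF D_facts R_inv_facts prod4[OF F]] times_eval3[OF I_inv_facts L_facts E_facts prod4[OF F]] by (simp add: tsum2_tsum3_swap)
  show "tsum3 pi (\<lambda>a b c. tsum3 ph (\<lambda>d e f. tsum3 ph (\<lambda>x y z. tsum2 (cop f) (\<lambda>f\<^sub>1 f\<^sub>2. tsum2 (cop x) (\<lambda>x\<^sub>1 x\<^sub>2.
        F4 (d * x\<^sub>1) (a * (e * x\<^sub>2)) (b * (f\<^sub>1 * y)) (c * (f\<^sub>2 * z))))))) =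
      tsum3 ph (\<lambda>p q r. tsum3 ph (\<lambda>s t u. tsum2 (cop q) (\<lambda>q\<^sub>1 q\<^sub>2.
        F4 (p * s) (q\<^sub>1 * t) (q\<^sub>2 * u) r)))"
    if F: "form4 F4" for F4
    using pentagon3_times[THEN fun_cong, of "\<lambda>(a, b, c, d). F4 a b c d"]
    unfolding times_eval3[OF L_inv_facts I_facts D_facts prod4[OF F]] times_eval[OF E_facts R_facts prod4[OF F]] by (simp add: tsum2_tsum3_swap)
  show "tsum3 pi (\<lambda>x y z. tsum3 pi (\<lambda>a b c. tsum2 (cop y) (\<lambda>y\<^sub>1 y\<^sub>2.
        F4 x (y\<^sub>1 * a) (y\<^sub>2 * b) (z * c)))) =
      tsum3 ph (\<lambda>x y z. tsum3 pi (\<lambda>p q r. tsum3 pi (\<lambda>d e f. tsum2 (cop p) (\<lambda>p\<^sub>1 p\<^sub>2. tsum2 (cop f) (\<lambda>f\<^sub>1 f\<^sub>2.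
        F4 (x * (p\<^sub>1 * d)) (y * (p\<^sub>2 * e)) (z * (q * f\<^sub>1)) (r * f\<^sub>2))))))"
    if F: "form4 F4" for F4
    using pentagon4_times[THEN fun_cong, of "\<lambda>(a, b, c, d). F4 a b c d"]
    unfolding times_eval[OF E_inv_facts L_inv_facts prod4[OF F]] times_eval3[OF R_facts D_inv_facts I_inv_facts prod4[OF F]] by (simp add: tsum2_tsum3_swap)
  show "tsum3 pi (\<lambda>p q r. tsum3 pi (\<lambda>x y z. tsum2 (cop r) (\<lambda>r\<^sub>1 r\<^sub>2. tsum2 (cop x) (\<lambda>x\<^sub>1 x\<^sub>2.
        F4 (x\<^sub>1 * p) (x\<^sub>2 * q) (y * r\<^sub>1) (z * r\<^sub>2))))) =
      tsum3 pi (\<lambda>x y z. tsum3 pi (\<lambda>p q r. tsum3 pi (\<lambda>s t u. tsum2 (cop q) (\<lambda>q\<^sub>1 q\<^sub>2.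
        F4 (s * p) (t * (q\<^sub>1 * x)) (u * (q\<^sub>2 * y)) (r * z)))))" (is "?lhs = ?rhs")
    if F: "form4 F4" for F4
  proof -
    \<comment> \<open>Evaluation yields the summations in the order of the factors; the required
      statement has the order of \<open>pentagon\<close> for the reversed product. The two orders
      are matched below.\<close>
    have "tsum3 pi (\<lambda>x y z. tsum3 pi (\<lambda>p q r. tsum2 (cop x) (\<lambda>x\<^sub>1 x\<^sub>2. tsum2 (cop r) (\<lambda>r\<^sub>1 r\<^sub>2.
        F4 (x\<^sub>1 * p) (x\<^sub>2 * q) (y * r\<^sub>1) (z * r\<^sub>2))))) =
      tsum3 pi (\<lambda>s t u. tsum3 pi (\<lambda>p q r. tsum3 pi (\<lambda>x y z. tsum2 (cop q) (\<lambda>q\<^sub>1 q\<^sub>2.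
        F4 (s * p) (t * (q\<^sub>1 * x)) (u * (q\<^sub>2 * y)) (r * z)))))" (is "?lhs' = ?rhs'")
      using pentagon_pi_times[THEN fun_cong, of "\<lambda>(a, b, c, d). F4 a b c d"]
      unfolding times_eval[OF D_inv_facts I_inv_facts prod4[OF F]] times_eval3[OF R_inv_facts E_inv_facts L_inv_facts prod4[OF F]]
      by (simp add: tsum2_tsum3_swap)
    moreover have "?lhs' = ?lhs"
      by (rule trans[OF tsum3_tsum3_swap]) (intro tsum3_cong tsum2_tsum2_swap)
    moreover have "?rhs' = ?rhs"
      by (rule trans[OF tsum3_rotate tsum3_tsum3_swap, symmetric])
    ultimately show ?thesis by simp
  qed
  show "lin f \<Longrightarrow> tsum2 (cop a) (\<lambda>b c. f (S b * (\<alpha> * c))) = \<epsilon> a * f \<alpha>" for f a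
    using sweedler_\<Delta>[of f "\<lambda>b c. S b * \<alpha> * c" a] al_form
    by (simp add: antipode_\<alpha>[unfolded mult.assoc] scl_lin mult.assoc)
  show "lin f \<Longrightarrow> tsum2 (cop a) (\<lambda>b c. f (b * (\<beta> * S c))) = \<epsilon> a * f \<beta>" for f a
    using sweedler_\<Delta>[of f "\<lambda>b c. b * \<beta> * S c" a] be_form
    by (simp add: antipode_\<beta>[unfolded mult.assoc] scl_lin mult.assoc)
  show "lin f \<Longrightarrow> tsum3 ph (\<lambda>x y z. f (x * (\<beta> * (S y * (\<alpha> * z))))) = f 1" for f
    using sweedler_lin[OF \<phi>_in, of f "\<lambda>(x, y, z). x * \<beta> * S y * \<alpha> * z"] ph_form
    by (simp add: antipode_\<phi>[unfolded mult.assoc] \<phi>_apply mult.assoc)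
  show "bij S" by (rule S_bij)
qed

section \<open>The special elements as sums over lists\<close>

lemma form2_swap: "form2 F \<Longrightarrow> form2 (\<lambda>a b. F b a)"
  by (simp add: form2_def)

lemma flip:
  assumes "x \<in> tensors H2"
  shows flip_in: "flip x \<in> tensors H2"
    and flip_apply: "B \<in> forms H2 \<Longrightarrow> flip x B = x (\<lambda>(a, b). B (b, a))"
proof -
  have form: "(\<lambda>x. (\<lambda>(a, b). pure_tensor H2 (b, a)) x B) \<in> forms H2" for B
  proof (cases "B \<in> forms H2")
    case True
    then show ?thesis by (simp add: pure_tensor_def) (simp add: forms_H2 form_defs)
  next
    case False
    then show ?thesis using good_zero[OF A2.good] by (simp add: pure_tensor_def case_prod_unfold)
  qed
  show "flip x \<in> tensors H2"
    unfolding flip_def by (rule sweedler_in[OF assms form]) (auto intro: tensor_pure)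
  show "flip x B = x (\<lambda>(a, b). B (b, a))" if "B \<in> forms H2"
    unfolding flip_def sweedler_fun[OF assms form] using that
    by (intro arg_cong[of _ _ x]) (auto simp: pure_tensor_def)
qed

lemma map2:
  assumes "x \<in> tensors H2" and F: "endo F"
  shows map2_in: "map2 F x \<in> tensors H2"
    and map2_apply: "B \<in> forms H2 \<Longrightarrow> map2 F x B = x (\<lambda>(a, b). B (F a, F b))"
proof -
  have form: "(\<lambda>x. (\<lambda>(a, b). pure_tensor H2 (F a, F b)) x B) \<in> forms H2" for B
    using form2D[OF _ F, of "\<lambda>a b. B (a, b)"]
    by (cases "B \<in> forms H2") (auto simp: pure_tensor_def forms_H2, auto simp: form_defs)
  show "map2 F x \<in> tensors H2"
    unfolding map2_def by (rule sweedler_in[OF assms(1) form]) (auto intro: tensor_pure)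
  show "map2 F x B = x (\<lambda>(a, b). B (F a, F b))" if "B \<in> forms H2"
    unfolding map2_def sweedler_fun[OF assms(1) form] using that
    by (intro arg_cong[of _ _ x]) (auto simp: pure_tensor_def)
qed

text \<open>The bridge between tensors and list identities. R is prescribed on bilinear forms only,
  so an identity proved for these may replace one description of an element by another
  (\<open>represents_cong\<close>).\<close>

definition represents :: "('h \<times> 'h, 'k) tensor \<Rightarrow> (('h \<Rightarrow> 'h \<Rightarrow> 'k) \<Rightarrow> 'k) \<Rightarrow> bool" where
  "represents t R \<longleftrightarrow> t \<in> tensors H2 \<and> (\<forall>F. form2 F \<longrightarrow> t (\<lambda>(a, b). F a b) = R F)"

lemma represents_in: "represents t R \<Longrightarrow> t \<in> tensors H2"
  by (simp add: represents_def)

lemma represents_apply: "represents t R \<Longrightarrow> B \<in> forms H2 \<Longrightarrow> t B = R (\<lambda>a b. B (a, b))"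
proof -
  assume "represents t R" "B \<in> forms H2"
  then have "t (\<lambda>(a, b). B (a, b)) = R (\<lambda>a b. B (a, b))"
    unfolding represents_def forms_H2 by blast
  then show ?thesis by simp
qed

lemma represents_\<Delta>: "represents (\<Delta> a) (tsum2 (cop a))"
  by (simp add: represents_def \<Delta>_in \<Delta>_apply forms_H2)

lemma represents_flip:
  assumes "represents x R"
  shows "represents (flip x) (\<lambda>F. R (\<lambda>a b. F b a))"
  unfolding represents_def
proof (intro conjI allI impI)
  fix F assume "form2 F"
  then show "flip x (\<lambda>(a, b). F a b) = R (\<lambda>a b. F b a)"
    using represents_apply[OF assms, of "\<lambda>(a, b). F b a"]
    by (simp add: flip_apply represents_in[OF assms] forms_H2 form2_swap[of F])
qed (rule flip_in[OF represents_in[OF assms]])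

lemma represents_map2:
  assumes x: "represents x R" and f: "endo f"
  shows "represents (map2 f x) (\<lambda>F. R (\<lambda>a b. F (f a) (f b)))"
proof -
  have "form2 (\<lambda>a b. F (f a) (f b))" if "form2 F" for F
    using form2D[OF that f] by (simp add: form2_def)
  then show ?thesis
    using represents_in[OF x] represents_apply[OF x] f
    by (simp add: represents_def map2_in map2_apply forms_H2)
qed

lemma represents_mult2:
  assumes x: "represents x X" and y: "represents y Y"
  shows "represents (mult2 x y) (\<lambda>F. X (\<lambda>a b. Y (\<lambda>c d. F (a * c) (b * d))))"
proof -
  have "mult2 x y (\<lambda>(a, b). F a b) = X (\<lambda>a b. Y (\<lambda>c d. F (a * c) (b * d)))" if F: "form2 F" for F
  proof -
    have B: "(\<lambda>(a, b). F a b) \<in> forms H2" using F by (simp add: forms_H2)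
    show ?thesis
      unfolding mult2_def A2.times_apply[OF represents_in[OF x] represents_in[OF y] B]
        represents_apply[OF x A2.times_form[OF represents_in[OF y] B]]
      unfolding represents_apply[OF y A2.form_right[OF B]] by simp
  qed
  then show ?thesis
    by (simp add: represents_def mult2_def A2.times_in represents_in[OF x] represents_in[OF y])
qed

lemma represents_sweedler:
  assumes t: "t \<in> tensors H3" "\<forall>B\<in>forms H3. t B = tsum3 xs (\<lambda>x y z. B (x, y, z))"
    and R: "\<And>x y z. represents (f x y z) (R x y z)"
    and form: "\<And>F. form2 F \<Longrightarrow> form3 (\<lambda>x y z. R x y z F)"
  shows "represents (sweedler H3 t (\<lambda>(x, y, z). f x y z)) (\<lambda>F. tsum3 xs (\<lambda>x y z. R x y z F))"
proof -
  have f_form: "(\<lambda>w. (\<lambda>(x, y, z). f x y z) w B) \<in> forms H3" for B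
  proof (cases "B \<in> forms H2")
    case True
    then show ?thesis
      using form[of "\<lambda>a b. B (a, b)"] by (simp add: represents_apply[OF R] forms_H2 forms_H3)
  next
    case False
    then show ?thesis
      by (simp add: tensor_outside[OF represents_in[OF R]] forms_H3 form3_def)
  qed
  have "sweedler H3 t (\<lambda>(x, y, z). f x y z) \<in> tensors H2"
    by (rule sweedler_in[OF t(1) f_form]) (auto simp: represents_in[OF R])
  moreover have "sweedler H3 t (\<lambda>(x, y, z). f x y z) (\<lambda>(a, b). F a b) = tsum3 xs (\<lambda>x y z. R x y z F)"
    if "form2 F" for F
    using that t(2)[rule_format, OF f_form[of "\<lambda>(a, b). F a b"]]
    by (simp add: sweedler_fun[OF t(1) f_form] represents_apply[OF R] forms_H2)
  ultimately show ?thesis by (simp add: represents_def)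
qed

lemma represents_cong:
  "represents t R \<Longrightarrow> (\<And>F. form2 F \<Longrightarrow> R F = R' F) \<Longrightarrow> represents t R'"
  by (simp add: represents_def)

lemma represents_pure: "represents (pure_tensor H2 (a, b)) (\<lambda>F. F a b)"
  by (simp add: represents_def tensor_pure) (simp add: pure_tensor_def forms_H2)

lemma endo_S: "endo S" and endo_T: "endo (inv S)"
  using alg.endo_intros(3)[OF endo_id] sums.endo_T[OF endo_id] by simp_all

lemma represents_q_R: "represents q_R (\<lambda>F. tsum3 ph (\<lambda>x y z. F x (inv S (\<alpha> * z) * y)))"
  unfolding q_R_def
proof (rule represents_sweedler[OF phi_facts represents_pure])
  fix F assume F: "form2 F"
  show "form3 (\<lambda>x y z. F x (inv S (\<alpha> * z) * y))"
    using form2D[OF F] by (simp add: form3_def)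
qed

lemma represents_p_R: "represents p_R sums.p_sum"
proof (rule represents_cong)
  show "represents p_R (\<lambda>F. tsum3 pi (\<lambda>x y z. F x (y * \<beta> * S z)))"
    unfolding p_R_def
  proof (rule represents_sweedler[OF phi_inv_facts represents_pure])
    fix F assume F: "form2 F"
    show "form3 (\<lambda>x y z. F x (y * \<beta> * S z))"
      using form2D[OF F] by (simp add: form3_def)
  qed
qed (simp add: sums.p_sum_def mult.assoc)

lemma represents_\<gamma>: "represents \<gamma> (tsum2 sums.gam)"
proof -
  have form: "(\<lambda>(t, u, v, w). F (S u * \<alpha> * v) (S t * \<alpha> * w)) \<in> forms H4" if "form2 F" for F
    using form2D[OF that] by (simp add: forms_H4 form4_def)
  have F4: "(\<lambda>x. (\<lambda>(t, u, v, w). pure_tensor H2 (S u * \<alpha> * v, S t * \<alpha> * w)) x B) \<in> forms H4" for B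
    using form[of "\<lambda>a b. B (a, b)"]
    by (cases "B \<in> forms H2") (simp_all add: pure_tensor_def forms_H2 forms_H4, simp add: form4_def)
  have t: "mult4 (one_tensor \<phi>_inv) (id_id_\<Delta> \<phi>) \<in> tensors H4"
    unfolding mult4_def by (intro A4.times_in legs_in phi_in)
  have "\<gamma> \<in> tensors H2"
    unfolding \<gamma>_def by (rule sweedler_in[OF t F4]) (auto intro: tensor_pure)
  moreover have "\<gamma> (\<lambda>(a, b). F a b) = tsum2 sums.gam F" if F: "form2 F" for F
  proof -
    have "\<gamma> (\<lambda>(a, b). F a b) = mult4 (one_tensor \<phi>_inv) (id_id_\<Delta> \<phi>) (\<lambda>(t, u, v, w). F (S u * \<alpha> * v) (S t * \<alpha> * w))"
      unfolding \<gamma>_def sweedler_fun[OF t F4] using F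
      by (intro arg_cong[of _ _ "mult4 (one_tensor \<phi>_inv) (id_id_\<Delta> \<phi>)"]) (auto simp: pure_tensor_def forms_H2)
    then show ?thesis
      unfolding mult4_def times_eval[OF L_inv_facts I_facts form[OF F]]
      by (simp add: sums.tsum_gam mult.assoc)
  qed
  ultimately show ?thesis by (simp add: represents_def)
qed

lemma represents_drinfeld_f: "represents drinfeld_f (tsum2 sums.fs)"
proof (rule represents_cong)
  show "represents drinfeld_f (\<lambda>F. tsum3 pi (\<lambda>x y z. tsum2 (cop x) (\<lambda>x\<^sub>1 x\<^sub>2. tsum2 sums.gam (\<lambda>u v.
      tsum2 (cop (y * \<beta> * S z)) (\<lambda>d e. F (S x\<^sub>2 * u * d) (S x\<^sub>1 * v * e))))))"
    unfolding drinfeld_f_def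
  proof (rule represents_sweedler[OF phi_inv_facts])
    show "represents (mult2 (mult2 (map2 S (flip (\<Delta> x))) \<gamma>) (\<Delta> (y * \<beta> * S z)))
      (\<lambda>F. tsum2 (cop x) (\<lambda>x\<^sub>1 x\<^sub>2. tsum2 sums.gam (\<lambda>u v.
      tsum2 (cop (y * \<beta> * S z)) (\<lambda>d e. F (S x\<^sub>2 * u * d) (S x\<^sub>1 * v * e)))))" for x y z
      by (rule represents_mult2[OF represents_mult2[OF represents_map2[OF represents_flip[OF represents_\<Delta>] endo_S]
            represents_\<gamma>] represents_\<Delta>])
    fix F assume F: "form2 F"
    show "form3 (\<lambda>x y z. tsum2 (cop x) (\<lambda>x\<^sub>1 x\<^sub>2. tsum2 sums.gam (\<lambda>u v.
      tsum2 (cop (y * \<beta> * S z)) (\<lambda>d e. F (S x\<^sub>2 * u * d) (S x\<^sub>1 * v * e)))))"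
      using form2D[OF F] by (simp add: form_defs)
  qed
qed (simp add: sums.tsum_fs sums.f_pairing_def mult.assoc)

lemma represents_list: "represents (\<Sum>x\<leftarrow>xs. pure_tensor H2 x) (tsum2 xs)"
  by (auto simp: represents_def tensor_sum_list tensor_pure sum_pure_apply forms_H2 tsum2_def)

lemma represents_one: "represents t (\<lambda>F. F 1 1) \<Longrightarrow> t = one2"
  unfolding one2_def
  by (rule tensor_eqI[of _ H2])
    (auto simp: represents_in represents_apply represents_apply[OF represents_pure] represents_in[OF represents_pure])

text \<open>The inverse of f is a definite description, and it is resolved by an explicit two-sided
  inverse: existence takes both \<open>f_h\<close> and \<open>h_f\<close>, uniqueness is
  associativity.\<close>

lemma represents_drinfeld_f_inv: "represents drinfeld_f_inv (tsum2 sums.hs)"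
proof -
  let ?h = "\<Sum>x\<leftarrow>sums.hs. pure_tensor H2 x"
  note f = represents_drinfeld_f and h = represents_list[of sums.hs]
  have "mult2 drinfeld_f ?h = one2"
    by (rule represents_one, rule represents_cong[OF represents_mult2[OF f h]]) (rule sums.f_h)
  moreover have "mult2 ?h drinfeld_f = one2"
    by (rule represents_one, rule represents_cong[OF represents_mult2[OF h f]]) (rule sums.h_f)
  ultimately have inv: "is_inverse2 drinfeld_f ?h"
    using represents_in[OF h] by (simp add: is_inverse2_def)
  have "g = ?h" if "is_inverse2 drinfeld_f g" for g
    using A2.inverse_unique[OF represents_in[OF f], of g ?h] that inv
    by (simp add: is_inverse2_def mult2_def one2_def)
  then have "drinfeld_f_inv = ?h"
    unfolding drinfeld_f_inv_def using inv by (intro the_equality)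
  then show ?thesis using h by simp
qed

text \<open>Here the U of the statement is identified with the contraction that the list
  \<open>us\<close> describes. From now on only its equivariance, its contraction rule and their
  consequences are used.\<close>

lemma represents_U: "represents U (tsum2 sums.us)"
proof (rule represents_cong)
  show "represents U (\<lambda>F. tsum2 sums.hs (\<lambda>f g. sums.Q_sum (\<lambda>u v. F (f * u) (g * v))))"
    unfolding U_def
    by (rule represents_cong[OF represents_mult2[OF represents_drinfeld_f_inv
            represents_map2[OF represents_flip[OF represents_q_R] endo_S]]])
      (simp add: sums.Q_sum_def S_mult)
qed (rule sums.h_Q)

lemma represents_V: "represents V (tsum2 sums.vs)"
proof (rule represents_cong)
  show "represents V (\<lambda>F. sums.p_sum (\<lambda>u v. tsum2 sums.fs (\<lambda>f g. F (inv S v * inv S g) (inv S u * inv S f))))"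
    unfolding V_def drinfeld_h_def
    by (rule represents_mult2[OF represents_map2[OF represents_flip[OF represents_p_R] endo_T]
            represents_map2[OF represents_flip[OF represents_drinfeld_f] endo_T]])
qed (simp add: sums.tsum_vs sums.p_sum_def sums.T_mul tsum2_tsum3_swap mult.assoc)

end

subsection \<open>The twisted coaction\<close>

locale left_bimodule_over_quasi_hopf =
  quasi_hopf_algebra scl \<Delta> \<epsilon> \<phi> S \<alpha> \<beta> + left_quasi_hopf_bimodule scl \<Delta> \<epsilon> \<phi> UNIV sM l r \<Lambda>
  for scl :: "'k::field \<Rightarrow> 'h::ring_1 \<Rightarrow> 'h" and \<Delta> \<epsilon> \<phi> S \<alpha> \<beta>
    and sM :: "'k \<Rightarrow> 'm::ab_group_add \<Rightarrow> 'm" and l r \<Lambda>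
begin

abbreviation "HM \<equiv> cons_factor UNIV scl (single_factor UNIV sM)"
abbreviation "HHM \<equiv> cons_factor UNIV scl HM"

abbreviation linM :: "('m \<Rightarrow> 'k) \<Rightarrow> bool" where "linM \<equiv> scalar_forms.lin sM"

definition formHM :: "('h \<Rightarrow> 'm \<Rightarrow> 'k) \<Rightarrow> bool" where
  "formHM F \<longleftrightarrow> (\<forall>n. lin (\<lambda>a. F a n)) \<and> (\<forall>a. linM (F a))"

definition formHHM :: "('h \<Rightarrow> 'h \<Rightarrow> 'm \<Rightarrow> 'k) \<Rightarrow> bool" where
  "formHHM F \<longleftrightarrow> (\<forall>b n. lin (\<lambda>a. F a b n)) \<and> (\<forall>a n. lin (\<lambda>b. F a b n)) \<and> (\<forall>a b. linM (F a b))"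

lemma linM_def: "linM f \<longleftrightarrow> (\<forall>x y. f (x + y) = f x + f y) \<and> (\<forall>c x. f (sM c x) = c * f x)"
  by (rule scalar_forms.lin_def)

lemmas linM_intros [simp] = scalar_forms.lin_intros[of sM] scalar_forms.lin_tsum2[of sM] scalar_forms.lin_tsum3[of sM]

lemma lin_act [simp]:
  assumes "linM f"
  shows "endo g \<Longrightarrow> lin (\<lambda>x. f (l (g x) n))" "endo g \<Longrightarrow> lin (\<lambda>x. f (r n (g x)))"
    "linM (\<lambda>n. f (l a n))" "linM (\<lambda>n. f (r n a))"
  using assms by (simp_all add: lin_def linM_def endo_def add_l scale_l add_r scale_r l_add l_scale r_add r_scale)

lemma lin_act2 [simp]:
  assumes "linM f"
  shows "endo g \<Longrightarrow> lin (\<lambda>x. f (l b (r n (g x))))" "endo g \<Longrightarrow> lin (\<lambda>x. f (l (g x) (r n b)))"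
    "linM (\<lambda>n. f (l a (r n b)))"
  using lin_act[OF lin_act(3)[OF assms]] lin_act(1)[OF assms] lin_act(4)[OF lin_act(3)[OF assms]] by simp_all

lemma act_simps [simp]: "l a (l b n) = l (a * b) n" "r (r n a) b = r n (a * b)" "r (l a n) b = l a (r n b)"
    "l 1 n = n" "r n 1 = n"
  by (simp_all add: mult_l mult_r l_r_commute one_l one_r)

lemma forms_M: "B \<in> forms (single_factor UNIV sM) \<longleftrightarrow> linM B"
  by (simp add: forms_single linear_form_on_UNIV)

lemma forms_HM: "B \<in> forms HM \<longleftrightarrow> formHM (\<lambda>a n. B (a, n))"
  by (simp add: forms_cons forms_M linear_form_on_UNIV formHM_def)

lemma forms_HHM: "B \<in> forms HHM \<longleftrightarrow> formHHM (\<lambda>a b n. B (a, b, n))"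
  by (auto simp: forms_cons[of _ _ _ HM] forms_HM linear_form_on_UNIV formHM_def formHHM_def)

lemma good_HM: "good_factors HM" and good_HHM: "good_factors HHM"
  by (simp_all add: good_cons good_single)

section \<open>Representing lists for \<Lambda>\<close>

definition La :: "'m \<Rightarrow> ('h \<times> 'm) list" where "La m = tlist HM (\<Lambda> m)"

lemma \<Lambda>_in': "\<Lambda> m \<in> tensors HM"
  by (rule \<Lambda>_in) simp

lemma \<Lambda>_apply: "B \<in> forms HM \<Longrightarrow> \<Lambda> m B = tsum2 (La m) (\<lambda>a n. B (a, n))"
  by (simp add: tensor_apply[OF \<Lambda>_in'] La_def tsum2_def)

lemma \<Lambda>_eval: "formHM F \<Longrightarrow> \<Lambda> m (\<lambda>(a, n). F a n) = tsum2 (La m) F"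
  by (simp add: \<Lambda>_apply forms_HM)

lemma linM_La:
  assumes "formHM F"
  shows "linM (\<lambda>m. tsum2 (La m) F)"
  unfolding \<Lambda>_eval[OF assms, symmetric] linM_def by (simp add: \<Lambda>_add \<Lambda>_scale fscale_def)

lemma formHMD:
  assumes "formHM F"
  shows "endo g \<Longrightarrow> lin (\<lambda>x. F (g x) n)" "linM (F a)" "linM (\<lambda>n. F a (l b n))" "linM (\<lambda>n. F a (r n b))"
    "endo g \<Longrightarrow> lin (\<lambda>x. F a (l (g x) n))" "endo g \<Longrightarrow> lin (\<lambda>x. F a (r n (g x)))"
  using assms by (simp_all add: formHM_def lin_endo[of "\<lambda>a. F a n"])

lemma formHHMD:
  assumes "formHHM F"
  shows "endo g \<Longrightarrow> lin (\<lambda>x. F (g x) b n)" "endo g \<Longrightarrow> lin (\<lambda>x. F a (g x) n)"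
    "linM (F a b)" "linM (\<lambda>n. F a b (l c n))" "linM (\<lambda>n. F a b (r n c))"
    "endo g \<Longrightarrow> lin (\<lambda>x. F a b (l (g x) n))" "endo g \<Longrightarrow> lin (\<lambda>x. F a b (r n (g x)))"
  using assms by (simp_all add: formHHM_def lin_endo[of "\<lambda>a. F a b n"] lin_endo[of "\<lambda>b. F a b n"])

lemma left_factorwise:
  assumes x: "x \<in> tensors H2" and t: "t \<in> tensors HM"
  shows left_factorwise_in: "factorwise H2 HM HM (pair_op (*) l) x t \<in> tensors HM"
    and left_factorwise_apply: "B \<in> forms HM \<Longrightarrow>
      factorwise H2 HM HM (pair_op (*) l) x t B = x (\<lambda>a. t (\<lambda>b. B (pair_op (*) l a b)))"
    and left_factorwise_form: "B \<in> forms HM \<Longrightarrow> (\<lambda>a. t (\<lambda>b. B (pair_op (*) l a b))) \<in> forms H2"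
    and left_factorwise_form': "B \<in> forms HM \<Longrightarrow> (\<lambda>b. B (pair_op (*) l a b)) \<in> forms HM"
proof -
  have 1: "(\<lambda>a. B (pair_op (*) l a b)) \<in> forms H2" if "B \<in> forms HM" for B b
    using formHMD[of "\<lambda>a n. B (a, n)"] that
    by (cases b) (simp add: pair_op_def forms_H2 forms_HM form2_def)
  have 2: "(\<lambda>b. B (pair_op (*) l a b)) \<in> forms HM" if "B \<in> forms HM" for B a
    using formHMD[of "\<lambda>a n. B (a, n)"] that
    by (cases a) (simp add: pair_op_def forms_H2 forms_HM, simp add: formHM_def)
  show "factorwise H2 HM HM (pair_op (*) l) x t \<in> tensors HM"
    by (rule factorwise_in[OF x t A2.good good_HM]) (auto simp: 1 2)
  show "B \<in> forms HM \<Longrightarrow>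
      factorwise H2 HM HM (pair_op (*) l) x t B = x (\<lambda>a. t (\<lambda>b. B (pair_op (*) l a b)))"
    by (rule factorwise_apply[OF x t A2.good good_HM]) (auto simp: 1 2)
  show "B \<in> forms HM \<Longrightarrow> (\<lambda>a. t (\<lambda>b. B (pair_op (*) l a b))) \<in> forms H2"
    by (rule tensor_apply_form[OF t A2.good]) (auto simp: 1 2)
  show "B \<in> forms HM \<Longrightarrow> (\<lambda>b. B (pair_op (*) l a b)) \<in> forms HM" by (rule 2)
qed

lemma right_factorwise:
  assumes x: "x \<in> tensors H2" and t: "t \<in> tensors HM"
  shows right_factorwise_in: "factorwise HM H2 HM (pair_op (*) r) t x \<in> tensors HM"
    and right_factorwise_apply: "B \<in> forms HM \<Longrightarrow>
      factorwise HM H2 HM (pair_op (*) r) t x B = t (\<lambda>b. x (\<lambda>a. B (pair_op (*) r b a)))"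
    and right_factorwise_form: "B \<in> forms HM \<Longrightarrow> (\<lambda>b. x (\<lambda>a. B (pair_op (*) r b a))) \<in> forms HM"
    and right_factorwise_form': "B \<in> forms HM \<Longrightarrow> (\<lambda>a. B (pair_op (*) r b a)) \<in> forms H2"
proof -
  have 1: "(\<lambda>a. B (pair_op (*) r b a)) \<in> forms H2" if "B \<in> forms HM" for B b
    using formHMD[of "\<lambda>a n. B (a, n)"] that
    by (cases b) (simp add: pair_op_def forms_H2 forms_HM form2_def)
  have 2: "(\<lambda>b. B (pair_op (*) r b a)) \<in> forms HM" if "B \<in> forms HM" for B a
    using formHMD[of "\<lambda>a n. B (a, n)"] that
    by (cases a) (simp add: pair_op_def forms_H2 forms_HM, simp add: formHM_def)
  show "factorwise HM H2 HM (pair_op (*) r) t x \<in> tensors HM"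
    by (rule factorwise_in[OF t x good_HM A2.good]) (auto simp: 1 2)
  show "B \<in> forms HM \<Longrightarrow>
      factorwise HM H2 HM (pair_op (*) r) t x B = t (\<lambda>b. x (\<lambda>a. B (pair_op (*) r b a)))"
    by (rule factorwise_apply[OF t x good_HM A2.good]) (auto simp: 1 2)
  show "B \<in> forms HM \<Longrightarrow> (\<lambda>b. x (\<lambda>a. B (pair_op (*) r b a))) \<in> forms HM"
    by (rule tensor_apply_form[OF x good_HM]) (auto simp: 1 2)
  show "B \<in> forms HM \<Longrightarrow> (\<lambda>a. B (pair_op (*) r b a)) \<in> forms H2" by (rule 1)
qed

lemma formHM_pair: "formHM F \<Longrightarrow> (\<lambda>(a, n). F a n) \<in> forms HM"
  by (simp add: forms_HM)

lemma La_l: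
  assumes F: "formHM F"
  shows "tsum2 (La (l a m)) F = tsum2 (cop a) (\<lambda>a\<^sub>1 a\<^sub>2. tsum2 (La m) (\<lambda>b n. F (a\<^sub>1 * b) (l a\<^sub>2 n)))"
proof -
  note B = formHM_pair[OF F]
  show ?thesis
    unfolding \<Lambda>_eval[OF F, symmetric] \<Lambda>_l[OF UNIV_I] left_factorwise_apply[OF \<Delta>_in \<Lambda>_in' B]
      \<Delta>_apply[OF left_factorwise_form[OF \<Delta>_in \<Lambda>_in' B]]
    unfolding \<Lambda>_apply[OF left_factorwise_form'[OF \<Delta>_in \<Lambda>_in' B]] by (simp add: pair_op_def)
qed

lemma La_r:
  assumes F: "formHM F"
  shows "tsum2 (La (r m a)) F = tsum2 (La m) (\<lambda>b n. tsum2 (cop a) (\<lambda>a\<^sub>1 a\<^sub>2. F (b * a\<^sub>1) (r n a\<^sub>2)))"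
proof -
  note B = formHM_pair[OF F]
  show ?thesis
    unfolding \<Lambda>_eval[OF F, symmetric] \<Lambda>_r[OF UNIV_I] right_factorwise_apply[OF \<Delta>_in \<Lambda>_in' B]
      \<Lambda>_apply[OF right_factorwise_form[OF \<Delta>_in \<Lambda>_in' B]]
    unfolding \<Delta>_apply[OF right_factorwise_form'[OF \<Delta>_in \<Lambda>_in' B]] by (simp add: pair_op_def)
qed

lemma linM_iff: "linM f \<longleftrightarrow> Vector_Spaces.linear sM (*) f"
  using vector_space_sM vector_space_field_mult
  by (auto simp: linM_def Vector_Spaces.linear_def module_hom_def module_hom_axioms_def module_iff_vector_space)

lemma lin_\<epsilon>: "endo g \<Longrightarrow> lin (\<lambda>x. \<epsilon> (g x))"
  by (rule sums.lin_eps_endo)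

lemma La_counit:
  assumes f: "linM f"
  shows "tsum2 (La m) (\<lambda>a n. \<epsilon> a * f n) = f m"
proof -
  have form: "formHM (\<lambda>a n. g (sM (\<epsilon> a) n))" if "linM g" for g
    using that lin_\<epsilon>[OF endo_id] by (simp add: formHM_def linM_def lin_def algebra_simps)
  have "f (sweedler HM (\<Lambda> m) (\<lambda>(a, n). sM (\<epsilon> a) n)) = \<Lambda> m (\<lambda>x. f (case x of (a, n) \<Rightarrow> sM (\<epsilon> a) n))"
    using f form by (intro sweedler_linear[OF \<Lambda>_in' vector_space_sM]) (simp_all add: linM_iff[symmetric] forms_HM)
  also have "\<dots> = tsum2 (La m) (\<lambda>a n. f (sM (\<epsilon> a) n))"
    using form[OF f] by (simp add: \<Lambda>_apply forms_HM)
  finally show ?thesis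
    using f by (simp add: \<Lambda>_counit linM_def)
qed

text \<open>The axiom compares two tensors in H \<otimes> H \<otimes> M. Before it can be evaluated
  at F, both iterated coactions, \<open>W1\<close> and \<open>W2\<close>, have to be recognised as
  tensors, with an evaluation formula for each.\<close>

lemma La_coassoc:
  assumes F: "formHHM F"
  shows "tsum3 ph (\<lambda>x y z. tsum2 (La m) (\<lambda>a n. tsum2 (cop a) (\<lambda>b c. F (x * b) (y * c) (l z n)))) =
    tsum2 (La m) (\<lambda>a n. tsum2 (La n) (\<lambda>b n'. tsum3 ph (\<lambda>x y z. F (a * x) (b * y) (r n' z))))"
proof -
  have B: "(\<lambda>(a, b, n). F a b n) \<in> forms HHM" using F by (simp add: forms_HHM)
  have leg1: "sweedler H2 (\<Delta> a) (\<lambda>(b, c). pure_tensor HHM (b, c, n)) \<in> tensors HHM"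
    "sweedler H2 (\<Delta> a) (\<lambda>(b, c). pure_tensor HHM (b, c, n)) B =
      (if B \<in> forms HHM then tsum2 (cop a) (\<lambda>b c. B (b, c, n)) else 0)" for a n B
    using leg[where T=HHM and \<iota>="\<lambda>b c. (b, c, n)" and a=a] tensor_outside[of _ HHM B]
    by (auto simp: good_HHM forms_HHM formHHM_def form2_def)
  have form1: "(\<lambda>x. (\<lambda>(a, n). sweedler H2 (\<Delta> a) (\<lambda>(b, c). pure_tensor HHM (b, c, n))) x B) \<in> forms HM" for B
    by (cases "B \<in> forms HHM") (simp_all add: leg1 forms_HM forms_HHM, auto simp: formHM_def formHHM_def form2_def)
  define W1 where "W1 = sweedler HM (\<Lambda> m) (\<lambda>(a, n). sweedler H2 (\<Delta> a) (\<lambda>(b, c). pure_tensor HHM (b, c, n)))"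
  have W1_in: "W1 \<in> tensors HHM"
    unfolding W1_def by (rule sweedler_in[OF \<Lambda>_in' form1]) (auto simp: leg1)
  have W1: "W1 B = tsum2 (La m) (\<lambda>a n. tsum2 (cop a) (\<lambda>b c. B (b, c, n)))" if "B \<in> forms HHM" for B
    unfolding W1_def using that form1[of B] by (simp add: sweedler_fun[OF \<Lambda>_in' form1] \<Lambda>_apply leg1)
  have leg2_form: "(\<lambda>x. (\<lambda>(b, n'). pure_tensor HHM (a, b, n')) x B) \<in> forms HM" for a B
    by (cases "B \<in> forms HHM") (simp_all add: pure_tensor_def forms_HM forms_HHM, auto simp: formHM_def formHHM_def)
  have leg2: "sweedler HM (\<Lambda> n) (\<lambda>(b, n'). pure_tensor HHM (a, b, n')) \<in> tensors HHM"
    "sweedler HM (\<Lambda> n) (\<lambda>(b, n'). pure_tensor HHM (a, b, n')) B =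
      (if B \<in> forms HHM then tsum2 (La n) (\<lambda>b n'. B (a, b, n')) else 0)" for a n B
  proof -
    show *: "sweedler HM (\<Lambda> n) (\<lambda>(b, n'). pure_tensor HHM (a, b, n')) \<in> tensors HHM"
      by (rule sweedler_in[OF \<Lambda>_in' leg2_form]) (auto intro: tensor_pure)
    show "sweedler HM (\<Lambda> n) (\<lambda>(b, n'). pure_tensor HHM (a, b, n')) B =
      (if B \<in> forms HHM then tsum2 (La n) (\<lambda>b n'. B (a, b, n')) else 0)"
      using leg2_form[of a B] tensor_outside[OF *, of B]
      by (simp add: sweedler_fun[OF \<Lambda>_in' leg2_form] \<Lambda>_apply) (simp add: pure_tensor_def)
  qed
  have form2: "(\<lambda>x. (\<lambda>(a, n). sweedler HM (\<Lambda> n) (\<lambda>(b, n'). pure_tensor HHM (a, b, n'))) x B) \<in> forms HM" for B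
  proof (cases "B \<in> forms HHM")
    case True
    then have "formHM (\<lambda>b n'. B (a, b, n'))" for a
      by (simp add: forms_HHM formHHM_def formHM_def)
    from linM_La[OF this] True show ?thesis
      by (simp add: leg2 forms_HM) (simp add: forms_HHM formHM_def formHHM_def)
  qed (simp add: leg2 forms_HM formHM_def)
  define W2 where "W2 = sweedler HM (\<Lambda> m) (\<lambda>(a, n). sweedler HM (\<Lambda> n) (\<lambda>(b, n'). pure_tensor HHM (a, b, n')))"
  have W2_in: "W2 \<in> tensors HHM"
    unfolding W2_def by (rule sweedler_in[OF \<Lambda>_in' form2]) (auto simp: leg2)
  have W2: "W2 B = tsum2 (La m) (\<lambda>a n. tsum2 (La n) (\<lambda>b n'. B (a, b, n')))" if "B \<in> forms HHM" for B
    unfolding W2_def using that form2[of B] by (simp add: sweedler_fun[OF \<Lambda>_in' form2] \<Lambda>_apply leg2)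
  have l1: "(\<lambda>a. B (pair_op (*) (pair_op (*) l) a b)) \<in> forms H3"
    and r1: "(\<lambda>a. B (pair_op (*) (pair_op (*) r) b a)) \<in> forms H3" if "B \<in> forms HHM" for B b
    using formHHMD[of "\<lambda>a b n. B (a, b, n)"] that
    by (cases b; simp add: pair_op_def forms_H3 forms_HHM form3_def)+
  have l2: "(\<lambda>b. B (pair_op (*) (pair_op (*) l) a b)) \<in> forms HHM"
    and r2: "(\<lambda>b. B (pair_op (*) (pair_op (*) r) b a)) \<in> forms HHM" if "B \<in> forms HHM" for B a
    using formHHMD[of "\<lambda>a b n. B (a, b, n)"] that
    by (cases a; simp add: pair_op_def forms_HHM; simp add: formHHM_def)+
  have "factorwise H3 HHM HHM (pair_op (*) (pair_op (*) l)) \<phi> W1 (\<lambda>(a, b, n). F a b n) =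
      factorwise HHM H3 HHM (pair_op (*) (pair_op (*) r)) W2 \<phi> (\<lambda>(a, b, n). F a b n)"
    using \<Lambda>_coassoc[OF UNIV_I, of m] by (simp only: W1_def W2_def)
  moreover have "factorwise H3 HHM HHM (pair_op (*) (pair_op (*) l)) \<phi> W1 (\<lambda>(a, b, n). F a b n) =
      \<phi> (\<lambda>u. W1 (\<lambda>v. (\<lambda>(a, b, n). F a b n) (pair_op (*) (pair_op (*) l) u v)))"
    by (rule factorwise_apply[OF \<phi>_in W1_in A3.good good_HHM _ l1 l2 B]) auto
  moreover have "factorwise HHM H3 HHM (pair_op (*) (pair_op (*) r)) W2 \<phi> (\<lambda>(a, b, n). F a b n) =
      W2 (\<lambda>u. \<phi> (\<lambda>v. (\<lambda>(a, b, n). F a b n) (pair_op (*) (pair_op (*) r) u v)))"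
    by (rule factorwise_apply[OF W2_in \<phi>_in good_HHM A3.good _ r2 r1 B]) auto
  moreover have "(\<lambda>u. W1 (\<lambda>v. (\<lambda>(a, b, n). F a b n) (pair_op (*) (pair_op (*) l) u v))) \<in> forms H3"
    by (rule tensor_apply_form[OF W1_in A3.good]) (rule l1[OF B] l2[OF B])+
  moreover have "(\<lambda>u. \<phi> (\<lambda>v. (\<lambda>(a, b, n). F a b n) (pair_op (*) (pair_op (*) r) u v))) \<in> forms HHM"
    by (rule tensor_apply_form[OF \<phi>_in good_HHM]) (rule r1[OF B] r2[OF B])+
  ultimately have "tsum3 ph (\<lambda>x y z. W1 (\<lambda>v. (\<lambda>(a, b, n). F a b n) (pair_op (*) (pair_op (*) l) (x, y, z) v))) =
    tsum2 (La m) (\<lambda>a n. tsum2 (La n) (\<lambda>b n'. \<phi> (\<lambda>v. (\<lambda>(a, b, n). F a b n) (pair_op (*) (pair_op (*) r) (a, b, n') v))))"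
    by (simp only: \<phi>_apply W2)
  then show ?thesis
    unfolding W1[OF l2[OF B]] \<phi>_apply[OF r1[OF B]] by (simp add: pair_op_def)
qed

text \<open>The scalar c([\<rho>(\<psi>)](m)), as \<open>lin_hom\<close> shows. Functionals c
  separate the points of H, so the coaction is determined by these numbers, and each of them is a
  plain sum over V, \<Lambda>(m) and U.\<close>

definition bar :: "('m \<Rightarrow> 'k) \<Rightarrow> 'm \<Rightarrow> ('h \<Rightarrow> 'k) \<Rightarrow> 'k" where
  "bar \<psi> m c = tsum2 sums.vs (\<lambda>v w. tsum2 (La m) (\<lambda>a n. tsum2 sums.us (\<lambda>u t.
     c (v * (a * u)) * \<psi> (l w (r n t)))))"

lemma \<Lambda>_bar_in: "\<Lambda>_bar sM l r \<Lambda> m \<in> tensors HM"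
  unfolding \<Lambda>_bar_def Let_def
  by (intro right_factorwise_in left_factorwise_in represents_in[OF represents_U] represents_in[OF represents_V] \<Lambda>_in')

lemma \<Lambda>_bar_apply:
  assumes F: "formHM F"
  shows "\<Lambda>_bar sM l r \<Lambda> m (\<lambda>(a, n). F a n) =
    tsum2 sums.vs (\<lambda>v w. tsum2 (La m) (\<lambda>a n. tsum2 sums.us (\<lambda>u t. F (v * (a * u)) (l w (r n t)))))"
proof -
  note U = represents_in[OF represents_U] and V = represents_in[OF represents_V]
  note B = formHM_pair[OF F]
  note R = right_factorwise_form[OF U left_factorwise_in[OF V \<Lambda>_in'] B]
  note R' = right_factorwise_form'[OF U left_factorwise_in[OF V \<Lambda>_in'] B]
  note L = left_factorwise_form[OF V \<Lambda>_in' R]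
  note L' = left_factorwise_form'[OF V \<Lambda>_in' R]
  have "\<Lambda>_bar sM l r \<Lambda> m (\<lambda>(a, n). F a n) = V (\<lambda>v. \<Lambda> m (\<lambda>b. U (\<lambda>a. (\<lambda>(a, n). F a n) (pair_op (*) r (pair_op (*) l v b) a))))"
    unfolding \<Lambda>_bar_def Let_def right_factorwise_apply[OF U left_factorwise_in[OF V \<Lambda>_in'] B]
    by (rule left_factorwise_apply[OF V \<Lambda>_in' R])
  also have "\<dots> = tsum2 sums.vs (\<lambda>v w. \<Lambda> m (\<lambda>b. U (\<lambda>a. (\<lambda>(a, n). F a n) (pair_op (*) r (pair_op (*) l (v, w) b) a))))"
    by (rule represents_apply[OF represents_V L])
  also have "\<dots> = tsum2 sums.vs (\<lambda>v w. tsum2 (La m) (\<lambda>a n. U (\<lambda>u. (\<lambda>(a, n). F a n) (pair_op (*) r (pair_op (*) l (v, w) (a, n)) u))))"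
    unfolding \<Lambda>_apply[OF L'] ..
  finally show ?thesis
    unfolding represents_apply[OF represents_U R'] by (simp add: pair_op_def mult.assoc)
qed

lemma bar_form:
  assumes "linM \<psi>" "lin c"
  shows "formHM (\<lambda>a n. c a * \<psi> n)"
  using assms by (simp add: formHM_def)

lemma bar_formHM:
  assumes "linM \<psi>" "lin c"
  shows "formHM (\<lambda>a n. tsum2 sums.us (\<lambda>u t. c (v * (a * u)) * \<psi> (l w (r n t))))"
  using assms(1) lin_endo[OF assms(2)] by (simp add: formHM_def)

lemma linM_bar: "linM \<psi> \<Longrightarrow> lin c \<Longrightarrow> linM (\<lambda>m. bar \<psi> m c)"
  unfolding bar_def by (intro linM_intros linM_La bar_formHM)

lemma lin_hom:
  assumes "linM \<psi>" "lin c"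
  shows "c (sweedler HM (\<Lambda>_bar sM l r \<Lambda> m) (\<lambda>(a, n). scl (\<psi> n) a)) = bar \<psi> m c"
proof -
  have form: "formHM (\<lambda>a n. g (scl (\<psi> n) a))" if "lin g" for g
    using bar_form[OF assms(1) that] that by (simp add: scl_lin mult.commute)
  have "c (sweedler HM (\<Lambda>_bar sM l r \<Lambda> m) (\<lambda>(a, n). scl (\<psi> n) a)) =
      \<Lambda>_bar sM l r \<Lambda> m (\<lambda>x. c (case x of (a, n) \<Rightarrow> scl (\<psi> n) a))"
    using assms(2) form
    by (intro sweedler_linear[OF \<Lambda>_bar_in vector_space_scl]) (simp_all add: lin_iff[symmetric] forms_HM)
  also have "(\<lambda>x. c (case x of (a, n) \<Rightarrow> scl (\<psi> n) a)) = (\<lambda>(a, n). c a * \<psi> n)"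
    using assms(2) by (auto simp: scl_lin)
  finally show ?thesis
    unfolding \<Lambda>_bar_apply[OF bar_form[OF assms]] bar_def .
qed

text \<open>The action of a on \<psi> puts S^{-1}(a) to the left of the second leg of V, where
  equivariance of V applies. It creates \<Delta>(S^{-1}(a_1)) to the right of V, and \<Lambda>
  absorbs this coproduct as the action of S^{-1}(a_1) on m.\<close>

lemma bar_l:
  assumes \<psi>: "linM \<psi>" and c: "lin c"
  shows "bar (\<lambda>n. \<psi> (l (inv S a) n)) m c = tsum2 (cop a) (\<lambda>a\<^sub>1 a\<^sub>2. bar \<psi> (l (inv S a\<^sub>1) m) (\<lambda>b. c (a\<^sub>2 * b)))"
proof -
  note [simp] = lin_endo[OF c] lin_act[OF \<psi>] lin_act2[OF \<psi>]
  have 1: "tsum2 sums.vs (\<lambda>v w. tsum2 (La m) (\<lambda>b n. tsum2 sums.us (\<lambda>u t. c (v * (b * u)) * \<psi> (l (inv S a * w) (r n t))))) =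
    tsum2 (cop a) (\<lambda>a\<^sub>1 a\<^sub>2. tsum2 (cop (inv S a\<^sub>1)) (\<lambda>d e. tsum2 sums.vs (\<lambda>v w.
      tsum2 (La m) (\<lambda>b n. tsum2 sums.us (\<lambda>u t. c (a\<^sub>2 * v * d * (b * u)) * \<psi> (l (w * e) (r n t)))))))"
    by (rule sums.V_equivariant) (simp add: form_defs)
  have 2: "tsum2 (La (l x m)) (\<lambda>b n. tsum2 sums.us (\<lambda>u t. c (a\<^sub>2 * (v * (b * u))) * \<psi> (l w (r n t)))) =
    tsum2 (cop x) (\<lambda>d e. tsum2 (La m) (\<lambda>b n. tsum2 sums.us (\<lambda>u t. c (a\<^sub>2 * (v * (d * b * u))) * \<psi> (l w (r (l e n) t)))))"
    for x a\<^sub>2 v w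
    using bar_formHM[OF \<psi> c, of "a\<^sub>2 * v" w] by (intro La_l) (simp add: mult.assoc)
  show ?thesis
    unfolding bar_def 2 using 1
    by (simp add: mult.assoc tsum2_tsum2_swap[of "cop (inv S x)" sums.vs for x])
qed

text \<open>The mirror image: S(a) stands behind the second leg of U, and \<Lambda> absorbs the
  coproduct of S(a_1) from the right.\<close>

lemma bar_r:
  assumes \<psi>: "linM \<psi>" and c: "lin c"
  shows "bar (\<lambda>n. \<psi> (r n (S a))) m c = tsum2 (cop a) (\<lambda>a\<^sub>1 a\<^sub>2. bar \<psi> (r m (S a\<^sub>1)) (\<lambda>b. c (b * a\<^sub>2)))"
proof -
  note [simp] = lin_endo[OF c] lin_act[OF \<psi>] lin_act2[OF \<psi>]
  have 1: "tsum2 sums.us (\<lambda>u t. c (v * (b * u)) * \<psi> (l w (r n (t * S a)))) =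
    tsum2 (cop a) (\<lambda>a\<^sub>1 a\<^sub>2. tsum2 (cop (S a\<^sub>1)) (\<lambda>d e. tsum2 sums.us (\<lambda>u t.
      c (v * (b * (d * (u * a\<^sub>2)))) * \<psi> (l w (r n (e * t))))))" for v w b n
    by (rule sums.U_equivariant) (simp add: form_defs)
  have 2: "tsum2 (La (r m x)) (\<lambda>b n. tsum2 sums.us (\<lambda>u t. c (v * (b * u) * a\<^sub>2) * \<psi> (l w (r n t)))) =
    tsum2 (La m) (\<lambda>b n. tsum2 (cop x) (\<lambda>d e. tsum2 sums.us (\<lambda>u t. c (v * (b * d * u) * a\<^sub>2) * \<psi> (l w (r (r n e) t)))))"
    for x a\<^sub>2 v w
    by (intro La_r) (simp add: formHM_def)
  show ?thesis
    unfolding bar_def 2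
    by (simp add: 1 mult.assoc tsum2_tsum2_swap[of "cop a" sums.vs] tsum2_tsum2_swap[of "cop a" "La m"])
qed

text \<open>Because \<epsilon> is multiplicative it splits over V, \<Lambda>(m) and U, and each of
  the three factors is removed by its own counit identity.\<close>

lemma bar_counit:
  assumes \<psi>: "linM \<psi>"
  shows "bar \<psi> m \<epsilon> = \<psi> m"
proof -
  note [simp] = lin_act[OF \<psi>] lin_act2[OF \<psi>]
  have 1: "tsum2 sums.us (\<lambda>u t. \<epsilon> u * \<psi> (l w (r n t))) = \<psi> (l w n)" for w n
    using sums.U.counit_U[of "\<lambda>t. \<psi> (l w (r n t))"] by simp
  have 2: "tsum2 (La m) (\<lambda>a n. \<epsilon> a * \<psi> (l w n)) = \<psi> (l w m)" for w
    by (rule La_counit) simp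
  have 3: "tsum2 sums.vs (\<lambda>v w. \<epsilon> v * \<psi> (l w m)) = \<psi> (l 1 m)"
    by (rule sums.V.counit_U) (use \<psi> in simp)
  show ?thesis
    using 3 by (simp add: bar_def \<epsilon>_mult mult.assoc 1 tsum2_mult 2)
qed

end

section \<open>Quasi-coassociativity of the twisted coaction\<close>

context quasi_hopf_algebra
begin

text \<open>The identity for V in the shape in which \<phi> and two coactions produce it: (Y
  \<otimes> Z \<otimes> 1)(1 \<otimes> V)(id \<otimes> \<Delta>)(V \<Delta>(S^{-1}(X))) = (\<Delta>
  \<otimes> id)(V) \<phi>^{-1}. \<open>V.lhs_eq_rhs\<close> expresses the doubled V with two inverse
  associators. Quasi-coassociativity moves the coproducts of S^{-1}(X) past the right one, after
  which the left one meets \<phi> leg by leg and cancels it.\<close>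

lemma V_cocycle:
  assumes H: "form3 H"
  shows "tsum3 ph (\<lambda>x y z. tsum2 (cop (inv S x)) (\<lambda>x\<^sub>1 x\<^sub>2. tsum2 sums.vs (\<lambda>v w. tsum2 sums.vs (\<lambda>v' w'.
      tsum2 (cop (w * x\<^sub>2)) (\<lambda>p q. H (y * (v * x\<^sub>1)) (z * (v' * p)) (w' * q)))))) =
    tsum2 sums.vs (\<lambda>v w. tsum2 (cop v) (\<lambda>g h. tsum3 pi (\<lambda>x y z. H (g * x) (h * y) (w * z))))"
proof -
  note [simp] = form_defs form3D[OF H]
  define K where "K p q r y\<^sub>0 z\<^sub>0 \<alpha>' \<beta>' \<gamma>' = tsum2 (cop (inv S p)) (\<lambda>d e. tsum2 sums.vs (\<lambda>u v.
      tsum2 (cop (u * d)) (\<lambda>g h. H (y\<^sub>0 * (q * (g * \<alpha>'))) (z\<^sub>0 * (r * (h * \<beta>'))) (v * (e * \<gamma>')))))"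
    for p q r y\<^sub>0 z\<^sub>0 \<alpha>' \<beta>' \<gamma>'
  have K: "form3 (K p q r y\<^sub>0 z\<^sub>0)" for p q r y\<^sub>0 z\<^sub>0 by (simp add: K_def)
  have lhs: "tsum2 sums.vs (\<lambda>v w. tsum2 sums.vs (\<lambda>v' w'. tsum2 (cop (w * x\<^sub>2)) (\<lambda>p q.
      H (y * (v * x\<^sub>1)) (z * (v' * p)) (w' * q)))) =
    tsum2 (cop x\<^sub>2) (\<lambda>k m. tsum3 pi (\<lambda>a b c. tsum3 pi (\<lambda>p q r. K p q r y z (a * x\<^sub>1) (b * k) (c * m))))" for x\<^sub>1 x\<^sub>2 y z
  proof -
    have B: "form3 (\<lambda>a b c. H (y * (a * x\<^sub>1)) (z * (b * k)) (c * m))" for k m by simp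
    have "tsum2 sums.vs (\<lambda>v w. tsum2 sums.vs (\<lambda>v' w'. tsum2 (cop (w * x\<^sub>2)) (\<lambda>p q.
        H (y * (v * x\<^sub>1)) (z * (v' * p)) (w' * q)))) =
      tsum2 (cop x\<^sub>2) (\<lambda>k m. sums.V.lhs (\<lambda>a b c. H (y * (a * x\<^sub>1)) (z * (b * k)) (c * m)))"
      by (simp add: sums.V.lhs_def cop_mul mult.assoc tsum2_tsum2_swap[of "cop x\<^sub>2"])
    then show ?thesis
      unfolding sums.V.lhs_eq_rhs[OF B] by (simp add: sums.V.rhs_def K_def mult.assoc)
  qed
  have coassoc: "tsum2 (cop a) (\<lambda>a\<^sub>1 a\<^sub>2. tsum2 (cop a\<^sub>2) (\<lambda>k m. tsum3 pi (\<lambda>x y z. tsum3 pi (\<lambda>p q r. K p q r y\<^sub>0 z\<^sub>0 (x * a\<^sub>1) (y * k) (z * m))))) =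
    tsum3 pi (\<lambda>p q r. tsum3 pi (\<lambda>x y z. tsum2 (cop (inv S p * a)) (\<lambda>d e. tsum2 sums.vs (\<lambda>u v.
      tsum2 (cop (u * d)) (\<lambda>g h. H (y\<^sub>0 * q * (g * x)) (z\<^sub>0 * r * (h * y)) (v * (e * z)))))))" for a y\<^sub>0 z\<^sub>0
  proof -
    have "tsum2 (cop a) (\<lambda>a\<^sub>1 a\<^sub>2. tsum2 (cop a\<^sub>1) (\<lambda>b c. K p q r y\<^sub>0 z\<^sub>0 (b * x) (c * y) (a\<^sub>2 * z))) =
      tsum2 (cop (inv S p * a)) (\<lambda>d e. tsum2 sums.vs (\<lambda>u v.
      tsum2 (cop (u * d)) (\<lambda>g h. H (y\<^sub>0 * q * (g * x)) (z\<^sub>0 * r * (h * y)) (v * (e * z)))))" for p q r x y z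
    proof -
      have "tsum2 (cop a\<^sub>1) (\<lambda>b c. K p q r y\<^sub>0 z\<^sub>0 (b * x) (c * y) (a\<^sub>2 * z)) =
        tsum2 (cop (inv S p)) (\<lambda>d e. tsum2 sums.vs (\<lambda>u v.
        tsum2 (cop (u * (d * a\<^sub>1))) (\<lambda>g h. H (y\<^sub>0 * q * (g * x)) (z\<^sub>0 * r * (h * y)) (v * (e * a\<^sub>2 * z)))))" for a\<^sub>1 a\<^sub>2
        by (simp add: K_def cop_mul mult.assoc tsum2_tsum2_swap[of "cop a\<^sub>1"])
      then show ?thesis
        by (subst cop_mul) (simp_all add: mult.assoc tsum2_tsum2_swap[of "cop a" "cop (inv S p)"])
    qed
    moreover have "tsum2 (cop a) (\<lambda>a\<^sub>1 a\<^sub>2. tsum2 (cop a\<^sub>2) (\<lambda>k m. tsum3 pi (\<lambda>x y z. tsum3 pi (\<lambda>p q r. K p q r y\<^sub>0 z\<^sub>0 (x * a\<^sub>1) (y * k) (z * m))))) =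
      tsum3 pi (\<lambda>p q r. tsum3 pi (\<lambda>x y z. tsum2 (cop a) (\<lambda>a\<^sub>1 a\<^sub>2. tsum2 (cop a\<^sub>2) (\<lambda>k m. K p q r y\<^sub>0 z\<^sub>0 (x * a\<^sub>1) (y * k) (z * m)))))"
      unfolding tsum2_tsum3_swap by (rule tsum3_tsum3_swap)
    ultimately show ?thesis
      unfolding sums.coassoc_pi[OF K] by simp
  qed
  define F3 where "F3 a b c = tsum3 pi (\<lambda>x y z. tsum2 (cop (inv S a)) (\<lambda>d e. tsum2 sums.vs (\<lambda>u v.
      tsum2 (cop (u * d)) (\<lambda>g h. H (b * (g * x)) (c * (h * y)) (v * (e * z))))))" for a b c
  have F3: "form3 F3" by (simp add: F3_def)
  have "tsum3 ph (\<lambda>x y z. tsum2 (cop (inv S x)) (\<lambda>x\<^sub>1 x\<^sub>2. tsum2 sums.vs (\<lambda>v w. tsum2 sums.vs (\<lambda>v' w'.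
      tsum2 (cop (w * x\<^sub>2)) (\<lambda>p q. H (y * (v * x\<^sub>1)) (z * (v' * p)) (w' * q)))))) =
    tsum3 ph (\<lambda>x y z. tsum3 pi (\<lambda>p q r. F3 (x * p) (y * q) (z * r)))"
    unfolding lhs coassoc F3_def sums.T_mul ..
  also have "\<dots> = F3 1 1 1" by (rule sums.ph_pi[OF F3])
  also have "\<dots> = tsum2 sums.vs (\<lambda>v w. tsum2 (cop v) (\<lambda>g h. tsum3 pi (\<lambda>x y z. H (g * x) (h * y) (w * z))))"
    by (simp add: F3_def cop_one tsum2_tsum3_swap)
  finally show ?thesis .
qed

end

context left_bimodule_over_quasi_hopf
begin

lemma bar_act:
  assumes \<psi>: "linM \<psi>" and c: "lin c"
  shows "bar \<psi> (l x (r n t)) c = tsum2 sums.vs (\<lambda>v w. tsum2 (cop x) (\<lambda>p q. tsum2 (La n) (\<lambda>b n'.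
    tsum2 sums.us (\<lambda>u t'. tsum2 (cop t) (\<lambda>s\<^sub>1 s\<^sub>2.
      c (v * (p * (b * (s\<^sub>1 * u)))) * \<psi> (l (w * q) (r n' (s\<^sub>2 * t'))))))))"
proof -
  note [simp] = lin_endo[OF c] lin_act[OF \<psi>] lin_act2[OF \<psi>]
  have 1: "tsum2 (La (l x (r n t))) (\<lambda>b k. tsum2 sums.us (\<lambda>u t'. c (v * (b * u)) * \<psi> (l w (r k t')))) =
    tsum2 (cop x) (\<lambda>p q. tsum2 (La (r n t)) (\<lambda>b k. tsum2 sums.us (\<lambda>u t'. c (v * (p * b * u)) * \<psi> (l w (r (l q k) t')))))" for v w
    by (intro La_l) (simp add: formHM_def)
  have 2: "tsum2 (La (r n t)) (\<lambda>b k. tsum2 sums.us (\<lambda>u t'. c (v * (p * b * u)) * \<psi> (l w (r (l q k) t')))) =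
    tsum2 (La n) (\<lambda>b n'. tsum2 (cop t) (\<lambda>s\<^sub>1 s\<^sub>2. tsum2 sums.us (\<lambda>u t'. c (v * (p * (b * s\<^sub>1) * u)) * \<psi> (l w (r (l q (r n' s\<^sub>2)) t')))))" for v w p q
    by (intro La_r) (simp add: formHM_def)
  show ?thesis
    unfolding bar_def 1 2 by (simp add: mult.assoc tsum2_tsum2_swap[of "cop t"])
qed

text \<open>Applying the coaction twice doubles V, \<Lambda> and U. The doubled U is replaced by
  \<open>U.lhs_eq_rhs\<close>, whose leading associator, by the axiom for \<Lambda>, changes the
  doubled \<Lambda> into \<Delta> on the first leg of a single one and reappears on the left. There
  it meets the inverse associator that \<open>V_cocycle\<close> leaves behind, and the coproducts of
  V, \<Lambda>(m) and U recombine.\<close>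

lemma bar_coassoc:
  assumes \<psi>: "linM \<psi>" and C: "form2 C"
  shows "tsum3 ph (\<lambda>x y z. tsum2 sums.vs (\<lambda>v w. tsum2 (La (l (inv S x) m)) (\<lambda>a n. tsum2 sums.us (\<lambda>u t.
      bar \<psi> (l w (r n t)) (\<lambda>b. C (y * (v * (a * u))) (z * b)))))) =
    tsum3 ph (\<lambda>x y z. bar \<psi> (r m (S x)) (\<lambda>a. tsum2 (cop a) (\<lambda>b c. C (b * y) (c * z))))"
proof -
  note [simp] = form_defs form2D[OF C] lin_act[OF \<psi>] lin_act2[OF \<psi>]
  \<comment> \<open>All of the double coaction except V: the doubled \<Lambda> and U, as a trilinear
    form in the three elements by which V multiplies from the left. This is the form to which
    \<open>V_cocycle\<close> is applied.\<close>
  define R where "R \<alpha>' \<beta>' \<gamma>' = tsum2 (La m) (\<lambda>a n. tsum2 (La n) (\<lambda>b n'.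
      sums.U.lhs (\<lambda>u\<^sub>1 u\<^sub>2 u\<^sub>3. C (\<alpha>' * (a * u\<^sub>1)) (\<beta>' * (b * u\<^sub>2)) * \<psi> (l \<gamma>' (r n' u\<^sub>3)))))" for \<alpha>' \<beta>' \<gamma>'
  have R: "form3 R" by (simp add: R_def sums.U.lhs_def)
  have lhs: "tsum2 (La (l X m)) (\<lambda>a n. tsum2 sums.us (\<lambda>u t. bar \<psi> (l w (r n t)) (\<lambda>b. C (y * (v * (a * u))) (z * b)))) =
    tsum2 (cop X) (\<lambda>x\<^sub>1 x\<^sub>2. tsum2 sums.vs (\<lambda>v' w'. tsum2 (cop (w * x\<^sub>2)) (\<lambda>p q. R (y * (v * x\<^sub>1)) (z * (v' * p)) (w' * q))))"
    for X w y v z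
  proof -
    have "tsum2 (La (l X m)) (\<lambda>a n. tsum2 sums.us (\<lambda>u t. bar \<psi> (l w (r n t)) (\<lambda>b. C (y * (v * (a * u))) (z * b)))) =
      tsum2 (cop X) (\<lambda>x\<^sub>1 x\<^sub>2. tsum2 (La m) (\<lambda>a n. tsum2 sums.us (\<lambda>u t.
        bar \<psi> (l w (r (l x\<^sub>2 n) t)) (\<lambda>b. C (y * (v * (x\<^sub>1 * a * u))) (z * b)))))"
    proof (rule La_l)
      have "formHM (\<lambda>a n. bar \<psi> (l w (r n t)) (\<lambda>b. C (y * (v * (a * u))) (z * b)))" for u t
        using lin_act2[OF linM_bar[OF \<psi>, of "\<lambda>b. C (y * (v * (a * u))) (z * b)" for a]]
        by (simp add: formHM_def) (simp add: bar_def)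
      then show "formHM (\<lambda>a n. tsum2 sums.us (\<lambda>u t. bar \<psi> (l w (r n t)) (\<lambda>b. C (y * (v * (a * u))) (z * b))))"
        by (simp add: formHM_def)
    qed
    also have "\<dots> = tsum2 (cop X) (\<lambda>x\<^sub>1 x\<^sub>2. tsum2 (La m) (\<lambda>a n. tsum2 sums.us (\<lambda>u t.
        tsum2 sums.vs (\<lambda>v' w'. tsum2 (cop (w * x\<^sub>2)) (\<lambda>p q. tsum2 (La n) (\<lambda>b n'.
        tsum2 sums.us (\<lambda>u' t'. tsum2 (cop t) (\<lambda>s\<^sub>1 s\<^sub>2.
        C (y * (v * (x\<^sub>1 * a * u))) (z * (v' * (p * (b * (s\<^sub>1 * u'))))) * \<psi> (l (w' * q) (r n' (s\<^sub>2 * t')))))))))))"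
      by (simp add: bar_act[OF \<psi>])
    also have "\<dots> = tsum2 (cop X) (\<lambda>x\<^sub>1 x\<^sub>2. tsum2 (La m) (\<lambda>a n.
        tsum2 sums.vs (\<lambda>v' w'. tsum2 (cop (w * x\<^sub>2)) (\<lambda>p q. tsum2 (La n) (\<lambda>b n'. tsum2 sums.us (\<lambda>u t.
        tsum2 sums.us (\<lambda>u' t'. tsum2 (cop t) (\<lambda>s\<^sub>1 s\<^sub>2.
        C (y * (v * (x\<^sub>1 * a * u))) (z * (v' * (p * (b * (s\<^sub>1 * u'))))) * \<psi> (l (w' * q) (r n' (s\<^sub>2 * t')))))))))))"
      by (simp only: tsum2_tsum2_swap[of sums.us sums.vs] tsum2_tsum2_swap[of sums.us "cop (w * x\<^sub>2)" for x\<^sub>2]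
          tsum2_tsum2_swap[of sums.us "La n" for n])
    also have "\<dots> = tsum2 (cop X) (\<lambda>x\<^sub>1 x\<^sub>2. tsum2 sums.vs (\<lambda>v' w'. tsum2 (cop (w * x\<^sub>2)) (\<lambda>p q. R (y * (v * x\<^sub>1)) (z * (v' * p)) (w' * q))))"
      by (simp only: R_def sums.U.lhs_def mult.assoc tsum2_tsum2_swap[of "La m" sums.vs] tsum2_tsum2_swap[of "La m" "cop (w * x\<^sub>2)" for x\<^sub>2])
    finally show ?thesis .
  qed
  have R_eq: "R \<alpha>' \<beta>' \<gamma>' = tsum3 ph (\<lambda>p q s. tsum2 (cop (S p)) (\<lambda>d e. tsum2 sums.us (\<lambda>u t. tsum2 (cop (d * u)) (\<lambda>g h.
      tsum3 ph (\<lambda>x y z. tsum2 (La m) (\<lambda>a n. tsum2 (cop a) (\<lambda>b c.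
      C (\<alpha>' * (x * b * (g * q))) (\<beta>' * (y * c * (h * s))) * \<psi> (l \<gamma>' (r (l z n) (e * t))))))))))" for \<alpha>' \<beta>' \<gamma>'
  proof -
    have B: "form3 (\<lambda>u\<^sub>1 u\<^sub>2 u\<^sub>3. C (\<alpha>' * (a * u\<^sub>1)) (\<beta>' * (b * u\<^sub>2)) * \<psi> (l \<gamma>' (r n' u\<^sub>3)))" for a b n'
      by simp
    have 1: "tsum2 (La m) (\<lambda>a n. tsum2 (La n) (\<lambda>b n'. tsum3 ph (\<lambda>x y z.
        C (\<alpha>' * (a * x * (g * q))) (\<beta>' * (b * y * (h * s))) * \<psi> (l \<gamma>' (r (r n' z) (e * t)))))) =
      tsum3 ph (\<lambda>x y z. tsum2 (La m) (\<lambda>a n. tsum2 (cop a) (\<lambda>b c.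
        C (\<alpha>' * (x * b * (g * q))) (\<beta>' * (y * c * (h * s))) * \<psi> (l \<gamma>' (r (l z n) (e * t))))))" for g q h s e t
      by (rule La_coassoc[of "\<lambda>a b n. C (\<alpha>' * (a * (g * q))) (\<beta>' * (b * (h * s))) * \<psi> (l \<gamma>' (r n (e * t)))", symmetric])
        (simp add: formHHM_def)
    have 2: "tsum2 (La m) (\<lambda>a n. tsum2 (La n) (\<lambda>b n'. tsum3 ph (\<lambda>x y z. tsum3 ph (\<lambda>p q s. tsum2 (cop (S p)) (\<lambda>d e. tsum2 sums.us (\<lambda>u t. tsum2 (cop (d * u)) (\<lambda>g h.
        C (\<alpha>' * (a * x * (g * q))) (\<beta>' * (b * y * (h * s))) * \<psi> (l \<gamma>' (r (r n' z) (e * t)))))))))) =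
      tsum3 ph (\<lambda>p q s. tsum2 (cop (S p)) (\<lambda>d e. tsum2 sums.us (\<lambda>u t. tsum2 (cop (d * u)) (\<lambda>g h.
      tsum2 (La m) (\<lambda>a n. tsum2 (La n) (\<lambda>b n'. tsum3 ph (\<lambda>x y z.
        C (\<alpha>' * (a * x * (g * q))) (\<beta>' * (b * y * (h * s))) * \<psi> (l \<gamma>' (r (r n' z) (e * t))))))))))"
      unfolding tsum2_tsum3_swap
      by (rule trans[OF tsum3_tsum3_swap], intro tsum3_cong)
        (simp only: tsum2_tsum2_swap[of "La m" "cop a" for a] tsum2_tsum2_swap[of "La m" sums.us]
          tsum2_tsum2_swap[of "La n" "cop a" for n a] tsum2_tsum2_swap[of "La n" sums.us for n])
    show ?thesis
      unfolding R_def sums.U.lhs_eq_rhs[OF B] sums.U.rhs_def 1[symmetric] 2[symmetric]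
      by (simp add: mult.assoc)
  qed
  \<comment> \<open>The inverse associator comes from V and the associator from the
    quasi-coassociativity of \<Lambda>; they are adjacent in all three legs.\<close>
  have cancel: "tsum3 pi (\<lambda>x' y' z'. tsum3 ph (\<lambda>x y z. tsum2 (La m) (\<lambda>a n. tsum2 (cop a) (\<lambda>b c.
      C (g' * x' * (x * b * (g * q))) (h' * y' * (y * c * (h * s))) * \<psi> (l (w * z') (r (l z n) (e * t))))))) =
    tsum2 (La m) (\<lambda>a n. tsum2 (cop a) (\<lambda>b c. C (g' * (b * (g * q))) (h' * (c * (h * s))) * \<psi> (l w (r n (e * t)))))"
    for g' h' g h q s w e t
    using sums.pi_ph[of "\<lambda>x y z. tsum2 (La m) (\<lambda>a n. tsum2 (cop a) (\<lambda>b c.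
      C (g' * (x * (b * (g * q)))) (h' * (y * (c * (h * s)))) * \<psi> (l (w * z) (r n (e * t)))))"]
    by (simp add: mult.assoc)
  have "tsum3 ph (\<lambda>x y z. tsum2 sums.vs (\<lambda>v w. tsum2 (La (l (inv S x) m)) (\<lambda>a n. tsum2 sums.us (\<lambda>u t.
      bar \<psi> (l w (r n t)) (\<lambda>b. C (y * (v * (a * u))) (z * b)))))) =
    tsum2 sums.vs (\<lambda>v w. tsum2 (cop v) (\<lambda>g h. tsum3 pi (\<lambda>x y z. R (g * x) (h * y) (w * z))))"
    unfolding lhs V_cocycle[OF R, symmetric]
    by (simp only: tsum2_tsum2_swap[of sums.vs "cop (inv S x)" for x])
  also have "\<dots> = tsum2 sums.vs (\<lambda>v w. tsum2 (cop v) (\<lambda>g' h'. tsum3 ph (\<lambda>p q s. tsum2 (cop (S p)) (\<lambda>d e.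
      tsum2 sums.us (\<lambda>u t. tsum2 (cop (d * u)) (\<lambda>g h. tsum2 (La m) (\<lambda>a n. tsum2 (cop a) (\<lambda>b c.
      C (g' * (b * (g * q))) (h' * (c * (h * s))) * \<psi> (l w (r n (e * t)))))))))))"
    by (simp only: R_eq tsum3_tsum3_swap[of pi ph] tsum2_tsum3_swap[where xs="cop (S p)" and ys=pi for p, symmetric]
        tsum2_tsum3_swap[where xs="cop (d * u)" and ys=pi for d u, symmetric]
        tsum2_tsum3_swap[where xs=sums.us and ys=pi, symmetric] cancel[unfolded tsum3_tsum3_swap[of pi ph]])
  also have "\<dots> = tsum3 ph (\<lambda>x y z. bar \<psi> (r m (S x)) (\<lambda>a. tsum2 (cop a) (\<lambda>b c. C (b * y) (c * z))))"
    unfolding tsum2_tsum3_swap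
  proof (rule tsum3_cong)
    fix p q s
    define c where "c a = tsum2 (cop a) (\<lambda>b c. C (b * q) (c * s))" for a
    have "lin (\<lambda>a. c a)" unfolding c_def by (rule lin_cop) simp
    then have c: "lin c" .
    have c_eq: "c = (\<lambda>a. tsum2 (cop a) (\<lambda>b c. C (b * q) (c * s)))"
      by (simp add: c_def fun_eq_iff)
    have c_mul: "c (v * (a * x)) = tsum2 (cop v) (\<lambda>g' h'. tsum2 (cop a) (\<lambda>b c. tsum2 (cop x) (\<lambda>g h.
        C (g' * (b * (g * q))) (h' * (c * (h * s))))))" for v a x
      by (simp add: c_def cop_mul mult.assoc)
    have "bar \<psi> (r m (S p)) c = tsum2 sums.vs (\<lambda>v w. tsum2 (La m) (\<lambda>a n. tsum2 (cop (S p)) (\<lambda>d e.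
        tsum2 sums.us (\<lambda>u t. c (v * (a * (d * u))) * \<psi> (l w (r n (e * t)))))))"
      unfolding bar_def La_r[OF bar_formHM[OF \<psi> c]] by (simp add: mult.assoc)
    also have "\<dots> = tsum2 sums.vs (\<lambda>v w. tsum2 (cop v) (\<lambda>g' h'. tsum2 (cop (S p)) (\<lambda>d e.
        tsum2 sums.us (\<lambda>u t. tsum2 (cop (d * u)) (\<lambda>g h. tsum2 (La m) (\<lambda>a n. tsum2 (cop a) (\<lambda>b c.
        C (g' * (b * (g * q))) (h' * (c * (h * s))) * \<psi> (l w (r n (e * t))))))))))"
    proof (rule tsum2_cong)
      fix v w
      have right: "tsum2 xs F * k = tsum2 xs (\<lambda>a b. F a b * k)" for xs :: "('h \<times> 'h) list" and F and k :: 'k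
        using tsum2_mult[of xs k F] by (simp add: mult.commute)
      show "tsum2 (La m) (\<lambda>a n. tsum2 (cop (S p)) (\<lambda>d e.
        tsum2 sums.us (\<lambda>u t. c (v * (a * (d * u))) * \<psi> (l w (r n (e * t)))))) =
        tsum2 (cop v) (\<lambda>g' h'. tsum2 (cop (S p)) (\<lambda>d e.
        tsum2 sums.us (\<lambda>u t. tsum2 (cop (d * u)) (\<lambda>g h. tsum2 (La m) (\<lambda>a n. tsum2 (cop a) (\<lambda>b c.
        C (g' * (b * (g * q))) (h' * (c * (h * s))) * \<psi> (l w (r n (e * t)))))))))"
        by (simp only: c_mul right tsum2_tsum2_swap[of "La m" "cop (S p)"] tsum2_tsum2_swap[of "La m" sums.us]
            tsum2_tsum2_swap[of "La m" "cop v"] tsum2_tsum2_swap[of "cop (d * u)" "La m" for d u]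
            tsum2_tsum2_swap[of "cop (d * u)" "cop a" for d u a]
            tsum2_tsum2_swap[of "cop v" "cop (S p)"] tsum2_tsum2_swap[of "cop v" sums.us])
    qed
    finally show "tsum2 sums.vs (\<lambda>v w. tsum2 (cop v) (\<lambda>g' h'. tsum2 (cop (S p)) (\<lambda>d e.
        tsum2 sums.us (\<lambda>u t. tsum2 (cop (d * u)) (\<lambda>g h. tsum2 (La m) (\<lambda>a n. tsum2 (cop a) (\<lambda>b c.
        C (g' * (b * (g * q))) (h' * (c * (h * s))) * \<psi> (l w (r n (e * t)))))))))) =
      bar \<psi> (r m (S p)) (\<lambda>a. tsum2 (cop a) (\<lambda>b c. C (b * q) (c * s)))"
      unfolding c_eq by (rule sym)
  qed
  finally show ?thesis .
qed

end

subsection \<open>Tensors with the dual space\<close>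

text \<open>A tensor involves finitely many vectors, so a finite part of a basis with its coordinate
  functionals acts as a dual basis for them in any dimension. This gives the embedding into Hom
  without a finiteness assumption.\<close>

lemma finite_coordinates:
  fixes s :: "'k::field \<Rightarrow> 'v::ab_group_add \<Rightarrow> 'v"
  assumes "vector_space s" "finite Y"
  shows "\<exists>E e. finite E \<and> (\<forall>b. scalar_forms.lin s (e b)) \<and> (\<forall>y\<in>Y. y = (\<Sum>b\<in>E. s (e b y) b))"
proof -
  interpret vector_space s by fact
  define B where "B = extend_basis {}"
  have B: "independent B" "span B = UNIV"
    unfolding B_def using independent_extend_basis[OF independent_empty] span_extend_basis[OF independent_empty] by auto
  define E where "E = (\<Union>y\<in>Y. {b. representation B y b \<noteq> 0})"
  have fin: "finite E"
    unfolding E_def using assms(2) finite_representation by auto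
  have "scalar_forms.lin s (\<lambda>y. representation B y b)" for b
    using B by (simp add: scalar_forms.lin_def representation_add representation_scale)
  moreover have "y = (\<Sum>b\<in>E. s (representation B y b) b)" if "y \<in> Y" for y
  proof -
    have "y = (\<Sum>b | representation B y b \<noteq> 0. s (representation B y b) b)"
      using B by (simp add: sum_nonzero_representation_eq)
    also have "\<dots> = (\<Sum>b\<in>E. s (representation B y b) b)"
      using that fin by (intro sum.mono_neutral_left) (auto simp: E_def)
    finally show ?thesis .
  qed
  ultimately show ?thesis using fin by (intro exI[of _ E] exI[of _ "\<lambda>b y. representation B y b"]) auto
qed

lemma finite_dimensional_coordinates:
  fixes s :: "'k::field \<Rightarrow> 'v::ab_group_add \<Rightarrow> 'v"
  assumes "finite_dimensional s"
  shows "\<exists>E e. finite E \<and> (\<forall>b. scalar_forms.lin s (e b)) \<and> (\<forall>y. y = (\<Sum>b\<in>E. s (e b y) b))"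
proof -
  obtain B where "finite_dimensional_vector_space s B"
    using assms unfolding finite_dimensional_def by blast
  then interpret finite_dimensional_vector_space s B .
  have "scalar_forms.lin s (\<lambda>y. representation B y b)" for b
    using independent_Basis span_Basis by (simp add: scalar_forms.lin_def representation_add representation_scale)
  moreover have "y = (\<Sum>b\<in>B. s (representation B y b) b)" for y
    using independent_Basis span_Basis finite_Basis by (simp add: sum_representation_eq)
  ultimately show ?thesis using finite_Basis
    by (intro exI[of _ B] exI[of _ "\<lambda>b y. representation B y b"]) auto
qed

lemma lin_sum:
  fixes f :: "'v::ab_group_add \<Rightarrow> 'k::field"
  assumes "scalar_forms.lin s f"
  shows "f (\<Sum>b\<in>E. s (k b) (v b)) = (\<Sum>b\<in>E. k b * f (v b))"
proof -
  have add: "f (x + y) = f x + f y" and scale: "f (s c x) = c * f x" for x y c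
    using assms by (simp_all add: scalar_forms.lin_def)
  have "f 0 + f 0 = f 0 + 0" using add[of 0 0] by simp
  then have "f 0 = 0" by (simp only: add_left_cancel)
  then show ?thesis
    by (induction E rule: infinite_finite_induct) (simp_all add: add scale)
qed

lemma tensor_sum: "(\<And>i. i \<in> I \<Longrightarrow> f i \<in> tensors T) \<Longrightarrow> (\<Sum>i\<in>I. f i) \<in> tensors T"
  by (induction I rule: infinite_finite_induct) (auto simp: tensor_zero tensor_add)

lemma sum_apply: "(\<Sum>i\<in>I. f i) x = (\<Sum>i\<in>I. f i x)" for f :: "'i \<Rightarrow> 'x \<Rightarrow> 'k::comm_monoid_add"
  by (induction I rule: infinite_finite_induct) auto

lemma sum_list_sum_swap: "(\<Sum>x\<leftarrow>xs. \<Sum>i\<in>I. F x i) = (\<Sum>i\<in>I. \<Sum>x\<leftarrow>xs. F x i)"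
  for F :: "'x \<Rightarrow> 'i \<Rightarrow> 'k::comm_monoid_add"
  by (induction xs) (simp_all add: sum.distrib)

text \<open>A partial dual basis for tensors: on a prescribed finite set of tuples every form is
  recovered from its values at finitely many tuples e, with coefficients c e that are themselves
  forms and do not depend on B.\<close>

definition has_coordinates :: "('x, 'k::field) factors \<Rightarrow> bool" where
  "has_coordinates T \<longleftrightarrow> (\<forall>Y. finite Y \<longrightarrow> Y \<subseteq> tuples T \<longrightarrow>
     (\<exists>E c. finite E \<and> E \<subseteq> tuples T \<and> (\<forall>e\<in>E. c e \<in> forms T) \<and>
       (\<forall>y\<in>Y. \<forall>B\<in>forms T. B y = (\<Sum>e\<in>E. c e y * B e))))"

context left_bimodule_over_quasi_hopf
begin

abbreviation "dual \<equiv> dual_space sM"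

lemma dual_iff: "\<psi> \<in> dual \<longleftrightarrow> linM \<psi>"
  by (simp add: dual_space_def linM_iff)

lemma dual_closed: "\<chi> \<in> dual \<Longrightarrow> \<chi>' \<in> dual \<Longrightarrow> \<chi> + \<chi>' \<in> dual" "\<chi> \<in> dual \<Longrightarrow> fscale k \<chi> \<in> dual" "0 \<in> dual"
  by (auto simp: dual_iff linM_def fscale_def algebra_simps)

lemma closed_dual: "closed_under dual fscale"
  by (simp add: closed_under_def dual_closed)

lemma good_dual: "good_factors T \<Longrightarrow> good_factors (cons_factor dual fscale T)"
  by (rule good_cons[OF closed_dual])

lemma evaluation_form:
  assumes "C \<in> forms T" "\<And>k. (\<lambda>y. k * C y) \<in> forms T"
  shows "(\<lambda>(\<chi>, y). \<chi> m * C y) \<in> forms (cons_factor dual fscale T)"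
  using assms by (simp add: forms_cons linear_form_on_def fscale_def algebra_simps)

text \<open>B is linear on the dual space only, so the induction carries along that every partial
  sum stays in it; otherwise additivity could not be applied in the next step.\<close>

lemma dual_form_sum_list:
  assumes B: "linear_form_on dual fscale B" and "set xs \<subseteq> dual \<times> UNIV"
  shows "(\<Sum>(\<chi>, y)\<leftarrow>xs. fscale (k y) \<chi>) \<in> dual \<and>
    (\<Sum>(\<chi>, y)\<leftarrow>xs. k y * B \<chi>) = B (\<Sum>(\<chi>, y)\<leftarrow>xs. fscale (k y) \<chi>)"
  using assms(2)
proof (induction xs)
  case Nil
  have "B (fscale 0 0) = 0 * B 0" using B dual_closed(3) unfolding linear_form_on_def by blast
  moreover have "fscale 0 (0 :: 'm \<Rightarrow> 'k) = 0" by (simp add: fscale_def fun_eq_iff)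
  ultimately have "B 0 = 0" by simp
  then show ?case using dual_closed(3) by (simp add: zero_fun_def)
next
  case (Cons x xs)
  obtain \<chi> y where x: "x = (\<chi>, y)" by force
  have \<chi>: "\<chi> \<in> dual" "fscale (k y) \<chi> \<in> dual" using Cons.prems x by (auto simp: dual_closed)
  have IH: "(\<Sum>(\<chi>, y)\<leftarrow>xs. fscale (k y) \<chi>) \<in> dual"
    "(\<Sum>(\<chi>, y)\<leftarrow>xs. k y * B \<chi>) = B (\<Sum>(\<chi>, y)\<leftarrow>xs. fscale (k y) \<chi>)"
    using Cons by simp_all
  have "B (fscale (k y) \<chi> + (\<Sum>(\<chi>, y)\<leftarrow>xs. fscale (k y) \<chi>)) = k y * B \<chi> + B (\<Sum>(\<chi>, y)\<leftarrow>xs. fscale (k y) \<chi>)"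
    using B \<chi> IH(1) by (simp add: linear_form_on_def)
  then show ?case
    using IH dual_closed(1)[OF \<chi>(2) IH(1)] x by (simp add: plus_fun_def)
qed

text \<open>Expanding the second legs in coordinates gives u(B) as the sum over e of B(\<chi>_e, e),
  where the functional \<chi>_e sends m to the value of u at the form that evaluates the first leg
  at m and applies c e to the second. So u is determined by such evaluations.\<close>

lemma dual_tensor_eqI:
  assumes T: "has_coordinates T" "tuples T = UNIV" "\<And>k C. C \<in> forms T \<Longrightarrow> (\<lambda>y. k * C y) \<in> forms T"
    and t: "t \<in> tensors (cons_factor dual fscale T)" and t': "t' \<in> tensors (cons_factor dual fscale T)"
    and eq: "\<And>m C. C \<in> forms T \<Longrightarrow> t (\<lambda>(\<chi>, y). \<chi> m * C y) = t' (\<lambda>(\<chi>, y). \<chi> m * C y)"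
  shows "t = t'"
proof (rule tensor_eqI[OF t t'])
  fix B assume B: "B \<in> forms (cons_factor dual fscale T)"
  let ?xs = "\<lambda>t. tlist (cons_factor dual fscale T) t"
  \<comment> \<open>One system of coordinates is chosen for the second legs of both tensors, so that
    their expansions can be compared term by term.\<close>
  have "finite (snd ` (set (?xs t) \<union> set (?xs t')))" by simp
  then have "\<exists>E c. finite E \<and> E \<subseteq> tuples T \<and> (\<forall>e\<in>E. c e \<in> forms T) \<and>
      (\<forall>y\<in>snd ` (set (?xs t) \<union> set (?xs t')). \<forall>B\<in>forms T. B y = (\<Sum>e\<in>E. c e y * B e))"
    by (rule T(1)[unfolded has_coordinates_def, rule_format]) (simp_all add: T(2))
  then obtain E c where E: "finite E" "\<forall>e\<in>E. c e \<in> forms T"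
    and coord: "\<forall>y\<in>snd ` (set (?xs t) \<union> set (?xs t')). \<forall>B\<in>forms T. B y = (\<Sum>e\<in>E. c e y * B e)"
    by (elim exE conjE)
  have *: "u B = (\<Sum>e\<in>E. B (\<lambda>m. u (\<lambda>(\<chi>, y). \<chi> m * c e y), e))"
    if u: "u \<in> tensors (cons_factor dual fscale T)" and sub: "set (?xs u) \<subseteq> set (?xs t) \<union> set (?xs t')" for u
  proof -
    have dual: "set (?xs u) \<subseteq> dual \<times> UNIV"
      using set_tlist[OF u] T(2) by simp
    have "u B = (\<Sum>x\<leftarrow>?xs u. B x)" by (rule tensor_apply[OF u B])
    also have "\<dots> = (\<Sum>(\<chi>, y)\<leftarrow>?xs u. \<Sum>e\<in>E. c e y * B (\<chi>, e))"
    proof (intro arg_cong[of _ _ sum_list] map_cong refl)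
      fix x assume x: "x \<in> set (?xs u)"
      obtain \<chi> y where [simp]: "x = (\<chi>, y)" by force
      have "(\<lambda>y. B (\<chi>, y)) \<in> forms T" using B x dual by (auto simp: forms_cons)
      moreover have "y \<in> snd ` (set (?xs t) \<union> set (?xs t'))"
        using x sub by (intro image_eqI[of _ _ x]) auto
      ultimately have "B (\<chi>, y) = (\<Sum>e\<in>E. c e y * B (\<chi>, e))" by (rule coord[rule_format, rotated])
      then show "B x = (case x of (\<chi>, y) \<Rightarrow> \<Sum>e\<in>E. c e y * B (\<chi>, e))" by simp
    qed
    also have "\<dots> = (\<Sum>e\<in>E. \<Sum>(\<chi>, y)\<leftarrow>?xs u. c e y * B (\<chi>, e))"
      using sum_list_sum_swap[of "\<lambda>x e. case x of (\<chi>, y) \<Rightarrow> c e y * B (\<chi>, e)" E "?xs u"]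
      by (simp add: case_prod_unfold)
    also have "\<dots> = (\<Sum>e\<in>E. B (\<lambda>m. u (\<lambda>(\<chi>, y). \<chi> m * c e y), e))"
    proof (rule sum.cong[OF refl])
      fix e assume e: "e \<in> E"
      have lin: "linear_form_on dual fscale (\<lambda>\<chi>. B (\<chi>, e))" using B T(2) by (simp add: forms_cons)
      have "(\<lambda>(\<chi>, y). \<chi> m * c e y) \<in> forms (cons_factor dual fscale T)" for m
        by (intro evaluation_form E(2)[rule_format, OF e] T(3))
      then have "(\<Sum>(\<chi>, y)\<leftarrow>?xs u. fscale (c e y) \<chi>) = (\<lambda>m. u (\<lambda>(\<chi>, y). \<chi> m * c e y))"
        by (simp add: tensor_apply[OF u] fun_eq_iff sum_list_fun_apply fscale_def case_prod_unfold mult.commute)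
      then show "(\<Sum>(\<chi>, y)\<leftarrow>?xs u. c e y * B (\<chi>, e)) = B (\<lambda>m. u (\<lambda>(\<chi>, y). \<chi> m * c e y), e)"
        using dual_form_sum_list[OF lin dual] by simp
    qed
    finally show ?thesis .
  qed
  show "t B = t' B"
    unfolding *[OF t Un_upper1] *[OF t' Un_upper2] by (intro sum.cong refl) (simp add: eq E(2))
qed

lemma coordinates_H1: "has_coordinates H1"
  unfolding has_coordinates_def
proof (intro allI impI)
  fix Y :: "'h set" assume "finite Y"
  then obtain E e where E: "finite E" "\<And>b. lin (e b)" "\<And>y. y \<in> Y \<Longrightarrow> y = (\<Sum>b\<in>E. scl (e b y) b)"
    using finite_coordinates[OF vector_space_scl] by meson
  have "B y = (\<Sum>b\<in>E. e b y * B b)" if "y \<in> Y" "lin B" for y B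
    using arg_cong[OF E(3)[OF that(1)], of B] unfolding lin_sum[OF that(2)] .
  then show "\<exists>E c. finite E \<and> E \<subseteq> tuples H1 \<and> (\<forall>e\<in>E. c e \<in> forms H1) \<and>
       (\<forall>y\<in>Y. \<forall>B\<in>forms H1. B y = (\<Sum>e\<in>E. c e y * B e))"
    using E(1,2) by (intro exI[of _ E] exI[of _ e]) (simp add: forms_H1)
qed

lemma coordinates_H2: "has_coordinates H2"
  unfolding has_coordinates_def
proof (intro allI impI)
  fix Y :: "('h \<times> 'h) set" assume "finite Y"
  then have "finite (fst ` Y \<union> snd ` Y)" by simp
  then obtain E e where E: "finite E" "\<And>b. lin (e b)"
      and rep: "\<And>y. y \<in> fst ` Y \<union> snd ` Y \<Longrightarrow> y = (\<Sum>b\<in>E. scl (e b y) b)"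
    using finite_coordinates[OF vector_space_scl] by meson
  have coord: "f y = (\<Sum>b\<in>E. e b y * f b)" if "y \<in> fst ` Y \<union> snd ` Y" "lin f" for y f
    using arg_cong[OF rep[OF that(1)], of f] unfolding lin_sum[OF that(2)] .
  have "B y = (\<Sum>b\<in>E \<times> E. (case y of (u, v) \<Rightarrow> e (fst b) u * e (snd b) v) * B b)"
    if y: "y \<in> Y" and B: "form2 (\<lambda>a b. B (a, b))" for y B
  proof -
    obtain u v where [simp]: "y = (u, v)" by force
    have uv: "u \<in> fst ` Y \<union> snd ` Y" "v \<in> fst ` Y \<union> snd ` Y" using y by force+
    have "B (u, v) = (\<Sum>b\<in>E. e b u * B (b, v))"
      using coord[OF uv(1), of "\<lambda>a. B (a, v)"] B by (simp add: form2_def)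
    also have "\<dots> = (\<Sum>b\<in>E. \<Sum>b'\<in>E. e b u * e b' v * B (b, b'))"
      using coord[OF uv(2), of "\<lambda>a. B (b, a)" for b] B by (simp add: form2_def sum_distrib_left mult.assoc)
    finally show ?thesis by (simp add: sum.cartesian_product case_prod_unfold)
  qed
  moreover have "form2 (\<lambda>u v. e (fst b) u * e (snd b) v)" for b
    using E(2) by (simp add: form2_def)
  ultimately show "\<exists>E c. finite E \<and> E \<subseteq> tuples H2 \<and> (\<forall>e\<in>E. c e \<in> forms H2) \<and>
       (\<forall>y\<in>Y. \<forall>B\<in>forms H2. B y = (\<Sum>e\<in>E. c e y * B e))"
    using E(1) by (intro exI[of _ "E \<times> E"] exI[of _ "\<lambda>b (u, v). e (fst b) u * e (snd b) v"]) (simp add: forms_H2)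
qed

section \<open>The embedding into homomorphisms and the existence of the coaction\<close>

abbreviation "DH \<equiv> cons_factor dual fscale H1"
abbreviation "DHH \<equiv> cons_factor dual fscale H2"

lemma DH_form: "lin c \<Longrightarrow> (\<lambda>(\<chi>, a). \<chi> m * c a) \<in> forms DH"
  by (rule evaluation_form) (simp_all add: forms_H1)

lemma DHH_form: "form2 C \<Longrightarrow> (\<lambda>(\<chi>, a, b). \<chi> m * C a b) \<in> forms DHH"
  using evaluation_form[of "\<lambda>(a, b). C a b" H2 m]
  by (simp add: forms_H2 form2_def case_prod_unfold)

lemma DH_eqI:
  assumes "t \<in> tensors DH" "t' \<in> tensors DH"
    and "\<And>m c. lin c \<Longrightarrow> t (\<lambda>(\<chi>, a). \<chi> m * c a) = t' (\<lambda>(\<chi>, a). \<chi> m * c a)"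
  shows "t = t'"
  by (rule dual_tensor_eqI[OF coordinates_H1 _ _ assms(1,2)]) (simp_all add: assms(3) forms_H1)

lemma DHH_eqI:
  assumes "t \<in> tensors DHH" "t' \<in> tensors DHH"
    and "\<And>m C. form2 C \<Longrightarrow> t (\<lambda>(\<chi>, a, b). \<chi> m * C a b) = t' (\<lambda>(\<chi>, a, b). \<chi> m * C a b)"
  shows "t = t'"
proof (rule dual_tensor_eqI[OF coordinates_H2 _ _ assms(1,2)])
  fix m C assume "C \<in> forms H2"
  then show "t (\<lambda>(\<chi>, y). \<chi> m * C y) = t' (\<lambda>(\<chi>, y). \<chi> m * C y)"
    using assms(3)[of "\<lambda>a b. C (a, b)" m] by (simp add: forms_H2 case_prod_unfold)
qed (simp_all add: forms_H2 form2_def)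

abbreviation hom :: "('m \<Rightarrow> 'k) \<Rightarrow> 'm \<Rightarrow> 'h" where
  "hom \<psi> m \<equiv> sweedler HM (\<Lambda>_bar sM l r \<Lambda> m) (\<lambda>(a, n). scl (\<psi> n) a)"

abbreviation rho :: "('m \<Rightarrow> 'k) \<Rightarrow> (('m \<Rightarrow> 'k) \<times> 'h, 'k) tensor" where
  "rho \<equiv> dual_coaction sM l r \<Lambda>"

lemma lin_dual_tensor_to_hom:
  assumes t: "t \<in> tensors DH" and c: "lin c"
  shows "c (dual_tensor_to_hom sM t m) = t (\<lambda>(\<chi>, a). \<chi> m * c a)"
proof -
  have form: "(\<lambda>x. g (case x of (\<chi>, a) \<Rightarrow> scl (\<chi> m) a)) \<in> forms DH" if "lin g" for g
    using DH_form[OF that, of m] scl_lin[OF that] by (simp add: case_prod_unfold)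
  have "c (dual_tensor_to_hom sM t m) = t (\<lambda>x. c (case x of (\<chi>, a) \<Rightarrow> scl (\<chi> m) a))"
    unfolding dual_tensor_to_hom_def
    using c form by (intro sweedler_linear[OF t vector_space_scl]) (simp_all add: lin_iff[symmetric])
  then show ?thesis
    using scl_lin[OF c] by (simp add: case_prod_unfold)
qed

lemma lin_separating:
  assumes "\<And>c. lin c \<Longrightarrow> c x = c y"
  shows "x = y"
proof (rule ccontr)
  assume "x \<noteq> y"
  then obtain g where g: "lin g" "g (x - y) \<noteq> 0"
    using separating_functional[OF vector_space_scl, of "x - y"] by (auto simp: lin_iff)
  have "g (x - y + y) = g (x - y) + g y" using g(1) unfolding lin_def by blast
  with g assms[OF g(1)] show False by simp
qed

lemma represents_hom_iff:
  assumes "linM \<psi>" "t \<in> tensors DH"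
  shows "(\<forall>m. dual_tensor_to_hom sM t m = hom \<psi> m) \<longleftrightarrow>
    (\<forall>m c. lin c \<longrightarrow> t (\<lambda>(\<chi>, a). \<chi> m * c a) = bar \<psi> m c)"
proof (intro iffI allI impI lin_separating)
  fix m c
  assume "\<forall>m. dual_tensor_to_hom sM t m = hom \<psi> m" and c: "lin c"
  then have "c (dual_tensor_to_hom sM t m) = c (hom \<psi> m)" by simp
  then show "t (\<lambda>(\<chi>, a). \<chi> m * c a) = bar \<psi> m c"
    unfolding lin_dual_tensor_to_hom[OF assms(2) c] lin_hom[OF assms(1) c] .
next
  fix m c
  assume eq: "\<forall>m c. lin c \<longrightarrow> t (\<lambda>(\<chi>, a). \<chi> m * c a) = bar \<psi> m c" and c: "lin c"
  show "c (dual_tensor_to_hom sM t m) = c (hom \<psi> m)"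
    unfolding lin_dual_tensor_to_hom[OF assms(2) c] lin_hom[OF assms(1) c] using eq c by blast
qed

text \<open>Each case has its own preimage. For a basis of H, the first legs are the coordinates of
  [\<rho>(\<psi>)](m) as functions of m and the second legs are the basis vectors. For a basis of M,
  the first legs are the coordinate functionals and the second legs are the values
  [\<rho>(\<psi>)](b) at the basis vectors b.\<close>

lemma dual_coaction_exists:
  assumes fd: "finite_dimensional scl \<or> finite_dimensional sM" and \<psi>: "linM \<psi>"
  shows "\<exists>t\<in>tensors DH. \<forall>m c. lin c \<longrightarrow> t (\<lambda>(\<chi>, a). \<chi> m * c a) = bar \<psi> m c"
  using fd
proof
  assume "finite_dimensional scl"
  then obtain E e where E: "finite E" "\<And>b. lin (e b)" "\<And>y. y = (\<Sum>b\<in>E. scl (e b y) b)"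
    using finite_dimensional_coordinates[of scl] by auto
  let ?t = "\<Sum>b\<in>E. pure_tensor DH (\<lambda>m. bar \<psi> m (e b), b)"
  have "?t \<in> tensors DH"
    by (intro tensor_sum tensor_pure) (simp add: dual_iff linM_bar[OF \<psi> E(2)])
  moreover have "?t (\<lambda>(\<chi>, a). \<chi> m * c a) = bar \<psi> m c" if c: "lin c" for m c
  proof -
    have "bar \<psi> m c = c (\<Sum>b\<in>E. scl (e b (hom \<psi> m)) b)"
      unfolding lin_hom[OF \<psi> c, symmetric] by (rule arg_cong[OF E(3)])
    also have "\<dots> = (\<Sum>b\<in>E. bar \<psi> m (e b) * c b)"
      by (simp add: lin_sum[OF c] lin_hom[OF \<psi> E(2)])
    finally show ?thesis by (simp add: sum_apply pure_tensor_def DH_form[OF c])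
  qed
  ultimately show ?thesis by blast
next
  assume "finite_dimensional sM"
  then obtain E e where E: "finite E" "\<And>b. linM (e b)" "\<And>y. y = (\<Sum>b\<in>E. sM (e b y) b)"
    using finite_dimensional_coordinates[of sM] by auto
  let ?t = "\<Sum>b\<in>E. pure_tensor DH (e b, hom \<psi> b)"
  have "?t \<in> tensors DH"
    by (intro tensor_sum tensor_pure) (simp add: dual_iff E(2))
  moreover have "?t (\<lambda>(\<chi>, a). \<chi> m * c a) = bar \<psi> m c" if c: "lin c" for m c
  proof -
    have "bar \<psi> m c = bar \<psi> (\<Sum>b\<in>E. sM (e b m) b) c"
      by (rule arg_cong[OF E(3), of "\<lambda>m. bar \<psi> m c"])
    also have "\<dots> = (\<Sum>b\<in>E. e b m * c (hom \<psi> b))"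
      by (simp add: lin_sum[OF linM_bar[OF \<psi> c]] lin_hom[OF \<psi> c])
    finally show ?thesis by (simp add: sum_apply pure_tensor_def DH_form[OF c])
  qed
  ultimately show ?thesis by blast
qed

end

subsection \<open>The dual bimodule\<close>

locale dual_of_left_bimodule = left_bimodule_over_quasi_hopf scl \<Delta> \<epsilon> \<phi> S \<alpha> \<beta> sM l r \<Lambda>
  for scl :: "'k::field \<Rightarrow> 'h::ring_1 \<Rightarrow> 'h" and \<Delta> \<epsilon> \<phi> S \<alpha> \<beta>
    and sM :: "'k \<Rightarrow> 'm::ab_group_add \<Rightarrow> 'm" and l r \<Lambda> +
  assumes finite_dimensional: "finite_dimensional scl \<or> finite_dimensional sM"
begin

text \<open>The definite description of the coaction is resolved by the preimage just constructed
  together with the injectivity of the embedding, \<open>DH_eqI\<close>.\<close>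

lemma rho:
  assumes \<psi>: "linM \<psi>"
  shows rho_in: "rho \<psi> \<in> tensors DH"
    and rho_apply: "lin c \<Longrightarrow> rho \<psi> (\<lambda>(\<chi>, a). \<chi> m * c a) = bar \<psi> m c"
proof -
  obtain t where t: "t \<in> tensors DH" "\<forall>m c. lin c \<longrightarrow> t (\<lambda>(\<chi>, a). \<chi> m * c a) = bar \<psi> m c"
    using dual_coaction_exists[OF finite_dimensional \<psi>] by blast
  have "rho \<psi> = t"
    unfolding dual_coaction_def
  proof (rule the_equality)
    show "t \<in> tensors DH \<and> (\<forall>m. dual_tensor_to_hom sM t m = hom \<psi> m)"
      using t represents_hom_iff[OF \<psi> t(1)] by blast
    fix t' assume t': "t' \<in> tensors DH \<and> (\<forall>m. dual_tensor_to_hom sM t' m = hom \<psi> m)"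
    then have "\<forall>m c. lin c \<longrightarrow> t' (\<lambda>(\<chi>, a). \<chi> m * c a) = bar \<psi> m c"
      using represents_hom_iff[OF \<psi>, of t'] by blast
    with t t' show "t' = t" by (intro DH_eqI) simp_all
  qed
  with t show "rho \<psi> \<in> tensors DH" "lin c \<Longrightarrow> rho \<psi> (\<lambda>(\<chi>, a). \<chi> m * c a) = bar \<psi> m c"
    by simp_all
qed

lemma endo_inv_S: "inv S (a + b) = inv S a + inv S b" "inv S (scl k a) = scl k (inv S a)"
    "inv S (a * b) = inv S b * inv S a" "inv S 1 = 1"
  by (simp_all add: sums.T_add sums.T_scl sums.T_mul)

lemma S_simps: "S (a + b) = S a + S b" "S (scl k a) = scl k (S a)"
  by (simp_all add: alg.S_add alg.S_scl)

sublocale dual: algebra_bimodule scl dual fscale "dual_left l" "dual_right r"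
proof unfold_locales
  show "module.subspace fscale dual"
    using dual_closed by (simp add: module.subspace_def[OF vector_space_fscale[unfolded module_iff_vector_space[symmetric]]])
qed (auto simp: dual_left_def dual_right_def dual_iff linM_def fscale_def fun_eq_iff endo_inv_S S_simps S_mult S_one
    l_add l_scale r_add r_scale add_l scale_l add_r scale_r algebra_simps)

lemma dual_left_form:
  assumes "tuple_algebra T op e" "B \<in> forms (cons_factor dual fscale T)"
  shows "y \<in> tuples (cons_factor dual fscale T) \<Longrightarrow>
      (\<lambda>a. B (pair_op (dual_left l) op a y)) \<in> forms (cons_factor UNIV scl T)"
    and "(\<lambda>y. B (pair_op (dual_left l) op a y)) \<in> forms (cons_factor dual fscale T)"
proof -
  interpret tuple_algebra T op e by fact
  have lin: "linear_form_on dual fscale (\<lambda>\<chi>. B (\<chi>, y))" for y using assms(2) by (simp add: forms_cons)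
  have form: "(\<lambda>y. B (\<chi>, y)) \<in> forms T" if "\<chi> \<in> dual" for \<chi> using assms(2) that by (simp add: forms_cons)
  show "(\<lambda>a. B (pair_op (dual_left l) op a y)) \<in> forms (cons_factor UNIV scl T)"
    if "y \<in> tuples (cons_factor dual fscale T)"
  proof -
    obtain \<chi> u where y: "y = (\<chi>, u)" by force
    have \<chi>: "\<chi> \<in> dual" using that by (simp add: y)
    have "linear_form_on UNIV scl (\<lambda>x. B (dual_left l x \<chi>, v))" for v
      using lin[of v] \<chi> by (simp add: linear_form_on_def dual.add_l dual.scale_l dual.l_closed)
    then show ?thesis
      using form_left[OF form[OF dual.l_closed[OF \<chi>]]] by (simp add: y pair_op_def forms_cons)
  qed
  show "(\<lambda>y. B (pair_op (dual_left l) op a y)) \<in> forms (cons_factor dual fscale T)"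
  proof -
    obtain x v where a: "a = (x, v)" by force
    have "linear_form_on dual fscale (\<lambda>\<chi>. B (dual_left l x \<chi>, u))" for u
      using lin[of u] by (simp add: linear_form_on_def dual.l_add dual.l_scale dual.l_closed)
    then show ?thesis
      using form_right[OF form[OF dual.l_closed]] by (simp add: a pair_op_def forms_cons)
  qed
qed

lemma dual_right_form:
  assumes "tuple_algebra T op e" "B \<in> forms (cons_factor dual fscale T)"
  shows "y \<in> tuples (cons_factor dual fscale T) \<Longrightarrow>
      (\<lambda>a. B (pair_op (dual_right r) op y a)) \<in> forms (cons_factor UNIV scl T)"
    and "(\<lambda>y. B (pair_op (dual_right r) op y a)) \<in> forms (cons_factor dual fscale T)"
proof -
  interpret tuple_algebra T op e by fact
  have lin: "linear_form_on dual fscale (\<lambda>\<chi>. B (\<chi>, y))" for y using assms(2) by (simp add: forms_cons)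
  have form: "(\<lambda>y. B (\<chi>, y)) \<in> forms T" if "\<chi> \<in> dual" for \<chi> using assms(2) that by (simp add: forms_cons)
  show "(\<lambda>a. B (pair_op (dual_right r) op y a)) \<in> forms (cons_factor UNIV scl T)"
    if "y \<in> tuples (cons_factor dual fscale T)"
  proof -
    obtain \<chi> u where y: "y = (\<chi>, u)" by force
    have \<chi>: "\<chi> \<in> dual" using that by (simp add: y)
    have "linear_form_on UNIV scl (\<lambda>x. B (dual_right r \<chi> x, v))" for v
      using lin[of v] \<chi> by (simp add: linear_form_on_def dual.add_r dual.scale_r dual.r_closed)
    then show ?thesis
      using form_right[OF form[OF dual.r_closed[OF \<chi>]]] by (simp add: y pair_op_def forms_cons)
  qed
  show "(\<lambda>y. B (pair_op (dual_right r) op y a)) \<in> forms (cons_factor dual fscale T)"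
  proof -
    obtain x v where a: "a = (x, v)" by force
    have "linear_form_on dual fscale (\<lambda>\<chi>. B (dual_right r \<chi> x, u))" for u
      using lin[of u] by (simp add: linear_form_on_def dual.r_add dual.r_scale dual.r_closed)
    then show ?thesis
      using form_left[OF form[OF dual.r_closed]] by (simp add: a pair_op_def forms_cons)
  qed
qed

lemma dual_left_factorwise:
  assumes T: "tuple_algebra T op e" and x: "x \<in> tensors (cons_factor UNIV scl T)"
    and t: "t \<in> tensors (cons_factor dual fscale T)"
  shows "factorwise (cons_factor UNIV scl T) (cons_factor dual fscale T) (cons_factor dual fscale T)
      (pair_op (dual_left l) op) x t \<in> tensors (cons_factor dual fscale T)"
    and "B \<in> forms (cons_factor dual fscale T) \<Longrightarrow>
      factorwise (cons_factor UNIV scl T) (cons_factor dual fscale T) (cons_factor dual fscale T)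
      (pair_op (dual_left l) op) x t B = x (\<lambda>a. t (\<lambda>y. B (pair_op (dual_left l) op a y)))"
    and "B \<in> forms (cons_factor dual fscale T) \<Longrightarrow>
      (\<lambda>a. t (\<lambda>y. B (pair_op (dual_left l) op a y))) \<in> forms (cons_factor UNIV scl T)"
proof -
  interpret tuple_algebra T op e by fact
  have good1: "good_factors (cons_factor UNIV scl T)" and good2: "good_factors (cons_factor dual fscale T)"
    by (rule good_cons[OF closed_UNIV good], rule good_dual[OF good])
  have tup: "pair_op (dual_left l) op a y \<in> dual \<times> UNIV" if "y \<in> dual \<times> UNIV" for a y
    using that by (cases a; cases y) (auto simp: pair_op_def dual.l_closed)
  show "factorwise (cons_factor UNIV scl T) (cons_factor dual fscale T) (cons_factor dual fscale T)
      (pair_op (dual_left l) op) x t \<in> tensors (cons_factor dual fscale T)"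
    by (rule factorwise_in[OF x t good1 good2]) (simp_all add: tup dual_left_form[OF T])
  show "B \<in> forms (cons_factor dual fscale T) \<Longrightarrow>
      factorwise (cons_factor UNIV scl T) (cons_factor dual fscale T) (cons_factor dual fscale T)
      (pair_op (dual_left l) op) x t B = x (\<lambda>a. t (\<lambda>y. B (pair_op (dual_left l) op a y)))"
    by (rule factorwise_apply[OF x t good1 good2]) (simp_all add: tup dual_left_form[OF T])
  show "B \<in> forms (cons_factor dual fscale T) \<Longrightarrow>
      (\<lambda>a. t (\<lambda>y. B (pair_op (dual_left l) op a y))) \<in> forms (cons_factor UNIV scl T)"
    by (rule tensor_apply_form[OF t good1]) (simp_all add: dual_left_form[OF T])
qed

lemma dual_right_factorwise:
  assumes T: "tuple_algebra T op e" and x: "x \<in> tensors (cons_factor UNIV scl T)"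
    and t: "t \<in> tensors (cons_factor dual fscale T)"
  shows "factorwise (cons_factor dual fscale T) (cons_factor UNIV scl T) (cons_factor dual fscale T)
      (pair_op (dual_right r) op) t x \<in> tensors (cons_factor dual fscale T)"
    and "B \<in> forms (cons_factor dual fscale T) \<Longrightarrow>
      factorwise (cons_factor dual fscale T) (cons_factor UNIV scl T) (cons_factor dual fscale T)
      (pair_op (dual_right r) op) t x B = t (\<lambda>y. x (\<lambda>a. B (pair_op (dual_right r) op y a)))"
    and "B \<in> forms (cons_factor dual fscale T) \<Longrightarrow>
      (\<lambda>y. x (\<lambda>a. B (pair_op (dual_right r) op y a))) \<in> forms (cons_factor dual fscale T)"
proof -
  interpret tuple_algebra T op e by fact
  have good1: "good_factors (cons_factor UNIV scl T)" and good2: "good_factors (cons_factor dual fscale T)"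
    by (rule good_cons[OF closed_UNIV good], rule good_dual[OF good])
  have tup: "pair_op (dual_right r) op y a \<in> dual \<times> UNIV" if "y \<in> dual \<times> UNIV" for a y
    using that by (cases a; cases y) (auto simp: pair_op_def dual.r_closed)
  show "factorwise (cons_factor dual fscale T) (cons_factor UNIV scl T) (cons_factor dual fscale T)
      (pair_op (dual_right r) op) t x \<in> tensors (cons_factor dual fscale T)"
    by (rule factorwise_in[OF t x good2 good1]) (simp_all add: tup dual_right_form[OF T])
  show "B \<in> forms (cons_factor dual fscale T) \<Longrightarrow>
      factorwise (cons_factor dual fscale T) (cons_factor UNIV scl T) (cons_factor dual fscale T)
      (pair_op (dual_right r) op) t x B = t (\<lambda>y. x (\<lambda>a. B (pair_op (dual_right r) op y a)))"
    by (rule factorwise_apply[OF t x good2 good1]) (simp_all add: tup dual_right_form[OF T])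
  show "B \<in> forms (cons_factor dual fscale T) \<Longrightarrow>
      (\<lambda>y. x (\<lambda>a. B (pair_op (dual_right r) op y a))) \<in> forms (cons_factor dual fscale T)"
    by (rule tensor_apply_form[OF x good2]) (simp_all add: dual_right_form[OF T])
qed

section \<open>The axioms of a right quasi-Hopf bimodule\<close>

definition rlist :: "('m \<Rightarrow> 'k) \<Rightarrow> (('m \<Rightarrow> 'k) \<times> 'h) list" where "rlist \<psi> = tlist DH (rho \<psi>)"

lemma rho_eval: "linM \<psi> \<Longrightarrow> B \<in> forms DH \<Longrightarrow> rho \<psi> B = tsum2 (rlist \<psi>) (\<lambda>\<chi> a. B (\<chi>, a))"
  by (simp add: tensor_apply[OF rho_in] rlist_def tsum2_def)

lemma rlist_bar:
  assumes "linM \<psi>" "lin c"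
  shows "tsum2 (rlist \<psi>) (\<lambda>\<chi> a. \<chi> m * c a) = bar \<psi> m c"
  using rho_apply[OF assms, of m] DH_form[OF assms(2), of m] by (simp add: rho_eval[OF assms(1)])

lemma rho_add:
  assumes "linM \<psi>" "linM \<psi>'"
  shows "rho (\<psi> + \<psi>') = rho \<psi> + rho \<psi>'"
proof (rule DH_eqI)
  have sum: "linM (\<psi> + \<psi>')" using assms by (simp add: dual_iff[symmetric] dual_closed)
  show "rho (\<psi> + \<psi>') \<in> tensors DH" "rho \<psi> + rho \<psi>' \<in> tensors DH"
    using assms sum by (simp_all add: rho_in tensor_add)
  show "rho (\<psi> + \<psi>') (\<lambda>(\<chi>, a). \<chi> m * c a) = (rho \<psi> + rho \<psi>') (\<lambda>(\<chi>, a). \<chi> m * c a)" if "lin c" for m c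
    by (simp add: rho_apply assms sum that) (simp add: bar_def distrib_left tsum2_add)
qed

lemma rho_scale:
  assumes "linM \<psi>"
  shows "rho (fscale k \<psi>) = fscale k (rho \<psi>)"
proof (rule DH_eqI)
  have lin: "linM (fscale k \<psi>)" using assms by (simp add: dual_iff[symmetric] dual_closed)
  show "rho (fscale k \<psi>) \<in> tensors DH" by (rule rho_in[OF lin])
  \<comment> \<open>The space of tensors consists of sums of pure tensors without coefficients, so a
    scalar multiple is shown to belong to it by rescaling all first legs.\<close>
  have "fscale k (rho \<psi>) = (\<Sum>x\<leftarrow>rlist \<psi>. pure_tensor DH (fscale k (fst x), snd x))"
  proof
    fix B show "fscale k (rho \<psi>) B = (\<Sum>x\<leftarrow>rlist \<psi>. pure_tensor DH (fscale k (fst x), snd x)) B"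
    proof (cases "B \<in> forms DH")
      case True
      have "B (fscale k \<chi>, a) = k * B (\<chi>, a)" if "(\<chi>, a) \<in> set (rlist \<psi>)" for \<chi> a
        using True set_tlist[OF rho_in[OF assms]] that
        by (auto simp: forms_cons linear_form_on_def rlist_def)
      then show ?thesis
        using True by (auto simp: fscale_def rho_eval[OF assms] sum_list_fun_apply pure_tensor_def tsum2_def
            case_prod_unfold sum_list_const_mult[symmetric] intro!: arg_cong[of _ _ sum_list])
    next
      case False
      then show ?thesis
        using tensor_outside[OF rho_in[OF assms] False] by (simp add: fscale_def sum_list_fun_apply pure_tensor_def)
    qed
  qed
  then show "fscale k (rho \<psi>) \<in> tensors DH"
    using set_tlist[OF rho_in[OF assms]]
    by (auto intro!: tensor_sum_list tensor_pure dual_closed simp: rlist_def)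
  show "rho (fscale k \<psi>) (\<lambda>(\<chi>, a). \<chi> m * c a) = fscale k (rho \<psi>) (\<lambda>(\<chi>, a). \<chi> m * c a)" if "lin c" for m c
    by (simp add: rho_apply assms lin that fscale_def[of k "rho \<psi>"])
      (simp add: bar_def fscale_def mult.left_commute[of _ k] tsum2_mult)
qed

text \<open>At an evaluation point m, the action of a_1 on the first leg moves the point to
  S^{-1}(a_1) m and the factor a_2 is taken into the functional c; this is the right side of
  \<open>bar_l\<close>.\<close>

lemma rho_left:
  assumes "linM \<psi>"
  shows "rho (dual_left l a \<psi>) = factorwise H2 DH DH (pair_op (dual_left l) (*)) (\<Delta> a) (rho \<psi>)"
proof (rule DH_eqI)
  note fw = dual_left_factorwise[OF tuple_algebra_H1 \<Delta>_in rho_in[OF assms]]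
  have lin: "linM (dual_left l a \<psi>)" using dual.l_closed[of \<psi> a] assms by (simp add: dual_iff)
  show "rho (dual_left l a \<psi>) \<in> tensors DH" by (rule rho_in[OF lin])
  show "factorwise H2 DH DH (pair_op (dual_left l) (*)) (\<Delta> a) (rho \<psi>) \<in> tensors DH" by (rule fw(1))
  show "rho (dual_left l a \<psi>) (\<lambda>(\<chi>, a). \<chi> m * c a) =
    factorwise H2 DH DH (pair_op (dual_left l) (*)) (\<Delta> a) (rho \<psi>) (\<lambda>(\<chi>, a). \<chi> m * c a)" if c: "lin c" for m c
  proof -
    have 1: "rho \<psi> (\<lambda>y. (\<lambda>(\<chi>, a). \<chi> m * c a) (pair_op (dual_left l) (*) (a\<^sub>1, a\<^sub>2) y)) =
        bar \<psi> (l (inv S a\<^sub>1) m) (\<lambda>b. c (a\<^sub>2 * b))" for a\<^sub>1 a\<^sub>2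
      using rho_apply[OF assms, of "\<lambda>b. c (a\<^sub>2 * b)" "l (inv S a\<^sub>1) m"] lin_endo[OF c]
      by (simp add: pair_op_def dual_left_def case_prod_unfold)
    show ?thesis
      unfolding fw(2)[OF DH_form[OF c]] \<Delta>_apply[OF fw(3)[OF DH_form[OF c]]] 1 rho_apply[OF lin c]
      unfolding dual_left_def by (rule bar_l[OF assms c])
  qed
qed

lemma rho_right:
  assumes "linM \<psi>"
  shows "rho (dual_right r \<psi> a) = factorwise DH H2 DH (pair_op (dual_right r) (*)) (rho \<psi>) (\<Delta> a)"
proof (rule DH_eqI)
  note fw = dual_right_factorwise[OF tuple_algebra_H1 \<Delta>_in rho_in[OF assms]]
  have lin: "linM (dual_right r \<psi> a)" using dual.r_closed[of \<psi> a] assms by (simp add: dual_iff)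
  show "rho (dual_right r \<psi> a) \<in> tensors DH" by (rule rho_in[OF lin])
  show "factorwise DH H2 DH (pair_op (dual_right r) (*)) (rho \<psi>) (\<Delta> a) \<in> tensors DH" by (rule fw(1))
  show "rho (dual_right r \<psi> a) (\<lambda>(\<chi>, a). \<chi> m * c a) =
    factorwise DH H2 DH (pair_op (dual_right r) (*)) (rho \<psi>) (\<Delta> a) (\<lambda>(\<chi>, a). \<chi> m * c a)" if c: "lin c" for m c
  proof -
    have 1: "\<Delta> a (\<lambda>a. (\<lambda>(\<chi>, a). \<chi> m * c a) (pair_op (dual_right r) (*) (\<chi>, b) a)) =
        tsum2 (cop a) (\<lambda>a\<^sub>1 a\<^sub>2. \<chi> (r m (S a\<^sub>1)) * c (b * a\<^sub>2))" if "\<chi> \<in> dual" for \<chi> b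
      using \<Delta>_apply[OF dual_right_form(1)[OF tuple_algebra_H1 DH_form[OF c], of "(\<chi>, b)" m]] that
      by (simp add: pair_op_def dual_right_def)
    have "tsum2 (rlist \<psi>) (\<lambda>\<chi> b. \<Delta> a (\<lambda>a. (\<lambda>(\<chi>, a). \<chi> m * c a) (pair_op (dual_right r) (*) (\<chi>, b) a))) =
      tsum2 (rlist \<psi>) (\<lambda>\<chi> b. tsum2 (cop a) (\<lambda>a\<^sub>1 a\<^sub>2. \<chi> (r m (S a\<^sub>1)) * c (b * a\<^sub>2)))"
      unfolding tsum2_def
      using set_tlist[OF rho_in[OF assms]] 1
      by (intro arg_cong[of _ _ sum_list] map_cong refl) (auto simp: rlist_def tsum2_def)
    also have "\<dots> = tsum2 (cop a) (\<lambda>a\<^sub>1 a\<^sub>2. bar \<psi> (r m (S a\<^sub>1)) (\<lambda>b. c (b * a\<^sub>2)))"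
      using lin_endo[OF c] by (subst tsum2_tsum2_swap) (simp add: rlist_bar[OF assms])
    finally show ?thesis
      unfolding fw(2)[OF DH_form[OF c]] rho_eval[OF assms fw(3)[OF DH_form[OF c]]] rho_apply[OF lin c]
      unfolding dual_right_def bar_r[OF assms c] by simp
  qed
qed

lemma rho_counit:
  assumes "linM \<psi>"
  shows "sweedler DH (rho \<psi>) (\<lambda>(\<chi>, a). fscale (\<epsilon> a) \<chi>) = \<psi>"
proof -
  have eq: "(\<lambda>x. (\<lambda>(\<chi>, a). fscale (\<epsilon> a) \<chi>) x m) = (\<lambda>(\<chi>, a). \<chi> m * \<epsilon> a)" for m :: 'm
    by (auto simp: fscale_def)
  have form: "(\<lambda>x. (\<lambda>(\<chi>, a). fscale (\<epsilon> a) \<chi>) x m) \<in> forms DH" for m :: 'm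
    unfolding eq by (rule DH_form) (rule sums.lin_eps)
  show ?thesis
    unfolding sweedler_fun[OF rho_in[OF assms] form] eq rho_apply[OF assms sums.lin_eps] bar_counit[OF assms] ..
qed

lemma rlist_cong:
  assumes "linM \<psi>" "\<And>\<chi> a. linM \<chi> \<Longrightarrow> F \<chi> a = G \<chi> a"
  shows "tsum2 (rlist \<psi>) F = tsum2 (rlist \<psi>) G"
  using assms(2) set_tlist[OF rho_in[OF assms(1)]] unfolding tsum2_def
  by (intro arg_cong[of _ _ sum_list] map_cong refl) (auto simp: rlist_def dual_iff)

text \<open>The inner coaction is controlled for first legs in the dual space only. The required
  form conditions are therefore proved for an expression that agrees with it on the tuples and are
  then transferred.\<close>

lemma rho_twice:
  assumes \<psi>: "linM \<psi>"
  defines "W \<equiv> sweedler DH (rho \<psi>) (\<lambda>(\<chi>, a). sweedler DH (rho \<chi>) (\<lambda>(\<chi>', b). pure_tensor DHH (\<chi>', b, a)))"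
  shows rho_twice_in: "W \<in> tensors DHH"
    and rho_twice_apply: "B \<in> forms DHH \<Longrightarrow>
      W B = tsum2 (rlist \<psi>) (\<lambda>\<chi> a. tsum2 (rlist \<chi>) (\<lambda>\<chi>' b. B (\<chi>', b, a)))"
proof -
  have good: "good_factors DH" by (rule good_dual) (rule good_single[OF closed_UNIV])
  have swap: "(\<lambda>(\<chi>', b). B (\<chi>', b, a)) \<in> forms DH" if "B \<in> forms DHH" for B a
    using that by (simp add: forms_cons[of _ dual] forms_H1 forms_H2 form2_def)
  have pure: "(\<lambda>x. (\<lambda>(\<chi>', b). pure_tensor DHH (\<chi>', b, a)) x B) \<in> forms DH" for B a
    using swap[of B a] good_zero[OF good] by (cases "B \<in> forms DHH") (simp_all add: pure_tensor_def case_prod_unfold)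
  have inner_in: "sweedler DH (rho \<chi>) (\<lambda>(\<chi>', b). pure_tensor DHH (\<chi>', b, a)) \<in> tensors DHH" if "linM \<chi>" for \<chi> a
    by (rule sweedler_in[OF rho_in[OF that] pure]) (auto intro!: tensor_pure)
  have inner: "sweedler DH (rho \<chi>) (\<lambda>(\<chi>', b). pure_tensor DHH (\<chi>', b, a)) B =
      (if B \<in> forms DHH then rho \<chi> (\<lambda>(\<chi>', b). B (\<chi>', b, a)) else 0)" if "linM \<chi>" for \<chi> a B
    using tensor_outside[OF inner_in[OF that], of B a] pure[of a B]
    by (simp add: sweedler_fun[OF rho_in[OF that] pure]) (simp add: pure_tensor_def case_prod_unfold)
  have form: "(\<lambda>x. (\<lambda>(\<chi>, a). rho \<chi> (\<lambda>(\<chi>', b). B (\<chi>', b, a))) x) \<in> forms DH" if B: "B \<in> forms DHH" for B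
  proof -
    have "(\<lambda>a. rho \<chi> (\<lambda>(\<chi>', b). B (\<chi>', b, a))) \<in> forms H1" if "linM \<chi>" for \<chi>
    proof (rule tensor_apply_form[OF rho_in[OF that] good_single[OF closed_UNIV]])
      show "(\<lambda>(\<chi>', b). B (\<chi>', b, a)) \<in> forms DH" for a by (rule swap[OF B])
      show "(\<lambda>a. (\<lambda>(\<chi>', b). B (\<chi>', b, a)) y) \<in> forms H1" if "y \<in> tuples DH" for y
        using B that by (cases y) (simp add: forms_cons[of _ dual] forms_H1 forms_H2 form2_def)
    qed
    then show ?thesis
      by (simp add: forms_cons[of _ dual] linear_form_on_def dual_iff rho_add rho_scale fscale_def[of _ "rho _"])
  qed
  have outer: "(\<lambda>x. (\<lambda>(\<chi>, a). sweedler DH (rho \<chi>) (\<lambda>(\<chi>', b). pure_tensor DHH (\<chi>', b, a))) x B) \<in> forms DH" for B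
  proof (cases "B \<in> forms DHH")
    case True
    show ?thesis by (rule good_cong[OF good form[OF True]]) (auto simp: inner True dual_iff)
  next
    case False
    show ?thesis by (rule good_cong[OF good good_zero[OF good]]) (auto simp: inner False dual_iff)
  qed
  show "W \<in> tensors DHH"
    unfolding W_def by (rule sweedler_in[OF rho_in[OF \<psi>] outer]) (auto simp: dual_iff inner_in)
  show "W B = tsum2 (rlist \<psi>) (\<lambda>\<chi> a. tsum2 (rlist \<chi>) (\<lambda>\<chi>' b. B (\<chi>', b, a)))" if B: "B \<in> forms DHH"
    unfolding W_def sweedler_fun[OF rho_in[OF \<psi>] outer] rho_eval[OF \<psi> outer]
    by (rule rlist_cong[OF \<psi>]) (simp add: inner B rho_eval swap)
qed

lemma rho_\<Delta>:
  assumes \<psi>: "linM \<psi>"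
  defines "W \<equiv> sweedler DH (rho \<psi>) (\<lambda>(\<chi>, a). sweedler H2 (\<Delta> a) (\<lambda>(b, c). pure_tensor DHH (\<chi>, b, c)))"
  shows rho_\<Delta>_in: "W \<in> tensors DHH"
    and rho_\<Delta>_apply: "B \<in> forms DHH \<Longrightarrow>
      W B = tsum2 (rlist \<psi>) (\<lambda>\<chi> a. tsum2 (cop a) (\<lambda>b c. B (\<chi>, b, c)))"
proof -
  have good: "good_factors DH" by (rule good_dual) (rule good_single[OF closed_UNIV])
  have pure: "(\<lambda>x. (\<lambda>(b, c). pure_tensor DHH (\<chi>, b, c)) x B) \<in> forms H2" if "linM \<chi>" for \<chi> B
  proof -
    have "(\<lambda>x. pure_tensor DHH (\<chi>, x) B) \<in> forms H2"
      by (rule pure_tensor_form[OF A2.good]) (simp add: forms_cons[of _ dual] that dual_iff)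
    then show ?thesis by (simp add: case_prod_unfold)
  qed
  have inner_in: "sweedler H2 (\<Delta> a) (\<lambda>(b, c). pure_tensor DHH (\<chi>, b, c)) \<in> tensors DHH" if "linM \<chi>" for \<chi> a
    by (rule sweedler_in[OF \<Delta>_in pure[OF that]]) (auto intro!: tensor_pure simp: that dual_iff)
  have inner: "sweedler H2 (\<Delta> a) (\<lambda>(b, c). pure_tensor DHH (\<chi>, b, c)) B =
      (if B \<in> forms DHH then tsum2 (cop a) (\<lambda>b c. B (\<chi>, b, c)) else 0)" if "linM \<chi>" for \<chi> a B
    using tensor_outside[OF inner_in[OF that], of B a] pure[OF that, of B]
    by (simp add: sweedler_fun[OF \<Delta>_in pure[OF that]] \<Delta>_apply) (simp add: pure_tensor_def)
  have form: "(\<lambda>(\<chi>, a). tsum2 (cop a) (\<lambda>b c. B (\<chi>, b, c))) \<in> forms DH" if "B \<in> forms DHH" for B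
    using that
    by (simp add: forms_cons[of _ dual] forms_H1 forms_H2 linear_form_on_def tsum2_add tsum2_mult)
  have outer: "(\<lambda>x. (\<lambda>(\<chi>, a). sweedler H2 (\<Delta> a) (\<lambda>(b, c). pure_tensor DHH (\<chi>, b, c))) x B) \<in> forms DH" for B
  proof (cases "B \<in> forms DHH")
    case True
    show ?thesis by (rule good_cong[OF good form[OF True]]) (auto simp: inner True dual_iff)
  next
    case False
    show ?thesis by (rule good_cong[OF good good_zero[OF good]]) (auto simp: inner False dual_iff)
  qed
  show "W \<in> tensors DHH"
    unfolding W_def by (rule sweedler_in[OF rho_in[OF \<psi>] outer]) (auto simp: dual_iff inner_in)
  show "W B = tsum2 (rlist \<psi>) (\<lambda>\<chi> a. tsum2 (cop a) (\<lambda>b c. B (\<chi>, b, c)))" if B: "B \<in> forms DHH"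
    unfolding W_def sweedler_fun[OF rho_in[OF \<psi>] outer] rho_eval[OF \<psi> outer]
    by (rule rlist_cong[OF \<psi>]) (simp add: inner B)
qed

lemma rho_coassoc:
  assumes \<psi>: "linM \<psi>"
  shows "factorwise H3 DHH DHH (pair_op (dual_left l) op2) \<phi>
      (sweedler DH (rho \<psi>) (\<lambda>(\<chi>, a). sweedler DH (rho \<chi>) (\<lambda>(\<chi>', b). pure_tensor DHH (\<chi>', b, a)))) =
    factorwise DHH H3 DHH (pair_op (dual_right r) op2)
      (sweedler DH (rho \<psi>) (\<lambda>(\<chi>, a). sweedler H2 (\<Delta> a) (\<lambda>(b, c). pure_tensor DHH (\<chi>, b, c)))) \<phi>"
    (is "factorwise _ _ _ ?L \<phi> ?W = factorwise _ _ _ ?R ?W' \<phi>")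
proof (rule DHH_eqI)
  note L = dual_left_factorwise[OF A2.tuple_algebra_axioms \<phi>_in rho_twice_in[OF \<psi>]]
  note R = dual_right_factorwise[OF A2.tuple_algebra_axioms \<phi>_in rho_\<Delta>_in[OF \<psi>]]
  show "factorwise H3 DHH DHH ?L \<phi> ?W \<in> tensors DHH" by (rule L(1))
  show "factorwise DHH H3 DHH ?R ?W' \<phi> \<in> tensors DHH" by (rule R(1))
  fix m C assume C: "form2 C"
  note B = DHH_form[OF C, of m]
  note [simp] = form2D[OF C] form_defs
  \<comment> \<open>The inner coaction evaluated at S^{-1}(x) m is a \<open>bar\<close> of \<chi>,
    hence a sum of values of \<chi>. Pulling the outer sum over \<rho>(\<psi>) inside turns these
    values into \<open>bar\<close> of \<psi> at the points l w (r n t), the left side of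
    \<open>bar_coassoc\<close>.\<close>
  have 1: "?W (\<lambda>w. (\<lambda>(\<chi>, a, b). \<chi> m * C a b) (?L (x, y, z) w)) =
      tsum2 sums.vs (\<lambda>v w. tsum2 (La (l (inv S x) m)) (\<lambda>a n. tsum2 sums.us (\<lambda>u t.
        bar \<psi> (l w (r n t)) (\<lambda>b. C (y * (v * (a * u))) (z * b)))))" for x y z
  proof -
    have "?W (\<lambda>w. (\<lambda>(\<chi>, a, b). \<chi> m * C a b) (?L (x, y, z) w)) =
        tsum2 (rlist \<psi>) (\<lambda>\<chi> a. tsum2 (rlist \<chi>) (\<lambda>\<chi>' b. \<chi>' (l (inv S x) m) * C (y * b) (z * a)))"
      unfolding rho_twice_apply[OF \<psi> dual_left_form(2)[OF A2.tuple_algebra_axioms B]]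
      by (simp add: pair_op_def dual_left_def)
    also have "\<dots> = tsum2 (rlist \<psi>) (\<lambda>\<chi> a. bar \<chi> (l (inv S x) m) (\<lambda>b. C (y * b) (z * a)))"
      by (rule rlist_cong[OF \<psi>]) (simp add: rlist_bar)
    also have "\<dots> = tsum2 sums.vs (\<lambda>v w. tsum2 (La (l (inv S x) m)) (\<lambda>a n. tsum2 sums.us (\<lambda>u t.
        tsum2 (rlist \<psi>) (\<lambda>\<chi> b. \<chi> (l w (r n t)) * C (y * (v * (a * u))) (z * b)))))"
      unfolding bar_def by (simp add: tsum2_tsum2_swap[of "rlist \<psi>"] mult.commute[of "C _ _"])
    finally show ?thesis
      by (simp add: rlist_bar[OF \<psi>])
  qed
  have 2: "\<phi> (\<lambda>w. (\<lambda>(\<chi>, a, b). \<chi> m * C a b) (?R (\<chi>, b, c) w)) =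
      tsum3 ph (\<lambda>x y z. \<chi> (r m (S x)) * C (b * y) (c * z))" if "linM \<chi>" for \<chi> b c
    using \<phi>_apply[OF dual_right_form(1)[OF A2.tuple_algebra_axioms B, of "(\<chi>, b, c)"]] that
    by (simp add: dual_iff pair_op_def dual_right_def)
  have "?W' (\<lambda>u. \<phi> (\<lambda>w. (\<lambda>(\<chi>, a, b). \<chi> m * C a b) (?R u w))) =
      tsum2 (rlist \<psi>) (\<lambda>\<chi> a. tsum2 (cop a) (\<lambda>b c. tsum3 ph (\<lambda>x y z. \<chi> (r m (S x)) * C (b * y) (c * z))))"
    unfolding rho_\<Delta>_apply[OF \<psi> R(3)[OF B]] by (rule rlist_cong[OF \<psi>]) (simp add: 2)
  also have "\<dots> = tsum3 ph (\<lambda>x y z. tsum2 (rlist \<psi>) (\<lambda>\<chi> a. \<chi> (r m (S x)) * tsum2 (cop a) (\<lambda>b c. C (b * y) (c * z))))"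
    by (simp add: tsum2_tsum3_swap tsum2_mult)
  also have "\<dots> = tsum3 ph (\<lambda>x y z. bar \<psi> (r m (S x)) (\<lambda>a. tsum2 (cop a) (\<lambda>b c. C (b * y) (c * z))))"
    by (simp add: rlist_bar[OF \<psi>])
  finally show "factorwise H3 DHH DHH ?L \<phi> ?W (\<lambda>(\<chi>, a, b). \<chi> m * C a b) =
      factorwise DHH H3 DHH ?R ?W' \<phi> (\<lambda>(\<chi>, a, b). \<chi> m * C a b)"
    unfolding L(2)[OF B] R(2)[OF B] \<phi>_apply[OF L(3)[OF B]] 1 bar_coassoc[OF \<psi> C] by simp
qed

end

theorem proposition3p12:
  fixes scl :: "'k::field \<Rightarrow> 'h::ring_1 \<Rightarrow> 'h"
    and \<Delta> :: "'h \<Rightarrow> ('h \<times> 'h, 'k) tensor"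
    and \<epsilon> :: "'h \<Rightarrow> 'k"
    and \<phi> :: "('h \<times> 'h \<times> 'h, 'k) tensor"
    and S :: "'h \<Rightarrow> 'h"
    and \<alpha> \<beta> :: 'h
    and sM :: "'k \<Rightarrow> 'm::ab_group_add \<Rightarrow> 'm"
    and l :: "'h \<Rightarrow> 'm \<Rightarrow> 'm"
    and r :: "'m \<Rightarrow> 'h \<Rightarrow> 'm"
    and \<Lambda> :: "'m \<Rightarrow> ('h \<times> 'm, 'k) tensor"
  assumes "quasi_hopf_algebra scl \<Delta> \<epsilon> \<phi> S \<alpha> \<beta>"
    and "left_quasi_hopf_bimodule scl \<Delta> \<epsilon> \<phi> UNIV sM l r \<Lambda>"
    and "finite_dimensional scl \<or> finite_dimensional sM"
  shows "right_quasi_hopf_bimodule scl \<Delta> \<epsilon> \<phi> (dual_space sM) fscale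
    (quasi_hopf_algebra.dual_left S l) (quasi_hopf_algebra.dual_right S r)
    (quasi_hopf_algebra.dual_coaction scl \<Delta> \<phi> S \<alpha> \<beta> sM l r \<Lambda>)"
proof -
  interpret dual_of_left_bimodule scl \<Delta> \<epsilon> \<phi> S \<alpha> \<beta> sM l r \<Lambda>
    by (intro dual_of_left_bimodule.intro left_bimodule_over_quasi_hopf.intro
        dual_of_left_bimodule_axioms.intro assms)
  show ?thesis
    by (intro right_quasi_hopf_bimodule.intro right_quasi_hopf_bimodule_axioms.intro dual.algebra_bimodule_axioms)
      (simp_all only: dual_iff rho_in rho_add rho_scale rho_left rho_right rho_counit rho_coassoc)
qed

end
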